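(* Let $G$ be a connected linear algebraic group over $C$ with Levi decomposition $G=M\ltimes U$. Let $g\in G(C((t)))$ with $g=mu$ ($m\in M(C((t)))$, $u\in U(C((t)))$), and let $[\mu]$ be the conjugacy class of cocharacters of $M$ with $m\in M(C[[t]])t^\mu M(C[[t]])$. For any representation $\rho:G\to\mathrm{GL}_n$, if $[\nu]$ is the conjugacy class of cocharacters of $\mathrm{GL}_n$ with $\rho(g)\in\mathrm{GL}_n(C[[t]])t^\nu\mathrm{GL}_n(C[[t]])$, then $[\nu]\ge[\rho\circ\mu]$. If $\rho$ is faithful, then $[\nu]=[\rho\circ\mu]$ if and only if $g\in G(C[[t]])t^\mu G(C[[t]])$.
   Context: $C$ is an algebraically closed field of characteristic $0$, $t$ a variable, $t^\mu=\mu(t)$ for a cocharacter $\mu$. $M$ is reductive and $U$ the unipotent radical, so by the Cartan decomposition every element of $M(C((t)))$ lies in $M(C[[t]])t^\mu M(C[[t]])$ for a unique conjugacy class $[\mu]$. Conjugacy classes of cocharacters of $\mathrm{GL}_n$ are identified with multisets $(\mu_1\ge\cdots\ge\mu_n)$ of integers (the weights on the standard representation), and $[\mu]\le[\nu]$ means $\sum_{i=1}^k\mu_i\le\sum_{i=1}^k\nu_i$ for every $k$. *)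

theory Defs
  imports
    "HOL-Algebra.Coset"
    "HOL-Library.Poly_Mapping"
    "HOL-Computational_Algebra.Formal_Laurent_Series"
    "Jordan_Normal_Form.Determinant"
begin

no_notation fls_nth (infixl \<open>$$\<close> 75)

text \<open>
  Linear algebraic groups over an algebraically closed field of characteristic 0 are treated as
  Zariski closed subgroups of the group of invertible \<open>N \<times> N\<close> matrices over that field. In
  characteristic 0 every algebraic group is reduced, so nothing is lost by identifying a group with
  its set of points over the base field; the points over \<open>C((t))\<close> and \<open>C[[t]]\<close> are
  recovered from the vanishing ideal.
\<close>

definition GL :: "nat \<Rightarrow> 'b::comm_ring_1 mat monoid" where
  "GL n = units_of (ring_mat TYPE('b) n ())"


subsection \<open>Polynomials in the matrix entries and Zariski closed subsets\<close>

text \<open>The variables are pairs of indices; the pair \<open>(i, j)\<close> stands for the matrix entry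
  in row \<open>i\<close> and column \<open>j\<close>.\<close>

type_synonym 'a entry_poly = "((nat \<times> nat) \<Rightarrow>\<^sub>0 nat) \<Rightarrow>\<^sub>0 'a"

definition entry_polys :: "nat \<Rightarrow> 'a::zero entry_poly set" where
  "entry_polys N = {p. \<forall>e \<in> Poly_Mapping.keys p. Poly_Mapping.keys e \<subseteq> {..<N} \<times> {..<N}}"

text \<open>Evaluation at a matrix over an algebra, with structure map \<open>h\<close>.\<close>

definition eval_poly :: "('a::zero \<Rightarrow> 'b::comm_ring_1) \<Rightarrow> 'a entry_poly \<Rightarrow> 'b mat \<Rightarrow> 'b" where
  "eval_poly h p A = (\<Sum>e \<in> Poly_Mapping.keys p. h (Poly_Mapping.lookup p e) *
     (\<Prod>ij \<in> Poly_Mapping.keys e. (A $$ ij) ^ Poly_Mapping.lookup e ij))"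

definition zariski_closed :: "nat \<Rightarrow> 'a::field mat set \<Rightarrow> bool" where
  "zariski_closed N Z \<longleftrightarrow> (\<exists>S \<subseteq> entry_polys N.
     Z = {A \<in> carrier (GL N). \<forall>p \<in> S. eval_poly id p A = 0})"

text \<open>Only meant for closed \<open>Z\<close>, whose relatively closed subsets are the closed subsets of
  the ambient group contained in \<open>Z\<close>.\<close>

definition zariski_connected :: "nat \<Rightarrow> 'a::field mat set \<Rightarrow> bool" where
  "zariski_connected N Z \<longleftrightarrow> Z \<noteq> {} \<and>
     \<not> (\<exists>Z1 Z2. zariski_closed N Z1 \<and> zariski_closed N Z2 \<and> Z1 \<noteq> {} \<and> Z2 \<noteq> {} \<and>
          Z1 \<inter> Z2 = {} \<and> Z1 \<union> Z2 = Z)"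

definition linear_algebraic_group :: "nat \<Rightarrow> 'a::field mat set \<Rightarrow> bool" where
  "linear_algebraic_group N G \<longleftrightarrow> subgroup G (GL N) \<and> zariski_closed N G"


subsection \<open>Points over Laurent series and over power series\<close>

definition vanishing_ideal :: "nat \<Rightarrow> 'a::field mat set \<Rightarrow> 'a entry_poly set" where
  "vanishing_ideal N G = {p \<in> entry_polys N. \<forall>A \<in> G. eval_poly id p A = 0}"

definition laurent_points :: "nat \<Rightarrow> 'a::field mat set \<Rightarrow> 'a fls mat set" where
  "laurent_points N G =
     {A \<in> carrier (GL N). \<forall>p \<in> vanishing_ideal N G. eval_poly fls_const p A = 0}"

text \<open>\<open>GL_n(C[[t]])\<close> inside \<open>GL_n(C((t)))\<close>: both the matrix and its inverse have
  power series entries.\<close>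

definition GL_power_series :: "nat \<Rightarrow> 'a::field fls mat set" where
  "GL_power_series n = map_mat fps_to_fls ` carrier (GL n)"

definition power_series_points :: "nat \<Rightarrow> 'a::field mat set \<Rightarrow> 'a fls mat set" where
  "power_series_points N G = laurent_points N G \<inter> GL_power_series N"

definition double_coset :: "'b::comm_ring_1 mat set \<Rightarrow> 'b mat \<Rightarrow> 'b mat set" where
  "double_coset K x = {a * x * b | a b. a \<in> K \<and> b \<in> K}"


subsection \<open>Homomorphisms, representations and cocharacters\<close>

text \<open>A pair \<open>(p, k)\<close> stands for the regular function \<open>p / det ^ k\<close> on the general
  linear group; a regular map into a group of \<open>n \<times> n\<close> matrices is an \<open>n \<times> n\<close>
  matrix of such pairs.\<close>

type_synonym 'a regular_map = "('a entry_poly \<times> nat) mat"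

definition eval_map :: "('a::zero \<Rightarrow> 'b::field) \<Rightarrow> 'a regular_map \<Rightarrow> 'b mat \<Rightarrow> 'b mat" where
  "eval_map h f A = map_mat (\<lambda>(p, k). eval_poly h p A / det A ^ k) f"

definition algebraic_hom ::
  "nat \<Rightarrow> 'a::field mat set \<Rightarrow> nat \<Rightarrow> 'a mat set \<Rightarrow> 'a regular_map \<Rightarrow> bool" where
  "algebraic_hom N G n H f \<longleftrightarrow>
     f \<in> carrier_mat n n \<and> fst ` elements_mat f \<subseteq> entry_polys N \<and>
     eval_map id f \<in> hom ((GL N)\<lparr>carrier := G\<rparr>) ((GL n)\<lparr>carrier := H\<rparr>)"

definition algebraic_representation :: "nat \<Rightarrow> 'a::field mat set \<Rightarrow> nat \<Rightarrow> 'a regular_map \<Rightarrow> bool" where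
  "algebraic_representation N G n \<rho> \<longleftrightarrow> algebraic_hom N G n (carrier (GL n)) \<rho>"

text \<open>In characteristic 0, injectivity on points over an algebraically closed base field is
  the same as triviality of the scheme-theoretic kernel.\<close>

definition faithful :: "'a::field mat set \<Rightarrow> 'a regular_map \<Rightarrow> bool" where
  "faithful G \<rho> \<longleftrightarrow> inj_on (eval_map id \<rho>) G"

text \<open>The multiplicative group is the group of invertible \<open>1 \<times> 1\<close> matrices.\<close>

definition cocharacter :: "nat \<Rightarrow> 'a::field mat set \<Rightarrow> 'a regular_map \<Rightarrow> bool" where
  "cocharacter N H \<mu> \<longleftrightarrow> algebraic_hom 1 (carrier (GL 1)) N H \<mu>"

definition cochar_fun :: "'a::field regular_map \<Rightarrow> 'a \<Rightarrow> 'a mat" where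
  "cochar_fun \<mu> s = eval_map id \<mu> (mat 1 1 (\<lambda>_. s))"

definition t_power :: "'a::field regular_map \<Rightarrow> 'a fls mat" where
  "t_power \<mu> = eval_map fls_const \<mu> (mat 1 1 (\<lambda>_. fls_X))"


subsection \<open>Conjugacy classes of cocharacters of the general linear group\<close>

text \<open>From here on a cocharacter of the general linear group is given by its function
  on points, of which only the values at nonzero scalars matter.\<close>

definition GL_conjugate :: "nat \<Rightarrow> ('a::field \<Rightarrow> 'a mat) \<Rightarrow> ('a \<Rightarrow> 'a mat) \<Rightarrow> bool" where
  "GL_conjugate n \<alpha> \<beta> \<longleftrightarrow> (\<exists>P \<in> carrier (GL n). \<forall>s. s \<noteq> 0 \<longrightarrow>
     \<beta> s = P * \<alpha> s * inv\<^bsub>GL n\<^esub> P)"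

text \<open>\<open>w\<close> lists in decreasing order, with multiplicity, the weights of \<open>\<alpha>\<close> on the
  standard representation.\<close>

definition has_weights :: "nat \<Rightarrow> ('a::field \<Rightarrow> 'a mat) \<Rightarrow> int list \<Rightarrow> bool" where
  "has_weights n \<alpha> w \<longleftrightarrow> length w = n \<and> sorted_wrt (\<ge>) w \<and>
     GL_conjugate n (\<lambda>s. mat_diag n (\<lambda>i. s powi (w ! i))) \<alpha>"

definition weights_le :: "nat \<Rightarrow> ('a::field \<Rightarrow> 'a mat) \<Rightarrow> ('a \<Rightarrow> 'a mat) \<Rightarrow> bool" where
  "weights_le n \<alpha> \<beta> \<longleftrightarrow> (\<exists>w w'. has_weights n \<alpha> w \<and> has_weights n \<beta> w' \<and>
     (\<forall>k \<in> {1..n}. sum_list (take k w) \<le> sum_list (take k w')))"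


subsection \<open>Levi decompositions\<close>

definition unipotent_group :: "nat \<Rightarrow> 'a::field mat set \<Rightarrow> bool" where
  "unipotent_group N U \<longleftrightarrow> (\<forall>A \<in> U. \<exists>k. (A - 1\<^sub>m N) ^\<^sub>m k = 0\<^sub>m N N)"

definition connected_normal_unipotent :: "nat \<Rightarrow> 'a::field mat set \<Rightarrow> 'a mat set \<Rightarrow> bool" where
  "connected_normal_unipotent N G U \<longleftrightarrow>
     linear_algebraic_group N U \<and> zariski_connected N U \<and> unipotent_group N U \<and>
     U \<lhd> (GL N)\<lparr>carrier := G\<rparr>"

definition unipotent_radical :: "nat \<Rightarrow> 'a::field mat set \<Rightarrow> 'a mat set \<Rightarrow> bool" where
  "unipotent_radical N G U \<longleftrightarrow> connected_normal_unipotent N G U \<and>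
     (\<forall>V. connected_normal_unipotent N G V \<longrightarrow> V \<subseteq> U)"

definition reductive :: "nat \<Rightarrow> 'a::field mat set \<Rightarrow> bool" where
  "reductive N M \<longleftrightarrow> linear_algebraic_group N M \<and> unipotent_radical N M {1\<^sub>m N}"

text \<open>The semidirect product is that of abstract groups. In characteristic 0 the bijective
  multiplication map \<open>M \<times> U \<rightarrow> G\<close> is automatically an isomorphism of varieties. The factor
  \<open>M\<close> is isomorphic to \<open>G / U\<close>, so it is connected when \<open>G\<close> is.\<close>

definition levi_decomposition ::
  "nat \<Rightarrow> 'a::field mat set \<Rightarrow> 'a mat set \<Rightarrow> 'a mat set \<Rightarrow> bool" where
  "levi_decomposition N G M U \<longleftrightarrow>
     unipotent_radical N G U \<and> reductive N M \<and>
     M <#>\<^bsub>GL N\<^esub> U = G \<and> M \<inter> U = {1\<^sub>m N}"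

end

theory Submission
  imports Defs "HOL-Library.Nat_Bijection" "HOL-Library.Function_Algebras" "Jordan_Normal_Form.Char_Poly"
begin

text \<open>
  After multiplication by integral points, \<open>g\<close> becomes \<open>t\<^sup>\<mu> x\<close> with \<open>x \<in> U(C((t)))\<close>. Since \<open>\<rho>(U)\<close> consists of
  unipotent matrices and is normalized by the torus \<open>\<rho> \<circ> \<mu>\<close>, there is a basis in which \<open>\<rho>(t\<^sup>\<mu>)\<close> is a diagonal
  matrix \<open>D\<close> of powers of \<open>t\<close> and \<open>\<rho>(U)\<close> is upper unitriangular. The minors of the triangular matrix \<open>D \<rho>(x)\<close>
  then give the inequality. In the case of equality, elimination yields \<open>D \<rho>(x) = X D Y\<close> with integral
  unitriangular \<open>X\<close> and \<open>Y\<close>, where \<open>X\<close> only has entries of torus weight \<open>\<ge> 0\<close> and \<open>Y\<close> only of weight \<open>\<le> 0\<close>. If \<open>\<rho>\<close> is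
  faithful, the logarithm identifies \<open>U\<close> with a graded linear subspace of matrices; hence \<open>t\<^sup>\<mu> x t\<^sup>-\<^sup>\<mu>\<close> is a product
  \<open>a b\<close> in \<open>U(C((t)))\<close> of a factor of weights \<open>\<ge> 0\<close> and one of weights \<open>< 0\<close>. Comparison with \<open>X (D Y D\<^sup>-\<^sup>1)\<close> shows
  that \<open>a\<close> and \<open>t\<^sup>-\<^sup>\<mu> b t\<^sup>\<mu>\<close> are integral, and \<open>t\<^sup>\<mu> x = a t\<^sup>\<mu> (t\<^sup>-\<^sup>\<mu> b t\<^sup>\<mu>)\<close>.
\<close>

text \<open>\<open>laurent_points\<close> is defined by the vanishing ideal alone, while all
  hypotheses on groups, homomorphisms and representations concern points over the base field. The
  obstacle that shapes the development is therefore transfer: a Laurent point is treated as a ring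
  homomorphism from functions on \<open>Z\<close> to \<open>C((t))\<close>, at which every regular
  identity on \<open>Z\<close> may be evaluated. The same device handles \<open>t\<close> as a point
  of the torus, arbitrary matrices as points of affine space, and one-parameter families, where it
  certifies that an expression is polynomial in \<open>s\<close>. In the case of equality, the
  matrices \<open>X\<close> and \<open>Y\<close> found by elimination need not come from
  \<open>U\<close>; they carry only a support condition by weights. So the group element is factored
  by the same weights inside \<open>U\<close>, and the two factorizations can differ only in weight
  zero. Integrality returns from \<open>\<rho>(x)\<close> to \<open>x\<close> because the logarithms
  of \<open>U\<close> are recovered from those of its image by a linear map over the base field;
  exp, log and this map all preserve integrality.\<close>

hide_const (open) Ring_Hom_Poly.eval_poly
hide_fact (open) Ring_Hom_Poly.eval_poly_def

no_notation fps_nth (infixl \<open>$\<close> 75)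

section \<open>Laurent series points\<close>

text \<open>\<open>B\<close> prescribes Laurent series values for some functions on a set \<open>Z\<close> of points over the base field, and
  \<open>realizes\<close> extends it to the generated algebra. If this is well defined (\<open>fls_point\<close>), then identities
  between regular functions that hold on \<open>Z\<close> also hold for the values.\<close>

inductive realizes :: "'x set \<Rightarrow> (('x \<Rightarrow> 'a::field) \<times> 'a fls) set \<Rightarrow> ('x \<Rightarrow> 'a) \<Rightarrow> 'a fls \<Rightarrow> bool"
  for Z B where
  realizes_gen: "(f, v) \<in> B \<Longrightarrow> realizes Z B f v"
| realizes_const: "realizes Z B (\<lambda>_. c) (fls_const c)"
| realizes_add: "realizes Z B f v \<Longrightarrow> realizes Z B g w \<Longrightarrow> realizes Z B (\<lambda>x. f x + g x) (v + w)"
| realizes_mult: "realizes Z B f v \<Longrightarrow> realizes Z B g w \<Longrightarrow> realizes Z B (\<lambda>x. f x * g x) (v * w)"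
| realizes_cong: "realizes Z B f v \<Longrightarrow> (\<And>x. x \<in> Z \<Longrightarrow> f x = g x) \<Longrightarrow> realizes Z B g v"

definition fls_point :: "'x set \<Rightarrow> (('x \<Rightarrow> 'a::field) \<times> 'a fls) set \<Rightarrow> bool" where
  "fls_point Z B \<longleftrightarrow> (\<forall>f v. realizes Z B f v \<longrightarrow> (\<forall>x\<in>Z. f x = 0) \<longrightarrow> v = 0)"

lemma realizes_zero: "realizes Z B (\<lambda>_. 0) 0"
  using realizes_const[of Z B 0] by simp

lemma realizes_one: "realizes Z B (\<lambda>_. 1) 1"
  using realizes_const[of Z B 1] by simp

lemma realizes_cmult: "realizes Z B f v \<Longrightarrow> realizes Z B (\<lambda>x. c * f x) (fls_const c * v)"
  by (intro realizes_mult realizes_const)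

lemma realizes_uminus: "realizes Z B f v \<Longrightarrow> realizes Z B (\<lambda>x. - f x) (- v)"
  using realizes_cmult[of Z B f v "-1"] by simp

lemma realizes_diff:
  "realizes Z B f v \<Longrightarrow> realizes Z B g w \<Longrightarrow> realizes Z B (\<lambda>x. f x - g x) (v - w)"
  using realizes_add[OF _ realizes_uminus, of Z B f v g w] by simp

lemma realizes_sum:
  "(\<And>i. i \<in> I \<Longrightarrow> realizes Z B (f i) (v i)) \<Longrightarrow>
    realizes Z B (\<lambda>x. \<Sum>i\<in>I. f i x) (\<Sum>i\<in>I. v i)"
  by (induction I rule: infinite_finite_induct) (auto intro: realizes_zero realizes_add)

lemma realizes_prod:
  "(\<And>i. i \<in> I \<Longrightarrow> realizes Z B (f i) (v i)) \<Longrightarrow>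
    realizes Z B (\<lambda>x. \<Prod>i\<in>I. f i x) (\<Prod>i\<in>I. v i)"
  by (induction I rule: infinite_finite_induct) (auto intro: realizes_one realizes_mult)

lemma realizes_power: "realizes Z B f v \<Longrightarrow> realizes Z B (\<lambda>x. f x ^ k) (v ^ k)"
  by (induction k) (auto intro: realizes_one realizes_mult)

lemmas realizes_intros = realizes_zero realizes_one realizes_const realizes_add realizes_mult
  realizes_uminus realizes_diff realizes_sum realizes_prod realizes_power

lemma fls_point_unique:
  assumes "fls_point Z B" "realizes Z B f v" "realizes Z B g w" "\<And>x. x \<in> Z \<Longrightarrow> f x = g x"
  shows "v = w"
  using assms realizes_diff[of Z B f v g w] unfolding fls_point_def by fastforce

lemma realizes_comp:
  assumes "realizes Z' B' f v" and "\<phi> ` Z \<subseteq> Z'"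
    and "\<And>f v. (f, v) \<in> B' \<Longrightarrow> realizes Z B (\<lambda>x. f (\<phi> x)) v"
  shows "realizes Z B (\<lambda>x. f (\<phi> x)) v"
  using assms(1)
proof induction
  case (realizes_cong f v g)
  show ?case
    by (rule realizes.realizes_cong[OF realizes_cong.IH]) (use assms(2) realizes_cong.hyps in auto)
qed (auto intro: realizes_intros assms(3))

text \<open>Points push forward along a regular map \<open>\<phi>\<close>: a function vanishing on
  \<open>Z'\<close> pulls back to one vanishing on \<open>Z\<close>, and the pullback is realized
  with the same value.\<close>

lemma fls_point_image:
  assumes "fls_point Z B" and "\<phi> ` Z \<subseteq> Z'"
    and "\<And>f v. (f, v) \<in> B' \<Longrightarrow> realizes Z B (\<lambda>x. f (\<phi> x)) v"
  shows "fls_point Z' B'"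
  unfolding fls_point_def
proof (intro allI impI)
  fix f v assume f: "realizes Z' B' f v" "\<forall>x\<in>Z'. f x = 0"
  have "realizes Z B (\<lambda>x. f (\<phi> x)) v" by (rule realizes_comp[OF f(1) assms(2,3)])
  with assms(1,2) f(2) show "v = 0" unfolding fls_point_def by blast
qed

section \<open>Points of products\<close>

definition prod_gens ::
  "(('x \<Rightarrow> 'a) \<times> 'a fls) set \<Rightarrow> (('y \<Rightarrow> 'a) \<times> 'a fls) set \<Rightarrow> (('x \<times> 'y \<Rightarrow> 'a) \<times> 'a fls) set" where
  "prod_gens B1 B2 = (\<lambda>(f, v). (\<lambda>x. f (fst x), v)) ` B1 \<union> (\<lambda>(f, v). (\<lambda>x. f (snd x), v)) ` B2"

lemma realizes_prod_fst:
  assumes "realizes Z1 B1 f v" shows "realizes (Z1 \<times> Z2) (prod_gens B1 B2) (\<lambda>x. f (fst x)) v"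
  by (rule realizes_comp[OF assms]) (auto intro!: realizes_gen rev_image_eqI simp: prod_gens_def)

lemma realizes_prod_snd:
  assumes "realizes Z2 B2 f v" shows "realizes (Z1 \<times> Z2) (prod_gens B1 B2) (\<lambda>x. f (snd x)) v"
  by (rule realizes_comp[OF assms]) (auto intro!: realizes_gen rev_image_eqI simp: prod_gens_def)

text \<open>The coordinate algebra of a product is the tensor product of those of the factors, so
  each element is a finite sum of pure tensors. The indices are naturals because one fixed index
  type has to accommodate all sums and products met in the induction.\<close>

lemma realizes_prod_tensor:
  assumes "realizes (Z1 \<times> Z2) (prod_gens B1 B2) P v"
  shows "\<exists>I f w g u. finite (I :: nat set) \<and>
    (\<forall>i\<in>I. realizes Z1 B1 (f i) (w i) \<and> realizes Z2 B2 (g i) (u i)) \<and>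
    (\<forall>x\<in>Z1. \<forall>y\<in>Z2. P (x, y) = (\<Sum>i\<in>I. f i x * g i y)) \<and> v = (\<Sum>i\<in>I. w i * u i)"
  (is "?T P v")
  using assms
proof induction
  case (realizes_gen P v)
  then consider f where "(f, v) \<in> B1" "P = (\<lambda>x. f (fst x))"
    | f where "(f, v) \<in> B2" "P = (\<lambda>x. f (snd x))"
    unfolding prod_gens_def by auto
  then show ?case
  proof cases
    case 1
    then show ?thesis
      by (intro exI[of _ "{0}"], intro exI[of _ "\<lambda>_. f"], intro exI[of _ "\<lambda>_. v"], intro exI[of _ "\<lambda>_ _. 1"],
        intro exI[of _ "\<lambda>_. 1"]) (auto intro: realizes.realizes_gen realizes_one)
  next
    case 2
    then show ?thesis
      by (intro exI[of _ "{0}"], intro exI[of _ "\<lambda>_ _. 1"], intro exI[of _ "\<lambda>_. fls_const 1"],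
        intro exI[of _ "\<lambda>_. f"], intro exI[of _ "\<lambda>_. v"]) (auto intro: realizes.realizes_gen realizes_one)
  qed
next
  case (realizes_const c)
  show ?case
    by (intro exI[of _ "{0}"], intro exI[of _ "\<lambda>_ _. c"], intro exI[of _ "\<lambda>_. fls_const c"],
        intro exI[of _ "\<lambda>_ _. 1"], intro exI[of _ "\<lambda>_. 1"]) (auto intro: realizes.realizes_const realizes_one)
next
  case (realizes_add P v P' v')
  from realizes_add.IH(1) obtain I f w g u where
    I: "finite (I :: nat set)" "\<forall>i\<in>I. realizes Z1 B1 (f i) (w i) \<and> realizes Z2 B2 (g i) (u i)"
      "\<forall>x\<in>Z1. \<forall>y\<in>Z2. P (x, y) = (\<Sum>i\<in>I. f i x * g i y)" "v = (\<Sum>i\<in>I. w i * u i)"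
    by blast
  from realizes_add.IH(2) obtain I' f' w' g' u' where
    I': "finite (I' :: nat set)" "\<forall>i\<in>I'. realizes Z1 B1 (f' i) (w' i) \<and> realizes Z2 B2 (g' i) (u' i)"
      "\<forall>x\<in>Z1. \<forall>y\<in>Z2. P' (x, y) = (\<Sum>i\<in>I'. f' i x * g' i y)" "v' = (\<Sum>i\<in>I'. w' i * u' i)"
    by blast
  define J where "J = (\<lambda>i. 2 * i) ` I \<union> (\<lambda>i. 2 * i + 1) ` I'"
  have J: "(\<Sum>i\<in>J. (if even i then h (i div 2) else h' (i div 2))) = sum h I + sum h' I'"
    for h h' :: "nat \<Rightarrow> 'd::comm_monoid_add"
  proof -
    have "(\<lambda>i. 2 * i) ` I \<inter> (\<lambda>i. 2 * i + 1) ` I' = {}" by (auto, presburger)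
    then show ?thesis unfolding J_def using I(1) I'(1)
      by (subst sum.union_disjoint) (auto simp: sum.reindex inj_on_def)
  qed
  let ?m = "\<lambda>a b i. if even i then a (i div 2) else b (i div 2)"
  have "finite J" using I(1) I'(1) by (simp add: J_def)
  moreover have "\<forall>i\<in>J. realizes Z1 B1 (?m f f' i) (?m w w' i) \<and> realizes Z2 B2 (?m g g' i) (?m u u' i)"
    using I(2) I'(2) by (auto simp: J_def)
  moreover have "\<forall>x\<in>Z1. \<forall>y\<in>Z2. P (x, y) + P' (x, y) = (\<Sum>i\<in>J. ?m f f' i x * ?m g g' i y)"
    using I(3) I'(3) J[of "\<lambda>i. f i _ * g i _" "\<lambda>i. f' i _ * g' i _", symmetric]
    by (auto intro!: sum.cong)
  moreover have "v + v' = (\<Sum>i\<in>J. ?m w w' i * ?m u u' i)"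
    unfolding I(4) I'(4) J[of "\<lambda>i. w i * u i" "\<lambda>i. w' i * u' i", symmetric]
    by (auto intro!: sum.cong)
  ultimately show ?case
    by (intro exI[of _ J], intro exI[of _ "?m f f'"], intro exI[of _ "?m w w'"],
        intro exI[of _ "?m g g'"], intro exI[of _ "?m u u'"]) blast
next
  case (realizes_mult P v P' v')
  from realizes_mult.IH(1) obtain I f w g u where
    I: "finite (I :: nat set)" "\<forall>i\<in>I. realizes Z1 B1 (f i) (w i) \<and> realizes Z2 B2 (g i) (u i)"
      "\<forall>x\<in>Z1. \<forall>y\<in>Z2. P (x, y) = (\<Sum>i\<in>I. f i x * g i y)" "v = (\<Sum>i\<in>I. w i * u i)"
    by blast
  from realizes_mult.IH(2) obtain I' f' w' g' u' where
    I': "finite (I' :: nat set)" "\<forall>i\<in>I'. realizes Z1 B1 (f' i) (w' i) \<and> realizes Z2 B2 (g' i) (u' i)"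
      "\<forall>x\<in>Z1. \<forall>y\<in>Z2. P' (x, y) = (\<Sum>i\<in>I'. f' i x * g' i y)" "v' = (\<Sum>i\<in>I'. w' i * u' i)"
    by blast
  define J where "J = (prod_encode :: nat \<times> nat \<Rightarrow> nat) ` (I \<times> I')"
  have J: "(\<Sum>k\<in>J. h (fst (prod_decode k)) (snd (prod_decode k))) = (\<Sum>i\<in>I. \<Sum>j\<in>I'. h i j)"
    for h :: "nat \<Rightarrow> nat \<Rightarrow> 'd::comm_monoid_add"
    unfolding J_def
    by (subst sum.reindex[OF inj_prod_encode]) (simp add: sum.cartesian_product split_def)
  let ?m = "\<lambda>a b k. a (fst (prod_decode k)) * b (snd (prod_decode k))"
  let ?m' = "\<lambda>a b k x. a (fst (prod_decode k)) x * b (snd (prod_decode k)) x"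
  have "finite J" using I(1) I'(1) by (simp add: J_def)
  moreover have "\<forall>k\<in>J. realizes Z1 B1 (?m' f f' k) (?m w w' k) \<and> realizes Z2 B2 (?m' g g' k) (?m u u' k)"
    using I(2) I'(2) by (auto simp: J_def intro!: realizes.realizes_mult)
  moreover have "P (x, y) * P' (x, y) = (\<Sum>k\<in>J. ?m' f f' k x * ?m' g g' k y)"
    if "x \<in> Z1" "y \<in> Z2" for x y
    unfolding J[of "\<lambda>i j. (f i x * f' j x) * (g i y * g' j y)"] I(3)[rule_format, OF that]
      I'(3)[rule_format, OF that] sum_product by (intro sum.cong refl) (simp add: mult_ac)
  moreover have "v * v' = (\<Sum>k\<in>J. ?m w w' k * ?m u u' k)"
    unfolding I(4) I'(4) J[of "\<lambda>i j. (w i * w' j) * (u i * u' j)"]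
    unfolding sum_product by (intro sum.cong refl) (simp add: mult_ac)
  ultimately show ?case
    by (intro exI[of _ J], intro exI[of _ "?m' f f'"], intro exI[of _ "?m w w'"],
        intro exI[of _ "?m' g g'"], intro exI[of _ "?m u u'"]) blast
next
  case (realizes_cong P v P')
  then obtain I f w g u where
    "finite (I :: nat set)" "\<forall>i\<in>I. realizes Z1 B1 (f i) (w i) \<and> realizes Z2 B2 (g i) (u i)"
      "\<forall>x\<in>Z1. \<forall>y\<in>Z2. P (x, y) = (\<Sum>i\<in>I. f i x * g i y)" "v = (\<Sum>i\<in>I. w i * u i)"
    by blast
  with realizes_cong.hyps show ?case
    by (intro exI[of _ I], intro exI[of _ f], intro exI[of _ w], intro exI[of _ g], intro exI[of _ u]) auto
qed

text \<open>Either the coefficients \<open>u i\<close> are linearly independent over the base field, and then every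
  \<open>f i\<close> vanishes on \<open>Z\<close>, or one of them can be eliminated.\<close>

lemma fls_point_linear_comb:
  assumes "finite I" and "fls_point Z B" and "\<And>i. i \<in> I \<Longrightarrow> realizes Z B (f i) (w i)"
    and "\<And>x. x \<in> Z \<Longrightarrow> (\<Sum>i\<in>I. fls_const (f i x) * u i) = 0"
  shows "(\<Sum>i\<in>I. w i * u i) = 0"
  using assms
proof (induction "card I" arbitrary: I f w)
  case 0
  then show ?case by simp
next
  case (Suc n)
  show ?case
  proof (cases "\<forall>x\<in>Z. \<forall>i\<in>I. f i x = 0")
    case True
    then have "\<forall>i\<in>I. w i = 0" using Suc.prems unfolding fls_point_def by blast
    then show ?thesis by simp
  next
    case False
    then obtain x0 r where x0: "x0 \<in> Z" "r \<in> I" "f r x0 \<noteq> 0" by blast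
    \<comment> \<open>The relation at \<open>x0\<close>, where \<open>f r\<close> does not vanish,
      expresses \<open>u r\<close> by the other \<open>u i\<close> with coefficients
      \<open>a i\<close> in the base field. Substituting this leaves a relation with one term
      fewer.\<close>
    define a where "a i = f i x0 / f r x0" for i
    let ?J = "I - {r}"
    have fI: "finite I" by fact
    have "(\<Sum>i\<in>?J. fls_const (a i) * u i) + u r = fls_const (1 / f r x0) * (\<Sum>i\<in>I. fls_const (f i x0) * u i)"
      using x0 fI by (simp add: a_def sum.remove[of I r] sum_distrib_left distrib_left mult.assoc[symmetric])
    then have ur: "u r = - (\<Sum>i\<in>?J. fls_const (a i) * u i)"
      using Suc.prems(4)[OF x0(1)] by (simp add: add_eq_0_iff2)
    define f' where "f' i x = f i x - a i * f r x" for i x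
    define w' where "w' i = w i - fls_const (a i) * w r" for i
    have "(\<Sum>i\<in>?J. w' i * u i) = 0"
    proof (rule Suc.hyps(1)[of ?J f'])
      show "n = card ?J" using Suc.hyps(2) x0 fI by simp
      show "realizes Z B (f' i) (w' i)" if "i \<in> ?J" for i
        unfolding f'_def w'_def using that x0 by (intro realizes_intros Suc.prems) auto
      show "(\<Sum>i\<in>?J. fls_const (f' i x) * u i) = 0" if "x \<in> Z" for x
      proof -
        have "(\<Sum>i\<in>I. fls_const (f i x) * u i) = fls_const (f r x) * u r + (\<Sum>i\<in>?J. fls_const (f i x) * u i)"
          using x0 fI by (simp add: sum.remove)
        also have "\<dots> = (\<Sum>i\<in>?J. fls_const (f' i x) * u i)"
          unfolding ur f'_def
          by (simp add: sum_distrib_left sum_negf[symmetric] sum.distrib[symmetric] fls_minus_const[symmetric]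
              fls_const_mult_const[symmetric] algebra_simps del: fls_const_mult_const)
        finally show ?thesis using Suc.prems(4)[OF that] by simp
      qed
    qed (use fI Suc.prems in auto)
    moreover have "(\<Sum>i\<in>I. w i * u i) = w r * u r + (\<Sum>i\<in>?J. w i * u i)"
      using x0 fI by (simp add: sum.remove)
    moreover have "\<dots> = (\<Sum>i\<in>?J. w' i * u i)"
      unfolding ur w'_def
      by (simp add: sum_distrib_left sum_negf[symmetric] sum.distrib[symmetric] algebra_simps)
    ultimately show ?thesis by simp
  qed
qed

text \<open>With \<open>x\<close> frozen, the second point turns \<open>P (x, _) = 0\<close> into a
  linear relation between the Laurent series \<open>u i\<close> with coefficients
  \<open>f i x\<close>. Since the \<open>u i\<close> are not constants, the first point is then
  applied through \<open>fls_point_linear_comb\<close>.\<close>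

lemma fls_point_prod:
  assumes "fls_point Z1 B1" and "fls_point Z2 B2"
  shows "fls_point (Z1 \<times> Z2) (prod_gens B1 B2)"
  unfolding fls_point_def
proof (intro allI impI)
  fix P v assume P: "realizes (Z1 \<times> Z2) (prod_gens B1 B2) P v" "\<forall>x\<in>Z1 \<times> Z2. P x = 0"
  obtain I f w g u where I: "finite (I :: nat set)"
    "\<forall>i\<in>I. realizes Z1 B1 (f i) (w i) \<and> realizes Z2 B2 (g i) (u i)"
    "\<forall>x\<in>Z1. \<forall>y\<in>Z2. P (x, y) = (\<Sum>i\<in>I. f i x * g i y)" "v = (\<Sum>i\<in>I. w i * u i)"
    using realizes_prod_tensor[OF P(1)] by blast
  show "v = 0" unfolding I(4)
  proof (rule fls_point_linear_comb[OF I(1) assms(1)])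
    show "realizes Z1 B1 (f i) (w i)" if "i \<in> I" for i using I(2) that by blast
    show "(\<Sum>i\<in>I. fls_const (f i x) * u i) = 0" if x: "x \<in> Z1" for x
    proof -
      have "realizes Z2 B2 (\<lambda>y. \<Sum>i\<in>I. f i x * g i y) (\<Sum>i\<in>I. fls_const (f i x) * u i)"
        using I(2) by (intro realizes_intros) auto
      moreover have "\<forall>y\<in>Z2. (\<Sum>i\<in>I. f i x * g i y) = 0"
        using I(3) P(2) x by force
      ultimately show ?thesis using assms(2) unfolding fls_point_def by blast
    qed
  qed
qed

section \<open>Points of affine space and of the multiplicative group\<close>

definition coord_gens :: "'j set \<Rightarrow> ('j \<Rightarrow> 'a::field fls) \<Rightarrow> ((('j \<Rightarrow> 'a) \<Rightarrow> 'a) \<times> 'a fls) set" where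
  "coord_gens J v = (\<lambda>j. (\<lambda>a. a j, v j)) ` J"

lemma fls_const_sum: "fls_const (\<Sum>i\<in>I. f i) = (\<Sum>i\<in>I. fls_const (f i))"
  by (induction I rule: infinite_finite_induct) (auto simp: fls_plus_const[symmetric])

lemma realizes_line:
  assumes "realizes Z {(\<lambda>s. s, v)} f w"
  shows "\<exists>p. (\<forall>s\<in>Z. f s = poly p s) \<and> w = poly (map_poly fls_const p) v"
  using assms
proof induction
  case (realizes_gen f w)
  then show ?case by (intro exI[of _ "[:0, 1:]"]) (auto simp: map_poly_pCons)
next
  case (realizes_const c)
  have "map_poly fls_const [:c:] = [:fls_const c:]"
    by (rule poly_eqI) (auto simp: coeff_map_poly coeff_pCons split: nat.splits)
  then show ?case by (intro exI[of _ "[:c:]"]) auto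
next
  case (realizes_add f v' g w')
  then obtain p q where "\<forall>s\<in>Z. f s = poly p s" "v' = poly (map_poly fls_const p) v"
    "\<forall>s\<in>Z. g s = poly q s" "w' = poly (map_poly fls_const q) v" by blast
  moreover have "map_poly fls_const (p + q) = map_poly fls_const p + map_poly fls_const q"
    by (rule poly_eqI) (auto simp: coeff_map_poly fls_plus_const)
  ultimately show ?case by (intro exI[of _ "p + q"]) auto
next
  case (realizes_mult f v' g w')
  then obtain p q where "\<forall>s\<in>Z. f s = poly p s" "v' = poly (map_poly fls_const p) v"
    "\<forall>s\<in>Z. g s = poly q s" "w' = poly (map_poly fls_const q) v" by blast
  moreover have "map_poly fls_const (p * q) = map_poly fls_const p * map_poly fls_const q"
    by (rule poly_eqI) (simp add: coeff_map_poly coeff_mult fls_const_sum)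
  ultimately show ?case by (intro exI[of _ "p * q"]) auto
qed auto

text \<open>A polynomial with infinitely many zeros is zero, so the coordinate satisfies no relation
  on \<open>Z\<close> and may take any value \<open>v\<close>. The set \<open>Z\<close> is kept
  general in order to cover the nonzero scalars as well.\<close>

lemma fls_point_line:
  fixes v :: "'a::field_char_0 fls"
  assumes "infinite Z" shows "fls_point Z {(\<lambda>s. s, v)}"
  unfolding fls_point_def
proof (intro allI impI)
  fix f w assume f: "realizes Z {(\<lambda>s. s, v)} f w" "\<forall>s\<in>Z. f s = 0"
  obtain p where p: "\<forall>s\<in>Z. f s = poly p s" "w = poly (map_poly fls_const p) v"
    using realizes_line[OF f(1)] by blast
  have "Z \<subseteq> {s. poly p s = 0}" using f(2) p(1) by auto
  then have "p = 0" using assms poly_roots_finite[of p] finite_subset by blast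
  then show "w = 0" using p(2) by simp
qed

lemma fls_point_coords:
  fixes v :: "'j \<Rightarrow> 'a::field_char_0 fls"
  assumes "finite J" shows "fls_point UNIV (coord_gens J v)"
  using assms
proof (induction J)
  case empty
  have "\<exists>c. (\<forall>x. f x = c) \<and> w = fls_const c" if "realizes UNIV (coord_gens {} v) f w" for f w
    using that by induction (auto simp: coord_gens_def fls_plus_const)
  then show ?case unfolding fls_point_def by fastforce
next
  case (insert j J)
  show ?case
  proof (rule fls_point_image[OF fls_point_prod[OF insert.IH fls_point_line[OF infinite_UNIV_char_0]],
        where \<phi> = "\<lambda>(a, s). a(j := s)"])
    fix f w assume "(f, w) \<in> coord_gens (insert j J) v"
    then consider "f = (\<lambda>a. a j)" "w = v j" | i where "i \<in> J" "f = (\<lambda>a. a i)" "w = v i"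
      by (auto simp: coord_gens_def)
    then show "realizes (UNIV \<times> UNIV) (prod_gens (coord_gens J v) {(\<lambda>s. s, v j)})
        (\<lambda>x. f (case x of (a, s) \<Rightarrow> a(j := s))) w"
    proof cases
      case 1
      have "realizes (UNIV \<times> UNIV) (prod_gens (coord_gens J v) {(\<lambda>s. s, v j)}) (\<lambda>x. snd x) (v j)"
        by (rule realizes_prod_snd[where f = "\<lambda>s. s"]) (auto intro: realizes_gen)
      with 1 show ?thesis by (auto intro: realizes_cong simp: split_def)
    next
      case 2
      then have "i \<noteq> j" using insert.hyps by auto
      have "realizes (UNIV \<times> UNIV) (prod_gens (coord_gens J v) {(\<lambda>s. s, v j)}) (\<lambda>x. fst x i) (v i)"
        by (rule realizes_prod_fst[where f = "\<lambda>a. a i"])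
          (use 2 in \<open>auto intro!: realizes_gen simp: coord_gens_def\<close>)
      with 2 \<open>i \<noteq> j\<close> show ?thesis by (auto intro: realizes_cong simp: split_def)
    qed
  qed simp
qed

text \<open>The point \<open>s = t\<close> of the multiplicative group. The inverse is a generator
  of its own because \<open>realizes\<close> has no rule for division.\<close>

definition torus_gens :: "(('a::field \<Rightarrow> 'a) \<times> 'a fls) set" where
  "torus_gens = {(\<lambda>s. s, fls_X), (inverse, inverse fls_X)}"

text \<open>Regular functions on the multiplicative group are Laurent polynomials; multiplication by
  a power of \<open>s\<close> clears the denominators and leads back to the line.\<close>

lemma realizes_torus:
  assumes "realizes {s. s \<noteq> 0} torus_gens f w"
  shows "\<exists>g w' k. realizes {s. s \<noteq> 0} {(\<lambda>s. s, fls_X)} g w' \<and> (\<forall>s. s \<noteq> 0 \<longrightarrow> f s * s ^ k = g s) \<and>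
    w * fls_X ^ k = w'"
  using assms
proof induction
  case (realizes_gen f w)
  then consider "f = (\<lambda>s. s)" "w = fls_X" | "f = inverse" "w = inverse fls_X"
    by (auto simp: torus_gens_def)
  then show ?case
  proof cases
    case 1
    have "realizes {s. s \<noteq> 0} {(\<lambda>s. s, fls_X)} (\<lambda>s. s :: 'a) fls_X" by (rule realizes.realizes_gen) simp
    then show ?thesis unfolding 1
      by (intro exI[of _ "\<lambda>s. s"] exI[of _ fls_X] exI[of _ 0] conjI) (simp_all only: power_0 mult_1_right simp_thms)
  next
    case 2
    then show ?thesis
      by (intro exI[of _ "\<lambda>s. 1"] exI[of _ 1] exI[of _ 1]) (auto intro: realizes_one simp del: fls_inverse_X)
  qed
next
  case (realizes_const c)
  show ?case
    by (intro exI[of _ "\<lambda>s. c"] exI[of _ "fls_const c"] exI[of _ 0]) (auto intro: realizes.realizes_const)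
next
  case (realizes_add f v f' v')
  from realizes_add.IH(1) obtain g w k where
    g: "realizes {s. s \<noteq> 0} {(\<lambda>s. s, fls_X)} g w" "\<And>s. s \<noteq> 0 \<Longrightarrow> f s * s ^ k = g s" "v * fls_X ^ k = w"
    by blast
  from realizes_add.IH(2) obtain g' w' k' where
    g': "realizes {s. s \<noteq> 0} {(\<lambda>s. s, fls_X)} g' w'" "\<And>s. s \<noteq> 0 \<Longrightarrow> f' s * s ^ k' = g' s" "v' * fls_X ^ k' = w'"
    by blast
  have "realizes {s. s \<noteq> 0} {(\<lambda>s. s, fls_X)} (\<lambda>s. g s * s ^ k' + g' s * s ^ k) (w * fls_X ^ k' + w' * fls_X ^ k)"
    by (intro realizes_intros g g' realizes_gen) auto
  moreover have "(f s + f' s) * s ^ (k + k') = g s * s ^ k' + g' s * s ^ k" if "s \<noteq> 0" for s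
    unfolding g(2)[OF that, symmetric] g'(2)[OF that, symmetric] by (simp add: power_add algebra_simps)
  moreover have "(v + v') * fls_X ^ (k + k') = w * fls_X ^ k' + w' * fls_X ^ k"
    unfolding g(3)[symmetric] g'(3)[symmetric] by (simp add: power_add algebra_simps)
  ultimately show ?case
    by (intro exI[of _ "\<lambda>s. g s * s ^ k' + g' s * s ^ k"] exI[of _ "w * fls_X ^ k' + w' * fls_X ^ k"]
        exI[of _ "k + k'"] conjI allI impI)
next
  case (realizes_mult f v f' v')
  from realizes_mult.IH(1) obtain g w k where
    g: "realizes {s. s \<noteq> 0} {(\<lambda>s. s, fls_X)} g w" "\<And>s. s \<noteq> 0 \<Longrightarrow> f s * s ^ k = g s" "v * fls_X ^ k = w"
    by blast
  from realizes_mult.IH(2) obtain g' w' k' where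
    g': "realizes {s. s \<noteq> 0} {(\<lambda>s. s, fls_X)} g' w'" "\<And>s. s \<noteq> 0 \<Longrightarrow> f' s * s ^ k' = g' s" "v' * fls_X ^ k' = w'"
    by blast
  have "realizes {s. s \<noteq> 0} {(\<lambda>s. s, fls_X)} (\<lambda>s. g s * g' s) (w * w')"
    by (intro realizes_intros g g')
  moreover have "(f s * f' s) * s ^ (k + k') = g s * g' s" if "s \<noteq> 0" for s
    unfolding g(2)[OF that, symmetric] g'(2)[OF that, symmetric] by (simp add: power_add algebra_simps)
  moreover have "(v * v') * fls_X ^ (k + k') = w * w'"
    unfolding g(3)[symmetric] g'(3)[symmetric] by (simp add: power_add algebra_simps)
  ultimately show ?case
    by (intro exI[of _ "\<lambda>s. g s * g' s"] exI[of _ "w * w'"] exI[of _ "k + k'"] conjI allI impI)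
next
  case (realizes_cong f v g)
  then obtain h w' k where "realizes {s. s \<noteq> 0} {(\<lambda>s. s, fls_X)} h w'"
    "\<forall>s. s \<noteq> 0 \<longrightarrow> f s * s ^ k = h s" "v * fls_X ^ k = w'" by blast
  with realizes_cong.hyps show ?case by (intro exI[of _ h] exI[of _ w'] exI[of _ k]) auto
qed

lemma fls_point_torus: "fls_point {s :: 'a::field_char_0. s \<noteq> 0} torus_gens"
  unfolding fls_point_def
proof (intro allI impI)
  fix f :: "'a \<Rightarrow> 'a" and w
  assume f: "realizes {s. s \<noteq> 0} torus_gens f w" "\<forall>s\<in>{s. s \<noteq> 0}. f s = 0"
  obtain g w' k where g: "realizes {s. s \<noteq> 0} {(\<lambda>s. s, fls_X)} g w'"
    "\<forall>s. s \<noteq> 0 \<longrightarrow> f s * s ^ k = g s" "w * fls_X ^ k = w'" using realizes_torus[OF f(1)] by blast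
  have "{s :: 'a. s \<noteq> 0} = UNIV - {0}" by auto
  then have "infinite {s :: 'a. s \<noteq> 0}"
    using infinite_UNIV_char_0[where ?'a = 'a] by (metis Diff_infinite_finite finite.emptyI finite.insertI)
  then have pt: "fls_point {s :: 'a. s \<noteq> 0} {(\<lambda>s. s, fls_X)}" by (rule fls_point_line)
  have "\<forall>s\<in>{s. s \<noteq> 0}. g s = 0" using f(2) g(2) by (metis mem_Collect_eq mult_zero_left)
  with pt g(1) have "w' = 0" unfolding fls_point_def by blast
  then show "w = 0" using g(3) by simp
qed

section \<open>Matrix-valued regular functions and their Laurent series values\<close>

interpretation fls_const: comm_ring_hom "fls_const :: 'a::comm_ring_1 \<Rightarrow> 'a fls"
  by unfold_locales (auto simp: fls_plus_const)

lemma GL_carrier: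
  "carrier (GL n :: 'b::comm_ring_1 mat monoid) =
    {A \<in> carrier_mat n n. \<exists>B \<in> carrier_mat n n. A * B = 1\<^sub>m n \<and> B * A = 1\<^sub>m n}"
  by (auto simp: GL_def units_of_def Units_def ring_mat_def)

lemma GL_mult [simp]: "x \<otimes>\<^bsub>GL n\<^esub> y = x * y"
  by (simp add: GL_def units_of_def ring_mat_def)

lemma GL_one [simp]: "\<one>\<^bsub>GL n\<^esub> = 1\<^sub>m n"
  by (simp add: GL_def units_of_def ring_mat_def)

lemma group_GL: "group (GL n :: 'b::comm_ring_1 mat monoid)"
proof -
  interpret ring "ring_mat TYPE('b) n ()" by (rule ring_mat)
  show ?thesis unfolding GL_def by (rule units_group)
qed

lemma GL_carrier_det:
  "A \<in> carrier (GL n) \<longleftrightarrow> A \<in> carrier_mat n n \<and> det (A :: 'b::field mat) \<noteq> 0"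
proof
  assume "A \<in> carrier (GL n)"
  then obtain B where "A \<in> carrier_mat n n" "B \<in> carrier_mat n n" "A * B = 1\<^sub>m n"
    by (auto simp: GL_carrier)
  then show "A \<in> carrier_mat n n \<and> det A \<noteq> 0"
    using det_mult[of A n B] by (auto simp: det_one)
next
  assume A: "A \<in> carrier_mat n n \<and> det A \<noteq> 0"
  let ?B = "inverse (det A) \<cdot>\<^sub>m adj_mat A"
  note adj = adj_mat[of A n]
  have "?B \<in> carrier_mat n n" "A * ?B = 1\<^sub>m n" "?B * A = 1\<^sub>m n"
    using A adj mult_smult_distrib[of A n n "adj_mat A" n "inverse (det A)"]
      mult_smult_assoc_mat[of "adj_mat A" n n A n "inverse (det A)"] by auto
  with A show "A \<in> carrier (GL n)" by (auto simp: GL_carrier)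
qed

definition mrealizes ::
  "'x set \<Rightarrow> (('x \<Rightarrow> 'a::field) \<times> 'a fls) set \<Rightarrow> nat \<Rightarrow> nat \<Rightarrow> ('x \<Rightarrow> 'a mat) \<Rightarrow> 'a fls mat \<Rightarrow> bool" where
  "mrealizes Z B n m F V \<longleftrightarrow> V \<in> carrier_mat n m \<and> (\<forall>x\<in>Z. F x \<in> carrier_mat n m) \<and>
    (\<forall>i<n. \<forall>j<m. realizes Z B (\<lambda>x. F x $$ (i, j)) (V $$ (i, j)))"

lemma mrealizesI:
  assumes "V \<in> carrier_mat n m" "\<And>x. x \<in> Z \<Longrightarrow> F x \<in> carrier_mat n m"
    and "\<And>i j. i < n \<Longrightarrow> j < m \<Longrightarrow> realizes Z B (\<lambda>x. F x $$ (i, j)) (V $$ (i, j))"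
  shows "mrealizes Z B n m F V"
  using assms by (auto simp: mrealizes_def)

lemma mrealizesD:
  assumes "mrealizes Z B n m F V"
  shows "V \<in> carrier_mat n m" "\<And>x. x \<in> Z \<Longrightarrow> F x \<in> carrier_mat n m"
    and "\<And>i j. i < n \<Longrightarrow> j < m \<Longrightarrow> realizes Z B (\<lambda>x. F x $$ (i, j)) (V $$ (i, j))"
    and "dim_row V = n" "dim_col V = m"
    and "\<And>x. x \<in> Z \<Longrightarrow> dim_row (F x) = n" "\<And>x. x \<in> Z \<Longrightarrow> dim_col (F x) = m"
  using assms by (auto simp: mrealizes_def)

lemma mrealizes_mat:
  assumes "\<And>i j. i < n \<Longrightarrow> j < m \<Longrightarrow> realizes Z B (\<lambda>x. f x (i, j)) (v (i, j))"
  shows "mrealizes Z B n m (\<lambda>x. mat n m (f x)) (mat n m v)"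
  using assms by (auto simp: mrealizes_def)

lemma mrealizes_cong:
  assumes "mrealizes Z B n m F V" "\<And>x. x \<in> Z \<Longrightarrow> F x = G x"
  shows "mrealizes Z B n m G V"
  using assms(2) mrealizesD[OF assms(1)] by (intro mrealizesI realizes_cong[OF mrealizesD(3)[OF assms(1)]]) auto

lemma fls_point_unique_mat:
  assumes "fls_point Z B" "mrealizes Z B n m F V" "mrealizes Z B n m G W"
    and "\<And>x. x \<in> Z \<Longrightarrow> F x = G x"
  shows "V = W"
proof (rule eq_matI)
  show "V $$ (i, j) = W $$ (i, j)" if "i < dim_row W" "j < dim_col W" for i j
    using assms(4) that mrealizesD(1)[OF assms(2)] mrealizesD(1)[OF assms(3)]
    by (intro fls_point_unique[OF assms(1) mrealizesD(3)[OF assms(2)] mrealizesD(3)[OF assms(3)]]) auto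
qed (use mrealizesD(1)[OF assms(2)] mrealizesD(1)[OF assms(3)] in auto)

lemma mrealizes_const: "A \<in> carrier_mat n m \<Longrightarrow> mrealizes Z B n m (\<lambda>_. A) (map_mat fls_const A)"
  by (rule mrealizesI) (auto intro: realizes_const)

lemma mrealizes_one: "mrealizes Z B n n (\<lambda>_. 1\<^sub>m n) (1\<^sub>m n)"
  by (rule mrealizesI) (auto intro: realizes_intros)

lemma mrealizes_zero: "mrealizes Z B n m (\<lambda>_. 0\<^sub>m n m) (0\<^sub>m n m)"
  by (rule mrealizesI) (auto intro: realizes_intros)

lemma mrealizes_add:
  assumes "mrealizes Z B n m F V" "mrealizes Z B n m G W"
  shows "mrealizes Z B n m (\<lambda>x. F x + G x) (V + W)"
proof (rule mrealizesI)
  note F = mrealizesD[OF assms(1)] and G = mrealizesD[OF assms(2)]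
  show "V + W \<in> carrier_mat n m" by (rule add_carrier_mat[OF G(1)])
  show "F x + G x \<in> carrier_mat n m" if "x \<in> Z" for x by (rule add_carrier_mat[OF G(2)[OF that]])
  fix i j assume ij: "i < n" "j < m"
  have "(V + W) $$ (i, j) = V $$ (i, j) + W $$ (i, j)"
    using ij by (simp add: G(4,5))
  then have "realizes Z B (\<lambda>x. F x $$ (i, j) + G x $$ (i, j)) ((V + W) $$ (i, j))"
    using realizes_add[OF F(3)[OF ij] G(3)[OF ij]] by simp
  then show "realizes Z B (\<lambda>x. (F x + G x) $$ (i, j)) ((V + W) $$ (i, j))"
    by (rule realizes_cong) (use ij in \<open>simp add: G(6,7)\<close>)
qed

lemma mrealizes_minus:
  assumes "mrealizes Z B n m F V" "mrealizes Z B n m G W"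
  shows "mrealizes Z B n m (\<lambda>x. F x - G x) (V - W)"
proof (rule mrealizesI)
  note F = mrealizesD[OF assms(1)] and G = mrealizesD[OF assms(2)]
  show "V - W \<in> carrier_mat n m" by (rule minus_carrier_mat[OF G(1)])
  show "F x - G x \<in> carrier_mat n m" if "x \<in> Z" for x by (rule minus_carrier_mat[OF G(2)[OF that]])
  fix i j assume ij: "i < n" "j < m"
  have "(V - W) $$ (i, j) = V $$ (i, j) - W $$ (i, j)"
    using ij by (simp add: G(4,5))
  then have "realizes Z B (\<lambda>x. F x $$ (i, j) - G x $$ (i, j)) ((V - W) $$ (i, j))"
    using realizes_diff[OF F(3)[OF ij] G(3)[OF ij]] by simp
  then show "realizes Z B (\<lambda>x. (F x - G x) $$ (i, j)) ((V - W) $$ (i, j))"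
    by (rule realizes_cong) (use ij in \<open>simp add: G(6,7)\<close>)
qed

lemma mrealizes_smult:
  assumes "realizes Z B f v" "mrealizes Z B n m F V"
  shows "mrealizes Z B n m (\<lambda>x. f x \<cdot>\<^sub>m F x) (v \<cdot>\<^sub>m V)"
proof (rule mrealizesI)
  note F = mrealizesD[OF assms(2)]
  show "v \<cdot>\<^sub>m V \<in> carrier_mat n m" by (rule smult_carrier_mat[OF F(1)])
  show "f x \<cdot>\<^sub>m F x \<in> carrier_mat n m" if "x \<in> Z" for x by (rule smult_carrier_mat[OF F(2)[OF that]])
  fix i j assume ij: "i < n" "j < m"
  have "(v \<cdot>\<^sub>m V) $$ (i, j) = v * V $$ (i, j)"
    using ij by (simp add: F(4,5))
  then have "realizes Z B (\<lambda>x. f x * F x $$ (i, j)) ((v \<cdot>\<^sub>m V) $$ (i, j))"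
    using realizes_mult[OF assms(1) F(3)[OF ij]] by simp
  then show "realizes Z B (\<lambda>x. (f x \<cdot>\<^sub>m F x) $$ (i, j)) ((v \<cdot>\<^sub>m V) $$ (i, j))"
    by (rule realizes_cong) (use ij in \<open>simp add: F(6,7)\<close>)
qed

lemma mrealizes_mult:
  assumes "mrealizes Z B n m F V" "mrealizes Z B m k G W"
  shows "mrealizes Z B n k (\<lambda>x. F x * G x) (V * W)"
proof (rule mrealizesI)
  note F = mrealizesD[OF assms(1)] and G = mrealizesD[OF assms(2)]
  show "V * W \<in> carrier_mat n k" by (rule mult_carrier_mat[OF F(1) G(1)])
  show "F x * G x \<in> carrier_mat n k" if "x \<in> Z" for x
    by (rule mult_carrier_mat[OF F(2)[OF that] G(2)[OF that]])
  fix i j assume ij: "i < n" "j < k"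
  have "realizes Z B (\<lambda>x. \<Sum>l<m. F x $$ (i, l) * G x $$ (l, j)) (\<Sum>l<m. V $$ (i, l) * W $$ (l, j))"
  proof (rule realizes_sum)
    fix l assume "l \<in> {..<m}"
    then show "realizes Z B (\<lambda>x. F x $$ (i, l) * G x $$ (l, j)) (V $$ (i, l) * W $$ (l, j))"
      by (intro realizes_mult[OF F(3)[OF ij(1)] G(3)[OF _ ij(2)]]) auto
  qed
  moreover have "(V * W) $$ (i, j) = (\<Sum>l<m. V $$ (i, l) * W $$ (l, j))"
    using ij by (simp add: scalar_prod_def atLeast0LessThan F(4,5) G(4,5))
  ultimately have "realizes Z B (\<lambda>x. \<Sum>l<m. F x $$ (i, l) * G x $$ (l, j)) ((V * W) $$ (i, j))"
    by simp
  then show "realizes Z B (\<lambda>x. (F x * G x) $$ (i, j)) ((V * W) $$ (i, j))"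
    by (rule realizes_cong) (use ij in \<open>simp add: scalar_prod_def atLeast0LessThan F(6,7) G(6,7)\<close>)
qed

lemma mrealizes_pow:
  assumes "mrealizes Z B n n F V" shows "mrealizes Z B n n (\<lambda>x. F x ^\<^sub>m k) (V ^\<^sub>m k)"
proof (induction k)
  case 0
  show ?case
    using mrealizesD(1,2)[OF assms] by (auto intro!: mrealizes_cong[OF mrealizes_one])
next
  case (Suc k)
  then show ?case by (simp add: mrealizes_mult[OF _ assms])
qed

lemma realizes_det:
  fixes F :: "'x \<Rightarrow> 'a::field mat"
  assumes "mrealizes Z B n n F V" shows "realizes Z B (\<lambda>x. det (F x)) (det V)"
proof -
  note F = mrealizesD[OF assms]
  have "realizes Z B (\<lambda>x. signof p * (\<Prod>i = 0..<n. F x $$ (i, p i))) (signof p * (\<Prod>i = 0..<n. V $$ (i, p i)))"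
    if "p permutes {0..<n}" for p
  proof -
    have "realizes Z B (\<lambda>_. signof p :: 'a) (fls_const (signof p :: 'a))" by (rule realizes_const)
    then have "realizes Z B (\<lambda>_. signof p :: 'a) (signof p)" by (simp only: fls_of_int)
    moreover have "realizes Z B (\<lambda>x. F x $$ (i, p i)) (V $$ (i, p i))" if "i \<in> {0..<n}" for i
      using that permutes_in_image[OF \<open>p permutes {0..<n}\<close>, of i] by (intro F(3)) auto
    ultimately show ?thesis by (rule realizes_mult[OF _ realizes_prod])
  qed
  then have "realizes Z B (\<lambda>x. \<Sum>p\<in>{p. p permutes {0..<n}}. signof p * (\<Prod>i = 0..<n. F x $$ (i, p i)))
     (\<Sum>p\<in>{p. p permutes {0..<n}}. signof p * (\<Prod>i = 0..<n. V $$ (i, p i)))"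
    by (intro realizes_sum) auto
  then show ?thesis
    unfolding det_def'[OF F(1)] by (rule realizes_cong) (simp add: det_def'[OF F(2)])
qed

lemma mrealizes_adj:
  assumes "mrealizes Z B n n F V" shows "mrealizes Z B n n (\<lambda>x. adj_mat (F x)) (adj_mat V)"
proof (rule mrealizesI)
  note F = mrealizesD[OF assms]
  fix i j assume ij: "i < n" "j < n"
  have "mrealizes Z B (n - 1) (n - 1) (\<lambda>x. mat (n - 1) (n - 1) (\<lambda>(i', j').
      F x $$ (if i' < j then i' else Suc i', if j' < i then j' else Suc j'))) (mat_delete V j i)"
    unfolding mat_delete_def F(4,5) using ij by (intro mrealizes_mat) (auto intro!: F(3))
  then have "mrealizes Z B (n - 1) (n - 1) (\<lambda>x. mat_delete (F x) j i) (mat_delete V j i)"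
    by (rule mrealizes_cong) (simp add: mat_delete_def F(6,7))
  from realizes_mult[OF realizes_const realizes_det[OF this]]
  have "realizes Z B (\<lambda>x. (- 1) ^ (j + i) * det (mat_delete (F x) j i)) ((- 1) ^ (j + i) * det (mat_delete V j i))"
    by (metis fls_const.hom_one fls_const.hom_power fls_const.hom_uminus)
  then show "realizes Z B (\<lambda>x. adj_mat (F x) $$ (i, j)) (adj_mat V $$ (i, j))"
    using ij unfolding adj_mat_def cofactor_def
    by (simp add: F(4,5)) (erule realizes_cong, simp add: F(6,7))
next
  show "adj_mat V \<in> carrier_mat n n" by (rule adj_mat(1)[OF mrealizesD(1)[OF assms]])
  show "adj_mat (F x) \<in> carrier_mat n n" if "x \<in> Z" for x
    by (rule adj_mat(1)[OF mrealizesD(2)[OF assms that]])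
qed

lemma realizes_eval_poly:
  assumes "mrealizes Z B N N F V" "p \<in> entry_polys N"
  shows "realizes Z B (\<lambda>x. eval_poly id p (F x)) (eval_poly fls_const p V)"
  unfolding eval_poly_def id_def
proof (intro realizes_sum realizes_mult realizes_const realizes_prod realizes_power)
  fix e ij assume "e \<in> Poly_Mapping.keys p" "ij \<in> Poly_Mapping.keys e"
  with assms(2) have "ij \<in> {..<N} \<times> {..<N}" unfolding entry_polys_def by blast
  then obtain i j where "ij = (i, j)" "i < N" "j < N" by auto
  then show "realizes Z B (\<lambda>x. F x $$ ij) (V $$ ij)" using mrealizesD(3)[OF assms(1)] by simp
qed

text \<open>Regular maps have denominators \<open>det ^ k\<close>, and \<open>realizes\<close> knows
  no division. Hence the inverse determinant has to be supplied as a realized function.\<close>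

lemma mrealizes_eval_map:
  assumes "mrealizes Z B N N F V" "realizes Z B (\<lambda>x. inverse (det (F x))) (inverse (det V))"
    and "\<rho> \<in> carrier_mat n n" "fst ` elements_mat \<rho> \<subseteq> entry_polys N"
  shows "mrealizes Z B n n (\<lambda>x. eval_map id \<rho> (F x)) (eval_map fls_const \<rho> V)"
proof (rule mrealizesI)
  fix i j assume ij: "i < n" "j < n"
  obtain p k where pk: "\<rho> $$ (i, j) = (p, k)" by fastforce
  have "\<rho> $$ (i, j) \<in> elements_mat \<rho>" using ij assms(3) elements_matI by blast
  then have "p \<in> entry_polys N" using assms(4) pk by force
  then have "realizes Z B (\<lambda>x. eval_poly id p (F x) * inverse (det (F x)) ^ k)
      (eval_poly fls_const p V * inverse (det V) ^ k)"
    by (rule realizes_mult[OF realizes_eval_poly[OF assms(1)] realizes_power[OF assms(2)]])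
  then show "realizes Z B (\<lambda>x. eval_map id \<rho> (F x) $$ (i, j)) (eval_map fls_const \<rho> V $$ (i, j))"
    using ij assms(3) pk by (auto simp: eval_map_def divide_inverse power_inverse)
qed (use assms(3) in \<open>auto simp: eval_map_def\<close>)

text \<open>Cramer's formula: with it, inversion is polynomial in the entries and the inverse
  determinant, hence realizable. On \<open>GL n\<close> it agrees with the group inverse by
  \<open>GL_inv\<close>.\<close>

definition minv :: "'b::field mat \<Rightarrow> 'b mat" where
  "minv A = inverse (det A) \<cdot>\<^sub>m adj_mat A"

lemma minv:
  assumes "A \<in> carrier_mat n n" "det A \<noteq> 0"
  shows "minv A \<in> carrier_mat n n" "A * minv A = 1\<^sub>m n" "minv A * A = 1\<^sub>m n"
  using assms adj_mat[of A n] mult_smult_distrib[of A n n "adj_mat A" n "inverse (det A)"]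
      mult_smult_assoc_mat[of "adj_mat A" n n A n "inverse (det A)"]
  by (auto simp: minv_def)

lemma mat_inverse_unique:
  assumes "A \<in> carrier_mat n n" "B \<in> carrier_mat n n" "C \<in> carrier_mat n n"
    and "B * A = 1\<^sub>m n" "A * C = (1\<^sub>m n :: 'b::semiring_1 mat)"
  shows "B = C"
proof -
  have "B = B * (A * C)" using assms by simp
  also have "\<dots> = (B * A) * C" using assms(1-3) by (metis assoc_mult_mat)
  finally show ?thesis using assms by simp
qed

lemma mrealizes_minv:
  assumes "mrealizes Z B N N F V" "realizes Z B (\<lambda>x. inverse (det (F x))) (inverse (det V))"
  shows "mrealizes Z B N N (\<lambda>x. minv (F x)) (minv V)"
  unfolding minv_def by (intro mrealizes_smult mrealizes_adj assms)

lemma GL_inv: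
  assumes "A \<in> carrier (GL n)" shows "inv\<^bsub>GL n\<^esub> A = minv (A :: 'b::field mat)"
proof -
  interpret group "GL n :: 'b mat monoid" by (rule group_GL)
  have A: "A \<in> carrier_mat n n" "det A \<noteq> 0" using assms by (auto simp: GL_carrier_det)
  note m = minv[OF A]
  have "minv A \<in> carrier (GL n)" using m A by (auto simp: GL_carrier)
  then show ?thesis using m assms by (intro inv_equality) auto
qed

section \<open>Points of matrix groups and vanishing ideals\<close>

definition mat_gens :: "nat \<Rightarrow> nat \<Rightarrow> 'a::field fls mat \<Rightarrow> (('a mat \<Rightarrow> 'a) \<times> 'a fls) set" where
  "mat_gens n m V = (\<lambda>ij. (\<lambda>A. A $$ ij, V $$ ij)) ` ({..<n} \<times> {..<m})"

lemma mrealizes_mat_gens: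
  assumes "V \<in> carrier_mat n m" "Z \<subseteq> carrier_mat n m" "mat_gens n m V \<subseteq> B"
  shows "mrealizes Z B n m (\<lambda>A. A) V"
  using assms by (intro mrealizesI realizes_gen) (auto simp: mat_gens_def)

text \<open>An arbitrary Laurent series matrix is a point of the affine space of all matrices. Later
  this transfers statements about every matrix over the base field.\<close>

lemma fls_point_mats:
  fixes V :: "'a::field_char_0 fls mat"
  assumes "V \<in> carrier_mat n m" shows "fls_point (carrier_mat n m) (mat_gens n m V)"
proof (rule fls_point_image[OF fls_point_coords[of "{..<n} \<times> {..<m}" "\<lambda>ij. V $$ ij"], where \<phi> = "mat n m"])
  fix f v assume "(f, v) \<in> mat_gens n m V"
  then obtain i j where ij: "i < n" "j < m" "f = (\<lambda>A. A $$ (i, j))" "v = V $$ (i, j)"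
    by (auto simp: mat_gens_def)
  then have "realizes UNIV (coord_gens ({..<n} \<times> {..<m}) (\<lambda>ij. V $$ ij)) (\<lambda>x. x (i, j)) (V $$ (i, j))"
    by (intro realizes_gen) (auto simp: coord_gens_def)
  with ij show "realizes UNIV (coord_gens ({..<n} \<times> {..<m}) (\<lambda>ij. V $$ ij)) (\<lambda>x. f (mat n m x)) v"
    by simp
qed auto

definition GL_gens :: "nat \<Rightarrow> 'a::field fls mat \<Rightarrow> (('a mat \<Rightarrow> 'a) \<times> 'a fls) set" where
  "GL_gens n V = insert (\<lambda>A. inverse (det A), inverse (det V)) (mat_gens n n V)"

definition mon :: "((nat \<times> nat) \<Rightarrow>\<^sub>0 nat) \<Rightarrow> 'b::comm_ring_1 mat \<Rightarrow> 'b" where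
  "mon e A = (\<Prod>ij\<in>Poly_Mapping.keys e. (A $$ ij) ^ Poly_Mapping.lookup e ij)"

lemma mon_superset:
  assumes "finite S" "Poly_Mapping.keys e \<subseteq> S"
  shows "mon e A = (\<Prod>ij\<in>S. (A $$ ij) ^ Poly_Mapping.lookup e ij)"
  unfolding mon_def using assms by (intro prod.mono_neutral_left) (auto simp: in_keys_iff)

lemma mon_add: "mon (d + e) A = mon d A * mon e A"
proof -
  let ?S = "Poly_Mapping.keys d \<union> Poly_Mapping.keys e"
  have "mon (d + e) A = (\<Prod>ij\<in>?S. (A $$ ij) ^ Poly_Mapping.lookup (d + e) ij)"
    by (rule mon_superset) (use keys_add[of d e] in auto)
  also have "\<dots> = (\<Prod>ij\<in>?S. (A $$ ij) ^ Poly_Mapping.lookup d ij) *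
      (\<Prod>ij\<in>?S. (A $$ ij) ^ Poly_Mapping.lookup e ij)"
    by (simp add: lookup_add power_add prod.distrib)
  also have "\<dots> = mon d A * mon e A"
    by (subst (1 2) mon_superset[of ?S]) auto
  finally show ?thesis .
qed

lemma eval_entry_poly_superset:
  assumes "finite S" "Poly_Mapping.keys p \<subseteq> S" "h 0 = 0"
  shows "eval_poly h p A = (\<Sum>e\<in>S. h (Poly_Mapping.lookup p e) * mon e A)"
  unfolding eval_poly_def mon_def[symmetric] using assms
  by (intro sum.mono_neutral_left) (auto simp: in_keys_iff)

lemma eval_entry_poly_add:
  assumes "comm_ring_hom h" shows "eval_poly h (p + q) A = eval_poly h p A + eval_poly h q A"
proof -
  interpret comm_ring_hom h by fact
  let ?S = "Poly_Mapping.keys p \<union> Poly_Mapping.keys q"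
  have "eval_poly h (p + q) A = (\<Sum>e\<in>?S. h (Poly_Mapping.lookup (p + q) e) * mon e A)"
    by (rule eval_entry_poly_superset) (use keys_add[of p q] in auto)
  also have "\<dots> = (\<Sum>e\<in>?S. h (Poly_Mapping.lookup p e) * mon e A) + (\<Sum>e\<in>?S. h (Poly_Mapping.lookup q e) * mon e A)"
    by (simp add: lookup_add hom_add distrib_right sum.distrib)
  also have "\<dots> = eval_poly h p A + eval_poly h q A"
    by (subst (1 2) eval_entry_poly_superset[of ?S]) auto
  finally show ?thesis .
qed

lemma eval_entry_poly_sum:
  assumes "comm_ring_hom h" shows "eval_poly h (\<Sum>i\<in>I. p i) A = (\<Sum>i\<in>I. eval_poly h (p i) A)"
  by (induction I rule: infinite_finite_induct) (auto simp: eval_entry_poly_add[OF assms], auto simp: eval_poly_def)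

lemma eval_entry_poly_single:
  assumes "h 0 = 0" shows "eval_poly h (Poly_Mapping.single e c) A = h c * mon e A"
  by (subst eval_entry_poly_superset[of "{e}"]) (auto simp: assms)

lemma entry_polys_add: "p \<in> entry_polys N \<Longrightarrow> q \<in> entry_polys N \<Longrightarrow> p + q \<in> entry_polys N"
  using keys_add[of p q] unfolding entry_polys_def by blast

lemma entry_polys_sum: "(\<And>i. i \<in> I \<Longrightarrow> p i \<in> entry_polys N) \<Longrightarrow> (\<Sum>i\<in>I. p i) \<in> entry_polys N"
  by (induction I rule: infinite_finite_induct) (auto intro: entry_polys_add, auto simp: entry_polys_def)

lemma entry_polys_single:
  "Poly_Mapping.keys e \<subseteq> {..<N} \<times> {..<N} \<Longrightarrow> Poly_Mapping.single e c \<in> entry_polys N"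
  by (auto simp: entry_polys_def split: if_splits)

lemma comm_ring_hom_id: "comm_ring_hom (id :: 'b::comm_ring_1 \<Rightarrow> 'b)"
  by unfold_locales auto

text \<open>The product in the polynomial ring, written out by monomials so that its evaluation
  reduces to \<open>mon_add\<close>.\<close>

definition entry_prod :: "'a::comm_ring_1 entry_poly \<Rightarrow> 'a entry_poly \<Rightarrow> 'a entry_poly" where
  "entry_prod p q = (\<Sum>d\<in>Poly_Mapping.keys p. \<Sum>e\<in>Poly_Mapping.keys q.
    Poly_Mapping.single (d + e) (Poly_Mapping.lookup p d * Poly_Mapping.lookup q e))"

lemma entry_polys_prod:
  assumes "p \<in> entry_polys N" "q \<in> entry_polys N" shows "entry_prod p q \<in> entry_polys N"
  unfolding entry_prod_def
proof (intro entry_polys_sum entry_polys_single)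
  fix d e assume "d \<in> Poly_Mapping.keys p" "e \<in> Poly_Mapping.keys q"
  then show "Poly_Mapping.keys (d + e) \<subseteq> {..<N} \<times> {..<N}"
    using assms keys_add[of d e] unfolding entry_polys_def by blast
qed

lemma eval_entry_poly_prod:
  assumes "comm_ring_hom h" shows "eval_poly h (entry_prod p q) A = eval_poly h p A * eval_poly h q A"
proof -
  interpret comm_ring_hom h by fact
  show ?thesis
    unfolding entry_prod_def eval_entry_poly_sum[OF assms] eval_entry_poly_single[where h = h, OF hom_zero] mon_add hom_mult
    unfolding eval_poly_def mon_def[symmetric] sum_product
    by (intro sum.cong refl) (simp add: mult_ac)
qed

text \<open>The algebra generated by the matrix entries is the image of the polynomial ring. This
  links \<open>realizes\<close> with \<open>vanishing_ideal\<close>.\<close>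

lemma realizes_mat_gens:
  fixes Z :: "'a::field mat set"
  assumes "realizes Z (mat_gens N N V) f v"
  shows "\<exists>p\<in>entry_polys N. (\<forall>A\<in>Z. f A = eval_poly id p A) \<and> v = eval_poly fls_const p V"
  using assms
proof induction
  case (realizes_gen f v)
  then obtain i j where ij: "i < N" "j < N" "f = (\<lambda>A. A $$ (i, j))" "v = V $$ (i, j)"
    by (auto simp: mat_gens_def)
  let ?p = "Poly_Mapping.single (Poly_Mapping.single (i, j) 1) 1"
  have "eval_poly h ?p A = A $$ (i, j)" if "comm_ring_hom h" for A and h :: "'a \<Rightarrow> 'c::comm_ring_1"
  proof -
    interpret comm_ring_hom h by fact
    show ?thesis by (subst eval_entry_poly_single[where h = h]) (simp_all add: mon_def)
  qed
  note e = this[OF comm_ring_hom_id] this[OF fls_const.comm_ring_hom_axioms]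
  have "?p \<in> entry_polys N" using ij by (intro entry_polys_single) auto
  then show ?case by (rule bexI[rotated]) (simp only: ij e, simp)
next
  case (realizes_const c)
  let ?p = "Poly_Mapping.single 0 c"
  have e: "eval_poly h ?p A = h c" if "comm_ring_hom h" for A and h :: "'a \<Rightarrow> 'c::comm_ring_1"
  proof -
    interpret comm_ring_hom h by fact
    show ?thesis by (subst eval_entry_poly_single[where h = h]) (simp_all add: mon_def)
  qed
  note e = this[OF comm_ring_hom_id] this[OF fls_const.comm_ring_hom_axioms]
  have "?p \<in> entry_polys N" by (intro entry_polys_single) auto
  then show ?case by (rule bexI[rotated]) (simp only: e, simp)
next
  case (realizes_add f v g w)
  then obtain p q where p: "p \<in> entry_polys N" "\<And>A. A \<in> Z \<Longrightarrow> f A = eval_poly id p A" "v = eval_poly fls_const p V"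
    "q \<in> entry_polys N" "\<And>A. A \<in> Z \<Longrightarrow> g A = eval_poly id q A" "w = eval_poly fls_const q V" by blast
  show ?case
    by (rule bexI[of _ "p + q"], intro conjI ballI)
      (simp_all only: eval_entry_poly_add[OF comm_ring_hom_id] eval_entry_poly_add[OF fls_const.comm_ring_hom_axioms]
        entry_polys_add p)
next
  case (realizes_mult f v g w)
  then obtain p q where p: "p \<in> entry_polys N" "\<And>A. A \<in> Z \<Longrightarrow> f A = eval_poly id p A" "v = eval_poly fls_const p V"
    "q \<in> entry_polys N" "\<And>A. A \<in> Z \<Longrightarrow> g A = eval_poly id q A" "w = eval_poly fls_const q V" by blast
  show ?case
    by (rule bexI[of _ "entry_prod p q"], intro conjI ballI)
      (simp_all only: eval_entry_poly_prod[OF comm_ring_hom_id] eval_entry_poly_prod[OF fls_const.comm_ring_hom_axioms]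
        entry_polys_prod p)
next
  case (realizes_cong f v g)
  then show ?case by force
qed

text \<open>Powers of the determinant are cleared, just as powers of \<open>s\<close> in
  \<open>realizes_torus\<close>.\<close>

lemma realizes_GL_gens:
  fixes Z :: "'a::field mat set"
  assumes "realizes Z (GL_gens N V) f v" and "Z \<subseteq> carrier (GL N)" "V \<in> carrier (GL N)"
  shows "\<exists>g w k. realizes Z (mat_gens N N V) g w \<and> (\<forall>A\<in>Z. f A * det A ^ k = g A) \<and> v * det V ^ k = w"
  using assms(1)
proof induction
  case (realizes_gen f v)
  then consider "(f, v) \<in> mat_gens N N V" | "f = (\<lambda>A. inverse (det A))" "v = inverse (det V)"
    by (auto simp: GL_gens_def)
  then show ?case
  proof cases
    case 1
    show ?thesis
      by (rule exI[of _ f], rule exI[of _ v], rule exI[of _ 0], intro conjI realizes.realizes_gen 1) simp_all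
  next
    case 2
    have "det A \<noteq> 0" if "A \<in> Z" for A using that assms(2) GL_carrier_det[of A N] by blast
    moreover have "det V \<noteq> 0" using assms(3) GL_carrier_det[of V N] by blast
    ultimately have "\<forall>A\<in>Z. inverse (det A) * det A ^ 1 = 1" "inverse (det V) * det V ^ 1 = 1" by auto
    then show ?thesis unfolding 2
      by (intro exI[of _ "\<lambda>_. 1"] exI[of _ 1] conjI realizes_one)
  qed
next
  case (realizes_const c)
  show ?case
    by (rule exI[of _ "\<lambda>_. c"], rule exI[of _ "fls_const c"], rule exI[of _ 0],
        intro conjI realizes.realizes_const) simp_all
next
  have d: "realizes Z (mat_gens N N V) (\<lambda>A. det A ^ k) (det V ^ k)" for k
    using assms(2,3) by (intro realizes_power realizes_det mrealizes_mat_gens) (auto simp: GL_carrier)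
  {
    case (realizes_add f v f' v')
    from realizes_add.IH(1) obtain g w k where g: "realizes Z (mat_gens N N V) g w"
      "\<And>A. A \<in> Z \<Longrightarrow> f A * det A ^ k = g A" "v * det V ^ k = w" by blast
    from realizes_add.IH(2) obtain g' w' k' where g': "realizes Z (mat_gens N N V) g' w'"
      "\<And>A. A \<in> Z \<Longrightarrow> f' A * det A ^ k' = g' A" "v' * det V ^ k' = w'" by blast
    have "realizes Z (mat_gens N N V) (\<lambda>A. g A * det A ^ k' + g' A * det A ^ k)
        (w * det V ^ k' + w' * det V ^ k)"
      by (rule realizes.realizes_add[OF realizes.realizes_mult[OF g(1) d] realizes.realizes_mult[OF g'(1) d]])
    moreover have "(f A + f' A) * det A ^ (k + k') = g A * det A ^ k' + g' A * det A ^ k" if "A \<in> Z" for A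
      unfolding g(2)[OF that, symmetric] g'(2)[OF that, symmetric] by (simp add: power_add algebra_simps)
    moreover have "(v + v') * det V ^ (k + k') = w * det V ^ k' + w' * det V ^ k"
      unfolding g(3)[symmetric] g'(3)[symmetric] by (simp add: power_add algebra_simps)
    ultimately show ?case
      by (intro exI[of _ "\<lambda>A. g A * det A ^ k' + g' A * det A ^ k"] exI[of _ "w * det V ^ k' + w' * det V ^ k"]
          exI[of _ "k + k'"] conjI ballI)
  next
    case (realizes_mult f v f' v')
    from realizes_mult.IH(1) obtain g w k where g: "realizes Z (mat_gens N N V) g w"
      "\<And>A. A \<in> Z \<Longrightarrow> f A * det A ^ k = g A" "v * det V ^ k = w" by blast
    from realizes_mult.IH(2) obtain g' w' k' where g': "realizes Z (mat_gens N N V) g' w'"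
      "\<And>A. A \<in> Z \<Longrightarrow> f' A * det A ^ k' = g' A" "v' * det V ^ k' = w'" by blast
    have "realizes Z (mat_gens N N V) (\<lambda>A. g A * g' A) (w * w')"
      by (rule realizes.realizes_mult[OF g(1) g'(1)])
    moreover have "(f A * f' A) * det A ^ (k + k') = g A * g' A" if "A \<in> Z" for A
      unfolding g(2)[OF that, symmetric] g'(2)[OF that, symmetric] by (simp add: power_add algebra_simps)
    moreover have "(v * v') * det V ^ (k + k') = w * w'"
      unfolding g(3)[symmetric] g'(3)[symmetric] by (simp add: power_add algebra_simps)
    ultimately show ?case
      by (intro exI[of _ "\<lambda>A. g A * g' A"] exI[of _ "w * w'"] exI[of _ "k + k'"] conjI ballI)
  }
next
  case (realizes_cong f v f')
  then obtain g w k where "realizes Z (mat_gens N N V) g w"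
    "\<forall>A\<in>Z. f A * det A ^ k = g A" "v * det V ^ k = w" by blast
  with realizes_cong.hyps show ?case by (intro exI[of _ g] exI[of _ w] exI[of _ k]) auto
qed

lemma laurent_points_GL: "V \<in> laurent_points N G \<Longrightarrow> V \<in> carrier (GL N)"
  by (simp add: laurent_points_def)

text \<open>That the ideal of \<open>G\<close> vanishes at \<open>V\<close> is what makes evaluation
  at \<open>V\<close> well defined on the regular functions on \<open>G\<close>. The power of
  \<open>det V\<close> introduced by clearing denominators cancels because \<open>V\<close> is
  invertible.\<close>

lemma fls_point_laurent:
  assumes "G \<subseteq> carrier (GL N)" "V \<in> laurent_points N G"
  shows "fls_point G (GL_gens N V)"
  unfolding fls_point_def
proof (intro allI impI)
  fix f v assume f: "realizes G (GL_gens N V) f v" "\<forall>A\<in>G. f A = 0"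
  have V: "V \<in> carrier (GL N)" by (rule laurent_points_GL[OF assms(2)])
  obtain g w k where g: "realizes G (mat_gens N N V) g w" "\<forall>A\<in>G. f A * det A ^ k = g A" "v * det V ^ k = w"
    using realizes_GL_gens[OF f(1) assms(1) V] by blast
  obtain p where p: "p \<in> entry_polys N" "\<forall>A\<in>G. g A = eval_poly id p A" "w = eval_poly fls_const p V"
    using realizes_mat_gens[OF g(1)] by blast
  have "eval_poly id p A = 0" if "A \<in> G" for A
    using p(2)[rule_format, OF that] g(2)[rule_format, OF that] f(2)[rule_format, OF that] by simp
  then have "p \<in> vanishing_ideal N G" unfolding vanishing_ideal_def using p(1) by blast
  then have "w = 0" using assms(2) p(3) by (auto simp: laurent_points_def)
  then show "v = 0" using g(3) V by (auto simp: GL_carrier_det)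
qed

text \<open>The way in which Laurent points of a group are produced below: as values, at some point
  of \<open>Z\<close>, of a regular map from \<open>Z\<close> into \<open>G\<close>.\<close>

lemma laurent_pointsI:
  assumes "fls_point Z B" "mrealizes Z B N N F V" "\<And>x. x \<in> Z \<Longrightarrow> F x \<in> G" "det V \<noteq> 0"
  shows "V \<in> laurent_points N G"
proof -
  have "eval_poly fls_const p V = 0" if "p \<in> vanishing_ideal N G" for p
  proof -
    have "realizes Z B (\<lambda>x. eval_poly id p (F x)) (eval_poly fls_const p V)"
      using that by (intro realizes_eval_poly[OF assms(2)]) (auto simp: vanishing_ideal_def)
    moreover have "\<forall>x\<in>Z. eval_poly id p (F x) = 0"
      using that assms(3) by (auto simp: vanishing_ideal_def)
    ultimately show ?thesis using assms(1) unfolding fls_point_def by blast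
  qed
  then show ?thesis
    using assms(4) mrealizesD(1)[OF assms(2)] by (auto simp: laurent_points_def GL_carrier_det)
qed

lemma laurent_points_mono: "H \<subseteq> G \<Longrightarrow> laurent_points N H \<subseteq> laurent_points N G"
  by (auto simp: laurent_points_def vanishing_ideal_def)

lemma mrealizes_GL_gens:
  assumes "V \<in> carrier (GL N)" "G \<subseteq> carrier (GL N)"
  shows "mrealizes G (GL_gens N V) N N (\<lambda>A. A) V"
  using assms by (intro mrealizes_mat_gens) (auto simp: GL_carrier GL_gens_def)

lemma realizes_inverse_det_GL_gens:
  "realizes G (GL_gens N V) (\<lambda>A. inverse (det A)) (inverse (det V))"
  by (rule realizes_gen) (simp add: GL_gens_def)

section \<open>The group of Laurent points\<close>

lemma subgroup_GL_D:
  assumes "subgroup G (GL N :: 'a::field mat monoid)"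
  shows "G \<subseteq> carrier (GL N)" "\<And>a b. a \<in> G \<Longrightarrow> b \<in> G \<Longrightarrow> a * b \<in> G" "1\<^sub>m N \<in> G"
    "\<And>a. a \<in> G \<Longrightarrow> minv a \<in> G" "G \<subseteq> carrier_mat N N" "\<And>a. a \<in> G \<Longrightarrow> det a \<noteq> 0"
proof -
  show G: "G \<subseteq> carrier (GL N)" by (rule subgroup.subset[OF assms])
  show "a * b \<in> G" if "a \<in> G" "b \<in> G" for a b using subgroup.m_closed[OF assms that] by simp
  show "1\<^sub>m N \<in> G" using subgroup.one_closed[OF assms] by simp
  show "minv a \<in> G" if "a \<in> G" for a
    using subgroup.m_inv_closed[OF assms that] GL_inv G that by (metis subsetD)
  show "G \<subseteq> carrier_mat N N" "\<And>a. a \<in> G \<Longrightarrow> det a \<noteq> 0" using G GL_carrier_det by blast+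
qed

text \<open>The pair \<open>(x, y)\<close> as one point of \<open>G \<times> H\<close>, through
  which group laws in two variables are evaluated.\<close>

definition pair_gens where "pair_gens N x y = prod_gens (GL_gens N x) (GL_gens N y)"

lemma fls_point_pair:
  assumes "subgroup G (GL N)" "subgroup H (GL N)" "x \<in> laurent_points N G" "y \<in> laurent_points N H"
  shows "fls_point (G \<times> H) (pair_gens N x y)"
  unfolding pair_gens_def
  by (intro fls_point_prod fls_point_laurent assms subgroup_GL_D[OF assms(1)] subgroup_GL_D[OF assms(2)])

lemma mrealizes_prod_fst:
  assumes "mrealizes Z1 B1 n m F V" shows "mrealizes (Z1 \<times> Z2) (prod_gens B1 B2) n m (\<lambda>x. F (fst x)) V"
proof (rule mrealizesI)
  show "realizes (Z1 \<times> Z2) (prod_gens B1 B2) (\<lambda>x. F (fst x) $$ (i, j)) (V $$ (i, j))" if "i < n" "j < m" for i j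
    by (rule realizes_prod_fst[OF mrealizesD(3)[OF assms that]])
qed (use mrealizesD(1,2)[OF assms] in auto)

lemma mrealizes_prod_snd:
  assumes "mrealizes Z2 B2 n m F V" shows "mrealizes (Z1 \<times> Z2) (prod_gens B1 B2) n m (\<lambda>x. F (snd x)) V"
proof (rule mrealizesI)
  show "realizes (Z1 \<times> Z2) (prod_gens B1 B2) (\<lambda>x. F (snd x) $$ (i, j)) (V $$ (i, j))" if "i < n" "j < m" for i j
    by (rule realizes_prod_snd[OF mrealizesD(3)[OF assms that]])
qed (use mrealizesD(1,2)[OF assms] in auto)

lemma mrealizes_pair:
  assumes "subgroup G (GL N)" "subgroup H (GL N)" "x \<in> carrier (GL N)" "y \<in> carrier (GL N)"
  shows "mrealizes (G \<times> H) (pair_gens N x y) N N fst x" "mrealizes (G \<times> H) (pair_gens N x y) N N snd y"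
    "realizes (G \<times> H) (pair_gens N x y) (\<lambda>z. inverse (det (fst z))) (inverse (det x))"
    "realizes (G \<times> H) (pair_gens N x y) (\<lambda>z. inverse (det (snd z))) (inverse (det y))"
proof -
  note G = subgroup_GL_D(1)[OF assms(1)] and H = subgroup_GL_D(1)[OF assms(2)]
  show "mrealizes (G \<times> H) (pair_gens N x y) N N fst x" "mrealizes (G \<times> H) (pair_gens N x y) N N snd y"
    unfolding pair_gens_def using mrealizes_prod_fst[OF mrealizes_GL_gens[OF assms(3) G]]
      mrealizes_prod_snd[OF mrealizes_GL_gens[OF assms(4) H]] by auto
  show "realizes (G \<times> H) (pair_gens N x y) (\<lambda>z. inverse (det (fst z))) (inverse (det x))"
    "realizes (G \<times> H) (pair_gens N x y) (\<lambda>z. inverse (det (snd z))) (inverse (det y))"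
    unfolding pair_gens_def
    by (rule realizes_prod_fst[OF realizes_inverse_det_GL_gens], rule realizes_prod_snd[OF realizes_inverse_det_GL_gens])
qed

lemma GL_mult_closed: "x \<in> carrier (GL N) \<Longrightarrow> y \<in> carrier (GL N) \<Longrightarrow> x * y \<in> carrier (GL N)"
  using group.is_monoid[OF group_GL] monoid.m_closed by fastforce

lemma laurent_points_mult:
  assumes "subgroup G (GL N)" "x \<in> laurent_points N G" "y \<in> laurent_points N G"
  shows "x * y \<in> laurent_points N G"
proof (rule laurent_pointsI[OF fls_point_pair[OF assms(1,1,2,3)]])
  note GL = laurent_points_GL[OF assms(2)] laurent_points_GL[OF assms(3)]
  show "mrealizes (G \<times> G) (pair_gens N x y) N N (\<lambda>z. fst z * snd z) (x * y)"
    by (intro mrealizes_mult[where m = N] mrealizes_pair assms GL)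
  show "det (x * y) \<noteq> 0" using GL_mult_closed[OF GL] by (simp add: GL_carrier_det)
qed (use subgroup_GL_D[OF assms(1)] in auto)

lemma det_minv:
  assumes "A \<in> carrier_mat n n" "det A \<noteq> 0"
  shows "det (minv A) * det A = 1" "det (minv A) \<noteq> 0"
proof -
  show "det (minv A) * det A = 1"
    using det_mult[of "minv A" n A] minv[OF assms] assms by (simp add: det_one)
  then show "det (minv A) \<noteq> 0" by auto
qed

lemma laurent_points_minv:
  assumes "subgroup G (GL N)" "x \<in> laurent_points N G"
  shows "minv x \<in> laurent_points N G"
proof (rule laurent_pointsI[OF fls_point_laurent[OF subgroup_GL_D(1)[OF assms(1)] assms(2)]])
  note GL = laurent_points_GL[OF assms(2)]
  show "mrealizes G (GL_gens N x) N N minv (minv x)"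
    by (intro mrealizes_minv mrealizes_GL_gens realizes_inverse_det_GL_gens GL subgroup_GL_D[OF assms(1)])
  show "det (minv x) \<noteq> 0" using GL det_minv(2)[of x N] by (simp add: GL_carrier_det)
qed (use subgroup_GL_D[OF assms(1)] in auto)

text \<open>Normalization is assumed only over the base field. Conjugation is a regular map from
  \<open>M \<times> U\<close> to \<open>U\<close>, so it carries the pair \<open>(x, y)\<close> to a
  Laurent point of \<open>U\<close>.\<close>

lemma laurent_points_conj:
  assumes "subgroup M (GL N)" "subgroup U (GL N)" "\<And>a b. a \<in> M \<Longrightarrow> b \<in> U \<Longrightarrow> a * b * minv a \<in> U"
    and "x \<in> laurent_points N M" "y \<in> laurent_points N U"
  shows "x * y * minv x \<in> laurent_points N U"
proof (rule laurent_pointsI[OF fls_point_pair[OF assms(1,2,4,5)]])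
  note GL = laurent_points_GL[OF assms(4)] laurent_points_GL[OF assms(5)]
  show "mrealizes (M \<times> U) (pair_gens N x y) N N (\<lambda>z. fst z * snd z * minv (fst z)) (x * y * minv x)"
    by (intro mrealizes_mult[where m = N] mrealizes_minv mrealizes_pair assms GL)
  have "minv x \<in> carrier (GL N)"
    by (rule laurent_points_GL[OF laurent_points_minv[OF assms(1,4)]])
  then show "det (x * y * minv x) \<noteq> 0" using GL_mult_closed GL by (metis GL_carrier_det)
qed (use assms(3) in auto)

section \<open>Homomorphisms evaluated at Laurent points\<close>

lemma algebraic_homD:
  assumes "algebraic_hom N G n H \<rho>"
  shows "\<rho> \<in> carrier_mat n n" "fst ` elements_mat \<rho> \<subseteq> entry_polys N"
    "\<And>a. a \<in> G \<Longrightarrow> eval_map id \<rho> a \<in> H"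
    "\<And>a b. a \<in> G \<Longrightarrow> b \<in> G \<Longrightarrow> eval_map id \<rho> (a * b) = eval_map id \<rho> a * eval_map id \<rho> b"
  using assms by (auto simp: algebraic_hom_def hom_def)

lemma algebraic_hom_one:
  assumes "algebraic_hom N G n H \<rho>" "subgroup G (GL N)" "H \<subseteq> carrier (GL n)"
  shows "eval_map id \<rho> (1\<^sub>m N) = 1\<^sub>m n"
proof -
  let ?E = "eval_map id \<rho> (1\<^sub>m N)"
  have E: "?E \<in> carrier_mat n n" "det ?E \<noteq> 0"
    using algebraic_homD(3)[OF assms(1) subgroup_GL_D(3)[OF assms(2)]] assms(3) GL_carrier_det by blast+
  note m = minv[OF E]
  have EE: "?E * ?E = ?E"
    using algebraic_homD(4)[OF assms(1), of "1\<^sub>m N" "1\<^sub>m N"] subgroup_GL_D(3)[OF assms(2)] by simp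
  have "1\<^sub>m n = minv ?E * (?E * ?E)" unfolding EE using m by simp
  also have "\<dots> = (minv ?E * ?E) * ?E" using E m by (metis assoc_mult_mat)
  also have "\<dots> = ?E" using m E by simp
  finally show ?thesis by simp
qed

lemma algebraic_hom_minv:
  assumes "algebraic_hom N G n H \<rho>" "subgroup G (GL N)" "H \<subseteq> carrier (GL n)" "a \<in> G"
  shows "eval_map id \<rho> a * eval_map id \<rho> (minv a) = 1\<^sub>m n"
    "eval_map id \<rho> (minv a) = minv (eval_map id \<rho> a)"
proof -
  note G = subgroup_GL_D[OF assms(2)]
  have a: "a \<in> carrier_mat N N" "det a \<noteq> 0" "minv a \<in> G" using G assms(4) by auto
  note m = minv[OF a(1,2)]
  show 1: "eval_map id \<rho> a * eval_map id \<rho> (minv a) = 1\<^sub>m n"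
    unfolding algebraic_homD(4)[OF assms(1,4) a(3), symmetric] m
    by (rule algebraic_hom_one[OF assms(1-3)])
  have E: "eval_map id \<rho> b \<in> carrier_mat n n" "det (eval_map id \<rho> b) \<noteq> 0" if "b \<in> G" for b
    using algebraic_homD(3)[OF assms(1) that] assms(3) GL_carrier_det by blast+
  show "eval_map id \<rho> (minv a) = minv (eval_map id \<rho> a)"
    using mat_inverse_unique[OF E(1)[OF assms(4)] minv(1)[OF E[OF assms(4)]] E(1)[OF a(3)] minv(3)[OF E[OF assms(4)]] 1]
    by simp
qed

lemma inverse_det_minv:
  assumes "A \<in> carrier_mat n n" "det A \<noteq> 0" shows "inverse (det (minv A)) = det A"
  using det_minv(1)[OF assms] by (metis inverse_unique)

lemma mat_mult_one_det:
  assumes "A \<in> carrier_mat n n" "B \<in> carrier_mat n n" "A * B = (1\<^sub>m n :: 'b::field mat)"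
  shows "det A \<noteq> 0" "det B \<noteq> 0" "inverse (det A) = det B"
proof -
  have "det A * det B = 1" using det_mult[OF assms(1,2)] assms(3) by (simp add: det_one)
  then show "det A \<noteq> 0" "det B \<noteq> 0" "inverse (det A) = det B" by (auto intro: inverse_unique)
qed

context
  fixes N n G H \<rho>
  assumes hom: "algebraic_hom N G n H \<rho>" and G: "subgroup G (GL N)" and H: "H \<subseteq> carrier (GL n)"
begin

text \<open>\<open>\<rho>\<close> is multiplicative only over the base field by assumption. Both
  sides are regular maps on \<open>G \<times> G\<close>, so the identity passes to the pair of
  Laurent points.\<close>

lemma eval_map_laurent_mult:
  assumes "x \<in> laurent_points N G" "y \<in> laurent_points N G"
  shows "eval_map fls_const \<rho> (x * y) = eval_map fls_const \<rho> x * eval_map fls_const \<rho> y"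
proof (rule fls_point_unique_mat[OF fls_point_pair[OF G G assms]])
  note GL = laurent_points_GL[OF assms(1)] laurent_points_GL[OF assms(2)]
  note pr = mrealizes_pair[OF G G GL]
  note D = algebraic_homD[OF hom]
  have c: "x \<in> carrier_mat N N" "y \<in> carrier_mat N N" using GL GL_carrier_det by blast+
  show "mrealizes (G \<times> G) (pair_gens N x y) n n (\<lambda>z. eval_map id \<rho> (fst z) * eval_map id \<rho> (snd z))
      (eval_map fls_const \<rho> x * eval_map fls_const \<rho> y)"
    by (rule mrealizes_mult[OF mrealizes_eval_map[OF pr(1,3) D(1,2)] mrealizes_eval_map[OF pr(2,4) D(1,2)]])
  have "inverse (det (fst z)) * inverse (det (snd z)) = inverse (det (fst z * snd z))" if "z \<in> G \<times> G" for z
  proof -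
    have "fst z \<in> carrier_mat N N" "snd z \<in> carrier_mat N N" using that subgroup_GL_D(5)[OF G] by auto
    then show ?thesis by (simp add: det_mult[of _ N])
  qed
  then have "realizes (G \<times> G) (pair_gens N x y) (\<lambda>z. inverse (det (fst z * snd z))) (inverse (det x) * inverse (det y))"
    by (rule realizes_cong[OF realizes_mult[OF pr(3,4)]])
  then have "realizes (G \<times> G) (pair_gens N x y) (\<lambda>z. inverse (det (fst z * snd z))) (inverse (det (x * y)))"
    using c by (simp add: det_mult[of _ N])
  then show "mrealizes (G \<times> G) (pair_gens N x y) n n (\<lambda>z. eval_map id \<rho> (fst z * snd z))
      (eval_map fls_const \<rho> (x * y))"
    by (intro mrealizes_eval_map[where N = N] mrealizes_mult[where m = N] pr D)
  show "eval_map id \<rho> (fst z * snd z) = eval_map id \<rho> (fst z) * eval_map id \<rho> (snd z)" if "z \<in> G \<times> G" for z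
    using that by (intro D(4)) auto
qed

lemma eval_map_laurent_minv:
  assumes "x \<in> laurent_points N G"
  shows "eval_map fls_const \<rho> x * eval_map fls_const \<rho> (minv x) = 1\<^sub>m n"
    "eval_map fls_const \<rho> x \<in> carrier (GL n)"
    "eval_map fls_const \<rho> (minv x) = minv (eval_map fls_const \<rho> x)"
proof -
  note GL = laurent_points_GL[OF assms]
  note S = subgroup_GL_D[OF G]
  note D = algebraic_homD[OF hom]
  note id = mrealizes_GL_gens[OF GL S(1)] and dt = realizes_inverse_det_GL_gens[of G N x]
  have x: "x \<in> carrier_mat N N" "det x \<noteq> 0" using GL GL_carrier_det by blast+
  \<comment> \<open>Evaluating \<open>\<rho>\<close> at \<open>minv x\<close> calls for the inverse
    determinant of \<open>minv x\<close>, which is \<open>det x\<close> itself.\<close>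
  have "realizes G (GL_gens N x) (\<lambda>a. inverse (det (minv a))) (det x)"
  proof (rule realizes_cong[OF realizes_det[OF id]])
    show "det a = inverse (det (minv a))" if "a \<in> G" for a
      using inverse_det_minv[of a N] S(5) S(6)[OF that] that by auto
  qed
  then have dt': "realizes G (GL_gens N x) (\<lambda>a. inverse (det (minv a))) (inverse (det (minv x)))"
    using inverse_det_minv[OF x] by simp
  show 1: "eval_map fls_const \<rho> x * eval_map fls_const \<rho> (minv x) = 1\<^sub>m n"
  proof (rule fls_point_unique_mat[OF fls_point_laurent[OF S(1) assms] _ mrealizes_one])
    show "mrealizes G (GL_gens N x) n n (\<lambda>a. eval_map id \<rho> a * eval_map id \<rho> (minv a))
        (eval_map fls_const \<rho> x * eval_map fls_const \<rho> (minv x))"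
      by (rule mrealizes_mult[OF mrealizes_eval_map[OF id dt D(1,2)]
            mrealizes_eval_map[OF mrealizes_minv[OF id dt] dt' D(1,2)]])
    show "eval_map id \<rho> a * eval_map id \<rho> (minv a) = 1\<^sub>m n" if "a \<in> G" for a
      by (rule algebraic_hom_minv[OF hom G H that])
  qed
  have E: "eval_map fls_const \<rho> z \<in> carrier_mat n n" for z using D(1) by (auto simp: eval_map_def)
  note d = mat_mult_one_det[OF E E 1]
  show "eval_map fls_const \<rho> x \<in> carrier (GL n)" using d E by (simp add: GL_carrier_det)
  show "eval_map fls_const \<rho> (minv x) = minv (eval_map fls_const \<rho> x)"
    using mat_inverse_unique[OF E minv(1)[OF E d(1)] E minv(3)[OF E d(1)] 1] by simp
qed

end

section \<open>Cocharacters and their values at \<open>t\<close>\<close>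

lemma det_mat_1: "det (mat 1 1 (\<lambda>_. c)) = c"
  using det_upper_triangular[of "mat 1 1 (\<lambda>_. c)" 1] by (auto simp: diag_mat_def upper_triangular_def)

lemma mat_1_mult: "mat 1 1 (\<lambda>_. a) * mat 1 1 (\<lambda>_. b) = mat 1 1 (\<lambda>_. a * b :: 'b::comm_ring_1)"
  by (rule eq_matI) (auto simp: scalar_prod_def)

lemma realizes_torus_id: "realizes Z torus_gens (\<lambda>s. s) fls_X"
  and realizes_torus_inverse: "realizes Z torus_gens inverse (inverse fls_X)"
  by (rule realizes_gen, simp add: torus_gens_def)+

lemma realizes_torus_powi: "realizes Z torus_gens (\<lambda>s. s powi k) (fls_X powi k)"
proof (cases "k \<ge> 0")
  case True
  then have "realizes Z torus_gens (\<lambda>s. s ^ nat k) (fls_X ^ nat k)"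
    by (intro realizes_power realizes_torus_id)
  with True show ?thesis by (simp add: power_int_def del: fls_X_power_int)
next
  case False
  then have "realizes Z torus_gens (\<lambda>s. inverse s ^ nat (-k)) (inverse fls_X ^ nat (-k))"
    by (intro realizes_power realizes_torus_inverse)
  with False show ?thesis by (simp add: power_int_def del: fls_X_power_int fls_inverse_X)
qed

lemma mrealizes_torus_diag:
  "mrealizes Z torus_gens n n (\<lambda>s. mat_diag n (\<lambda>i. s powi w i)) (mat_diag n (\<lambda>i. fls_X powi w i))"
  unfolding mat_diag_def
proof (rule mrealizes_mat)
  fix i j
  show "realizes Z torus_gens (\<lambda>s. case (i, j) of (i, j) \<Rightarrow> if i = j then s powi w j else 0)
      (case (i, j) of (i, j) \<Rightarrow> if i = j then fls_X powi w j else 0)"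
    using realizes_torus_powi[of Z "w j"] realizes_zero[of Z torus_gens] by (cases "i = j") (simp_all del: fls_X_power_int)
qed

abbreviation torus_eval :: "('a::field \<Rightarrow> 'a mat) \<Rightarrow> 'a fls mat \<Rightarrow> nat \<Rightarrow> bool" where
  "torus_eval \<alpha> V n \<equiv> mrealizes {s. s \<noteq> 0} torus_gens n n \<alpha> V"

lemma cocharacterD:
  fixes \<mu> :: "'a::field_char_0 regular_map"
  assumes "cocharacter N H \<mu>" "H \<subseteq> carrier (GL N)"
  shows "\<And>s. s \<noteq> 0 \<Longrightarrow> cochar_fun \<mu> s \<in> H"
    "\<And>s r. s \<noteq> 0 \<Longrightarrow> r \<noteq> 0 \<Longrightarrow> cochar_fun \<mu> (s * r) = cochar_fun \<mu> s * cochar_fun \<mu> r"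
    "cochar_fun \<mu> 1 = 1\<^sub>m N"
    "torus_eval (cochar_fun \<mu>) (t_power \<mu>) N"
    "torus_eval (\<lambda>s. cochar_fun \<mu> (inverse s)) (minv (t_power \<mu>)) N"
    "realizes {s. s \<noteq> 0} torus_gens (\<lambda>s. inverse (det (cochar_fun \<mu> s))) (inverse (det (t_power \<mu>)))"
    "det (t_power \<mu>) \<noteq> 0"
proof -
  have hom: "algebraic_hom 1 (carrier (GL 1)) N H \<mu>" using assms by (simp add: cocharacter_def)
  note D = algebraic_homD[OF hom]
  have sub: "subgroup (carrier (GL 1 :: 'a mat monoid)) (GL 1)" by (rule group.subgroup_self[OF group_GL])
  have S: "mat 1 1 (\<lambda>_. s) \<in> carrier (GL 1)" if "s \<noteq> (0 :: 'a)" for s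
    using that by (simp add: GL_carrier_det det_mat_1 del: One_nat_def)
  show m: "cochar_fun \<mu> s \<in> H" if "s \<noteq> 0" for s unfolding cochar_fun_def by (rule D(3)[OF S[OF that]])
  show mult: "cochar_fun \<mu> (s * r) = cochar_fun \<mu> s * cochar_fun \<mu> r" if "s \<noteq> 0" "r \<noteq> 0" for s r
    unfolding cochar_fun_def mat_1_mult[symmetric] by (rule D(4)[OF S[OF that(1)] S[OF that(2)]])
  have "mat 1 1 (\<lambda>_. 1 :: 'a) = 1\<^sub>m 1" by (rule eq_matI) auto
  then show one: "cochar_fun \<mu> 1 = 1\<^sub>m N"
    unfolding cochar_fun_def using algebraic_hom_one[OF hom sub assms(2)] by simp
  have r: "torus_eval (\<lambda>s. mat 1 1 (\<lambda>_. f s)) (mat 1 1 (\<lambda>_. v)) 1"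
    if "realizes {s. s \<noteq> 0} torus_gens f v" for f and v :: "'a fls"
    by (rule mrealizes_mat) (rule that)
  show ev: "torus_eval (cochar_fun \<mu>) (t_power \<mu>) N"
    unfolding cochar_fun_def t_power_def
    by (rule mrealizes_eval_map[OF r[OF realizes_torus_id] _ D(1,2)])
      (unfold det_mat_1, rule realizes_torus_inverse)
  \<comment> \<open>The value at the inverse of \<open>t\<close>. It is inverse to
    \<open>t_power \<mu>\<close>, and its determinant supplies the inverse determinant that has to
    be realized.\<close>
  define V where "V = eval_map fls_const \<mu> (mat 1 1 (\<lambda>_. inverse fls_X))"
  have ev': "torus_eval (\<lambda>s. cochar_fun \<mu> (inverse s)) V N"
    unfolding cochar_fun_def V_def
    by (rule mrealizes_eval_map[OF r[OF realizes_torus_inverse] _ D(1,2)])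
      (unfold det_mat_1 inverse_inverse_eq, rule realizes_torus_id)
  have inv: "cochar_fun \<mu> s * cochar_fun \<mu> (inverse s) = 1\<^sub>m N" if "s \<noteq> 0" for s
    using mult[of s "inverse s"] that one by simp
  have VV: "t_power \<mu> * V = 1\<^sub>m N"
    by (rule fls_point_unique_mat[OF fls_point_torus mrealizes_mult[OF ev ev'] mrealizes_one]) (use inv in auto)
  note c = mrealizesD(1)[OF ev] mrealizesD(1)[OF ev']
  note d = mat_mult_one_det[OF c VV]
  show "det (t_power \<mu>) \<noteq> 0" by (rule d(1))
  have "V = minv (t_power \<mu>)"
    using mat_inverse_unique[OF c(1) minv(1)[OF c(1) d(1)] c(2) minv(3)[OF c(1) d(1)] VV] by simp
  with ev' show "torus_eval (\<lambda>s. cochar_fun \<mu> (inverse s)) (minv (t_power \<mu>)) N" by simp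
  have "realizes {s. s \<noteq> 0} torus_gens (\<lambda>s. inverse (det (cochar_fun \<mu> s))) (det V)"
  proof (rule realizes_cong[OF realizes_det[OF ev']])
    fix s :: 'a assume "s \<in> {s. s \<noteq> 0}"
    then have s: "s \<noteq> 0" "inverse s \<noteq> 0" by auto
    have "cochar_fun \<mu> s \<in> carrier_mat N N" "cochar_fun \<mu> (inverse s) \<in> carrier_mat N N"
      using m[OF s(1)] m[OF s(2)] assms(2) GL_carrier_det by blast+
    from mat_mult_one_det(3)[OF this inv[OF s(1)]]
    show "det (cochar_fun \<mu> (inverse s)) = inverse (det (cochar_fun \<mu> s))" by simp
  qed
  with d(3) show "realizes {s. s \<noteq> 0} torus_gens (\<lambda>s. inverse (det (cochar_fun \<mu> s))) (inverse (det (t_power \<mu>)))"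
    by simp
qed

lemma t_power_laurent:
  fixes \<mu> :: "'a::field_char_0 regular_map"
  assumes "cocharacter N H \<mu>" "subgroup H (GL N)"
  shows "t_power \<mu> \<in> laurent_points N H"
proof -
  note c = cocharacterD[OF assms(1) subgroup_GL_D(1)[OF assms(2)]]
  show ?thesis by (rule laurent_pointsI[OF fls_point_torus c(4) _ c(7)]) (use c(1) in auto)
qed

lemma torus_eval_rep:
  fixes \<mu> :: "'a::field_char_0 regular_map"
  assumes "cocharacter N M \<mu>" "M \<subseteq> carrier (GL N)" "algebraic_hom N G n H \<rho>"
  shows "torus_eval (\<lambda>s. eval_map id \<rho> (cochar_fun \<mu> s)) (eval_map fls_const \<rho> (t_power \<mu>)) n"
proof -
  note c = cocharacterD[OF assms(1,2)]
  note D = algebraic_homD[OF assms(3)]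
  show ?thesis by (rule mrealizes_eval_map[OF c(4,6) D(1,2)])
qed

text \<open>A diagonalization valid for all nonzero scalars persists at \<open>s = t\<close>, with
  the same constant change of basis.\<close>

lemma torus_eval_conj_diag:
  assumes "torus_eval \<alpha> V n" "P \<in> carrier_mat n n" "Q \<in> carrier_mat n n"
    and "\<And>s. s \<noteq> 0 \<Longrightarrow> \<alpha> s = P * mat_diag n (\<lambda>i. s powi w i) * (Q :: 'a::field_char_0 mat)"
  shows "V = map_mat fls_const P * mat_diag n (\<lambda>i. fls_X powi w i) * map_mat fls_const Q"
  by (rule fls_point_unique_mat[OF fls_point_torus assms(1)
      mrealizes_mult[OF mrealizes_mult[OF mrealizes_const[OF assms(2)] mrealizes_torus_diag] mrealizes_const[OF assms(3)]]])
    (use assms(4) in auto)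

subsection \<open>Integrality\<close>

definition fls_int :: "'a::comm_ring_1 fls \<Rightarrow> bool" where "fls_int x \<longleftrightarrow> x \<in> range fps_to_fls"

lemma fls_int_intros [intro, simp]:
  "fls_int 0" "fls_int 1" "fls_int (fls_const c)"
  "fls_int x \<Longrightarrow> fls_int y \<Longrightarrow> fls_int (x + y)"
  "fls_int x \<Longrightarrow> fls_int y \<Longrightarrow> fls_int (x - y)"
  "fls_int x \<Longrightarrow> fls_int (- x)"
  "fls_int x \<Longrightarrow> fls_int y \<Longrightarrow> fls_int (x * y)"
  unfolding fls_int_def
proof goal_cases
  case 1 then show ?case by (metis fps_zero_to_fls rangeI)
next
  case 2 then show ?case by (metis fps_one_to_fls rangeI)
next
  case 3 then show ?case by (metis fps_const_to_fls rangeI)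
next
  case 4 then show ?case by (auto simp flip: fps_to_fls_plus)
next
  case 5 then show ?case by (auto simp flip: fps_to_fls_minus)
next
  case 6 then show ?case by (auto simp flip: fps_to_fls_uminus)
next
  case 7 then show ?case by (auto simp flip: fls_times_fps_to_fls)
qed

lemma fls_int_sum: "(\<And>i. i \<in> I \<Longrightarrow> fls_int (f i)) \<Longrightarrow> fls_int (\<Sum>i\<in>I. f i)"
  by (induction I rule: infinite_finite_induct) auto

lemma fls_int_prod: "(\<And>i. i \<in> I \<Longrightarrow> fls_int (f i)) \<Longrightarrow> fls_int (\<Prod>i\<in>I. f i)"
  by (induction I rule: infinite_finite_induct) auto

lemma fls_int_power: "fls_int x \<Longrightarrow> fls_int (x ^ k)"
  by (induction k) auto

definition imat :: "nat \<Rightarrow> 'a::comm_ring_1 fls mat \<Rightarrow> bool" where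
  "imat n A \<longleftrightarrow> A \<in> carrier_mat n n \<and> (\<forall>i<n. \<forall>j<n. fls_int (A $$ (i, j)))"

lemma imatD: "imat n A \<Longrightarrow> A \<in> carrier_mat n n" "imat n A \<Longrightarrow> i < n \<Longrightarrow> j < n \<Longrightarrow> fls_int (A $$ (i, j))"
  by (auto simp: imat_def)

lemma imat_mult:
  assumes "imat n A" "imat n B" shows "imat n (A * B)"
  using assms by (auto simp: imat_def scalar_prod_def intro!: fls_int_sum)

lemma imat_one: "imat n (1\<^sub>m n)" by (auto simp: imat_def)

lemma imat_const: "A \<in> carrier_mat n n \<Longrightarrow> imat n (map_mat fls_const A)" by (auto simp: imat_def)

lemma fls_int_det: assumes "imat n A" shows "fls_int (det A)"
proof -
  have A: "A \<in> carrier_mat n n" using assms by (rule imatD)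
  have "fls_int (signof p :: 'a fls)" for p :: "nat \<Rightarrow> nat" by (auto simp: sign_def)
  then show ?thesis
    unfolding det_def'[OF A] using assms
    by (intro fls_int_sum fls_int_intros(7) fls_int_prod imatD(2)) (auto dest: permutes_in_image)
qed

text \<open>\<open>fps_to_fls\<close> is an injective ring homomorphism, so the condition can be
  tested inside \<open>C((t))\<close>: an integral inverse over \<open>C((t))\<close> is the image
  of an inverse over \<open>C[[t]]\<close>.\<close>

lemma GL_power_series_iff:
  "A \<in> GL_power_series n \<longleftrightarrow> imat n A \<and> (\<exists>B. imat n B \<and> A * B = 1\<^sub>m n \<and> B * A = 1\<^sub>m n)"
proof
  interpret h: comm_ring_hom "fps_to_fls :: 'a fps \<Rightarrow> 'a fls"
    by unfold_locales (auto simp: fls_times_fps_to_fls)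
  have im: "imat n (map_mat fps_to_fls A)" if "A \<in> carrier_mat n n" for A
    using that by (auto simp: imat_def fls_int_def)
  assume "A \<in> GL_power_series n"
  then obtain A' B' where A: "A = map_mat fps_to_fls A'" "A' \<in> carrier_mat n n" "B' \<in> carrier_mat n n"
    "A' * B' = 1\<^sub>m n" "B' * A' = 1\<^sub>m n" by (auto simp: GL_power_series_def GL_carrier)
  have "A * map_mat fps_to_fls B' = 1\<^sub>m n" "map_mat fps_to_fls B' * A = 1\<^sub>m n"
    unfolding A(1) h.mat_hom_mult[OF A(2,3), symmetric] h.mat_hom_mult[OF A(3,2), symmetric]
    by (simp_all add: A h.mat_hom_one)
  then show "imat n A \<and> (\<exists>B. imat n B \<and> A * B = 1\<^sub>m n \<and> B * A = 1\<^sub>m n)"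
    using im A by blast
next
  interpret h: comm_ring_hom "fps_to_fls :: 'a fps \<Rightarrow> 'a fls"
    by unfold_locales (auto simp: fls_times_fps_to_fls)
  have inj: "A = B" if "map_mat fps_to_fls A = map_mat fps_to_fls B" for A B :: "'a fps mat"
  proof (rule eq_matI)
    have d: "dim_row A = dim_row B" "dim_col A = dim_col B" using that by (metis index_map_mat(2,3))+
    then show "dim_row A = dim_row B" "dim_col A = dim_col B" by auto
    fix i j assume "i < dim_row B" "j < dim_col B"
    with d that show "A $$ (i, j) = B $$ (i, j)" by (metis fps_to_fls_eq_iff index_map_mat(1))
  qed
  have ex: "\<exists>A'\<in>carrier_mat n n. A = map_mat fps_to_fls A'" if "imat n A" for A :: "'a fls mat"
  proof
    show "A = map_mat fps_to_fls (mat n n (\<lambda>ij. inv_into UNIV fps_to_fls (A $$ ij)))"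
      using that by (intro eq_matI) (auto simp: imat_def fls_int_def f_inv_into_f)
  qed auto
  assume "imat n A \<and> (\<exists>B. imat n B \<and> A * B = 1\<^sub>m n \<and> B * A = 1\<^sub>m n)"
  then obtain A' B' where A: "A' \<in> carrier_mat n n" "B' \<in> carrier_mat n n" "A = map_mat fps_to_fls A'"
    "map_mat fps_to_fls A' * map_mat fps_to_fls B' = 1\<^sub>m n" "map_mat fps_to_fls B' * map_mat fps_to_fls A' = 1\<^sub>m n"
    using ex by metis
  have "A' * B' = 1\<^sub>m n" "B' * A' = 1\<^sub>m n"
    using A(4,5) by (auto intro!: inj simp: h.mat_hom_mult[OF A(1,2)] h.mat_hom_mult[OF A(2,1)] h.mat_hom_one)
  then show "A \<in> GL_power_series n" unfolding GL_power_series_def using A by (auto simp: GL_carrier)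
qed

lemma GL_power_series_minv:
  assumes "A \<in> GL_power_series n"
  shows "imat n A" "imat n (minv A)" "A \<in> carrier_mat n n" "det A \<noteq> 0" "minv A \<in> GL_power_series n"
    "fls_int (inverse (det A))"
proof -
  obtain B where B: "imat n A" "imat n B" "A * B = 1\<^sub>m n" "B * A = 1\<^sub>m n" using assms by (auto simp: GL_power_series_iff)
  note c = imatD(1)[OF B(1)] imatD(1)[OF B(2)]
  note d = mat_mult_one_det[OF c B(3)]
  show "imat n A" "A \<in> carrier_mat n n" "det A \<noteq> 0" using B c d by auto
  have "B = minv A" using mat_inverse_unique[OF c(1) minv(1)[OF c(1) d(1)] c(2) minv(3)[OF c(1) d(1)] B(3)] by simp
  then show "imat n (minv A)" "minv A \<in> GL_power_series n" using B by (auto simp: GL_power_series_iff)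
  show "fls_int (inverse (det A))" unfolding d(3) by (rule fls_int_det[OF B(2)])
qed

lemma GL_power_seriesI: "imat n A \<Longrightarrow> imat n B \<Longrightarrow> A * B = 1\<^sub>m n \<Longrightarrow> B * A = 1\<^sub>m n \<Longrightarrow> A \<in> GL_power_series n"
  by (auto simp: GL_power_series_iff)

lemma GL_power_series_mult:
  assumes "A \<in> GL_power_series n" "B \<in> GL_power_series n" shows "A * B \<in> GL_power_series n"
proof -
  note a = GL_power_series_minv[OF assms(1)] and b = GL_power_series_minv[OF assms(2)]
  note ma = minv[OF a(3,4)] and mb = minv[OF b(3,4)]
  have "(A * B) * (minv B * minv A) = A * (B * minv B) * minv A"
    using a(3) b(3) ma(1) mb(1) by (smt (verit) assoc_mult_mat mult_carrier_mat)
  moreover have "(minv B * minv A) * (A * B) = minv B * (minv A * A) * B"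
    using a(3) b(3) ma(1) mb(1) by (smt (verit) assoc_mult_mat mult_carrier_mat)
  ultimately show ?thesis
    using a b ma mb by (intro GL_power_seriesI[of n _ "minv B * minv A"]) (auto intro: imat_mult)
qed

lemma GL_power_series_const:
  assumes "P \<in> carrier_mat n n" "Q \<in> carrier_mat n n" "P * Q = 1\<^sub>m n" "Q * P = 1\<^sub>m n"
  shows "map_mat fls_const P \<in> GL_power_series n"
    "map_mat fls_const P * map_mat fls_const Q = 1\<^sub>m n" "map_mat fls_const Q * map_mat fls_const P = 1\<^sub>m n"
proof -
  show 1: "map_mat fls_const P * map_mat fls_const Q = 1\<^sub>m n" "map_mat fls_const Q * map_mat fls_const P = 1\<^sub>m n"
    using assms by (simp_all add: fls_const.mat_hom_mult[symmetric] fls_const.mat_hom_one)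
  show "map_mat fls_const P \<in> GL_power_series n"
    by (rule GL_power_seriesI[OF imat_const[OF assms(1)] imat_const[OF assms(2)] 1])
qed

lemma power_series_points_mult:
  assumes "subgroup G (GL N)" "x \<in> power_series_points N G" "y \<in> power_series_points N G"
  shows "x * y \<in> power_series_points N G"
  using assms laurent_points_mult GL_power_series_mult unfolding power_series_points_def by blast

text \<open>The denominators \<open>det y ^ k\<close> are units of \<open>C[[t]]\<close>, so values
  at integral points are integral. The inverse of the value at \<open>x\<close> is the value at
  \<open>minv x\<close>, hence integral too.\<close>

lemma eval_map_power_series:
  assumes "algebraic_hom N G n H \<rho>" "subgroup G (GL N)" "H \<subseteq> carrier (GL n)" "x \<in> power_series_points N G"
  shows "eval_map fls_const \<rho> x \<in> GL_power_series n"
proof -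
  note D = algebraic_homD[OF assms(1)]
  have im: "imat n (eval_map fls_const \<rho> y)" if "y \<in> GL_power_series N" for y
  proof -
    note y = GL_power_series_minv[OF that]
    show ?thesis unfolding imat_def
    proof (intro conjI allI impI)
      show "eval_map fls_const \<rho> y \<in> carrier_mat n n" using D(1) by (auto simp: eval_map_def)
      fix i j assume ij: "i < n" "j < n"
      obtain p k where pk: "\<rho> $$ (i, j) = (p, k)" by fastforce
      have "\<rho> $$ (i, j) \<in> elements_mat \<rho>" using ij D(1) elements_matI by blast
      then have "p \<in> entry_polys N" using D(2) pk by force
      then have "fls_int (y $$ ij)" if "e \<in> Poly_Mapping.keys p" "ij \<in> Poly_Mapping.keys e" for e ij
        using imatD(2)[OF y(1)] that unfolding entry_polys_def by (cases ij) fastforce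
      then have "fls_int (eval_poly fls_const p y)"
        unfolding eval_poly_def by (intro fls_int_sum fls_int_intros(7) fls_int_prod fls_int_power fls_int_intros(3))
      then have "fls_int (eval_poly fls_const p y * inverse (det y) ^ k)"
        by (intro fls_int_intros(7) fls_int_power y(6))
      then show "fls_int (eval_map fls_const \<rho> y $$ (i, j))"
        using ij D(1) pk by (auto simp: eval_map_def divide_inverse power_inverse)
    qed
  qed
  have x: "x \<in> laurent_points N G" "x \<in> GL_power_series N" using assms(4) by (auto simp: power_series_points_def)
  note i = eval_map_laurent_minv[OF assms(1-3) x(1)]
  have E: "eval_map fls_const \<rho> x \<in> carrier_mat n n" "det (eval_map fls_const \<rho> x) \<noteq> 0"
    using i(2) GL_carrier_det by blast+
  show ?thesis
    by (rule GL_power_seriesI[OF im[OF x(2)] im[OF GL_power_series_minv(5)[OF x(2)]] i(1)])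
      (unfold i(3), rule minv(3)[OF E])
qed

section \<open>Power series evaluated at nilpotent matrices\<close>

text \<open>The truncation at \<open>m\<close> loses nothing once \<open>A ^\<^sub>m m\<close>
  vanishes, and it keeps the expression polynomial in the entries. With \<open>h\<close> equal to
  \<open>id\<close> or \<open>fls_const\<close>, the same series serves over the base field and over
  Laurent series.\<close>

definition fev :: "('a \<Rightarrow> 'b::comm_ring_1) \<Rightarrow> 'a fps \<Rightarrow> nat \<Rightarrow> 'b mat \<Rightarrow> 'b mat" where
  "fev h f m A = mat (dim_row A) (dim_row A) (\<lambda>ij. \<Sum>k<m. h (fps_nth f k) * (A ^\<^sub>m k) $$ ij)"

lemma fev_carrier [simp]: "A \<in> carrier_mat n n \<Longrightarrow> fev h f m A \<in> carrier_mat n n"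
  by (auto simp: fev_def)

lemma fev_index:
  "A \<in> carrier_mat n n \<Longrightarrow> i < n \<Longrightarrow> j < n \<Longrightarrow>
    fev h f m A $$ (i, j) = (\<Sum>k<m. h (fps_nth f k) * (A ^\<^sub>m k) $$ (i, j))"
  by (auto simp: fev_def)

lemma mrealizes_fev:
  assumes "mrealizes Z B n n F V"
  shows "mrealizes Z B n n (\<lambda>x. fev id f m (F x)) (fev fls_const f m V)"
proof (rule mrealizesI)
  note F = mrealizesD[OF assms]
  show "fev fls_const f m V \<in> carrier_mat n n" "\<And>x. x \<in> Z \<Longrightarrow> fev id f m (F x) \<in> carrier_mat n n"
    using F by auto
  fix i j assume ij: "i < n" "j < n"
  have "realizes Z B (\<lambda>x. \<Sum>k<m. fps_nth f k * (F x ^\<^sub>m k) $$ (i, j))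
      (\<Sum>k<m. fls_const (fps_nth f k) * (V ^\<^sub>m k) $$ (i, j))"
    by (intro realizes_sum realizes_cmult mrealizesD(3)[OF mrealizes_pow[OF assms] ij])
  then have "realizes Z B (\<lambda>x. \<Sum>k<m. fps_nth f k * (F x ^\<^sub>m k) $$ (i, j)) (fev fls_const f m V $$ (i, j))"
    using ij by (simp add: fev_index[OF F(1)])
  then show "realizes Z B (\<lambda>x. fev id f m (F x) $$ (i, j)) (fev fls_const f m V $$ (i, j))"
    by (rule realizes_cong) (use ij in \<open>simp add: fev_index[OF F(2)]\<close>)
qed

lemma pow_mat_add:
  assumes "A \<in> carrier_mat n n"
  shows "(A :: 'b::semiring_1 mat) ^\<^sub>m (k + l) = A ^\<^sub>m k * A ^\<^sub>m l"
proof (induction l)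
  case (Suc l)
  have "A ^\<^sub>m k \<in> carrier_mat n n" "A ^\<^sub>m l \<in> carrier_mat n n" using assms by auto
  with Suc assms show ?case by (simp add: assoc_mult_mat[of _ n n _ n _ n])
qed (use assms in auto)

lemma pow_mat_zero_ge:
  assumes "A \<in> carrier_mat n n" "(A :: 'b::semiring_1 mat) ^\<^sub>m m = 0\<^sub>m n n" "m \<le> k"
  shows "A ^\<^sub>m k = 0\<^sub>m n n"
proof -
  have "A ^\<^sub>m (m + (k - m)) = 0\<^sub>m n n" unfolding pow_mat_add[OF assms(1)] assms(2)
    using assms(1) by simp
  with assms(3) show ?thesis by simp
qed

lemma index_mult_mat_sum:
  "A \<in> carrier_mat n m \<Longrightarrow> B \<in> carrier_mat m k \<Longrightarrow> i < n \<Longrightarrow> j < k \<Longrightarrow>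
    (A * B) $$ (i, j) = (\<Sum>l<m. A $$ (i, l) * B $$ (l, j))"
  by (auto simp: scalar_prod_def atLeast0LessThan)

lemma index_mult_mult_mat_sum:
  assumes "A \<in> carrier_mat n m" "B \<in> carrier_mat m l" "C \<in> carrier_mat l k" "i < n" "j < k"
  shows "(A * B * (C :: 'b::semiring_0 mat)) $$ (i, j) = (\<Sum>p<m. \<Sum>q<l. A $$ (i, p) * B $$ (p, q) * C $$ (q, j))"
proof -
  have "(A * B * C) $$ (i, j) = (\<Sum>q<l. (\<Sum>p<m. A $$ (i, p) * B $$ (p, q)) * C $$ (q, j))"
    unfolding index_mult_mat_sum[OF mult_carrier_mat[OF assms(1,2)] assms(3,4,5)]
    by (intro sum.cong refl) (simp only: index_mult_mat_sum[OF assms(1,2,4)] lessThan_iff)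
  also have "\<dots> = (\<Sum>p<m. \<Sum>q<l. A $$ (i, p) * B $$ (p, q) * C $$ (q, j))"
    unfolding sum_distrib_right by (rule sum.swap)
  finally show ?thesis .
qed

locale fev_nil = comm_ring_hom h for h :: "'a::comm_ring_1 \<Rightarrow> 'b::comm_ring_1" +
  fixes n m :: nat and A :: "'b mat"
  assumes A: "A \<in> carrier_mat n n" and nil: "A ^\<^sub>m m = 0\<^sub>m n n" and m: "m > 0"
begin

text \<open>The product of the truncations has more terms than the truncation of
  \<open>f * g\<close>; the surplus ones have \<open>a + b \<ge> m\<close> and contain a vanishing
  power of \<open>A\<close>.\<close>

lemma fev_mult: "fev h (f * g) m A = fev h f m A * fev h g m A"
proof (rule eq_matI)
  show "dim_row (fev h (f * g) m A) = dim_row (fev h f m A * fev h g m A)"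
    "dim_col (fev h (f * g) m A) = dim_col (fev h f m A * fev h g m A)" by (auto simp: fev_def)
  fix i j assume "i < dim_row (fev h f m A * fev h g m A)" "j < dim_col (fev h f m A * fev h g m A)"
  then have ij: "i < n" "j < n" using A by (auto simp: fev_def)
  let ?c = "\<lambda>a b. h (fps_nth f a) * h (fps_nth g b) * (A ^\<^sub>m (a + b)) $$ (i, j)"
  have "(fev h f m A * fev h g m A) $$ (i, j) = (\<Sum>l<n. (\<Sum>a<m. h (fps_nth f a) * (A ^\<^sub>m a) $$ (i, l)) * (\<Sum>b<m. h (fps_nth g b) * (A ^\<^sub>m b) $$ (l, j)))"
    using A ij by (simp add: index_mult_mat_sum[of _ n n _ n] fev_index[OF A] del: index_mult_mat)
  also have "\<dots> = (\<Sum>l<n. \<Sum>a<m. \<Sum>b<m. h (fps_nth f a) * h (fps_nth g b) * ((A ^\<^sub>m a) $$ (i, l) * (A ^\<^sub>m b) $$ (l, j)))"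
    unfolding sum_product by (intro sum.cong refl) (simp add: mult_ac)
  also have "\<dots> = (\<Sum>a<m. \<Sum>b<m. \<Sum>l<n. h (fps_nth f a) * h (fps_nth g b) * ((A ^\<^sub>m a) $$ (i, l) * (A ^\<^sub>m b) $$ (l, j)))"
    by (subst sum.swap, rule sum.cong[OF refl], rule sum.swap)
  also have "\<dots> = (\<Sum>a<m. \<Sum>b<m. ?c a b)"
    unfolding pow_mat_add[OF A] sum_distrib_left[symmetric]
    using A ij by (intro sum.cong refl) (simp add: index_mult_mat_sum[of _ n n _ n] del: index_mult_mat)
  also have "\<dots> = (\<Sum>(a, b)\<in>{..<m} \<times> {..<m}. ?c a b)" by (simp add: sum.cartesian_product)
  also have "\<dots> = (\<Sum>(a, b)\<in>{(a, b). a + b < m}. ?c a b)"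
  proof (rule sum.mono_neutral_right)
    have "?c a b = 0" if "\<not> a + b < m" for a b
      using pow_mat_zero_ge[OF A nil, of "a + b"] that ij by simp
    then show "\<forall>x\<in>{..<m} \<times> {..<m} - {(a, b). a + b < m}. (case x of (a, b) \<Rightarrow> ?c a b) = 0" by auto
  qed auto
  also have "\<dots> = (\<Sum>k<m. \<Sum>a\<le>k. ?c a (k - a))" by (rule sum.triangle_reindex)
  also have "\<dots> = fev h (f * g) m A $$ (i, j)"
    using ij by (simp add: fev_index[OF A] fps_mult_nth hom_sum hom_mult sum_distrib_right atLeast0AtMost)
  finally show "fev h (f * g) m A $$ (i, j) = (fev h f m A * fev h g m A) $$ (i, j)" by simp
qed

lemma fev_one: "fev h 1 m A = 1\<^sub>m n"
  by (rule eq_matI) (use A m in \<open>auto simp: fev_def sum.delta if_distrib[of h] if_distrib[of "\<lambda>x. x * _"] cong: if_cong\<close>)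

lemma fev_X: "fev h fps_X m A = A"
proof (rule eq_matI)
  fix i j assume "i < dim_row A" "j < dim_col A"
  then have ij: "i < n" "j < n" using A by auto
  have "fev h fps_X m A $$ (i, j) = (\<Sum>k<m. if k = 1 then (A ^\<^sub>m k) $$ (i, j) else 0)"
    unfolding fev_index[OF A ij] by (intro sum.cong) auto
  also have "\<dots> = (if 1 < m then A $$ (i, j) else 0)" using A by (simp add: sum.delta)
  \<comment> \<open>For \<open>m = 1\<close> the linear term is cut off, but then \<open>A\<close>
    itself is zero.\<close>
  also have "\<dots> = A $$ (i, j)"
  proof (cases "1 < m")
    case False
    with m have "m = 1" by simp
    with nil A have "A = 0\<^sub>m n n" by simp
    then show ?thesis using ij by simp
  qed simp
  finally show "fev h fps_X m A $$ (i, j) = A $$ (i, j)" .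
qed (use A in \<open>auto simp: fev_def\<close>)

lemma fev_pow: "fev h (f ^ k) m A = fev h f m A ^\<^sub>m k"
proof (induction k)
  case 0
  show ?case using A fev_one by (simp add: fev_def)
next
  case (Suc k)
  then show ?case by (simp add: fev_mult mult.commute[of f])
qed

lemma fev_nilpotent:
  assumes "fps_nth f 0 = 0" shows "fev h f m A ^\<^sub>m m = 0\<^sub>m n n"
proof -
  have "fps_nth (f ^ m) k = 0" if "k < m" for k using startsby_zero_power_prefix[OF assms] that by blast
  then have "fev h (f ^ m) m A = 0\<^sub>m n n"
    by (intro eq_matI) (use A in \<open>auto simp: fev_def\<close>)
  then show ?thesis by (simp add: fev_pow)
qed

text \<open>As \<open>g\<close> has no constant term, \<open>g ^ k\<close> starts in degree
  \<open>k\<close>. So the coefficients of \<open>f oo g\<close> below \<open>m\<close> involve only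
  \<open>k < m\<close>, and the outer truncation is harmless.\<close>

lemma fev_compose:
  assumes "fps_nth g 0 = 0" shows "fev h (f oo g) m A = fev h f m (fev h g m A)"
proof (rule eq_matI)
  have C: "fev h g m A \<in> carrier_mat n n" using A by simp
  show "dim_row (fev h (f oo g) m A) = dim_row (fev h f m (fev h g m A))"
    "dim_col (fev h (f oo g) m A) = dim_col (fev h f m (fev h g m A))" by (auto simp: fev_def)
  fix i j assume "i < dim_row (fev h f m (fev h g m A))" "j < dim_col (fev h f m (fev h g m A))"
  then have ij: "i < n" "j < n" using A by (auto simp: fev_def)
  have "fev h f m (fev h g m A) $$ (i, j) = (\<Sum>k<m. h (fps_nth f k) * fev h (g ^ k) m A $$ (i, j))"
    unfolding fev_index[OF C ij] fev_pow ..
  also have "\<dots> = (\<Sum>k<m. \<Sum>l<m. h (fps_nth f k) * h (fps_nth (g ^ k) l) * (A ^\<^sub>m l) $$ (i, j))"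
    unfolding fev_index[OF A ij] sum_distrib_left by (simp add: mult_ac)
  also have "\<dots> = (\<Sum>l<m. \<Sum>k<m. h (fps_nth f k) * h (fps_nth (g ^ k) l) * (A ^\<^sub>m l) $$ (i, j))"
    by (rule sum.swap)
  also have "\<dots> = (\<Sum>l<m. h (fps_nth (f oo g) l) * (A ^\<^sub>m l) $$ (i, j))"
  proof (rule sum.cong[OF refl])
    fix l assume l: "l \<in> {..<m}"
    have "(\<Sum>k<m. h (fps_nth f k) * h (fps_nth (g ^ k) l)) = (\<Sum>k\<in>{0..l}. h (fps_nth f k) * h (fps_nth (g ^ k) l))"
    proof (rule sum.mono_neutral_right)
      have "fps_nth (g ^ k) l = 0" if "l < k" for k using startsby_zero_power_prefix[OF assms] that by blast
      then show "\<forall>i\<in>{..<m} - {0..l}. h (fps_nth f i) * h (fps_nth (g ^ i) l) = 0" by auto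
    qed (use l in auto)
    also have "\<dots> = h (fps_nth (f oo g) l)" by (simp add: fps_compose_nth hom_sum hom_mult)
    finally show "(\<Sum>k<m. h (fps_nth f k) * h (fps_nth (g ^ k) l) * (A ^\<^sub>m l) $$ (i, j)) = h (fps_nth (f oo g) l) * (A ^\<^sub>m l) $$ (i, j)"
      by (simp add: sum_distrib_right[symmetric])
  qed
  also have "\<dots> = fev h (f oo g) m A $$ (i, j)" by (simp add: fev_index[OF A ij])
  finally show "fev h (f oo g) m A $$ (i, j) = fev h f m (fev h g m A) $$ (i, j)" by simp
qed

lemma fev_diff: "fev h (f - g) m A = fev h f m A - fev h g m A"
  by (rule eq_matI) (auto simp: fev_def hom_minus algebra_simps sum_subtractf)

lemma fev_add: "fev h (f + g) m A = fev h f m A + fev h g m A"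
  by (rule eq_matI) (auto simp: fev_def hom_add algebra_simps sum.distrib)

end

lemma mult_mat_conj:
  assumes "P \<in> carrier_mat n n" "Q \<in> carrier_mat n n" "A \<in> carrier_mat n n" "B \<in> carrier_mat n n"
    "Q * P = (1\<^sub>m n :: 'b::semiring_1 mat)"
  shows "(P * A * Q) * (P * B * Q) = P * (A * B) * Q"
proof -
  have "(P * A * Q) * (P * B * Q) = P * A * (Q * P) * B * Q"
    using assms(1-4) by (smt (verit) assoc_mult_mat mult_carrier_mat)
  also have "\<dots> = P * (A * B) * Q" unfolding assms(5)
    using assms(1-4) by (smt (verit) assoc_mult_mat mult_carrier_mat right_mult_one_mat)
  finally show ?thesis .
qed

lemma pow_mat_conj:
  assumes "P \<in> carrier_mat n n" "Q \<in> carrier_mat n n" "A \<in> carrier_mat n n"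
    "Q * P = (1\<^sub>m n :: 'b::semiring_1 mat)" "P * Q = 1\<^sub>m n"
  shows "(P * A * Q) ^\<^sub>m k = P * A ^\<^sub>m k * Q"
proof (induction k)
  case 0
  then show ?case using assms by simp
next
  case (Suc k)
  have "A ^\<^sub>m k \<in> carrier_mat n n" using assms by simp
  with Suc show ?case using mult_mat_conj[OF assms(1,2) _ assms(3,4)] by simp
qed

lemma fev_conj:
  assumes "P \<in> carrier_mat n n" "Q \<in> carrier_mat n n" "A \<in> carrier_mat n n"
    "Q * P = (1\<^sub>m n :: 'b::comm_ring_1 mat)" "P * Q = 1\<^sub>m n"
  shows "fev h f m (P * A * Q) = P * fev h f m A * Q"
proof (rule eq_matI)
  have c: "P * A * Q \<in> carrier_mat n n" "fev h f m A \<in> carrier_mat n n" using assms by auto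
  fix i j assume "i < dim_row (P * fev h f m A * Q)" "j < dim_col (P * fev h f m A * Q)"
  then have ij: "i < n" "j < n" using assms by auto
  have "(P * fev h f m A * Q) $$ (i, j) = (\<Sum>p<n. \<Sum>q<n. \<Sum>k<m. h (fps_nth f k) * (P $$ (i, p) * (A ^\<^sub>m k) $$ (p, q) * Q $$ (q, j)))"
    unfolding index_mult_mult_mat_sum[OF assms(1) c(2) assms(2) ij]
    by (intro sum.cong refl) (simp add: fev_index[OF assms(3)] sum_distrib_left sum_distrib_right mult_ac)
  also have "\<dots> = (\<Sum>p<n. \<Sum>k<m. \<Sum>q<n. h (fps_nth f k) * (P $$ (i, p) * (A ^\<^sub>m k) $$ (p, q) * Q $$ (q, j)))"
    by (rule sum.cong[OF refl], rule sum.swap)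
  also have "\<dots> = (\<Sum>k<m. \<Sum>p<n. \<Sum>q<n. h (fps_nth f k) * (P $$ (i, p) * (A ^\<^sub>m k) $$ (p, q) * Q $$ (q, j)))"
    by (rule sum.swap)
  also have "\<dots> = (\<Sum>k<m. h (fps_nth f k) * (P * A ^\<^sub>m k * Q) $$ (i, j))"
    unfolding sum_distrib_left[symmetric]
    using assms by (intro sum.cong refl) (simp only: index_mult_mult_mat_sum[OF assms(1) pow_carrier_mat[OF assms(3)] assms(2) ij])
  also have "\<dots> = fev h f m (P * A * Q) $$ (i, j)"
    by (simp only: fev_index[OF c(1) ij] pow_mat_conj[OF assms])
  finally show "fev h f m (P * A * Q) $$ (i, j) = (P * fev h f m A * Q) $$ (i, j)" by simp
qed (use assms in \<open>auto simp: fev_def\<close>)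

text \<open>Triangular shapes, weight conditions and their combinations are all treated as support
  conditions. A transitive \<open>P\<close> makes the class closed under products.\<close>

definition pat :: "nat \<Rightarrow> (nat \<Rightarrow> nat \<Rightarrow> bool) \<Rightarrow> 'b::zero mat \<Rightarrow> bool" where
  "pat n P A \<longleftrightarrow> A \<in> carrier_mat n n \<and> (\<forall>i<n. \<forall>j<n. \<not> P i j \<longrightarrow> A $$ (i, j) = 0)"

lemma patD: "pat n P A \<Longrightarrow> A \<in> carrier_mat n n" "pat n P A \<Longrightarrow> i < n \<Longrightarrow> j < n \<Longrightarrow> \<not> P i j \<Longrightarrow> A $$ (i, j) = 0"
  by (auto simp: pat_def)

lemma pat_mult:
  assumes "pat n P A" "pat n Q (B :: 'b::semiring_0 mat)"
    and "\<And>i j k. i < n \<Longrightarrow> j < n \<Longrightarrow> k < n \<Longrightarrow> P i j \<Longrightarrow> Q j k \<Longrightarrow> R i k"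
  shows "pat n R (A * B)"
  unfolding pat_def
proof (intro conjI allI impI)
  note c = patD(1)[OF assms(1)] patD(1)[OF assms(2)]
  show "A * B \<in> carrier_mat n n" using c by simp
  fix i j assume ij: "i < n" "j < n" "\<not> R i j"
  have "A $$ (i, l) * B $$ (l, j) = 0" if "l < n" for l
    using patD(2)[OF assms(1) ij(1) that] patD(2)[OF assms(2) that ij(2)] assms(3)[OF ij(1) that ij(2)] ij(3)
    by (cases "P i l"; cases "Q l j") auto
  then show "(A * B) $$ (i, j) = 0" unfolding index_mult_mat_sum[OF c ij(1,2)] by simp
qed

lemma pat_mono: "pat n P A \<Longrightarrow> (\<And>i j. i < n \<Longrightarrow> j < n \<Longrightarrow> P i j \<Longrightarrow> Q i j) \<Longrightarrow> pat n Q A"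
  unfolding pat_def by blast

lemma pat_add: "pat n P A \<Longrightarrow> pat n P B \<Longrightarrow> pat n P (A + (B :: 'b::monoid_add mat))"
  unfolding pat_def by auto

lemma pat_minus: "pat n P A \<Longrightarrow> pat n P B \<Longrightarrow> pat n P (A - (B :: 'b::group_add mat))"
  unfolding pat_def by auto

lemma pat_pow:
  assumes "pat n P (A :: 'b::semiring_1 mat)" "\<And>i j k. i < n \<Longrightarrow> j < n \<Longrightarrow> k < n \<Longrightarrow> P i j \<Longrightarrow> P j k \<Longrightarrow> P i k" "k > 0"
  shows "pat n P (A ^\<^sub>m k)"
  using assms(3)
proof (induction k)
  case (Suc k)
  show ?case
  proof (cases "k = 0")
    case True
    then show ?thesis using assms(1) patD(1)[OF assms(1)] by simp
  next
    case False
    then have "pat n P (A ^\<^sub>m k)" using Suc.IH by simp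
    from pat_mult[OF this assms(1), of P] assms(2) have "pat n P (A ^\<^sub>m k * A)" by blast
    then show ?thesis by simp
  qed
qed simp

lemma pat_fev:
  assumes "pat n P A" "\<And>i j k. i < n \<Longrightarrow> j < n \<Longrightarrow> k < n \<Longrightarrow> P i j \<Longrightarrow> P j k \<Longrightarrow> P i k" "h (fps_nth f 0) = 0"
  shows "pat n P (fev h f m A)"
  unfolding pat_def
proof (intro conjI allI impI)
  note c = patD(1)[OF assms(1)]
  show "fev h f m A \<in> carrier_mat n n" using c by simp
  fix i j assume ij: "i < n" "j < n" "\<not> P i j"
  have "h (fps_nth f k) * (A ^\<^sub>m k) $$ (i, j) = 0" for k
    using assms(3) patD(2)[OF pat_pow[OF assms(1,2), where k = k] ij] by (cases "k = 0") auto
  then show "fev h f m A $$ (i, j) = 0" unfolding fev_index[OF c ij(1,2)] by simp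
qed

lemma imat_pow: "imat n A \<Longrightarrow> imat n (A ^\<^sub>m k)"
proof (induction k)
  case 0
  then show ?case using imat_one[of n] imatD(1)[of n A] by auto
qed (auto intro: imat_mult)

lemma imat_fev: assumes "imat n A" shows "imat n (fev fls_const f m A)"
  unfolding imat_def
proof (intro conjI allI impI)
  note c = imatD(1)[OF assms(1)]
  show "fev fls_const f m A \<in> carrier_mat n n" using c by simp
  fix i j assume ij: "i < n" "j < n"
  then show "fls_int (fev fls_const f m A $$ (i, j))"
    unfolding fev_index[OF c ij] by (intro fls_int_sum fls_int_intros(7,3) imatD(2)[OF imat_pow[OF assms]])
qed

abbreviation upat :: "nat \<Rightarrow> nat \<Rightarrow> 'b::zero mat \<Rightarrow> bool" where
  "upat n k A \<equiv> pat n (\<lambda>i j. i + k \<le> j) A"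

lemma upat_pow:
  assumes "upat n 1 (A :: 'b::semiring_1 mat)" shows "upat n k (A ^\<^sub>m k)"
proof (induction k)
  case 0
  show ?case using patD(1)[OF assms] by (auto simp: pat_def)
next
  case (Suc k)
  show ?case using pat_mult[OF Suc assms, of "\<lambda>i j. i + Suc k \<le> j"] by simp
qed

lemma upat_nilpotent:
  assumes "upat n 1 (A :: 'b::semiring_1 mat)" shows "A ^\<^sub>m n = 0\<^sub>m n n"
  using upat_pow[OF assms, of n] by (intro eq_matI) (auto simp: pat_def)

lemma pow_mat_smult:
  assumes "A \<in> carrier_mat n n" shows "(c \<cdot>\<^sub>m A) ^\<^sub>m k = (c ^ k :: 'b::comm_ring_1) \<cdot>\<^sub>m A ^\<^sub>m k"
proof (induction k)
  case (Suc k)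
  have "A ^\<^sub>m k \<in> carrier_mat n n" using assms by auto
  then show ?case unfolding pow_mat.simps Suc
    using assms by (intro eq_matI) (auto simp: mult_ac)
qed (use assms in \<open>auto intro!: eq_matI\<close>)

section \<open>Exponential and logarithm of matrices\<close>

definition mexp :: "('a::field_char_0 \<Rightarrow> 'b::comm_ring_1) \<Rightarrow> nat \<Rightarrow> 'b mat \<Rightarrow> 'b mat" where
  "mexp h m A = fev h (fps_exp 1) m A"

text \<open>\<open>fps_ln 1\<close> is the series of \<open>log (1 + X)\<close>, hence the
  subtraction of the identity.\<close>

definition mlog :: "('a::field_char_0 \<Rightarrow> 'b::comm_ring_1) \<Rightarrow> nat \<Rightarrow> 'b mat \<Rightarrow> 'b mat" where
  "mlog h m A = fev h (fps_ln 1) m (A - 1\<^sub>m (dim_row A))"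

locale mexp_nil = comm_ring_hom h for h :: "'a::field_char_0 \<Rightarrow> 'b::comm_ring_1" +
  fixes n m :: nat
  assumes m: "m > 0"
begin

abbreviation nilp where "nilp A \<equiv> A \<in> carrier_mat n n \<and> (A :: 'b mat) ^\<^sub>m m = 0\<^sub>m n n"

lemma fn: "nilp A \<Longrightarrow> fev_nil h n m A"
  by unfold_locales (auto intro: m)

lemma mexp_minus_one: assumes "nilp A" shows "mexp h m A - 1\<^sub>m n = fev h (fps_exp 1 - 1) m A"
  using fev_nil.fev_diff[OF fn[OF assms]] fev_nil.fev_one[OF fn[OF assms]] by (simp add: mexp_def)

lemma mexp_nilp: assumes "nilp A" shows "nilp (mexp h m A - 1\<^sub>m n)" "mexp h m A \<in> carrier_mat n n"
  using assms fev_nil.fev_nilpotent[OF fn[OF assms], of "fps_exp 1 - 1"]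
  by (auto simp: mexp_minus_one[OF assms], auto simp: mexp_def)

lemma mlog_nilp:
  assumes "A \<in> carrier_mat n n" "nilp (A - 1\<^sub>m n)" shows "nilp (mlog h m A)"
proof -
  have "dim_row A = n" using assms(1) by auto
  then have "mlog h m A = fev h (fps_ln 1) m (A - 1\<^sub>m n)" by (simp only: mlog_def)
  moreover have "fev h (fps_ln 1) m (A - 1\<^sub>m n) \<in> carrier_mat n n" using assms by (intro fev_carrier) simp
  ultimately show ?thesis using fev_nil.fev_nilpotent[OF fn[OF assms(2)], of "fps_ln 1"] by simp
qed

text \<open>The identity holds already for formal series: \<open>fps_ln 1\<close> is the
  compositional inverse of \<open>fps_exp 1 - 1\<close>.\<close>

lemma mlog_mexp: assumes "nilp A" shows "mlog h m (mexp h m A) = A"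
proof -
  have "dim_row (mexp h m A) = n" using mexp_nilp(2)[OF assms] by auto
  then have "mlog h m (mexp h m A) = fev h (fps_ln 1) m (fev h (fps_exp 1 - 1) m A)"
    by (simp add: mlog_def mexp_minus_one[OF assms])
  also have "\<dots> = fev h (fps_ln 1 oo (fps_exp 1 - 1)) m A"
    by (rule fev_nil.fev_compose[OF fn[OF assms], symmetric]) simp
  also have "fps_ln 1 oo (fps_exp 1 - 1) = (fps_X :: 'a fps)"
    unfolding fps_ln_fps_exp_inv[OF one_neq_zero] by (rule fps_inv) auto
  finally show ?thesis using fev_nil.fev_X[OF fn[OF assms]] by simp
qed

lemma mexp_mlog: assumes "A \<in> carrier_mat n n" "nilp (A - 1\<^sub>m n)" shows "mexp h m (mlog h m A) = A"
proof -
  have d: "dim_row A = n" using assms by auto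
  note f = fn[OF assms(2)]
  have "mexp h m (mlog h m A) = fev h (fps_exp 1) m (fev h (fps_ln 1) m (A - 1\<^sub>m n))"
    by (simp add: mexp_def mlog_def d)
  also have "\<dots> = fev h (fps_exp 1 oo fps_ln 1) m (A - 1\<^sub>m n)"
    by (rule fev_nil.fev_compose[OF f, symmetric]) simp
  also have "fps_exp 1 oo fps_ln 1 = 1 + (fps_X :: 'a fps)"
  proof -
    have "(fps_exp 1 - 1) oo fps_ln 1 = (fps_X :: 'a fps)"
      unfolding fps_ln_fps_exp_inv[OF one_neq_zero] by (rule fps_inv_right) auto
    then show ?thesis by (simp add: fps_compose_sub_distrib algebra_simps)
  qed
  finally have "mexp h m (mlog h m A) = 1\<^sub>m n + (A - 1\<^sub>m n)"
    using fev_nil.fev_X[OF f] fev_nil.fev_one[OF f] fev_nil.fev_add[OF f] by simp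
  also have "\<dots> = A" using assms(1) by (intro eq_matI) auto
  finally show ?thesis .
qed

lemma nilp_smult: assumes "nilp A" shows "nilp (c \<cdot>\<^sub>m A)"
proof -
  have "A \<in> carrier_mat n n" using assms by simp
  from pow_mat_smult[OF this] assms show ?thesis by (auto intro!: eq_matI)
qed

text \<open>Scalars move into the series, where the addition law of one-parameter subgroups becomes
  \<open>fps_exp_add_mult\<close>.\<close>

lemma mexp_smult: assumes "nilp A" shows "mexp h m (h c \<cdot>\<^sub>m A) = fev h (fps_exp c) m A"
proof -
  have A: "A \<in> carrier_mat n n" using assms by simp
  show ?thesis
  proof (rule eq_matI)
    fix i j assume "i < dim_row (fev h (fps_exp c) m A)" "j < dim_col (fev h (fps_exp c) m A)"
    then have ij: "i < n" "j < n" using A by (auto simp: fev_def)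
    have "h (1 / fact k) * (h c ^ k * x) = h (c ^ k / fact k) * x" for k x
    proof -
      have "h (c ^ k / fact k) = h (1 / fact k * c ^ k)" by simp
      also have "\<dots> = h (1 / fact k) * h c ^ k" unfolding hom_mult hom_power ..
      finally show ?thesis by (simp only: mult.assoc)
    qed
    then show "mexp h m (h c \<cdot>\<^sub>m A) $$ (i, j) = fev h (fps_exp c) m A $$ (i, j)"
      using ij A unfolding mexp_def
      by (simp add: fev_index[of _ n] pow_mat_smult[OF A])
  qed (use A in \<open>auto simp: mexp_def fev_def\<close>)
qed

lemma mexp_add_scalar:
  assumes "nilp A" shows "mexp h m (h c \<cdot>\<^sub>m A) * mexp h m (h d \<cdot>\<^sub>m A) = mexp h m (h (c + d) \<cdot>\<^sub>m A)"
  unfolding mexp_smult[OF assms] fev_nil.fev_mult[OF fn[OF assms], symmetric] by (simp add: fps_exp_add_mult)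

lemma mexp_zero: "mexp h m (0\<^sub>m n n) = 1\<^sub>m n"
proof -
  have "nilp (0\<^sub>m n n)" using m by (cases m) auto
  then have "mexp h m (h 0 \<cdot>\<^sub>m 0\<^sub>m n n) = fev h (fps_exp 0) m (0\<^sub>m n n)" by (rule mexp_smult)
  moreover have "h 0 \<cdot>\<^sub>m 0\<^sub>m n n = (0\<^sub>m n n :: 'b mat)" by (intro eq_matI) auto
  ultimately show ?thesis using fev_nil.fev_one[OF fn[OF \<open>nilp (0\<^sub>m n n)\<close>]] by simp
qed

lemma mexp_of_nat: assumes "nilp A" shows "mexp h m (h (of_nat k) \<cdot>\<^sub>m A) = mexp h m A ^\<^sub>m k"
proof (induction k)
  case 0
  have "h 0 \<cdot>\<^sub>m A = 0\<^sub>m n n" using assms by (intro eq_matI) auto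
  then show ?case using mexp_zero mexp_nilp(2)[OF assms] by auto
next
  case (Suc k)
  have "h 1 \<cdot>\<^sub>m A = A" using assms by (intro eq_matI) auto
  then show ?case using mexp_add_scalar[OF assms, of "of_nat k" 1] Suc by (simp add: add.commute)
qed

lemma mexp_minus:
  assumes "nilp A" shows "mexp h m A * mexp h m (h (-1) \<cdot>\<^sub>m A) = 1\<^sub>m n" "mexp h m (h (-1) \<cdot>\<^sub>m A) * mexp h m A = 1\<^sub>m n"
proof -
  have "h 1 \<cdot>\<^sub>m A = A" "h 0 \<cdot>\<^sub>m A = 0\<^sub>m n n" using assms by (auto intro!: eq_matI)
  then show "mexp h m A * mexp h m (h (-1) \<cdot>\<^sub>m A) = 1\<^sub>m n" "mexp h m (h (-1) \<cdot>\<^sub>m A) * mexp h m A = 1\<^sub>m n"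
    using mexp_add_scalar[OF assms, of 1 "-1"] mexp_add_scalar[OF assms, of "-1" 1] mexp_zero by (simp_all del: hom_uminus)
qed

end

section \<open>Simultaneous triangularization\<close>

lemma vectors_dependent:
  fixes x :: "nat \<Rightarrow> 'a::field vec"
  assumes "\<And>k. k \<le> n \<Longrightarrow> x k \<in> carrier_vec n"
  obtains c k where "k \<le> n" "c k \<noteq> 0" "\<And>i. i < n \<Longrightarrow> (\<Sum>k\<le>n. c k * x k $ i) = 0"
proof -
  \<comment> \<open>The \<open>n + 1\<close> vectors are the columns, padded by a zero row at index
    \<open>n\<close>. The determinant therefore vanishes, and a kernel vector is the required
    relation.\<close>
  define A where "A = mat (Suc n) (Suc n) (\<lambda>(i, k). if i < n then x k $ i else 0)"
  have A: "A \<in> carrier_mat (Suc n) (Suc n)" by (simp add: A_def)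
  have "transpose_mat A *\<^sub>v unit_vec (Suc n) n = 0\<^sub>v (Suc n)"
    by (rule eq_vecI) (auto simp: A_def)
  moreover have "unit_vec (Suc n) n \<noteq> (0\<^sub>v (Suc n) :: 'a vec)"
    by (metis index_unit_vec(1) index_zero_vec(1) lessI zero_neq_one)
  ultimately have "det (transpose_mat A) = 0"
    using det_0_iff_vec_prod_zero_field[of "transpose_mat A" "Suc n"] A by (metis transpose_carrier_mat unit_vec_carrier)
  then have "det A = 0" using det_transpose[OF A] by simp
  then obtain v where v: "v \<in> carrier_vec (Suc n)" "v \<noteq> 0\<^sub>v (Suc n)" "A *\<^sub>v v = 0\<^sub>v (Suc n)"
    using det_0_iff_vec_prod_zero_field[OF A] by blast
  obtain k where k: "k \<le> n" "v $ k \<noteq> 0"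
  proof -
    have "\<exists>k<Suc n. v $ k \<noteq> 0" using v(1,2) by (metis carrier_vecD eq_vecI index_zero_vec(1,2))
    then show ?thesis using that less_Suc_eq_le by blast
  qed
  moreover have "(\<Sum>k\<le>n. v $ k * x k $ i) = 0" if i: "i < n" for i
  proof -
    have "(A *\<^sub>v v) $ i = (\<Sum>k<Suc n. A $$ (i, k) * v $ k)"
      using v(1) A i by (auto simp: scalar_prod_def atLeast0LessThan)
    also have "\<dots> = (\<Sum>k\<le>n. v $ k * x k $ i)"
      using i by (intro sum.cong) (auto simp: A_def)
    finally show ?thesis using v(3) i by simp
  qed
  ultimately show ?thesis using that by blast
qed

lemma mult_mat_vec_index:
  "A \<in> carrier_mat n m \<Longrightarrow> v \<in> carrier_vec m \<Longrightarrow> i < n \<Longrightarrow> (A *\<^sub>v v) $ i = (\<Sum>j<m. A $$ (i, j) * v $ j)"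
  by (auto simp: scalar_prod_def atLeast0LessThan)

text \<open>If no such \<open>v\<close> exists, there is a sequence \<open>x 0, x 1, ...\<close> outside the coordinate subspace with
  \<open>x (k + 1) \<in> I (x k)\<close>. A linear relation among its members gives \<open>x k = b x k\<close> with
  \<open>b \<in> I\<close> nilpotent.\<close>

lemma nil_algebra_vector:
  fixes I :: "'a::field mat set"
  assumes I: "I \<subseteq> carrier_mat n n" "0\<^sub>m n n \<in> I" "\<And>a b. a \<in> I \<Longrightarrow> b \<in> I \<Longrightarrow> a + b \<in> I"
    "\<And>a b. a \<in> I \<Longrightarrow> b \<in> I \<Longrightarrow> a * b \<in> I" "\<And>a c. a \<in> I \<Longrightarrow> c \<cdot>\<^sub>m a \<in> I"
    and nil: "\<And>a. a \<in> I \<Longrightarrow> \<exists>k. a ^\<^sub>m k = 0\<^sub>m n n" and r: "r < n"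
  obtains v where "v \<in> carrier_vec n" "\<exists>i\<ge>r. i < n \<and> v $ i \<noteq> 0"
    "\<And>a i. a \<in> I \<Longrightarrow> r \<le> i \<Longrightarrow> i < n \<Longrightarrow> (a *\<^sub>v v) $ i = 0"
proof (rule ccontr)
  assume no: "\<not> thesis"
  note obt = that
  define N where "N v \<longleftrightarrow> v \<in> carrier_vec n \<and> (\<exists>i\<ge>r. i < n \<and> v $ i \<noteq> 0)" for v :: "'a vec"
  have step: "\<exists>a\<in>I. N (a *\<^sub>v v)" if "N v" for v
  proof (rule ccontr)
    assume *: "\<not> ?thesis"
    have "(a *\<^sub>v v) $ i = 0" if "a \<in> I" "r \<le> i" "i < n" for a i
    proof -
      have "a *\<^sub>v v \<in> carrier_vec n" using I(1) \<open>a \<in> I\<close> \<open>N v\<close> by (auto simp: N_def)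
      with * that show ?thesis unfolding N_def by blast
    qed
    with \<open>N v\<close> have thesis unfolding N_def by (intro obt[of v]) auto
    with no show False ..
  qed
  define next_mat where "next_mat v = (SOME a. a \<in> I \<and> N (a *\<^sub>v v))" for v
  have nm: "next_mat v \<in> I" "N (next_mat v *\<^sub>v v)" if "N v" for v
    using someI_ex[of "\<lambda>a. a \<in> I \<and> N (a *\<^sub>v v)"] step[OF that] unfolding next_mat_def by blast+
  define x where "x k = ((\<lambda>v. next_mat v *\<^sub>v v) ^^ k) (unit_vec n r)" for k
  have xS: "x (Suc k) = next_mat (x k) *\<^sub>v x k" for k by (simp add: x_def)
  have N: "N (x k)" for k
  proof (induction k)
    case 0
    show ?case using r unfolding N_def x_def by auto
  qed (simp add: xS nm)
  then have xc: "x k \<in> carrier_vec n" for k by (simp add: N_def)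
  have later: "\<exists>b\<in>I. x (Suc k + d) = b *\<^sub>v x k" for k d
  proof (induction d)
    case 0
    show ?case using nm(1)[OF N] xS by auto
  next
    case (Suc d)
    then obtain b where b: "b \<in> I" "x (Suc k + d) = b *\<^sub>v x k" by blast
    have c: "next_mat (x (Suc k + d)) \<in> carrier_mat n n" "b \<in> carrier_mat n n" using nm(1)[OF N] b I(1) by blast+
    have "x (Suc k + Suc d) = next_mat (x (Suc k + d)) *\<^sub>v (b *\<^sub>v x k)"
      using xS[of "Suc k + d"] b(2) by simp
    also have "\<dots> = (next_mat (x (Suc k + d)) * b) *\<^sub>v x k"
      using assoc_mult_mat_vec[OF c xc] by simp
    finally show ?case using I(4)[OF nm(1)[OF N] b(1)] by blast
  qed
  obtain c k where ck: "k \<le> n" "c k \<noteq> 0" "\<And>i. i < n \<Longrightarrow> (\<Sum>k\<le>n. c k * x k $ i) = 0"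
    by (rule vectors_dependent[of n x], rule xc, rule that)
  \<comment> \<open>The earliest vector of the relation is a combination of later ones, and by
    \<open>later\<close> each of these has the form \<open>b *\<^sub>v x k0\<close> with
    \<open>b\<close> in \<open>I\<close>. A later choice of index would not allow this.\<close>
  define k0 where "k0 = (LEAST k. k \<le> n \<and> c k \<noteq> 0)"
  have k0: "k0 \<le> n" "c k0 \<noteq> 0" using LeastI[of "\<lambda>k. k \<le> n \<and> c k \<noteq> 0" k] ck unfolding k0_def by blast+
  have c0: "c k = 0" if "k < k0" for k
    using not_less_Least[of k "\<lambda>k. k \<le> n \<and> c k \<noteq> 0"] that k0(1) unfolding k0_def by simp
  have comb: "\<exists>b\<in>I. \<forall>i<n. (b *\<^sub>v x k0) $ i = (\<Sum>k\<in>J. d k * x k $ i)"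
    if "finite J" "J \<subseteq> {k0<..}" for J and d :: "nat \<Rightarrow> 'a"
    using that
  proof (induction J)
    case empty
    show ?case using I(2) xc[of k0] by (intro bexI[of _ "0\<^sub>m n n"]) auto
  next
    case (insert l J)
    then obtain b where b: "b \<in> I" "\<forall>i<n. (b *\<^sub>v x k0) $ i = (\<Sum>k\<in>J. d k * x k $ i)" by auto
    have "Suc k0 + (l - Suc k0) = l" using insert.prems by auto
    with later[of k0 "l - Suc k0"] obtain b' where b': "b' \<in> I" "x l = b' *\<^sub>v x k0" by metis
    have c: "b \<in> carrier_mat n n" "b' \<in> carrier_mat n n" using b b' I(1) by auto
    have "((d l \<cdot>\<^sub>m b' + b) *\<^sub>v x k0) $ i = (\<Sum>k\<in>insert l J. d k * x k $ i)" if "i < n" for i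
    proof -
      have "((d l \<cdot>\<^sub>m b' + b) *\<^sub>v x k0) $ i = d l * (b' *\<^sub>v x k0) $ i + (b *\<^sub>v x k0) $ i"
        using c xc[of k0] that
        by (simp add: mult_mat_vec_index[of _ n n] sum.distrib sum_distrib_left algebra_simps del: index_mult_mat_vec)
      then show ?thesis using b(2) b'(2) insert.hyps that by simp
    qed
    then show ?case using I(3)[OF I(5)[OF b'(1)] b(1)] by blast
  qed
  have Ioc_subset: "finite {k0<..n}" "{k0<..n} \<subseteq> {k0<..}" by auto
  obtain b where b: "b \<in> I" "\<forall>i<n. (b *\<^sub>v x k0) $ i = (\<Sum>k\<in>{k0<..n}. (- c k / c k0) * x k $ i)"
    using comb[of "{k0<..n}" "\<lambda>k. - c k / c k0"] Ioc_subset by blast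
  have bc: "b \<in> carrier_mat n n" using b I(1) by auto
  have bx: "b *\<^sub>v x k0 = x k0"
  proof (rule eq_vecI)
    fix i assume "i < dim_vec (x k0)"
    then have i: "i < n" using xc[of k0] by simp
    have "(\<Sum>k\<le>n. c k * x k $ i) = (\<Sum>k\<in>{k0..n}. c k * x k $ i)"
      by (rule sum.mono_neutral_right) (use c0 in auto)
    also have "\<dots> = c k0 * x k0 $ i + (\<Sum>k\<in>{k0<..n}. c k * x k $ i)"
      using k0(1) by (subst sum.head) auto
    finally have "c k0 * x k0 $ i = - (\<Sum>k\<in>{k0<..n}. c k * x k $ i)"
      using ck(3)[OF i] by (simp add: eq_neg_iff_add_eq_0)
    then have "x k0 $ i = - (\<Sum>k\<in>{k0<..n}. c k * x k $ i) / c k0" using k0(2) by (simp add: field_simps)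
    also have "\<dots> = (\<Sum>k\<in>{k0<..n}. (- c k / c k0) * x k $ i)"
      by (simp add: sum_divide_distrib sum_negf[symmetric])
    finally show "(b *\<^sub>v x k0) $ i = x k0 $ i" using b(2) i by simp
  qed (use bc xc[of k0] in auto)
  have bk: "b ^\<^sub>m k *\<^sub>v x k0 = x k0" for k
  proof (induction k)
    case 0
    then show ?case using bc xc by auto
  next
    case (Suc k)
    then show ?case using bx assoc_mult_mat_vec[OF pow_carrier_mat[OF bc] bc xc] by simp
  qed
  obtain k where "b ^\<^sub>m k = 0\<^sub>m n n" using nil[OF b(1)] by blast
  moreover have "0\<^sub>m n n *\<^sub>v x k0 = 0\<^sub>v n" by (rule eq_vecI) (use xc[of k0] in auto)
  ultimately have "x k0 = 0\<^sub>v n" using bk[of k] by simp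
  then show False using N[of k0] by (auto simp: N_def)
qed

text \<open>Column \<open>r\<close> of the identity is replaced by \<open>v\<close>, and, to keep the matrix invertible, column
  \<open>i0\<close> by \<open>e\<^sub>r\<close>.\<close>

lemma extend_basis:
  fixes v :: "'a::field vec"
  assumes v: "v \<in> carrier_vec n" "r \<le> i0" "i0 < n" "v $ i0 \<noteq> 0"
  obtains Q Q' where "Q \<in> carrier_mat n n" "Q' \<in> carrier_mat n n" "Q * Q' = 1\<^sub>m n" "Q' * Q = 1\<^sub>m n"
    "\<And>i j. i < n \<Longrightarrow> j < r \<Longrightarrow> Q $$ (i, j) = (if i = j then 1 else 0)" "\<And>i. i < n \<Longrightarrow> Q $$ (i, r) = v $ i"
proof -
  define \<tau> where "\<tau> j = (if j = r then i0 else if j = i0 then r else j)" for j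
  define Q where "Q = mat n n (\<lambda>(i, j). if j = r then v $ i else if i = \<tau> j then 1 else 0)"
  have Q: "Q \<in> carrier_mat n n" by (simp add: Q_def)
  have \<tau>: "\<tau> (\<tau> j) = j" "j < n \<Longrightarrow> \<tau> j < n" "\<tau> r = i0" "\<tau> i0 = r" for j using v by (auto simp: \<tau>_def)
  have "det Q \<noteq> 0"
  proof
    assume "det Q = 0"
    then obtain w where w: "w \<in> carrier_vec n" "w \<noteq> 0\<^sub>v n" "Q *\<^sub>v w = 0\<^sub>v n"
      using det_0_iff_vec_prod_zero_field[OF Q] by blast
    have Qw: "v $ i * w $ r + (if \<tau> i = r then 0 else w $ \<tau> i) = 0" if i: "i < n" for i
    proof -
      have "(Q *\<^sub>v w) $ i = (\<Sum>j<n. Q $$ (i, j) * w $ j)" by (rule mult_mat_vec_index[OF Q w(1) i])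
      also have "\<dots> = Q $$ (i, r) * w $ r + (\<Sum>j\<in>{..<n} - {r}. Q $$ (i, j) * w $ j)"
        using v by (subst sum.remove[of _ r]) auto
      also have "(\<Sum>j\<in>{..<n} - {r}. Q $$ (i, j) * w $ j) = (\<Sum>j\<in>{..<n} - {r}. if j = \<tau> i then w $ j else 0)"
        using i \<tau> by (intro sum.cong) (auto simp: Q_def)
      also have "\<dots> = (if \<tau> i = r then 0 else w $ \<tau> i)" using \<tau>(2)[OF i] by (simp add: sum.delta)
      also have "Q $$ (i, r) = v $ i" using i v by (auto simp: Q_def)
      finally show ?thesis using w(3) i by simp
    qed
    have wr: "w $ r = 0" using Qw[OF v(3)] \<tau>(4) v(4) by simp
    have "w $ j = 0" if "j < n" for j
    proof (cases "j = r")
      case False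
      then show ?thesis using Qw[OF \<tau>(2)[OF that]] wr \<tau>(1) by simp
    qed (use wr in simp)
    then show False using w by (metis carrier_vecD eq_vecI index_zero_vec(1,2))
  qed
  note m = minv[OF Q this]
  show ?thesis
    by (rule that[OF Q m]) (use v in \<open>auto simp: Q_def \<tau>_def\<close>)
qed

lemma mat_vec_eq_imp:
  "A \<in> carrier_mat n m \<Longrightarrow> B \<in> carrier_mat m m \<Longrightarrow> j < m \<Longrightarrow> i < n \<Longrightarrow>
    (A * B) $$ (i, j) = (A *\<^sub>v col B j) $ i"
  by auto

text \<open>Each matrix \<open>A\<close> carries the support \<open>R\<close> it should acquire, so
  different shapes can be reached in one basis. The basis is built vector by vector:
  \<open>v\<close> is new modulo the first \<open>r\<close> basis vectors, \<open>l\<close> becomes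
  the diagonal entry of its column and \<open>s\<close> the permitted part above it.\<close>

lemma simultaneous_triangular:
  fixes \<A> :: "('a::field mat \<times> (nat \<Rightarrow> nat \<Rightarrow> bool)) set"
  assumes c: "\<And>A R. (A, R) \<in> \<A> \<Longrightarrow> A \<in> carrier_mat n n" "\<And>A R i j. (A, R) \<in> \<A> \<Longrightarrow> R i j \<Longrightarrow> i \<le> j"
    and step: "\<And>r P P'. r < n \<Longrightarrow> P \<in> carrier_mat n n \<Longrightarrow> P' \<in> carrier_mat n n \<Longrightarrow> P * P' = 1\<^sub>m n \<Longrightarrow> P' * P = 1\<^sub>m n \<Longrightarrow>
      (\<And>A R i j. (A, R) \<in> \<A> \<Longrightarrow> j < r \<Longrightarrow> i < n \<Longrightarrow> \<not> R i j \<Longrightarrow> (P' * A * P) $$ (i, j) = 0) \<Longrightarrow>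
      \<exists>v\<in>carrier_vec n. (\<exists>i\<ge>r. i < n \<and> v $ i \<noteq> 0) \<and> (\<forall>A R. (A, R) \<in> \<A> \<longrightarrow> (\<exists>l s. s \<in> carrier_vec n \<and>
        (P' * A * P) *\<^sub>v v = l \<cdot>\<^sub>v v + s \<and> (\<forall>i<n. \<not> (i < r \<and> R i r) \<longrightarrow> s $ i = 0) \<and> (\<not> R r r \<longrightarrow> l = 0)))"
  obtains P P' where "P \<in> carrier_mat n n" "P' \<in> carrier_mat n n" "P * P' = 1\<^sub>m n" "P' * P = 1\<^sub>m n"
    "\<And>A R. (A, R) \<in> \<A> \<Longrightarrow> pat n R (P' * A * P)"
proof -
  have "\<exists>P P'. P \<in> carrier_mat n n \<and> P' \<in> carrier_mat n n \<and> P * P' = 1\<^sub>m n \<and> P' * P = 1\<^sub>m n \<and>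
    (\<forall>A R. (A, R) \<in> \<A> \<longrightarrow> (\<forall>j<r. \<forall>i<n. \<not> R i j \<longrightarrow> (P' * A * P) $$ (i, j) = 0))" if "r \<le> n" for r
    using that
  proof (induction r)
    case 0
    show ?case by (intro exI[of _ "1\<^sub>m n"]) auto
  next
    case (Suc r)
    from Suc.IH[OF Suc_leD[OF Suc.prems]] obtain P P' where PP: "P \<in> carrier_mat n n \<and> P' \<in> carrier_mat n n \<and> P * P' = 1\<^sub>m n \<and> P' * P = 1\<^sub>m n \<and>
    (\<forall>A R. (A, R) \<in> \<A> \<longrightarrow> (\<forall>j<r. \<forall>i<n. \<not> R i j \<longrightarrow> (P' * A * P) $$ (i, j) = 0))" by (elim exE)
    then have P: "P \<in> carrier_mat n n" "P' \<in> carrier_mat n n" "P * P' = 1\<^sub>m n" "P' * P = 1\<^sub>m n" by blast+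
    have cols: "\<And>A R i j. (A, R) \<in> \<A> \<Longrightarrow> j < r \<Longrightarrow> i < n \<Longrightarrow> \<not> R i j \<Longrightarrow> (P' * A * P) $$ (i, j) = 0"
      using PP by blast
    have r: "r < n" using Suc.prems by simp
    note st = step[OF r P]
    have "\<exists>v\<in>carrier_vec n. (\<exists>i\<ge>r. i < n \<and> v $ i \<noteq> 0) \<and> (\<forall>A R. (A, R) \<in> \<A> \<longrightarrow> (\<exists>l s. s \<in> carrier_vec n \<and>
        (P' * A * P) *\<^sub>v v = l \<cdot>\<^sub>v v + s \<and> (\<forall>i<n. \<not> (i < r \<and> R i r) \<longrightarrow> s $ i = 0) \<and> (\<not> R r r \<longrightarrow> l = 0)))"
      by (rule st) (rule cols)
    then obtain v where v1: "v \<in> carrier_vec n" and v2: "(\<exists>i\<ge>r. i < n \<and> v $ i \<noteq> 0) \<and> (\<forall>A R. (A, R) \<in> \<A> \<longrightarrow> (\<exists>l s. s \<in> carrier_vec n \<and>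
        (P' * A * P) *\<^sub>v v = l \<cdot>\<^sub>v v + s \<and> (\<forall>i<n. \<not> (i < r \<and> R i r) \<longrightarrow> s $ i = 0) \<and> (\<not> R r r \<longrightarrow> l = 0)))"
      by (elim bexE)
    have vA: "\<exists>l s. s \<in> carrier_vec n \<and>
        (P' * A * P) *\<^sub>v v = l \<cdot>\<^sub>v v + s \<and> (\<forall>i<n. \<not> (i < r \<and> R i r) \<longrightarrow> s $ i = 0) \<and> (\<not> R r r \<longrightarrow> l = 0)"
      if "(A, R) \<in> \<A>" for A R using conjunct2[OF v2, rule_format, OF that] .
    from v1 conjunct1[OF v2] obtain i0 where v: "v \<in> carrier_vec n" "r \<le> i0" "i0 < n" "v $ i0 \<noteq> 0" by blast
    obtain Q Q' where Q: "Q \<in> carrier_mat n n" "Q' \<in> carrier_mat n n" "Q * Q' = 1\<^sub>m n" "Q' * Q = 1\<^sub>m n"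
      and Qe: "\<And>i j. i < n \<Longrightarrow> j < r \<Longrightarrow> Q $$ (i, j) = (if i = j then 1 else 0)" "\<And>i. i < n \<Longrightarrow> Q $$ (i, r) = v $ i"
      using extend_basis[OF v] by metis
    have Q_col: "col Q j = unit_vec n j" if "j < r" for j
      using that r Q(1) Qe(1) by (intro eq_vecI) auto
    have Q_colr: "col Q r = v" using r Q(1) Qe(2) v(1) by (intro eq_vecI) auto
    have Q'Q: "Q' *\<^sub>v (Q *\<^sub>v w) = w" if "w \<in> carrier_vec n" for w
      using assoc_mult_mat_vec[OF Q(2,1) that] Q(4) that by simp
    \<comment> \<open>\<open>Q\<close>, and hence \<open>Q'\<close>, fixes the span of the first
      \<open>r\<close> basis vectors. So the columns already treated are unchanged, and the part
      \<open>s\<close> of the new column stays in place.\<close>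
    have Q_fix: "Q *\<^sub>v s = s" if s: "s \<in> carrier_vec n" "\<And>i. r \<le> i \<Longrightarrow> i < n \<Longrightarrow> s $ i = 0" for s
    proof (rule eq_vecI)
      fix i assume "i < dim_vec s"
      then have i: "i < n" using s by simp
      have "(Q *\<^sub>v s) $ i = (\<Sum>j<n. Q $$ (i, j) * s $ j)" by (rule mult_mat_vec_index[OF Q(1) s(1) i])
      also have "\<dots> = (\<Sum>j<n. if j = i then s $ i else 0)"
      proof (rule sum.cong[OF refl])
        fix j assume "j \<in> {..<n}"
        then show "Q $$ (i, j) * s $ j = (if j = i then s $ i else 0)"
          using Qe(1)[OF i, of j] s(2)[of j] s(2)[of i] i by (cases "j < r") auto
      qed
      also have "\<dots> = s $ i" using i by (simp add: sum.delta)
      finally show "(Q *\<^sub>v s) $ i = s $ i" .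
    qed (use Q s in auto)
    have new: "((Q' * P') * A * (P * Q)) $$ (i, j) = 0" if A: "(A, R) \<in> \<A>" and ij: "j < Suc r" "i < n" "\<not> R i j" for A R i j
    proof -
      let ?B = "P' * A * P"
      have Ac: "A \<in> carrier_mat n n" by (rule c(1)[OF A])
      have B: "?B \<in> carrier_mat n n" using P Ac by auto
      have jn: "j < n" using ij r by simp
      have "(Q' * P') * A * (P * Q) = Q' * ?B * Q"
        using P(1,2) Q(1,2) Ac by (smt (verit) assoc_mult_mat mult_carrier_mat)
      then have e: "((Q' * P') * A * (P * Q)) $$ (i, j) = (Q' *\<^sub>v (?B *\<^sub>v col Q j)) $ i"
        using mat_vec_eq_imp[of "Q' * ?B" n n Q j i] assoc_mult_mat_vec[OF Q(2) B, of "col Q j"] Q B jn ij(2) by auto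
      show ?thesis
      proof (cases "j < r")
        case True
        let ?s = "?B *\<^sub>v col Q j"
        have s: "?s \<in> carrier_vec n" using B Q(1) jn by auto
        have sB: "?s $ k = ?B $$ (k, j)" if "k < n" for k
          unfolding Q_col[OF True] using B that jn by (simp del: index_mult_mat add: mult_mat_vec_index[OF B _ that] if_distrib cong: if_cong)
        have "?s $ k = 0" if "r \<le> k" "k < n" for k
          using sB[OF that(2)] cols[OF A True that(2)] c(2)[OF A, of k j] True that by auto
        then have "Q' *\<^sub>v ?s = ?s" using Q_fix[OF s] Q'Q[OF s] by metis
        then show ?thesis unfolding e using sB[OF ij(2)] cols[OF A True ij(2,3)] by simp
      next
        case False
        then have j: "j = r" using ij by simp
        obtain l s where s: "s \<in> carrier_vec n" "?B *\<^sub>v v = l \<cdot>\<^sub>v v + s"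
          "\<And>k. k < n \<Longrightarrow> \<not> (k < r \<and> R k r) \<Longrightarrow> s $ k = 0" "\<not> R r r \<Longrightarrow> l = 0" using vA[OF A] by blast
        have "Q' *\<^sub>v s = s" using Q_fix[OF s(1)] Q'Q[OF s(1)] s(3) by (metis not_le)
        moreover have "Q' *\<^sub>v v = unit_vec n r"
        proof -
          have "Q *\<^sub>v unit_vec n r = v" using Q_colr Q(1) r v(1) Qe(2) by (intro eq_vecI) auto
          then show ?thesis using Q'Q[of "unit_vec n r"] by simp
        qed
        ultimately have "Q' *\<^sub>v (?B *\<^sub>v col Q j) = l \<cdot>\<^sub>v unit_vec n r + s"
          unfolding j Q_colr s(2) using Q(2) v(1) s(1)
          by (simp add: mult_add_distrib_mat_vec[of _ n n] mult_mat_vec[of _ n n])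
        then have "((Q' * P') * A * (P * Q)) $$ (i, j) = l * (if i = r then 1 else 0) + s $ i"
          unfolding e using ij(2) s(1) r by simp
        then show ?thesis using ij(2,3) s(3)[OF ij(2)] s(4) j by auto
      qed
    qed
    have "P * Q * (Q' * P') = P * (Q * Q') * P'" "Q' * P' * (P * Q) = Q' * (P' * P) * Q"
      using P(1,2) Q(1,2) by (smt (verit) assoc_mult_mat mult_carrier_mat)+
    then have inv: "P * Q * (Q' * P') = 1\<^sub>m n" "Q' * P' * (P * Q) = 1\<^sub>m n"
      unfolding P(4) Q(3) using P Q by simp_all
    have "P * Q \<in> carrier_mat n n" "Q' * P' \<in> carrier_mat n n" using P Q by auto
    with inv new show ?case
      by (rule_tac exI[of _ "P * Q"], rule_tac exI[of _ "Q' * P'"]) blast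
  qed
  from this[of n] obtain P P' where PP: "P \<in> carrier_mat n n \<and> P' \<in> carrier_mat n n \<and> P * P' = 1\<^sub>m n \<and> P' * P = 1\<^sub>m n \<and>
    (\<forall>A R. (A, R) \<in> \<A> \<longrightarrow> (\<forall>j<n. \<forall>i<n. \<not> R i j \<longrightarrow> (P' * A * P) $$ (i, j) = 0))" by auto
  then have P: "P \<in> carrier_mat n n" "P' \<in> carrier_mat n n" "P * P' = 1\<^sub>m n" "P' * P = 1\<^sub>m n" by blast+
  have "pat n R (P' * A * P)" if "(A, R) \<in> \<A>" for A R
  proof -
    have "P' * A * P \<in> carrier_mat n n" using P(1,2) c(1)[OF that] by auto
    then show ?thesis unfolding pat_def using PP that by blast
  qed
  then show ?thesis by (rule that[OF P])
qed

text \<open>The next basis vector is an eigenvector of the lower right block, that is, of the map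
  induced on the quotient by the first \<open>r\<close> basis vectors. It exists because the field
  is algebraically closed.\<close>

lemma triangularize:
  fixes A :: "'a::alg_closed_field mat"
  assumes A: "A \<in> carrier_mat n n"
  obtains P P' where "P \<in> carrier_mat n n" "P' \<in> carrier_mat n n" "P * P' = 1\<^sub>m n" "P' * P = 1\<^sub>m n"
    "pat n (\<le>) (P' * A * P)"
proof (rule simultaneous_triangular[of "{(A, (\<le>))}" n])
  fix r P P'
  assume r: "r < n" and P: "P \<in> carrier_mat n n" "P' \<in> carrier_mat n n"
    and cols: "\<And>A' R i j. (A', R) \<in> {(A, (\<le>))} \<Longrightarrow> j < r \<Longrightarrow> i < n \<Longrightarrow> \<not> R i j \<Longrightarrow> (P' * A' * P) $$ (i, j) = 0"
  define B where "B = P' * A * P"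
  have B: "B \<in> carrier_mat n n" using P A by (simp add: B_def)
  have B0: "B $$ (i, j) = 0" if "j < r" "r \<le> i" "i < n" for i j
    unfolding B_def by (rule cols[of A "(\<le>)"]) (use that in auto)
  define C where "C = mat (n - r) (n - r) (\<lambda>(i, j). B $$ (i + r, j + r))"
  have C: "C \<in> carrier_mat (n - r) (n - r)" by (simp add: C_def)
  have "degree (char_poly C) > 0" using degree_monic_char_poly[OF C] r by simp
  then obtain l where "poly (char_poly C) l = 0" using alg_closed_imp_poly_has_root by blast
  then have "eigenvalue C l" using eigenvalue_root_char_poly[OF C] by simp
  then obtain w where w: "w \<in> carrier_vec (n - r)" "w \<noteq> 0\<^sub>v (n - r)" "C *\<^sub>v w = l \<cdot>\<^sub>v w"
    using C by (auto simp: eigenvalue_def eigenvector_def)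
  obtain i0 where i0: "i0 < n - r" "w $ i0 \<noteq> 0" using w(1,2) by (metis carrier_vecD eq_vecI index_zero_vec(1,2))
  define v where "v = vec n (\<lambda>i. if i < r then 0 else w $ (i - r))"
  define s where "s = B *\<^sub>v v - l \<cdot>\<^sub>v v"
  have v: "v \<in> carrier_vec n" by (simp add: v_def)
  have s: "s \<in> carrier_vec n" using B v by (simp add: s_def)
  have Bv: "B *\<^sub>v v = l \<cdot>\<^sub>v v + s"
    using B v unfolding s_def by (intro eq_vecI) auto
  have s0: "s $ i = 0" if i: "r \<le> i" "i < n" for i
  proof -
    have "(B *\<^sub>v v) $ i = (\<Sum>j<n. B $$ (i, j) * v $ j)" by (rule mult_mat_vec_index[OF B v i(2)])
    also have "\<dots> = (\<Sum>j\<in>{r..<n}. B $$ (i, j) * w $ (j - r))"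
      by (rule sum.mono_neutral_cong_right) (auto simp: v_def)
    also have "\<dots> = (\<Sum>j<n - r. B $$ (i, j + r) * w $ j)"
      by (rule sum.reindex_bij_witness[of _ "\<lambda>j. j + r" "\<lambda>j. j - r"]) auto
    also have "\<dots> = (\<Sum>j<n - r. C $$ (i - r, j) * w $ j)"
      using i by (intro sum.cong) (auto simp: C_def)
    also have "\<dots> = (C *\<^sub>v w) $ (i - r)"
      using mult_mat_vec_index[OF C w(1), of "i - r"] i by simp
    also have "\<dots> = l * v $ i" unfolding w(3) using i w(1) by (auto simp: v_def)
    finally show ?thesis using B v i by (simp add: s_def)
  qed
  have "\<exists>i\<ge>r. i < n \<and> v $ i \<noteq> 0" using i0 by (intro exI[of _ "i0 + r"]) (auto simp: v_def)
  moreover have "\<exists>l s. s \<in> carrier_vec n \<and> (P' * A' * P) *\<^sub>v v = l \<cdot>\<^sub>v v + s \<and>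
      (\<forall>i<n. \<not> (i < r \<and> R i r) \<longrightarrow> s $ i = 0) \<and> (\<not> R r r \<longrightarrow> l = 0)"
    if "(A', R) \<in> {(A, (\<le>))}" for A' R
    by (rule exI[of _ l], rule exI[of _ s]) (use that Bv s s0 in \<open>auto simp: B_def\<close>)
  ultimately show "\<exists>v\<in>carrier_vec n. (\<exists>i\<ge>r. i < n \<and> v $ i \<noteq> 0) \<and> (\<forall>A' R. (A', R) \<in> {(A, (\<le>))} \<longrightarrow>
      (\<exists>l s. s \<in> carrier_vec n \<and> (P' * A' * P) *\<^sub>v v = l \<cdot>\<^sub>v v + s \<and>
      (\<forall>i<n. \<not> (i < r \<and> R i r) \<longrightarrow> s $ i = 0) \<and> (\<not> R r r \<longrightarrow> l = 0)))"
    using v by blast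
next
  fix P P' assume "P \<in> carrier_mat n n" "P' \<in> carrier_mat n n" "P * P' = 1\<^sub>m n" "P' * P = 1\<^sub>m n"
    "\<And>A' R. (A', R) \<in> {(A, (\<le>))} \<Longrightarrow> pat n R (P' * A' * P)"
  then show thesis by (intro that[of P P']) auto
qed (use A in auto)

section \<open>Traces and nilpotence\<close>

definition mtrace :: "'b::comm_monoid_add mat \<Rightarrow> 'b" where
  "mtrace A = (\<Sum>i<dim_row A. A $$ (i, i))"

lemma mtrace_mult_commute:
  assumes "A \<in> carrier_mat n m" "B \<in> carrier_mat m n"
  shows "mtrace (A * B) = mtrace (B * (A :: 'b::comm_ring_1 mat))"
proof -
  have "mtrace (A * B) = (\<Sum>i<n. \<Sum>j<m. A $$ (i, j) * B $$ (j, i))"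
    using assms by (simp add: mtrace_def index_mult_mat_sum[OF assms] del: index_mult_mat(1))
  also have "\<dots> = (\<Sum>j<m. \<Sum>i<n. B $$ (j, i) * A $$ (i, j))"
    by (subst sum.swap) (simp add: mult.commute)
  also have "\<dots> = mtrace (B * A)"
    using assms by (simp add: mtrace_def index_mult_mat_sum[OF assms(2,1)] del: index_mult_mat(1))
  finally show ?thesis .
qed

lemma mtrace_conj:
  assumes "P \<in> carrier_mat n n" "P' \<in> carrier_mat n n" "A \<in> carrier_mat n n" "P * P' = (1\<^sub>m n :: 'b::comm_ring_1 mat)"
  shows "mtrace (P' * A * P) = mtrace A"
proof -
  have "mtrace (P' * A * P) = mtrace (P * (P' * A))"
    using assms by (intro mtrace_mult_commute) auto
  also have "P * (P' * A) = P * P' * A" using assms(1-3) by (rule assoc_mult_mat[symmetric])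
  finally show ?thesis using assms by simp
qed

lemma upper_pow_diag:
  assumes "pat n (\<le>) (T :: 'b::comm_ring_1 mat)" "i < n"
  shows "(T ^\<^sub>m k) $$ (i, i) = T $$ (i, i) ^ k"
proof (induction k)
  case 0
  show ?case using assms patD(1)[OF assms(1)] by auto
next
  case (Suc k)
  have T: "T \<in> carrier_mat n n" by (rule patD(1)[OF assms(1)])
  have "(T ^\<^sub>m k) $$ (i, l) * T $$ (l, i) = (if l = i then T $$ (i, i) ^ k * T $$ (i, i) else 0)" if l: "l < n" for l
  proof (cases "k = 0")
    case True
    then show ?thesis using Suc l assms(2) T by auto
  next
    case False
    have "pat n (\<le>) (T ^\<^sub>m k)" by (rule pat_pow[OF assms(1)]) (use False in auto)
    from patD(2)[OF this assms(2) l] patD(2)[OF assms(1) l assms(2)] Suc show ?thesis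
      by (cases "l = i") (auto simp: not_le linorder_neq_iff)
  qed
  then have "(T ^\<^sub>m Suc k) $$ (i, i) = (\<Sum>l<n. if l = i then T $$ (i, i) ^ k * T $$ (i, i) else 0)"
    unfolding pow_mat.simps index_mult_mat_sum[OF pow_carrier_mat[OF T] T assms(2,2)] by simp
  then show ?case using assms(2) by (simp add: sum.delta mult.commute)
qed

text \<open>The polynomial \<open>p\<close> vanishes at \<open>0\<close> and at all values other
  than \<open>l i\<close>. Without constant term, the sum of the \<open>p (l j)\<close> is a
  combination of power sums, hence zero; it is also \<open>p (l i)\<close> times the multiplicity of
  \<open>l i\<close>, which is nonzero in characteristic 0.\<close>

lemma power_sums_zero:
  fixes l :: "nat \<Rightarrow> 'a::field_char_0"
  assumes "\<And>k. k > 0 \<Longrightarrow> (\<Sum>i<n. l i ^ k) = 0" "i < n"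
  shows "l i = 0"
proof (rule ccontr)
  assume nz: "l i \<noteq> 0"
  define \<Lambda> where "\<Lambda> = l ` {..<n} - {l i}"
  define p where "p = [:0, 1:] * (\<Prod>\<mu>\<in>\<Lambda>. [:- \<mu>, 1:])"
  have f: "finite \<Lambda>" by (simp add: \<Lambda>_def)
  have "poly p 0 = 0" by (simp add: p_def)
  then have c0: "coeff p 0 = 0" by (simp add: poly_0_coeff_0)
  have "(\<Sum>j<n. poly p (l j)) = (\<Sum>k\<le>degree p. coeff p k * (\<Sum>j<n. l j ^ k))"
    unfolding poly_altdef by (subst sum.swap) (simp add: sum_distrib_left)
  also have "\<dots> = 0"
  proof (rule sum.neutral, rule ballI)
    fix k show "coeff p k * (\<Sum>j<n. l j ^ k) = 0" using c0 assms(1) by (cases "k = 0") auto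
  qed
  finally have s: "(\<Sum>j<n. poly p (l j)) = 0" .
  have "poly p (l j) = (if l j = l i then poly p (l i) else 0)" if "j < n" for j
    using that f by (auto simp: p_def poly_prod \<Lambda>_def)
  then have "(\<Sum>j<n. poly p (l j)) = (\<Sum>j<n. if l j = l i then poly p (l i) else 0)" by simp
  also have "\<dots> = (\<Sum>j\<in>{j\<in>{..<n}. l j = l i}. poly p (l i))"
    by (rule sum.inter_filter[symmetric]) simp
  also have "\<dots> = of_nat (card {j\<in>{..<n}. l j = l i}) * poly p (l i)" by simp
  finally have "card {j\<in>{..<n}. l j = l i} = 0 \<or> poly p (l i) = 0" using s by simp
  moreover have "poly p (l i) \<noteq> 0" using nz f by (auto simp: p_def poly_prod \<Lambda>_def)
  moreover have "i \<in> {j\<in>{..<n}. l j = l i}" using assms(2) by simp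
  moreover have "finite {j\<in>{..<n}. l j = l i}" by simp
  ultimately show False by (metis card_0_eq empty_iff)
qed

lemma conj_back:
  assumes "P \<in> carrier_mat n n" "P' \<in> carrier_mat n n" "A \<in> carrier_mat n n" "P * P' = (1\<^sub>m n :: 'b::comm_ring_1 mat)"
  shows "P * (P' * A * P) * P' = A"
proof -
  have "P * (P' * A * P) * P' = (P * P') * A * (P * P')"
    using assms(1-3) by (smt (verit) assoc_mult_mat mult_carrier_mat)
  with assms show ?thesis by simp
qed

text \<open>In triangular form the traces of the powers are the power sums of the diagonal, which
  therefore vanishes.\<close>

lemma nilpotent_by_trace:
  fixes A :: "'a::{alg_closed_field,field_char_0} mat"
  assumes A: "A \<in> carrier_mat n n" and tr: "\<And>k. k > 0 \<Longrightarrow> mtrace (A ^\<^sub>m k) = 0"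
  shows "A ^\<^sub>m n = 0\<^sub>m n n"
proof -
  obtain P P' where P: "P \<in> carrier_mat n n" "P' \<in> carrier_mat n n" "P * P' = 1\<^sub>m n" "P' * P = 1\<^sub>m n"
    and T: "pat n (\<le>) (P' * A * P)" using triangularize[OF A] .
  let ?T = "P' * A * P"
  have "dim_row ?T = n" using patD(1)[OF T] by (rule carrier_matD)
  then have dim: "dim_row (?T ^\<^sub>m k) = n" for k by (simp only: pow_mat_dim_square[OF patD(1)[OF T]])
  have "(\<Sum>i<n. ?T $$ (i, i) ^ k) = 0" if "k > 0" for k
  proof -
    have "mtrace (?T ^\<^sub>m k) = 0"
      unfolding pow_mat_conj[OF P(2,1) A P(3,4)]
      using mtrace_conj[OF P(1,2) pow_carrier_mat[OF A] P(3)] tr[OF that] by simp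
    then show ?thesis unfolding mtrace_def dim by (simp add: upper_pow_diag[OF T])
  qed
  from power_sums_zero[OF this] have d: "?T $$ (i, i) = 0" if "i < n" for i using that by simp
  have "upat n 1 ?T"
    unfolding pat_def
  proof (intro conjI allI impI)
    fix i j assume "i < n" "j < n" "\<not> i + 1 \<le> j"
    then show "?T $$ (i, j) = 0" using patD(2)[OF T, of i j] d[of i] by (cases "i = j") auto
  qed (rule patD(1)[OF T])
  then have "?T ^\<^sub>m n = 0\<^sub>m n n" by (rule upat_nilpotent)
  then have "P' * A ^\<^sub>m n * P = 0\<^sub>m n n" using pow_mat_conj[OF P(2,1) A P(3,4)] by simp
  then show ?thesis using conj_back[OF P(1,2) pow_carrier_mat[OF A] P(3), of n] P(1,2) by simp
qed

lemma nilpotent_trace: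
  fixes A :: "'a::alg_closed_field mat"
  assumes A: "A \<in> carrier_mat n n" and nil: "A ^\<^sub>m k = 0\<^sub>m n n"
  shows "mtrace A = 0"
proof -
  obtain P P' where P: "P \<in> carrier_mat n n" "P' \<in> carrier_mat n n" "P * P' = 1\<^sub>m n" "P' * P = 1\<^sub>m n"
    and T: "pat n (\<le>) (P' * A * P)" using triangularize[OF A] .
  let ?T = "P' * A * P"
  have "?T ^\<^sub>m k = 0\<^sub>m n n" using pow_mat_conj[OF P(2,1) A P(3,4), of k] nil P by simp
  then have "?T $$ (i, i) ^ k = 0" if "i < n" for i using upper_pow_diag[OF T that, of k] that by simp
  moreover have "dim_row ?T = n" using patD(1)[OF T] by (rule carrier_matD)
  ultimately have "mtrace ?T = 0" unfolding mtrace_def by simp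
  then show ?thesis using mtrace_conj[OF P(1,2) A P(3)] by simp
qed

text \<open>Multiplication by \<open>s powi (- Min K)\<close> leaves a polynomial with infinitely
  many zeros. All comparisons of coefficients in a torus parameter below rest on this.\<close>

lemma laurent_poly_zero:
  fixes c :: "int \<Rightarrow> 'a::field_char_0"
  assumes K: "finite K" and z: "\<And>s. s \<noteq> 0 \<Longrightarrow> (\<Sum>k\<in>K. s powi k * c k) = 0" and k: "k \<in> K"
  shows "c k = 0"
proof -
  define m where "m = Min K"
  define p where "p = (\<Sum>k\<in>K. Polynomial.monom (c k) (nat (k - m)))"
  have m: "m \<le> k" if "k \<in> K" for k using K that by (simp add: m_def)
  have "poly p s = 0" if s: "s \<noteq> 0" for s
  proof -
    have "poly p s = (\<Sum>k\<in>K. s powi (- m) * (s powi k * c k))"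
      unfolding p_def poly_sum poly_monom
    proof (rule sum.cong[OF refl])
      fix k assume "k \<in> K"
      then have "s ^ nat (k - m) = s powi (k - m)" using m by (simp add: power_int_def)
      also have "\<dots> = s powi (- m) * s powi k" using s by (simp add: power_int_add[symmetric])
      finally show "c k * s ^ nat (k - m) = s powi (- m) * (s powi k * c k)" by simp
    qed
    also have "\<dots> = s powi (- m) * (\<Sum>k\<in>K. s powi k * c k)" by (simp add: sum_distrib_left)
    finally show ?thesis using z[OF s] by simp
  qed
  then have "UNIV - {0} \<subseteq> {s. poly p s = 0}" by auto
  moreover have "infinite (UNIV - {0 :: 'a})" using infinite_UNIV_char_0[where ?'a = 'a] by simp
  ultimately have "p = 0" using poly_roots_finite[of p] finite_subset by blast
  then have "0 = coeff p (nat (k - m))" by simp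
  also have "\<dots> = (\<Sum>k'\<in>K. if k' = k then c k else 0)"
    unfolding p_def coeff_sum coeff_monom using m k by (intro sum.cong) (auto simp: nat_eq_iff)
  also have "\<dots> = c k" using K k by (simp add: sum.delta)
  finally show ?thesis by simp
qed

inductive_set lin_span :: "'b::comm_ring_1 mat set \<Rightarrow> nat \<Rightarrow> 'b mat set" for S n where
  zero: "0\<^sub>m n n \<in> lin_span S n"
| base: "a \<in> S \<Longrightarrow> a \<in> lin_span S n"
| add: "a \<in> lin_span S n \<Longrightarrow> b \<in> lin_span S n \<Longrightarrow> a + b \<in> lin_span S n"
| smult: "a \<in> lin_span S n \<Longrightarrow> c \<cdot>\<^sub>m a \<in> lin_span S n"

lemma lin_span_carrier:
  assumes "S \<subseteq> carrier_mat n n" "a \<in> lin_span S n" shows "a \<in> carrier_mat n n"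
  using assms(2) by induction (use assms(1) in auto)

lemma lin_span_mult:
  assumes S: "S \<subseteq> carrier_mat n n" and SS: "\<And>a b. a \<in> S \<Longrightarrow> b \<in> S \<Longrightarrow> a * b \<in> lin_span S n"
    and "a \<in> lin_span S n" "b \<in> lin_span S n"
  shows "a * b \<in> lin_span S n"
proof -
  note car = lin_span_carrier[OF S]
  have 1: "a * b \<in> lin_span S n" if "a \<in> S" "b \<in> lin_span S n" for a b
    using that(2)
  proof induction
    case zero
    have "a * 0\<^sub>m n n = 0\<^sub>m n n" using S that(1) by auto
    then show ?case by (simp add: lin_span.zero)
  next
    case (add b c)
    have "a * (b + c) = a * b + a * c"
      by (rule mult_add_distrib_mat[of _ n n _ n]) (use car add.hyps S that in auto)
    then show ?case using add.IH by (simp add: lin_span.add)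
  next
    case (smult b c)
    have "a * (c \<cdot>\<^sub>m b) = c \<cdot>\<^sub>m (a * b)"
      by (rule mult_smult_distrib[of _ n n _ n]) (use car smult.hyps S that in auto)
    then show ?case using smult.IH by (simp add: lin_span.smult)
  qed (rule SS[OF that(1)])
  show ?thesis using assms(3)
  proof induction
    case zero
    have "0\<^sub>m n n * b = 0\<^sub>m n n" using car[OF assms(4)] by auto
    then show ?case by (simp add: lin_span.zero)
  next
    case (add a c)
    have "(a + c) * b = a * b + c * b"
      by (rule add_mult_distrib_mat[of _ n n _ _ n]) (use car add.hyps assms(4) in auto)
    then show ?case using add.IH by (simp add: lin_span.add)
  next
    case (smult a c)
    have "(c \<cdot>\<^sub>m a) * b = c \<cdot>\<^sub>m (a * b)"
      by (rule mult_smult_assoc_mat[of _ n n _ n]) (use car smult.hyps assms(4) in auto)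
    then show ?case using smult.IH by (simp add: lin_span.smult)
  qed (rule 1[OF _ assms(4)])
qed

lemma lin_span_trace:
  assumes S: "S \<subseteq> carrier_mat n n" and "\<And>a. a \<in> S \<Longrightarrow> mtrace a = 0" and "a \<in> lin_span S n"
  shows "mtrace a = 0"
  using assms(3)
proof induction
  case (add a b)
  have "a \<in> carrier_mat n n" "b \<in> carrier_mat n n" using lin_span_carrier[OF S] add.hyps by auto
  with add show ?case by (simp add: mtrace_def sum.distrib)
next
  case (smult a c)
  have "a \<in> carrier_mat n n" using lin_span_carrier[OF S] smult.hyps by auto
  with smult show ?case by (simp add: mtrace_def sum_distrib_left[symmetric])
qed (auto simp: assms(2), simp add: mtrace_def)

text \<open>All traces on the algebra spanned by the \<open>h - 1\<close> vanish, since unipotent matrices have trace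
  \<open>n\<close>; hence this algebra consists of nilpotent matrices.\<close>

lemma unipotent_group_vector:
  fixes H :: "'a::{alg_closed_field,field_char_0} mat set"
  assumes H: "H \<subseteq> carrier_mat n n" "\<And>a b. a \<in> H \<Longrightarrow> b \<in> H \<Longrightarrow> a * b \<in> H"
    and uni: "\<And>a. a \<in> H \<Longrightarrow> \<exists>k. (a - 1\<^sub>m n) ^\<^sub>m k = 0\<^sub>m n n" and r: "r < n"
  obtains v where "v \<in> carrier_vec n" "\<exists>i\<ge>r. i < n \<and> v $ i \<noteq> 0"
    "\<And>a i. a \<in> H \<Longrightarrow> r \<le> i \<Longrightarrow> i < n \<Longrightarrow> ((a - 1\<^sub>m n) *\<^sub>v v) $ i = 0"
proof -
  define S where "S = (\<lambda>a. a - 1\<^sub>m n) ` H"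
  have S: "S \<subseteq> carrier_mat n n" using H(1) by (auto simp: S_def)
  let ?I = "lin_span S n"
  have SS: "x * y \<in> ?I" if xy: "x \<in> S" "y \<in> S" for x y
  proof -
    obtain a b where ab: "x = a - 1\<^sub>m n" "y = b - 1\<^sub>m n" "a \<in> H" "b \<in> H" using xy by (auto simp: S_def)
    have c: "a \<in> carrier_mat n n" "b \<in> carrier_mat n n" using ab H(1) by auto
    \<comment> \<open>Since \<open>(a - 1) (b - 1) = (a b - 1) - (a - 1) - (b - 1)\<close>, closure
      of \<open>H\<close> under products makes the span closed under products.\<close>
    have "x * y = (a * b - 1\<^sub>m n) + ((-1) \<cdot>\<^sub>m (a - 1\<^sub>m n) + (-1) \<cdot>\<^sub>m (b - 1\<^sub>m n))"
    proof -
      have "x * y = a * b - a - (b - 1\<^sub>m n)"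
      proof -
        have "x * y = a * (b - 1\<^sub>m n) - 1\<^sub>m n * (b - 1\<^sub>m n)"
          unfolding ab(1,2) by (rule minus_mult_distrib_mat[OF c(1) one_carrier_mat minus_carrier_mat[OF one_carrier_mat]])
        also have "a * (b - 1\<^sub>m n) = a * b - a * 1\<^sub>m n"
          by (rule mult_minus_distrib_mat[OF c one_carrier_mat])
        finally show ?thesis using c by simp
      qed
      also have "\<dots> = (a * b - 1\<^sub>m n) + ((-1) \<cdot>\<^sub>m (a - 1\<^sub>m n) + (-1) \<cdot>\<^sub>m (b - 1\<^sub>m n))"
        using c by (intro eq_matI) (auto simp del: index_mult_mat(1))
      finally show ?thesis .
    qed
    moreover have "a * b - 1\<^sub>m n \<in> S" "a - 1\<^sub>m n \<in> S" "b - 1\<^sub>m n \<in> S" using ab H(2) by (auto simp: S_def)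
    ultimately show ?thesis
      by (simp only:, intro lin_span.add lin_span.smult lin_span.base)
  qed
  have tr: "mtrace x = 0" if x: "x \<in> S" for x
  proof -
    obtain a where a: "x = a - 1\<^sub>m n" "a \<in> H" using x by (auto simp: S_def)
    with uni[OF a(2)] S x show ?thesis using nilpotent_trace by blast
  qed
  have pw: "a ^\<^sub>m Suc k \<in> ?I" if "a \<in> ?I" for a k
  proof (induction k)
    case 0
    have "a \<in> carrier_mat n n" using lin_span_carrier[OF S that] .
    then show ?case using that by simp
  next
    case (Suc k)
    then show ?case using lin_span_mult[OF S SS Suc that] by simp
  qed
  have nil: "\<exists>k. a ^\<^sub>m k = 0\<^sub>m n n" if a: "a \<in> ?I" for a
  proof
    show "a ^\<^sub>m n = 0\<^sub>m n n"
    proof (rule nilpotent_by_trace[OF lin_span_carrier[OF S a]])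
      fix k :: nat assume "k > 0"
      then obtain l where "k = Suc l" using gr0_conv_Suc by blast
      then show "mtrace (a ^\<^sub>m k) = 0" using lin_span_trace[OF S tr pw[OF a]] by simp
    qed
  qed
  obtain v where v: "v \<in> carrier_vec n" "\<exists>i\<ge>r. i < n \<and> v $ i \<noteq> 0"
    "\<And>a i. a \<in> ?I \<Longrightarrow> r \<le> i \<Longrightarrow> i < n \<Longrightarrow> (a *\<^sub>v v) $ i = 0"
  proof (rule nil_algebra_vector[of ?I n r])
    show "?I \<subseteq> carrier_mat n n" using lin_span_carrier[OF S] by blast
    show "a * b \<in> ?I" if "a \<in> ?I" "b \<in> ?I" for a b by (rule lin_span_mult[OF S SS that])
  qed (auto intro: lin_span.intros nil r)
  show ?thesis
  proof (rule that[OF v(1,2)])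
    fix a i assume "a \<in> H" "r \<le> i" "i < n"
    moreover from this have "a - 1\<^sub>m n \<in> ?I" by (intro lin_span.base) (simp add: S_def)
    ultimately show "((a - 1\<^sub>m n) *\<^sub>v v) $ i = 0" by (intro v(3))
  qed
qed

section \<open>Torus actions and their weight vectors\<close>

locale torus_action =
  fixes n :: nat and \<alpha> :: "'a::{alg_closed_field,field_char_0} \<Rightarrow> 'a mat" and K :: "int set" and E :: "int \<Rightarrow> 'a mat"
  assumes \<alpha>: "\<And>s. s \<noteq> 0 \<Longrightarrow> \<alpha> s \<in> carrier_mat n n"
    and \<alpha>_one: "\<alpha> 1 = 1\<^sub>m n"
    and \<alpha>_mult: "\<And>s r. s \<noteq> 0 \<Longrightarrow> r \<noteq> 0 \<Longrightarrow> \<alpha> (s * r) = \<alpha> s * \<alpha> r"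
    and K: "finite K"
    and E: "\<And>k. E k \<in> carrier_mat n n"
    and \<alpha>_E: "\<And>s i j. s \<noteq> 0 \<Longrightarrow> i < n \<Longrightarrow> j < n \<Longrightarrow> \<alpha> s $$ (i, j) = (\<Sum>k\<in>K. s powi k * E k $$ (i, j))"
begin

lemma \<alpha>_vec:
  assumes "s \<noteq> 0" "v \<in> carrier_vec n" "i < n"
  shows "(\<alpha> s *\<^sub>v v) $ i = (\<Sum>k\<in>K. s powi k * (E k *\<^sub>v v) $ i)"
proof -
  have "(\<alpha> s *\<^sub>v v) $ i = (\<Sum>j<n. \<Sum>k\<in>K. s powi k * (E k $$ (i, j) * v $ j))"
    unfolding mult_mat_vec_index[OF \<alpha>[OF assms(1)] assms(2,3)]
    using assms(1,3) by (simp add: \<alpha>_E sum_distrib_right mult.assoc)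
  also have "\<dots> = (\<Sum>k\<in>K. s powi k * (E k *\<^sub>v v) $ i)"
    unfolding mult_mat_vec_index[OF E assms(2,3)] by (subst sum.swap) (simp add: sum_distrib_left)
  finally show ?thesis .
qed

text \<open>Coefficients of \<open>r\<close> are compared in
  \<open>\<alpha> s (\<alpha> r v) = \<alpha> (s r) v\<close>. Together with \<open>E_sum\<close>
  this shows that the matrices \<open>E k\<close>, introduced only as coefficients of
  \<open>\<alpha> s\<close>, project to the weight spaces.\<close>

lemma E_eigenvector:
  assumes s: "s \<noteq> 0" and v: "v \<in> carrier_vec n" and k: "k \<in> K"
  shows "\<alpha> s *\<^sub>v (E k *\<^sub>v v) = (s powi k) \<cdot>\<^sub>v (E k *\<^sub>v v)"
proof (rule eq_vecI)
  have Ev: "E k *\<^sub>v v \<in> carrier_vec n" for k using E v by (rule mult_mat_vec_carrier)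
  show "dim_vec (\<alpha> s *\<^sub>v (E k *\<^sub>v v)) = dim_vec ((s powi k) \<cdot>\<^sub>v (E k *\<^sub>v v))"
    by (simp add: carrier_matD(1)[OF \<alpha>[OF s]] carrier_matD(1)[OF E])
  fix i assume "i < dim_vec ((s powi k) \<cdot>\<^sub>v (E k *\<^sub>v v))"
  then have i: "i < n" by (simp add: carrier_matD(1)[OF E])
  define c where "c k = s powi k * (E k *\<^sub>v v) $ i - (\<alpha> s *\<^sub>v (E k *\<^sub>v v)) $ i" for k
  have "c k = 0"
  proof (rule laurent_poly_zero[OF K _ k])
    fix r :: 'a assume r: "r \<noteq> 0"
    have "(\<alpha> s *\<^sub>v (\<alpha> r *\<^sub>v v)) $ i = (\<Sum>j<n. \<alpha> s $$ (i, j) * (\<Sum>k\<in>K. r powi k * (E k *\<^sub>v v) $ j))"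
      unfolding mult_mat_vec_index[OF \<alpha>[OF s] mult_mat_vec_carrier[OF \<alpha>[OF r] v] i]
      by (intro sum.cong refl) (simp only: \<alpha>_vec[OF r v] lessThan_iff)
    also have "\<dots> = (\<Sum>j<n. \<Sum>k\<in>K. r powi k * (\<alpha> s $$ (i, j) * (E k *\<^sub>v v) $ j))"
      by (simp add: sum_distrib_left mult_ac)
    also have "\<dots> = (\<Sum>k\<in>K. r powi k * (\<alpha> s *\<^sub>v (E k *\<^sub>v v)) $ i)"
      unfolding mult_mat_vec_index[OF \<alpha>[OF s] Ev i] by (subst sum.swap) (simp add: sum_distrib_left)
    finally have 1: "(\<alpha> s *\<^sub>v (\<alpha> r *\<^sub>v v)) $ i = \<dots>" .
    have "\<alpha> s *\<^sub>v (\<alpha> r *\<^sub>v v) = \<alpha> (s * r) *\<^sub>v v"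
      unfolding \<alpha>_mult[OF s r] by (rule assoc_mult_mat_vec[OF \<alpha>[OF s] \<alpha>[OF r] v, symmetric])
    then have "(\<alpha> s *\<^sub>v (\<alpha> r *\<^sub>v v)) $ i = (\<Sum>k\<in>K. (s * r) powi k * (E k *\<^sub>v v) $ i)"
      using \<alpha>_vec[of "s * r" v i] s r v i by simp
    also have "\<dots> = (\<Sum>k\<in>K. r powi k * (s powi k * (E k *\<^sub>v v) $ i))"
      by (simp add: power_int_mult_distrib mult_ac)
    finally show "(\<Sum>k\<in>K. r powi k * c k) = 0"
      using 1 unfolding c_def by (simp add: algebra_simps sum_subtractf)
  qed
  then show "(\<alpha> s *\<^sub>v (E k *\<^sub>v v)) $ i = ((s powi k) \<cdot>\<^sub>v (E k *\<^sub>v v)) $ i"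
    unfolding c_def using i by (simp add: carrier_matD(1)[OF E] del: index_mult_mat_vec)
qed

lemma E_sum:
  assumes v: "v \<in> carrier_vec n" "i < n" shows "v $ i = (\<Sum>k\<in>K. (E k *\<^sub>v v) $ i)"
  using \<alpha>_vec[OF one_neq_zero v] v by (simp add: \<alpha>_one)

lemma conj_action:
  assumes P: "P \<in> carrier_mat n n" "P' \<in> carrier_mat n n" "P * P' = 1\<^sub>m n" "P' * P = 1\<^sub>m n"
  shows "torus_action n (\<lambda>s. P' * \<alpha> s * P) K (\<lambda>k. P' * E k * P)"
proof
  show "P' * \<alpha> s * P \<in> carrier_mat n n" if "s \<noteq> 0" for s using P \<alpha>[OF that] by simp
  show "P' * \<alpha> 1 * P = 1\<^sub>m n" using P by (simp add: \<alpha>_one)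
  show "P' * \<alpha> (s * r) * P = P' * \<alpha> s * P * (P' * \<alpha> r * P)" if "s \<noteq> 0" "r \<noteq> 0" for s r
    unfolding \<alpha>_mult[OF that] by (rule mult_mat_conj[OF P(2,1) \<alpha>[OF that(1)] \<alpha>[OF that(2)] P(3), symmetric])
  show "P' * E k * P \<in> carrier_mat n n" for k using P E[of k] by simp
  show "(P' * \<alpha> s * P) $$ (i, j) = (\<Sum>k\<in>K. s powi k * (P' * E k * P) $$ (i, j))"
    if s: "s \<noteq> 0" and ij: "i < n" "j < n" for s i j
  proof -
    have "(P' * \<alpha> s * P) $$ (i, j) = (\<Sum>p<n. \<Sum>q<n. \<Sum>k\<in>K. s powi k * (P' $$ (i, p) * E k $$ (p, q) * P $$ (q, j)))"
      unfolding index_mult_mult_mat_sum[OF P(2) \<alpha>[OF s] P(1) ij] using s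
      by (intro sum.cong refl) (simp add: \<alpha>_E sum_distrib_left sum_distrib_right mult_ac)
    also have "\<dots> = (\<Sum>p<n. \<Sum>k\<in>K. \<Sum>q<n. s powi k * (P' $$ (i, p) * E k $$ (p, q) * P $$ (q, j)))"
      by (rule sum.cong[OF refl], rule sum.swap)
    also have "\<dots> = (\<Sum>k\<in>K. \<Sum>p<n. \<Sum>q<n. s powi k * (P' $$ (i, p) * E k $$ (p, q) * P $$ (q, j)))"
      by (rule sum.swap)
    also have "\<dots> = (\<Sum>k\<in>K. s powi k * (P' * E k * P) $$ (i, j))"
      unfolding index_mult_mult_mat_sum[OF P(2) E P(1) ij] by (simp add: sum_distrib_left)
    finally show ?thesis .
  qed
qed (rule K)

end

text \<open>The identity \<open>\<chi> (s r) = \<chi> s \<chi> r\<close> is compared coefficientwise in \<open>r\<close>.\<close>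

lemma torus_character:
  fixes \<chi> :: "'a::field_char_0 \<Rightarrow> 'a"
  assumes K: "finite K" and c: "\<And>s. s \<noteq> 0 \<Longrightarrow> \<chi> s = (\<Sum>k\<in>K. s powi k * c k)"
    and one: "\<chi> 1 = 1" and mult: "\<And>s r. s \<noteq> 0 \<Longrightarrow> r \<noteq> 0 \<Longrightarrow> \<chi> (s * r) = \<chi> s * \<chi> r"
  obtains w where "\<And>s. s \<noteq> 0 \<Longrightarrow> \<chi> s = s powi w"
proof -
  have "\<exists>k\<in>K. c k \<noteq> 0"
  proof (rule ccontr)
    assume "\<not> ?thesis"
    then have "\<chi> 1 = 0" using c[of 1] by simp
    with one show False by simp
  qed
  then obtain k where k: "k \<in> K" "c k \<noteq> 0" by blast
  have "\<chi> s = s powi k" if s: "s \<noteq> 0" for s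
  proof -
    have "(s powi k * c k - \<chi> s * c k) = 0"
    proof (rule laurent_poly_zero[OF K _ k(1)])
      fix r :: 'a assume r: "r \<noteq> 0"
      have "(\<Sum>k\<in>K. r powi k * (s powi k * c k - \<chi> s * c k)) = (\<Sum>k\<in>K. (s * r) powi k * c k) - \<chi> s * (\<Sum>k\<in>K. r powi k * c k)"
        by (simp add: power_int_mult_distrib algebra_simps sum_subtractf sum_distrib_left)
      also have "\<dots> = 0" using c[of "s * r"] c[OF r] mult[OF s r] s r by simp
      finally show "(\<Sum>k\<in>K. r powi k * (s powi k * c k - \<chi> s * c k)) = 0" .
    qed
    with k(2) show ?thesis by (simp add: left_diff_distrib[symmetric])
  qed
  then show ?thesis using that by blast
qed

text \<open>The vectors fixed by \<open>H\<close> modulo the first \<open>r\<close> basis vectors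
  form a space stable under the torus, as the torus normalizes \<open>H\<close>. So this space
  contains weight vectors, and these serve the unipotent and the diagonal requirements at
  once.\<close>

theorem (in torus_action) torus_unipotent_triangular:
  assumes H: "H \<subseteq> carrier_mat n n" "\<And>a b. a \<in> H \<Longrightarrow> b \<in> H \<Longrightarrow> a * b \<in> H"
    and uni: "\<And>a. a \<in> H \<Longrightarrow> \<exists>k. (a - 1\<^sub>m n) ^\<^sub>m k = 0\<^sub>m n n"
    and norm: "\<And>a s. a \<in> H \<Longrightarrow> s \<noteq> 0 \<Longrightarrow> \<alpha> (inverse s) * a * \<alpha> s \<in> H"
  obtains P P' w where "P \<in> carrier_mat n n" "P' \<in> carrier_mat n n" "P * P' = 1\<^sub>m n" "P' * P = 1\<^sub>m n"
    "\<And>a. a \<in> H \<Longrightarrow> upat n 1 (P' * a * P - 1\<^sub>m n)"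
    "\<And>s. s \<noteq> 0 \<Longrightarrow> P' * \<alpha> s * P = mat_diag n (\<lambda>i. s powi w i)"
proof -
  let ?A = "(\<lambda>a. (a - 1\<^sub>m n, \<lambda>i j. i + 1 \<le> (j :: nat))) ` H \<union> (\<lambda>s. (\<alpha> s, (=))) ` {s. s \<noteq> 0}"
  have conj1: "P' * (a - 1\<^sub>m n) * P = P' * a * P - 1\<^sub>m n"
    if "a \<in> carrier_mat n n" "P \<in> carrier_mat n n" "P' \<in> carrier_mat n n" "P' * P = 1\<^sub>m n" for a P P' :: "'a mat"
  proof -
    have "P' * (a - 1\<^sub>m n) = P' * a - P' * 1\<^sub>m n" by (rule mult_minus_distrib_mat[OF that(3,1) one_carrier_mat])
    then have "P' * (a - 1\<^sub>m n) * P = (P' * a - P') * P" using that by simp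
    also have "\<dots> = P' * a * P - P' * P" by (rule minus_mult_distrib_mat) (use that in auto)
    finally show ?thesis using that by simp
  qed
  obtain P P' where P: "P \<in> carrier_mat n n" "P' \<in> carrier_mat n n" "P * P' = 1\<^sub>m n" "P' * P = 1\<^sub>m n"
    and pt: "\<And>A R. (A, R) \<in> ?A \<Longrightarrow> pat n R (P' * A * P)"
  proof (rule simultaneous_triangular[of ?A n])
    show "A \<in> carrier_mat n n" if "(A, R) \<in> ?A" for A R using that H(1) \<alpha> by auto
    show "i \<le> j" if "(A, R) \<in> ?A" "R i j" for A R i j using that by auto
  next
    fix r P P'
    assume r: "r < n" and P: "P \<in> carrier_mat n n" "P' \<in> carrier_mat n n" "P * P' = 1\<^sub>m n" "P' * P = 1\<^sub>m n"
      and cols: "\<And>A R i j. (A, R) \<in> ?A \<Longrightarrow> j < r \<Longrightarrow> i < n \<Longrightarrow> \<not> R i j \<Longrightarrow> (P' * A * P) $$ (i, j) = 0"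
    interpret C: torus_action n "\<lambda>s. P' * \<alpha> s * P" K "\<lambda>k. P' * E k * P" by (rule conj_action[OF P])
    define H' where "H' = (\<lambda>a. P' * a * P) ` H"
    have H'c: "H' \<subseteq> carrier_mat n n" using H(1) P by (auto simp: H'_def)
    obtain v where v: "v \<in> carrier_vec n" "\<exists>i\<ge>r. i < n \<and> v $ i \<noteq> 0"
      "\<And>a i. a \<in> H' \<Longrightarrow> r \<le> i \<Longrightarrow> i < n \<Longrightarrow> ((a - 1\<^sub>m n) *\<^sub>v v) $ i = 0"
    proof (rule unipotent_group_vector[OF H'c _ _ r])
      show "a * b \<in> H'" if ab: "a \<in> H'" "b \<in> H'" for a b
      proof -
        obtain x y where xy: "a = P' * x * P" "b = P' * y * P" "x \<in> H" "y \<in> H" using ab by (auto simp: H'_def)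
        have "x \<in> carrier_mat n n" "y \<in> carrier_mat n n" using xy H(1) by auto
        from mult_mat_conj[OF P(2,1) this P(3)] show ?thesis using xy H(2) by (auto simp: H'_def)
      qed
      show "\<exists>k. (a - 1\<^sub>m n) ^\<^sub>m k = 0\<^sub>m n n" if a: "a \<in> H'" for a
      proof -
        obtain x where x: "a = P' * x * P" "x \<in> H" using a by (auto simp: H'_def)
        obtain k where k: "(x - 1\<^sub>m n) ^\<^sub>m k = 0\<^sub>m n n" using uni[OF x(2)] by blast
        have xc: "x \<in> carrier_mat n n" using x H(1) by auto
        have "(a - 1\<^sub>m n) ^\<^sub>m k = P' * (x - 1\<^sub>m n) ^\<^sub>m k * P"
          unfolding x(1) conj1[OF xc P(1,2,4), symmetric] by (rule pow_mat_conj[OF P(2,1) _ P(3,4)]) (use xc in auto)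
        also have "\<dots> = 0\<^sub>m n n" unfolding k using P by simp
        finally show ?thesis ..
      qed
    qed (rule that)
    obtain i0 where i0: "r \<le> i0" "i0 < n" "v $ i0 \<noteq> 0" using v(2) by blast
    have "\<exists>k\<in>K. ((P' * E k * P) *\<^sub>v v) $ i0 \<noteq> 0"
      using C.E_sum[OF v(1) i0(2)] i0(3) sum.neutral[of K "\<lambda>k. ((P' * E k * P) *\<^sub>v v) $ i0"] by metis
    then obtain k where k: "k \<in> K" "((P' * E k * P) *\<^sub>v v) $ i0 \<noteq> 0" by blast
    \<comment> \<open>The component of weight \<open>k\<close> of the vector \<open>v\<close>, with
      \<open>k\<close> chosen so that \<open>u\<close> stays nonzero in the coordinate
      \<open>i0 \<ge> r\<close>.\<close>
    define u where "u = (P' * E k * P) *\<^sub>v v"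
    have uc: "u \<in> carrier_vec n" unfolding u_def using C.E v(1) by (rule mult_mat_vec_carrier)
    have diag: "((P' * \<alpha> s * P) *\<^sub>v y) $ i = 0"
      if s: "s \<noteq> 0" and y: "y \<in> carrier_vec n" "\<And>i. r \<le> i \<Longrightarrow> i < n \<Longrightarrow> y $ i = 0" and i: "r \<le> i" "i < n" for s y i
    proof -
      have "(P' * \<alpha> s * P) $$ (i, j) * y $ j = 0" if "j < n" for j
      proof (cases "j < r")
        case True
        have "(P' * \<alpha> s * P) $$ (i, j) = 0" by (rule cols[of "\<alpha> s" "(=)"]) (use True s i in auto)
        then show ?thesis by simp
      qed (use y(2) that in auto)
      then show ?thesis unfolding mult_mat_vec_index[OF C.\<alpha>[OF s] y(1) i(2)] by (intro sum.neutral ballI) blast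
    qed
    have Hu: "((P' * a * P - 1\<^sub>m n) *\<^sub>v u) $ i = 0" if a: "a \<in> H" and i: "r \<le> i" "i < n" for a i
    proof -
      define b where "b = P' * a * P - 1\<^sub>m n"
      have ac: "a \<in> carrier_mat n n" using a H(1) by auto
      have b: "b \<in> carrier_mat n n" unfolding b_def by (rule minus_carrier_mat[OF one_carrier_mat])
      have Ev: "(P' * E k * P) *\<^sub>v v \<in> carrier_vec n" for k using C.E v(1) by (rule mult_mat_vec_carrier)
      have "(b *\<^sub>v u) $ i = (\<lambda>k. (b *\<^sub>v ((P' * E k * P) *\<^sub>v v)) $ i) k" by (simp add: u_def)
      also have "\<dots> = 0"
      \<comment> \<open>With \<open>a'\<close> the conjugate of \<open>a\<close> by the torus,
        \<open>b\<close> applied to \<open>\<alpha> s v\<close> equals \<open>\<alpha> s\<close>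
        applied to \<open>(a' - 1) v\<close>. The latter lies in the span of the first
        \<open>r\<close> basis vectors, which the torus preserves by \<open>diag\<close>; hence each
        coefficient of \<open>s\<close> vanishes in coordinate \<open>i\<close>.\<close>
      proof (rule laurent_poly_zero[OF K _ k(1)])
        fix s :: 'a assume s: "s \<noteq> 0"
        have s': "inverse s \<noteq> 0" using s by simp
        define A where "A = P' * \<alpha> s * P"
        define a' where "a' = P' * (\<alpha> (inverse s) * a * \<alpha> s) * P"
        have Ac: "A \<in> carrier_mat n n" unfolding A_def by (rule C.\<alpha>[OF s])
        have a': "a' \<in> H'" unfolding a'_def H'_def using norm[OF a s] by blast
        then have a'c: "a' \<in> carrier_mat n n" using H'c by auto
        have "\<alpha> s * (\<alpha> (inverse s) * a * \<alpha> s) = (\<alpha> s * \<alpha> (inverse s)) * a * \<alpha> s"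
          using \<alpha>[OF s] \<alpha>[OF s'] ac by (smt (verit) assoc_mult_mat mult_carrier_mat)
        also have "\<dots> = a * \<alpha> s" unfolding \<alpha>_mult[OF s s', symmetric] using s ac by (simp add: \<alpha>_one)
        finally have sa: "\<alpha> s * (\<alpha> (inverse s) * a * \<alpha> s) = a * \<alpha> s" .
        have "A * a' = P' * (\<alpha> s * (\<alpha> (inverse s) * a * \<alpha> s)) * P"
          unfolding A_def a'_def by (rule mult_mat_conj[OF P(2,1) \<alpha>[OF s] _ P(3)]) (use \<alpha>[OF s] \<alpha>[OF s'] ac in auto)
        also have "\<dots> = P' * a * P * A" unfolding sa A_def
          by (rule mult_mat_conj[OF P(2,1) ac \<alpha>[OF s] P(3), symmetric])
        finally have Aa: "A * a' = P' * a * P * A" .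
        have "b * A = P' * a * P * A - 1\<^sub>m n * A" unfolding b_def
          by (rule minus_mult_distrib_mat) (use ac P Ac in auto)
        also have "\<dots> = A * a' - A * 1\<^sub>m n" using Aa Ac by simp
        also have "\<dots> = A * (a' - 1\<^sub>m n)"
          by (rule mult_minus_distrib_mat[OF Ac a'c one_carrier_mat, symmetric])
        finally have bA: "b * A = A * (a' - 1\<^sub>m n)" .
        have a1: "a' - 1\<^sub>m n \<in> carrier_mat n n" by (rule minus_carrier_mat[OF one_carrier_mat])
        have y: "(a' - 1\<^sub>m n) *\<^sub>v v \<in> carrier_vec n" using a1 v(1) by (rule mult_mat_vec_carrier)
        have "b *\<^sub>v (A *\<^sub>v v) = A *\<^sub>v ((a' - 1\<^sub>m n) *\<^sub>v v)"
          unfolding assoc_mult_mat_vec[OF b Ac v(1), symmetric] bA by (rule assoc_mult_mat_vec[OF Ac a1 v(1)])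
        then have "(b *\<^sub>v (A *\<^sub>v v)) $ i = 0"
          unfolding A_def using diag[OF s y v(3)[OF a'] i] by simp
        moreover have "(b *\<^sub>v (A *\<^sub>v v)) $ i = (\<Sum>j<n. b $$ (i, j) * (\<Sum>k\<in>K. s powi k * ((P' * E k * P) *\<^sub>v v) $ j))"
          unfolding A_def mult_mat_vec_index[OF b mult_mat_vec_carrier[OF C.\<alpha>[OF s] v(1)] i(2)]
          by (intro sum.cong refl) (simp only: C.\<alpha>_vec[OF s v(1)] lessThan_iff)
        moreover have "\<dots> = (\<Sum>j<n. \<Sum>k\<in>K. s powi k * (b $$ (i, j) * ((P' * E k * P) *\<^sub>v v) $ j))"
          unfolding sum_distrib_left by (intro sum.cong refl) (simp only: mult_ac)
        moreover have "\<dots> = (\<Sum>k\<in>K. s powi k * (b *\<^sub>v ((P' * E k * P) *\<^sub>v v)) $ i)"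
          unfolding mult_mat_vec_index[OF b Ev i(2)] by (subst sum.swap) (simp only: sum_distrib_left)
        ultimately show "(\<Sum>k\<in>K. s powi k * (b *\<^sub>v ((P' * E k * P) *\<^sub>v v)) $ i) = 0" by simp
      qed
      finally show ?thesis by (simp add: b_def)
    qed
    have "\<exists>l s. s \<in> carrier_vec n \<and> (P' * A * P) *\<^sub>v u = l \<cdot>\<^sub>v u + s \<and>
        (\<forall>i<n. \<not> (i < r \<and> R i r) \<longrightarrow> s $ i = 0) \<and> (\<not> R r r \<longrightarrow> l = 0)" if AR: "(A, R) \<in> ?A" for A R
    proof -
      from AR consider a where "a \<in> H" "A = a - 1\<^sub>m n" "R = (\<lambda>i j. i + 1 \<le> j)" | s where "s \<noteq> 0" "A = \<alpha> s" "R = (=)"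
        by auto
      then show ?thesis
      proof cases
        case 1
        have ac: "a \<in> carrier_mat n n" using 1 H(1) by auto
        let ?s = "(P' * a * P - 1\<^sub>m n) *\<^sub>v u"
        have sc: "?s \<in> carrier_vec n" by (rule mult_mat_vec_carrier[OF _ uc]) (use ac P in auto)
        have e: "(P' * A * P) *\<^sub>v u = 0 \<cdot>\<^sub>v u + ?s"
          unfolding 1(2) conj1[OF ac P(1,2,4)] using sc uc by (intro eq_vecI) auto
        have "?s $ i = 0" if "i < n" "\<not> (i < r \<and> R i r)" for i
          by (rule Hu[OF 1(1) _ that(1)]) (use that(2) in \<open>auto simp: 1(3)\<close>)
        with e sc show ?thesis by (intro exI[of _ 0] exI[of _ ?s]) auto
      next
        case 2
        have "(P' * A * P) *\<^sub>v u = (s powi k) \<cdot>\<^sub>v u + 0\<^sub>v n"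
          unfolding 2(2) u_def C.E_eigenvector[OF 2(1) v(1) k(1)] using uc by (simp add: u_def)
        then show ?thesis by (intro exI[of _ "s powi k"] exI[of _ "0\<^sub>v n"]) (auto simp: 2(3))
      qed
    qed
    moreover have "\<exists>i\<ge>r. i < n \<and> u $ i \<noteq> 0" using i0 k(2) unfolding u_def by blast
    ultimately show "\<exists>v\<in>carrier_vec n. (\<exists>i\<ge>r. i < n \<and> v $ i \<noteq> 0) \<and> (\<forall>A R. (A, R) \<in> ?A \<longrightarrow>
        (\<exists>l s. s \<in> carrier_vec n \<and> (P' * A * P) *\<^sub>v v = l \<cdot>\<^sub>v v + s \<and>
        (\<forall>i<n. \<not> (i < r \<and> R i r) \<longrightarrow> s $ i = 0) \<and> (\<not> R r r \<longrightarrow> l = 0)))"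
      using uc by blast
  qed (rule that)
  interpret C: torus_action n "\<lambda>s. P' * \<alpha> s * P" K "\<lambda>k. P' * E k * P" by (rule conj_action[OF P])
  have dg: "(P' * \<alpha> s * P) $$ (i, j) = 0" if "s \<noteq> 0" "i < n" "j < n" "i \<noteq> j" for s i j
    using patD(2)[OF pt[of "\<alpha> s" "(=)"] that(2,3)] that by blast
  have "\<exists>w. \<forall>s. s \<noteq> 0 \<longrightarrow> (P' * \<alpha> s * P) $$ (i, i) = s powi w" if i: "i < n" for i
  proof -
    have "(P' * \<alpha> (s * r) * P) $$ (i, i) = (P' * \<alpha> s * P) $$ (i, i) * (P' * \<alpha> r * P) $$ (i, i)" if "s \<noteq> 0" "r \<noteq> 0" for s r
    proof -
      have "(P' * \<alpha> (s * r) * P) $$ (i, i) = (\<Sum>j<n. (P' * \<alpha> s * P) $$ (i, j) * (P' * \<alpha> r * P) $$ (j, i))"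
        unfolding C.\<alpha>_mult[OF that] by (rule index_mult_mat_sum[OF C.\<alpha>[OF that(1)] C.\<alpha>[OF that(2)] i i])
      also have "\<dots> = (\<Sum>j<n. if j = i then (P' * \<alpha> s * P) $$ (i, i) * (P' * \<alpha> r * P) $$ (i, i) else 0)"
        using dg[OF that(1) i] by (intro sum.cong refl) auto
      finally show ?thesis using i by (simp add: sum.delta)
    qed
    moreover have "(P' * \<alpha> 1 * P) $$ (i, i) = 1" unfolding C.\<alpha>_one using i by simp
    ultimately obtain w where "\<And>s. s \<noteq> 0 \<Longrightarrow> (P' * \<alpha> s * P) $$ (i, i) = s powi w"
      using torus_character[OF K C.\<alpha>_E[OF _ i i]] by blast
    then show ?thesis by blast
  qed
  then obtain w where w: "\<And>i s. i < n \<Longrightarrow> s \<noteq> 0 \<Longrightarrow> (P' * \<alpha> s * P) $$ (i, i) = s powi w i" by metis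
  show ?thesis
  proof (rule that[OF P])
    show "upat n 1 (P' * a * P - 1\<^sub>m n)" if a: "a \<in> H" for a
      using pt[of "a - 1\<^sub>m n" "\<lambda>i j. i + 1 \<le> j"] conj1[OF _ P(1,2,4), of a] a H(1) by auto
    show "P' * \<alpha> s * P = mat_diag n (\<lambda>i. s powi w i)" if s: "s \<noteq> 0" for s
    proof (rule eq_matI)
      fix i j assume "i < dim_row (mat_diag n (\<lambda>i. s powi w i))" "j < dim_col (mat_diag n (\<lambda>i. s powi w i))"
      then have ij: "i < n" "j < n" by (auto simp: mat_diag_def)
      then show "(P' * \<alpha> s * P) $$ (i, j) = mat_diag n (\<lambda>i. s powi w i) $$ (i, j)"
        using dg[OF s ij] w[OF ij(1) s] by (cases "i = j") (auto simp: mat_diag_def)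
    qed (use C.\<alpha>[OF s] in \<open>auto simp: mat_diag_def\<close>)
  qed
qed

section \<open>Valuations of minors and elimination\<close>

definition tpow :: "int \<Rightarrow> 'a::field fls" where "tpow k = fls_X powi k"

lemma tpow_add: "tpow (k + l) = tpow k * tpow l"
  unfolding tpow_def by (rule power_int_add) simp

lemma tpow_0 [simp]: "tpow 0 = 1" by (simp add: tpow_def)

lemma tpow_nonzero [simp]: "tpow k \<noteq> 0" by (simp add: tpow_def)

lemma tpow_minus: "tpow (- k) * tpow k = 1" "tpow k * tpow (- k) = 1"
  by (simp_all flip: tpow_add)

lemma tpow_sum: "tpow (\<Sum>i\<in>I. f i) = (\<Prod>i\<in>I. tpow (f i))"
  by (induction I rule: infinite_finite_induct) (auto simp: tpow_add)

lemma fls_int_tpow_iff: "fls_int (tpow k :: 'a::field fls) \<longleftrightarrow> 0 \<le> k"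
proof
  assume "fls_int (tpow k :: 'a fls)"
  then obtain f where "(tpow k :: 'a fls) = fps_to_fls f" by (auto simp: fls_int_def)
  moreover have "fls_subdegree (tpow k :: 'a fls) = k" by (simp add: tpow_def)
  ultimately show "0 \<le> k" using fls_subdegree_fls_to_fps_gt0[of f] by simp
next
  assume "0 \<le> k"
  then have "(tpow k :: 'a fls) = fps_to_fls (fps_X ^ nat k)"
    by (simp add: tpow_def power_int_def fps_to_fls_power del: fls_X_power_int)
  then show "fls_int (tpow k :: 'a fls)" by (auto simp: fls_int_def)
qed

text \<open>Valuation at least \<open>d\<close>. Phrased by integrality, it holds for
  \<open>0\<close> and every \<open>d\<close> without a case distinction.\<close>

definition vge :: "int \<Rightarrow> 'a::field fls \<Rightarrow> bool" where "vge d x \<longleftrightarrow> fls_int (tpow (- d) * x)"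

lemma vge_0 [simp]: "vge 0 x \<longleftrightarrow> fls_int x" by (simp add: vge_def)

lemma vge_zero [simp]: "vge d 0" by (simp add: vge_def)

lemma vge_mult: assumes "vge d x" "vge e y" shows "vge (d + e) (x * y)"
proof -
  have "tpow (- (d + e)) * (x * y) = (tpow (- d) * x) * (tpow (- e) * y)"
    by (simp only: minus_add_distrib tpow_add mult_ac)
  then show ?thesis using assms unfolding vge_def by (metis fls_int_intros(7))
qed

lemma vge_int_mult: "vge d x \<Longrightarrow> fls_int y \<Longrightarrow> vge d (x * y)"
  using vge_mult[of d x 0 y] by simp

lemma vge_sum: "(\<And>i. i \<in> I \<Longrightarrow> vge d (f i)) \<Longrightarrow> vge d (\<Sum>i\<in>I. f i)"
  unfolding vge_def sum_distrib_left by (rule fls_int_sum)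

lemma vge_tpow_iff: "vge d (tpow e) \<longleftrightarrow> d \<le> e"
  using fls_int_tpow_iff[of "- d + e"] unfolding vge_def tpow_add[symmetric] by auto

lemma vge_tpow_mult: "vge (d + e) (tpow d * x) \<longleftrightarrow> vge e x"
proof -
  have "tpow (- (d + e)) * (tpow d * x) = (tpow (- d) * tpow d) * (tpow (- e) * x)"
    by (simp only: minus_add_distrib tpow_add mult_ac)
  also have "\<dots> = tpow (- e) * x" by (simp only: tpow_minus mult_1_left)
  finally show ?thesis by (simp only: vge_def)
qed

abbreviation Dmat :: "nat \<Rightarrow> (nat \<Rightarrow> int) \<Rightarrow> 'a::field fls mat" where
  "Dmat n w \<equiv> mat_diag n (\<lambda>i. tpow (w i))"

definition minor :: "'b::comm_ring_1 mat \<Rightarrow> nat \<Rightarrow> (nat \<Rightarrow> nat) \<Rightarrow> (nat \<Rightarrow> nat) \<Rightarrow> 'b" where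
  "minor A k r c = det (mat k k (\<lambda>(i, j). A $$ (r i, c j)))"

text \<open>As in the Cauchy-Binet formula, the rows of \<open>X D Y\<close> are expanded by
  multilinearity into rows of \<open>Y\<close> with coefficients
  \<open>X $$ (r i, l) * tpow (w l)\<close>. A choice \<open>f\<close> that repeats a row
  contributes zero; an injective one contributes valuation at least the sum of its \<open>k\<close>
  weights.\<close>

lemma minor_bound:
  fixes X Y :: "'a::field fls mat"
  assumes X: "imat n X" and Y: "imat n Y"
    and b: "\<And>f. f ` {..<k} \<subseteq> {..<n} \<Longrightarrow> inj_on f {..<k} \<Longrightarrow> b \<le> (\<Sum>i<k. w (f i))"
    and rc: "r ` {..<k} \<subseteq> {..<n}" "c ` {..<k} \<subseteq> {..<n}"
  shows "vge b (minor (X * Dmat n w * Y) k r c)"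
proof -
  let ?A = "X * Dmat n w * Y"
  define y where "y l = vec k (\<lambda>j. Y $$ (l, c j))" for l
  define x where "x i l = X $$ (r i, l) * tpow (w l)" for i l
  have yc: "y l \<in> carrier_vec k" for l by (simp add: y_def)
  have A: "?A $$ (r i, c j) = (\<Sum>l<n. x i l * Y $$ (l, c j))" if "i < k" "j < k" for i j
  proof -
    have ij: "r i < n" "c j < n" using rc that by auto
    have XD: "X * Dmat n w = mat n n (\<lambda>(i, j). X $$ (i, j) * tpow (w j))"
      by (rule mat_diag_mult_right[OF imatD(1)[OF X]])
    show ?thesis unfolding XD x_def
      by (subst index_mult_mat_sum[of _ n n _ n]) (use ij imatD(1)[OF Y] in auto)
  qed
  have M: "mat k k (\<lambda>(i, j). ?A $$ (r i, c j)) = mat\<^sub>r k k (\<lambda>i. finsum_vec TYPE('a fls) k (\<lambda>l. x i l \<cdot>\<^sub>v y l) {..<n})"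
  proof (rule eq_matI)
    fix i j assume "i < dim_row (mat\<^sub>r k k (\<lambda>i. finsum_vec TYPE('a fls) k (\<lambda>l. x i l \<cdot>\<^sub>v y l) {..<n}))"
      "j < dim_col (mat\<^sub>r k k (\<lambda>i. finsum_vec TYPE('a fls) k (\<lambda>l. x i l \<cdot>\<^sub>v y l) {..<n}))"
    then have ij: "i < k" "j < k" by auto
    have "finsum_vec TYPE('a fls) k (\<lambda>l. x i l \<cdot>\<^sub>v y l) {..<n} $ j = (\<Sum>l<n. (x i l \<cdot>\<^sub>v y l) $ j)"
      by (rule index_finsum_vec) (use ij yc in auto)
    also have "\<dots> = ?A $$ (r i, c j)" unfolding A[OF ij] using ij by (simp add: y_def)
    finally show "mat k k (\<lambda>(i, j). ?A $$ (r i, c j)) $$ (i, j) =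
        mat\<^sub>r k k (\<lambda>i. finsum_vec TYPE('a fls) k (\<lambda>l. x i l \<cdot>\<^sub>v y l) {..<n}) $$ (i, j)"
      using ij by simp
  qed auto
  have "vge b (det (mat\<^sub>r k k (\<lambda>i. x i (f i) \<cdot>\<^sub>v y (f i))))"
    if f: "\<And>i. i \<in> {0..<k} \<Longrightarrow> f i \<in> {..<n}" for f
  proof -
    have "det (mat\<^sub>r k k (\<lambda>i. x i (f i) \<cdot>\<^sub>v y (f i))) = (\<Prod>i\<in>{0..<k}. x i (f i)) * det (mat\<^sub>r k k (\<lambda>i. y (f i)))"
      by (rule det_rows_mul) (use yc in auto)
    moreover have "vge b ((\<Prod>i\<in>{0..<k}. x i (f i)) * det (mat\<^sub>r k k (\<lambda>i. y (f i))))"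
    proof (cases "inj_on f {..<k}")
      case False
      then obtain i j where ij: "i < k" "j < k" "i \<noteq> j" "f i = f j" by (auto simp: inj_on_def)
      have "det (mat\<^sub>r k k (\<lambda>i. y (f i))) = 0"
        by (rule det_identical_rows[of _ k i j]) (use ij yc in auto)
      then show ?thesis by simp
    next
      case True
      have fn: "f ` {..<k} \<subseteq> {..<n}" using f by auto
      have "imat k (mat\<^sub>r k k (\<lambda>i. y (f i)))"
        using fn rc(2) imatD(2)[OF Y] by (auto simp: imat_def y_def subset_iff)
      then have "fls_int (det (mat\<^sub>r k k (\<lambda>i. y (f i))))" by (rule fls_int_det)
      moreover have "fls_int (\<Prod>i\<in>{0..<k}. X $$ (r i, f i))"
        using fn rc(1) by (intro fls_int_prod imatD(2)[OF X]) auto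
      ultimately have "fls_int ((\<Prod>i\<in>{0..<k}. X $$ (r i, f i)) * det (mat\<^sub>r k k (\<lambda>i. y (f i))))" by simp
      moreover have "vge b (tpow (\<Sum>i<k. w (f i)))" unfolding vge_tpow_iff by (rule b[OF fn True])
      ultimately have "vge b (tpow (\<Sum>i<k. w (f i)) * ((\<Prod>i\<in>{0..<k}. X $$ (r i, f i)) * det (mat\<^sub>r k k (\<lambda>i. y (f i)))))"
        by (rule vge_int_mult[rotated])
      then show ?thesis by (simp add: x_def prod.distrib tpow_sum atLeast0LessThan mult_ac)
    qed
    ultimately show ?thesis by simp
  qed
  then show ?thesis
    unfolding minor_def M
    by (subst det_linear_rows_sum) (use yc in \<open>auto intro!: vge_sum\<close>)
qed

lemma sum_mono_le:
  fixes W :: "nat \<Rightarrow> int"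
  assumes W: "\<And>i j. i \<le> j \<Longrightarrow> j < n \<Longrightarrow> W i \<le> W j" and "S \<subseteq> {..<n}" "card S = k"
  shows "(\<Sum>i<k. W i) \<le> sum W S"
  using assms(2,3)
proof (induction k arbitrary: S)
  case (Suc k)
  have f: "finite S" using Suc.prems(1) finite_subset by blast
  have ne: "S \<noteq> {}" using Suc.prems by auto
  define m where "m = Max S"
  have m: "m \<in> S" using f ne by (simp add: m_def)
  have "S \<subseteq> {..m}" using f by (auto simp: m_def)
  then have "Suc k \<le> Suc m" using card_mono[of "{..m}" S] Suc.prems by simp
  then have "W k \<le> W m" using W[of k m] m Suc.prems by auto
  moreover have "(\<Sum>i<k. W i) \<le> sum W (S - {m})"
    using Suc.prems m f by (intro Suc.IH) auto
  moreover have "sum W S = W m + sum W (S - {m})" using f m by (rule sum.remove)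
  ultimately show ?case by simp
next
  case 0
  then have "S = {}" using finite_subset[of S "{..<n}"] by simp
  then show ?case by simp
qed

text \<open>The order of the basis is tied to the triangular shape, so the weights are sorted
  through a permutation of the indices and not by reordering the matrix.\<close>

definition increasing_order :: "nat \<Rightarrow> (nat \<Rightarrow> int) \<Rightarrow> (nat \<Rightarrow> nat) \<Rightarrow> bool" where
  "increasing_order n w e \<longleftrightarrow> bij_betw e {..<n} {..<n} \<and> (\<forall>i j. i \<le> j \<longrightarrow> j < n \<longrightarrow> w (e i) \<le> w (e j))"

lemma increasing_order_exists: "\<exists>e. increasing_order n w e"
proof -
  define l where "l = sort_key w [0..<n]"
  have l1: "length l = n" unfolding l_def length_sort by (rule diff_zero[THEN trans[OF length_upt]])
  have l2: "set l = {..<n}" unfolding l_def set_sort set_upt by (rule atLeast0LessThan)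
  have l3: "distinct l" unfolding l_def distinct_sort by (rule distinct_upt)
  have l4: "sorted (map w l)" unfolding l_def by (rule sorted_sort_key)
  note l = l1 l2 l3 l4
  have "bij_betw ((!) l) {..<n} {..<n}" by (rule bij_betw_nth[OF l3]) (simp_all only: l1 l2)
  moreover have "w (l ! i) \<le> w (l ! j)" if "i \<le> j" "j < n" for i j
    using sorted_nth_mono[OF l4 that(1)] that by (simp add: l1)
  ultimately show ?thesis unfolding increasing_order_def by blast
qed

lemma increasing_order_sum_le:
  assumes e: "increasing_order n w e" and f: "f ` {..<k} \<subseteq> {..<n}" "inj_on f {..<k}"
  shows "(\<Sum>i<k. w (e i)) \<le> (\<Sum>i<k. w (f i))"
proof -
  have bij: "bij_betw e {..<n} {..<n}" and mono: "\<And>i j. i \<le> j \<Longrightarrow> j < n \<Longrightarrow> w (e i) \<le> w (e j)"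
    using e by (auto simp: increasing_order_def)
  define S where "S = {i. i < n \<and> e i \<in> f ` {..<k}}"
  have eS: "bij_betw e S (f ` {..<k})"
  proof -
    have "y \<in> e ` S" if y: "y \<in> f ` {..<k}" for y
    proof -
      have "y \<in> e ` {..<n}" using f(1) y bij by (auto simp: bij_betw_def)
      then obtain j where "j < n" "y = e j" by auto
      then show ?thesis using y by (auto simp: S_def)
    qed
    then have "f ` {..<k} = e ` S" by (auto simp: S_def)
    moreover have "inj_on e S" using bij by (auto simp: S_def bij_betw_def inj_on_def)
    ultimately show ?thesis by (simp add: bij_betw_def)
  qed
  have "card S = k" using bij_betw_same_card[OF eS] card_image[OF f(2)] by simp
  then have "(\<Sum>i<k. w (e i)) \<le> (\<Sum>i\<in>S. w (e i))"
    by (intro sum_mono_le[of n]) (auto simp: S_def mono)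
  also have "\<dots> = sum w (f ` {..<k})" by (rule sum.reindex_bij_betw[OF eS])
  also have "\<dots> = (\<Sum>i<k. w (f i))" by (simp add: sum.reindex[OF f(2)])
  finally show ?thesis .
qed

lemma minor_upper_diag:
  assumes A: "\<And>i j. i < k \<Longrightarrow> j < i \<Longrightarrow> A $$ (r i, c j) = 0"
  shows "minor A k r c = (\<Prod>i<k. (A :: 'b::comm_ring_1 mat) $$ (r i, c i))"
proof -
  let ?M = "mat k k (\<lambda>(i, j). A $$ (r i, c j))"
  have "det ?M = prod_list (diag_mat ?M)"
    by (rule det_upper_triangular[of _ k]) (auto simp: A)
  also have "\<dots> = (\<Prod>i<k. A $$ (r i, c i))"
    by (simp add: prod_list_diag_prod atLeast0LessThan)
  finally show ?thesis by (simp add: minor_def)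
qed

text \<open>By triangularity, the principal minor of \<open>A\<close> on the \<open>k\<close>
  smallest weights of \<open>w\<close> is \<open>tpow\<close> of their sum. As a minor of
  \<open>X D Y\<close>, its valuation is at least the sum of the \<open>k\<close> smallest weights
  of \<open>v\<close>.\<close>

lemma dominance_sum:
  fixes A :: "'a::field fls mat"
  assumes A: "pat n (\<le>) A" "\<And>i. i < n \<Longrightarrow> A $$ (i, i) = tpow (w i)"
    and XY: "A = X * Dmat n v * Y" "imat n X" "imat n Y"
    and e: "increasing_order n w e" "increasing_order n v e'" and k: "k \<le> n"
  shows "(\<Sum>i<k. v (e' i)) \<le> (\<Sum>i<k. w (e i))"
proof -
  have bij: "bij_betw e {..<n} {..<n}" using e(1) by (simp add: increasing_order_def)
  define S where "S = e ` {..<k}"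
  have inj: "inj_on e {..<k}" using bij k by (auto simp: bij_betw_def intro: inj_on_subset)
  have S: "finite S" "card S = k" "S \<subseteq> {..<n}" using bij k card_image[OF inj] by (auto simp: S_def bij_betw_def)
  \<comment> \<open>\<open>e\<close> lists \<open>S\<close> by weight, but the submatrix is
    triangular only if its indices increase. So \<open>S\<close> is listed anew in its natural
    order.\<close>
  define r where "r i = sorted_list_of_set S ! i" for i
  have l: "length (sorted_list_of_set S) = k" "set (sorted_list_of_set S) = S" using S by auto
  have r_mem: "r i \<in> S" if "i < k" for i using that l nth_mem[of i "sorted_list_of_set S"] by (simp add: r_def)
  have r_mono: "r j < r i" if "j < i" "i < k" for i j
    using sorted_wrt_nth_less[OF strict_sorted_list_of_set[of S], of j i] that l by (simp add: r_def)
  have r_bij: "bij_betw r {..<k} S" unfolding r_def using l by (intro bij_betw_nth) auto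
  have rn: "r i < n" if "i < k" for i using r_mem[OF that] S(3) by auto
  have "minor A k r r = (\<Prod>i<k. A $$ (r i, r i))"
  proof (rule minor_upper_diag)
    fix i j assume "i < k" "j < i"
    then show "A $$ (r i, r j) = 0" using r_mono[of j i] rn[of i] rn[of j] by (intro patD(2)[OF A(1)]) auto
  qed
  also have "\<dots> = (\<Prod>i<k. tpow (w (r i)))" using A(2) rn by simp
  also have "\<dots> = tpow (\<Sum>i<k. w (r i))" by (simp add: tpow_sum)
  also have "(\<Sum>i<k. w (r i)) = sum w S" by (rule sum.reindex_bij_betw[OF r_bij])
  also have "\<dots> = (\<Sum>i<k. w (e i))" unfolding S_def by (simp add: sum.reindex[OF inj])
  finally have "minor A k r r = tpow (\<Sum>i<k. w (e i))" .
  moreover have "vge (\<Sum>i<k. v (e' i)) (minor A k r r)"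
    unfolding XY(1) by (rule minor_bound[OF XY(2,3) increasing_order_sum_le[OF e(2)]]) (use rn in auto)
  ultimately show ?thesis by (simp add: vge_tpow_iff)
qed

text \<open>Determinants are compared; those of \<open>X\<close> and \<open>Y\<close> are units of
  \<open>C[[t]]\<close>. Equality of the totals later turns bounds on the smallest weights into
  bounds on the largest.\<close>

lemma sum_weights_eq:
  fixes A :: "'a::field fls mat"
  assumes A: "pat n (\<le>) A" "\<And>i. i < n \<Longrightarrow> A $$ (i, i) = tpow (w i)"
    and XY: "A = X * Dmat n v * Y" "X \<in> GL_power_series n" "Y \<in> GL_power_series n"
  shows "(\<Sum>i<n. v i) = (\<Sum>i<n. w i)"
proof -
  note x = GL_power_series_minv[OF XY(2)] and y = GL_power_series_minv[OF XY(3)]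
  have dA: "det A = tpow (\<Sum>i<n. w i)"
  proof -
    have "det A = prod_list (diag_mat A)"
      by (rule det_upper_triangular[of _ n]) (use patD(1)[OF A(1)] in \<open>auto simp: upper_triangular_def intro!: patD(2)[OF A(1)]\<close>)
    also have "\<dots> = (\<Prod>i<n. A $$ (i, i))" using patD(1)[OF A(1)] by (simp add: prod_list_diag_prod atLeast0LessThan)
    finally show ?thesis using A(2) by (simp add: tpow_sum)
  qed
  have dD: "det (Dmat n v :: 'a fls mat) = tpow (\<Sum>i<n. v i)"
  proof -
    have "det (Dmat n v :: 'a fls mat) = prod_list (diag_mat (Dmat n v))"
      by (rule det_upper_triangular[of _ n]) (auto simp: mat_diag_def)
    also have "\<dots> = (\<Prod>i<n. tpow (v i))" by (simp add: prod_list_diag_prod atLeast0LessThan mat_diag_def)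
    finally show ?thesis by (simp add: tpow_sum)
  qed
  have "det A = det X * det (Dmat n v) * det Y"
    unfolding XY(1) using x(3) y(3) by (simp add: det_mult[of _ n])
  then have e: "tpow (\<Sum>i<n. w i) = det X * tpow (\<Sum>i<n. v i) * det Y" by (simp add: dA dD)
  define u where "u = det X * det Y"
  have u: "fls_int u" "fls_int (inverse u)" "u \<noteq> 0"
    using fls_int_det[OF x(1)] fls_int_det[OF y(1)] x(4,6) y(4,6) by (auto simp: u_def)
  have e': "tpow (\<Sum>i<n. w i) = tpow (\<Sum>i<n. v i) * u" using e by (simp add: u_def mult_ac)
  then have "vge (\<Sum>i<n. v i) (tpow (\<Sum>i<n. w i) :: 'a fls)"
    using vge_int_mult[OF _ u(1), of "\<Sum>i<n. v i" "tpow (\<Sum>i<n. v i)"] by (simp add: vge_tpow_iff)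
  moreover have "tpow (\<Sum>i<n. v i) = tpow (\<Sum>i<n. w i) * inverse u" using e' u(3) by simp
  then have "vge (\<Sum>i<n. w i) (tpow (\<Sum>i<n. v i) :: 'a fls)"
    using vge_int_mult[OF _ u(2), of "\<Sum>i<n. w i" "tpow (\<Sum>i<n. w i)"] by (simp add: vge_tpow_iff)
  ultimately show ?thesis by (simp add: vge_tpow_iff)
qed

section \<open>Unipotent matrices with prescribed support\<close>

definition unip :: "nat \<Rightarrow> (nat \<Rightarrow> nat \<Rightarrow> bool) \<Rightarrow> 'b::ring_1 mat \<Rightarrow> bool" where
  "unip n P A \<longleftrightarrow> A \<in> carrier_mat n n \<and> pat n P (A - 1\<^sub>m n)"

lemma unipI:
  assumes "A \<in> carrier_mat n n" "\<And>i. i < n \<Longrightarrow> A $$ (i, i) = 1"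
    "\<And>i j. i < n \<Longrightarrow> j < n \<Longrightarrow> i \<noteq> j \<Longrightarrow> \<not> P i j \<Longrightarrow> A $$ (i, j) = 0"
  shows "unip n P A"
  using assms by (auto simp: unip_def pat_def)

lemma unipD:
  assumes "unip n P A"
  shows "A \<in> carrier_mat n n" "\<And>i j. i < n \<Longrightarrow> j < n \<Longrightarrow> i \<noteq> j \<Longrightarrow> \<not> P i j \<Longrightarrow> A $$ (i, j) = 0"
    "\<And>i. i < n \<Longrightarrow> \<not> P i i \<Longrightarrow> A $$ (i, i) = 1"
proof -
  show A: "A \<in> carrier_mat n n" using assms by (simp add: unip_def)
  have p: "(A - 1\<^sub>m n) $$ (i, j) = 0" if "i < n" "j < n" "\<not> P i j" for i j
    using assms that by (auto simp: unip_def pat_def)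
  show "A $$ (i, j) = 0" if "i < n" "j < n" "i \<noteq> j" "\<not> P i j" for i j
    using p[OF that(1,2,4)] that A by simp
  show "A $$ (i, i) = 1" if "i < n" "\<not> P i i" for i
    using p[OF that(1,1,2)] that A by simp
qed

lemma unip_mult:
  assumes "unip n P A" "unip n P (B :: 'b::ring_1 mat)"
    and tr: "\<And>i j k. i < n \<Longrightarrow> j < n \<Longrightarrow> k < n \<Longrightarrow> P i j \<Longrightarrow> P j k \<Longrightarrow> P i k"
  shows "unip n P (A * B)"
proof -
  have c: "A \<in> carrier_mat n n" "B \<in> carrier_mat n n" using assms by (auto simp: unip_def)
  have p: "pat n P (A - 1\<^sub>m n)" "pat n P (B - 1\<^sub>m n)" using assms by (auto simp: unip_def)
  have "(A - 1\<^sub>m n) * (B - 1\<^sub>m n) = A * (B - 1\<^sub>m n) - 1\<^sub>m n * (B - 1\<^sub>m n)"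
    by (rule minus_mult_distrib_mat[OF c(1) one_carrier_mat minus_carrier_mat[OF one_carrier_mat]])
  also have "A * (B - 1\<^sub>m n) = A * B - A * 1\<^sub>m n" by (rule mult_minus_distrib_mat[OF c one_carrier_mat])
  finally have "(A - 1\<^sub>m n) * (B - 1\<^sub>m n) = (A * B - A) - (B - 1\<^sub>m n)" using c by simp
  then have "A * B - 1\<^sub>m n = ((A - 1\<^sub>m n) * (B - 1\<^sub>m n)) + ((A - 1\<^sub>m n) + (B - 1\<^sub>m n))"
    using c by (intro eq_matI) (auto simp del: index_mult_mat(1))
  moreover have "pat n P ((A - 1\<^sub>m n) * (B - 1\<^sub>m n))" by (rule pat_mult[OF p tr])
  ultimately show ?thesis unfolding unip_def using c p by (auto intro!: pat_add)
qed

lemma unip_one: "unip n P (1\<^sub>m n)" by (rule unipI) auto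

text \<open>The inverse is the series \<open>1 / (1 + X)\<close> evaluated at the nilpotent matrix
  \<open>A - 1\<close>, so it inherits support and integrality.\<close>

lemma unip_inverse:
  fixes A :: "'a::field fls mat"
  assumes A: "unip n P A" and lt: "\<And>i j. i < n \<Longrightarrow> j < n \<Longrightarrow> P i j \<Longrightarrow> i < j"
    and tr: "\<And>i j k. i < n \<Longrightarrow> j < n \<Longrightarrow> k < n \<Longrightarrow> P i j \<Longrightarrow> P j k \<Longrightarrow> P i k"
  obtains B where "unip n P B" "A * B = 1\<^sub>m n" "B * A = 1\<^sub>m n" "imat n A \<Longrightarrow> imat n B"
proof -
  \<comment> \<open>The exponent is \<open>Suc n\<close> because \<open>fev_nil\<close> asks for a
    positive one, also when \<open>n = 0\<close>.\<close>
  let ?N = "A - 1\<^sub>m n" and ?f = "inverse (1 + fps_X) :: 'a fps" and ?m = "Suc n"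
  have c: "A \<in> carrier_mat n n" "pat n P ?N" using A by (auto simp: unip_def)
  have Nc: "?N \<in> carrier_mat n n" using c by (auto simp: pat_def)
  have "upat n 1 ?N" by (rule pat_mono[OF c(2)]) (use lt in force)
  then have "?N ^\<^sub>m n = 0\<^sub>m n n" by (rule upat_nilpotent)
  then have "?N ^\<^sub>m ?m = 0\<^sub>m n n" by (rule pow_mat_zero_ge[OF Nc]) simp
  then have fn: "fev_nil (fls_const :: 'a \<Rightarrow> 'a fls) n ?m ?N"
    by (intro fev_nil.intro fev_nil_axioms.intro fls_const.comm_ring_hom_axioms Nc zero_less_Suc)
  note fev_add = fev_nil.fev_add[OF fn] and fev_one = fev_nil.fev_one[OF fn] and fev_X = fev_nil.fev_X[OF fn]
    and fev_mult = fev_nil.fev_mult[OF fn] and fev_diff = fev_nil.fev_diff[OF fn]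
  have f: "?f * (1 + fps_X) = 1" by (rule inverse_mult_eq_1) simp
  define B where "B = fev fls_const ?f ?m ?N"
  have "1\<^sub>m n + ?N = A" using c by (intro eq_matI) auto
  then have A': "fev fls_const (1 + fps_X) ?m ?N = A" by (simp add: fev_add fev_one fev_X)
  have BA: "B * A = 1\<^sub>m n" "A * B = 1\<^sub>m n"
  proof -
    have "fev fls_const ?f ?m ?N * fev fls_const (1 + fps_X) ?m ?N = 1\<^sub>m n"
      unfolding fev_mult[symmetric] f by (rule fev_one)
    then show "B * A = 1\<^sub>m n" unfolding A' B_def .
    have "fev fls_const (1 + fps_X) ?m ?N * fev fls_const ?f ?m ?N = 1\<^sub>m n"
      unfolding fev_mult[symmetric] mult.commute[of "1 + fps_X" ?f] f by (rule fev_one)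
    then show "A * B = 1\<^sub>m n" unfolding A' B_def .
  qed
  have "B - 1\<^sub>m n = fev fls_const (?f - 1) ?m ?N" by (simp add: B_def fev_diff fev_one)
  moreover have "pat n P (fev fls_const (?f - 1) ?m ?N)" by (rule pat_fev[OF c(2) tr]) simp_all
  ultimately have "unip n P B" unfolding unip_def B_def using Nc by simp
  moreover have "imat n B" if "imat n A"
    unfolding B_def by (rule imat_fev) (use that Nc in \<open>auto simp: imat_def\<close>)
  ultimately show ?thesis using BA that by blast
qed

section \<open>Elimination with integral multipliers\<close>

lemma Dmat_carrier: "Dmat n w \<in> carrier_mat n n" by simp

lemma imat_minus_one_elementary:
  assumes "\<And>a. a < n \<Longrightarrow> fls_int (c a)" shows "imat n (mat n n (\<lambda>(a, b). if a = b then 1 else if b = i then c a else 0))"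
    "imat n (mat n n (\<lambda>(a, b). if a = b then 1 else if a = i then c b else 0))"
  using assms by (auto simp: imat_def)

lemma elementary_inverse:
  fixes c :: "nat \<Rightarrow> 'b::comm_ring_1"
  assumes i: "i < n"
  shows "mat n n (\<lambda>(a, b). if a = b then 1 else if b = i then - c a else 0) *
      mat n n (\<lambda>(a, b). if a = b then 1 else if b = i then c a else 0) = 1\<^sub>m n" (is "?L * ?R = _")
    "mat n n (\<lambda>(a, b). if a = b then 1 else if a = i then c b else 0) *
      mat n n (\<lambda>(a, b). if a = b then 1 else if a = i then - c b else 0) = 1\<^sub>m n" (is "?L' * ?R' = _")
proof -
  show "?L * ?R = 1\<^sub>m n"
  proof (rule eq_matI)
    fix a b assume "a < dim_row (1\<^sub>m n)" "b < dim_col (1\<^sub>m n)"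
    then have ab: "a < n" "b < n" by auto
    have "(?L * ?R) $$ (a, b) = (\<Sum>l<n. ?L $$ (a, l) * ?R $$ (l, b))"
      by (rule index_mult_mat_sum) (use ab in auto)
    also have "\<dots> = (\<Sum>l<n. (if l = a then ?R $$ (a, b) else 0) + (if l = i then (if a = i then 0 else - c a) * ?R $$ (i, b) else 0))"
      using ab i by (intro sum.cong refl) auto
    also have "\<dots> = ?R $$ (a, b) + (if a = i then 0 else - c a) * ?R $$ (i, b)"
      using ab i by (simp add: sum.distrib sum.delta)
    also have "\<dots> = 1\<^sub>m n $$ (a, b)" using ab i by auto
    finally show "(?L * ?R) $$ (a, b) = 1\<^sub>m n $$ (a, b)" .
  qed auto
  show "?L' * ?R' = 1\<^sub>m n"
  proof (rule eq_matI)
    fix a b assume "a < dim_row (1\<^sub>m n)" "b < dim_col (1\<^sub>m n)"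
    then have ab: "a < n" "b < n" by auto
    have "(?L' * ?R') $$ (a, b) = (\<Sum>l<n. ?L' $$ (a, l) * ?R' $$ (l, b))"
      by (rule index_mult_mat_sum) (use ab in auto)
    also have "\<dots> = (\<Sum>l<n. (if l = b then ?L' $$ (a, b) else 0) + (if l = i then ?L' $$ (a, i) * (if b = i then 0 else - c b) else 0))"
      using ab i by (intro sum.cong refl) auto
    also have "\<dots> = ?L' $$ (a, b) + ?L' $$ (a, i) * (if b = i then 0 else - c b)"
      using ab i by (simp add: sum.distrib sum.delta)
    also have "\<dots> = 1\<^sub>m n $$ (a, b)" using ab i by auto
    finally show "(?L' * ?R') $$ (a, b) = 1\<^sub>m n $$ (a, b)" .
  qed auto
qed

lemma elementary_product:
  fixes B :: "'b::comm_ring_1 mat"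
  assumes B: "B \<in> carrier_mat n n" and i: "i < n" and ab: "a < n" "b < n"
  shows "(mat n n (\<lambda>(a, b). if a = b then 1 else if b = i then c a else 0) * B *
      mat n n (\<lambda>(a, b). if a = b then 1 else if a = i then d b else 0)) $$ (a, b) =
    (B $$ (a, b) + (if a = i then 0 else c a) * B $$ (i, b)) +
    (B $$ (a, i) + (if a = i then 0 else c a) * B $$ (i, i)) * (if b = i then 0 else d b)" (is "(?E * B * ?F) $$ _ = _")
proof -
  have EB: "(?E * B) $$ (a, l) = B $$ (a, l) + (if a = i then 0 else c a) * B $$ (i, l)" if l: "l < n" for l
  proof -
    have "(?E * B) $$ (a, l) = (\<Sum>p<n. ?E $$ (a, p) * B $$ (p, l))"
      by (rule index_mult_mat_sum) (use ab l B in auto)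
    also have "\<dots> = (\<Sum>p<n. (if p = a then B $$ (a, l) else 0) + (if p = i then (if a = i then 0 else c a) * B $$ (i, l) else 0))"
      using ab i by (intro sum.cong refl) auto
    finally show ?thesis using ab i by (simp add: sum.distrib sum.delta)
  qed
  have "(?E * B * ?F) $$ (a, b) = (\<Sum>l<n. (?E * B) $$ (a, l) * ?F $$ (l, b))"
    by (rule index_mult_mat_sum) (use ab B in auto)
  also have "\<dots> = (\<Sum>l<n. (if l = b then (?E * B) $$ (a, b) else 0) + (if l = i then (?E * B) $$ (a, i) * (if b = i then 0 else d b) else 0))"
    using ab i by (intro sum.cong refl) (auto simp del: index_mult_mat(1))
  also have "\<dots> = (?E * B) $$ (a, b) + (?E * B) $$ (a, i) * (if b = i then 0 else d b)"
    using ab i by (simp add: sum.distrib sum.delta del: index_mult_mat(1))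
  finally show ?thesis unfolding EB[OF ab(2)] EB[OF i] .
qed

text \<open>Gaussian elimination with the pivots taken in order of increasing weight. The minors bound the
  remaining entries, so every multiplier is integral.\<close>

lemma elimination:
  fixes A :: "'a::field fls mat"
  assumes A: "pat n (\<le>) A" "\<And>i. i < n \<Longrightarrow> A $$ (i, i) = tpow (w i)"
    and XY: "A = X0 * Dmat n w * Y0" "imat n X0" "imat n Y0"
  obtains X Y where "A = X * Dmat n w * Y" "imat n X" "imat n Y"
    "unip n (\<lambda>i j. i < j \<and> w j \<le> w i) X" "unip n (\<lambda>i j. i < j \<and> w i \<le> w j) Y"
proof -
  let ?p = "\<lambda>i j. i < j \<and> w j \<le> w i" and ?q = "\<lambda>i j. i < j \<and> w i \<le> w j"
  obtain e where e: "increasing_order n w e" using increasing_order_exists by blast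
  have bij: "bij_betw e {..<n} {..<n}" and mono: "\<And>i j. i \<le> j \<Longrightarrow> j < n \<Longrightarrow> w (e i) \<le> w (e j)"
    using e by (auto simp: increasing_order_def)
  have en: "e k < n" if "k < n" for k using bij that by (auto simp: bij_betw_def)
  have e_inj: "e k = e l \<longleftrightarrow> k = l" if "k < n" "l < n" for k l
    using bij that by (auto simp: bij_betw_def inj_on_def)
  \<comment> \<open>Besides the cleared rows and columns, the invariant keeps a factorization of
    \<open>B\<close> itself with integral \<open>X'\<close> and \<open>Y'\<close>, so that
    \<open>minor_bound\<close> stays applicable.\<close>
  define G where "G k X Y B \<longleftrightarrow> A = X * B * Y \<and> imat n X \<and> imat n Y \<and> unip n ?p X \<and> unip n ?q Y \<and>
      pat n (\<le>) B \<and> (\<forall>i<n. B $$ (i, i) = tpow (w i)) \<and> (\<exists>X' Y'. B = X' * Dmat n w * Y' \<and> imat n X' \<and> imat n Y') \<and>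
      (\<forall>l<k. \<forall>j<n. j \<noteq> e l \<longrightarrow> B $$ (e l, j) = 0 \<and> B $$ (j, e l) = 0)" for k X Y and B :: "'a fls mat"
  have "\<exists>X Y B. G k X Y B" if "k \<le> n" for k
    using that
  proof (induction k)
    case 0
    have "G 0 (1\<^sub>m n) (1\<^sub>m n) A"
    proof -
      have "A = 1\<^sub>m n * A * 1\<^sub>m n" using patD(1)[OF A(1)] by simp
      with A XY show ?thesis unfolding G_def by (intro conjI imat_one unip_one) auto
    qed
    then show ?case by blast
  next
    case (Suc k)
    then obtain X Y B where "G k X Y B" by auto
    then obtain X' Y' where G: "A = X * B * Y" "imat n X" "imat n Y" "unip n ?p X" "unip n ?q Y" "pat n (\<le>) B"
      "\<And>i. i < n \<Longrightarrow> B $$ (i, i) = tpow (w i)" "B = X' * Dmat n w * Y'" "imat n X'" "imat n Y'"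
      "\<And>l j. l < k \<Longrightarrow> j < n \<Longrightarrow> j \<noteq> e l \<Longrightarrow> B $$ (e l, j) = 0 \<and> B $$ (j, e l) = 0" unfolding G_def by blast
    have kn: "k < n" using Suc.prems by simp
    define i where "i = e k"
    have i: "i < n" unfolding i_def by (rule en[OF kn])
    have B: "B \<in> carrier_mat n n" by (rule patD(1)[OF G(6)])
    note Xc = imatD(1)[OF G(2)] and Yc = imatD(1)[OF G(3)]
    have ne: "e l \<noteq> i" if "l < k" for l using e_inj[of l k] that kn unfolding i_def by auto
    \<comment> \<open>The pivots used so far are bordered by row \<open>a\<close> and column
      \<open>b\<close>. As the pivot columns are cleared, this minor is the product of the pivots
      and \<open>B $$ (a, b)\<close>; dividing its bound by the pivots leaves the next smallest
      weight \<open>w i\<close>.\<close>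
    have entry: "vge (w i) (B $$ (a, b))" if ab: "a < n" "b < n" "a \<notin> e ` {..<k}" "b \<notin> e ` {..<k}" for a b
    proof -
      define r where "r l = (if l < k then e l else a)" for l
      define c where "c l = (if l < k then e l else b)" for l
      have "minor B (Suc k) r c = (\<Prod>l<Suc k. B $$ (r l, c l))"
      proof (rule minor_upper_diag)
        fix p q assume pq: "p < Suc k" "q < p"
        then have q: "c q = e q" "q < k" by (auto simp: c_def)
        have "r p \<noteq> e q" "r p < n"
          using pq ab(1,3) e_inj[of p q] en[of p] kn by (auto simp: r_def)
        then show "B $$ (r p, c q) = 0" using G(11)[OF q(2), of "r p"] q(1) by simp
      qed
      also have "\<dots> = (\<Prod>l<k. tpow (w (e l))) * B $$ (a, b)"
      proof -
        have "(\<Prod>l<k. B $$ (r l, c l)) = (\<Prod>l<k. tpow (w (e l)))"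
          by (rule prod.cong[OF refl]) (use G(7) en kn in \<open>auto simp: r_def c_def\<close>)
        then show ?thesis by (simp add: r_def c_def)
      qed
      also have "\<dots> = tpow (\<Sum>l<k. w (e l)) * B $$ (a, b)" by (simp add: tpow_sum)
      finally have m: "minor B (Suc k) r c = \<dots>" .
      have rc: "r ` {..<Suc k} \<subseteq> {..<n}" "c ` {..<Suc k} \<subseteq> {..<n}"
      proof -
        have "r l < n" "c l < n" if "l < Suc k" for l
          using en[of l] that kn ab(1,2) by (simp_all add: r_def c_def)
        then show "r ` {..<Suc k} \<subseteq> {..<n}" "c ` {..<Suc k} \<subseteq> {..<n}" by auto
      qed
      have "vge (\<Sum>l<Suc k. w (e l)) (minor B (Suc k) r c)"
        unfolding G(8) by (rule minor_bound[OF G(9,10) increasing_order_sum_le[OF e] rc])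
      then show ?thesis unfolding m sum.lessThan_Suc i_def by (simp only: vge_tpow_mult)
    qed
    have w_ge: "w i \<le> w a" if a: "a < n" "a \<notin> e ` {..<k}" for a
    proof -
      have "a \<in> e ` {..<n}" using bij a(1) by (auto simp: bij_betw_def)
      then obtain l where l: "l < n" "a = e l" by auto
      with a(2) have "k \<le> l" by (meson imageI lessThan_iff not_le)
      with l show ?thesis unfolding i_def using mono by simp
    qed
    have i_new: "i \<notin> e ` {..<k}" using ne by auto
    define c where "c a = tpow (- w i) * B $$ (a, i)" for a
    define d where "d b = tpow (- w i) * B $$ (i, b)" for b
    \<comment> \<open>In a row not yet used as pivot, \<open>w i \<le> w a\<close> holds by the
      order of the pivots and triangularity yields \<open>a < i\<close>; used rows are already
      cleared. This is the origin of the weight condition on \<open>X\<close>, and \<open>d0\<close>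
      gives the one on \<open>Y\<close>.\<close>
    have c0: "c a = 0" if "a < n" "a \<noteq> i" "\<not> ?p a i" for a
    proof (cases "a \<in> e ` {..<k}")
      case True
      then obtain l where "l < k" "a = e l" by auto
      then show ?thesis using G(11)[of l i] i that(2) by (simp add: c_def)
    next
      case False
      with w_ge[OF that(1)] that have "\<not> a \<le> i" by auto
      then show ?thesis using patD(2)[OF G(6) that(1) i] by (simp add: c_def)
    qed
    have d0: "d b = 0" if "b < n" "b \<noteq> i" "\<not> ?q i b" for b
    proof (cases "b \<in> e ` {..<k}")
      case True
      then obtain l where "l < k" "b = e l" by auto
      then show ?thesis using G(11)[of l i] i that(2) by (simp add: d_def)
    next
      case False
      with w_ge[OF that(1)] that have "\<not> i \<le> b" by auto
      then show ?thesis using patD(2)[OF G(6) i that(1)] by (simp add: d_def)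
    qed
    have c_int: "fls_int (c a)" if a: "a < n" for a
    proof (cases "a \<in> e ` {..<k}")
      case True
      then obtain l where "l < k" "a = e l" by auto
      then show ?thesis using G(11)[of l i] i ne[of l] by (auto simp: c_def)
    next
      case False
      then show ?thesis using entry[OF a i False i_new] by (simp add: c_def vge_def)
    qed
    have d_int: "fls_int (d b)" if b: "b < n" for b
    proof (cases "b \<in> e ` {..<k}")
      case True
      then obtain l where "l < k" "b = e l" by auto
      then show ?thesis using G(11)[of l i] i ne[of l] by (auto simp: d_def)
    next
      case False
      then show ?thesis using entry[OF i b i_new False] by (simp add: d_def vge_def)
    qed
    have ct: "c a * tpow (w i) = B $$ (a, i)" for a
    proof -
      have "c a * tpow (w i) = (tpow (- w i) * tpow (w i)) * B $$ (a, i)" by (simp only: c_def mult_ac)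
      then show ?thesis by (simp only: tpow_minus mult_1_left)
    qed
    have dt: "tpow (w i) * d b = B $$ (i, b)" for b
    proof -
      have "tpow (w i) * d b = (tpow (- w i) * tpow (w i)) * B $$ (i, b)" by (simp only: d_def mult_ac)
      then show ?thesis by (simp only: tpow_minus mult_1_left)
    qed
    have cd: "B $$ (a, i) * d b = c a * B $$ (i, b)" for a b
      by (simp only: ct[of a, symmetric] dt[of b, symmetric] mult_ac)
    define E where "E = mat n n (\<lambda>(a, b). if a = b then 1 else if b = i then c a else 0)"
    define E' where "E' = mat n n (\<lambda>(a, b). if a = b then 1 else if b = i then - c a else 0)"
    define F where "F = mat n n (\<lambda>(a, b). if a = b then 1 else if a = i then d b else 0)"
    define F' where "F' = mat n n (\<lambda>(a, b). if a = b then 1 else if a = i then - d b else 0)"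
    \<comment> \<open>The matrix after clearing row and column \<open>i\<close>: a Schur complement
      with respect to the pivot \<open>tpow (w i)\<close>.\<close>
    define C where "C = mat n n (\<lambda>(a, b). if a = i \<and> b = i then tpow (w i) else if a = i \<or> b = i then 0
        else B $$ (a, b) - c a * B $$ (i, b))"
    have cE: "E \<in> carrier_mat n n" "E' \<in> carrier_mat n n" "F \<in> carrier_mat n n" "F' \<in> carrier_mat n n" "C \<in> carrier_mat n n"
      by (simp_all add: E_def E'_def F_def F'_def C_def)
    have inv: "E' * E = 1\<^sub>m n" "F * F' = 1\<^sub>m n"
      unfolding E_def E'_def F_def F'_def by (rule elementary_inverse[OF i])+
    have iE: "imat n E" "imat n F" "imat n E'" "imat n F'"
      unfolding E_def E'_def F_def F'_def
      by (rule imat_minus_one_elementary, use c_int d_int in simp)+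
    have ECF: "E * C * F = B"
    proof (rule eq_matI)
      fix a b assume "a < dim_row B" "b < dim_col B"
      then have ab: "a < n" "b < n" using B by auto
      have "(E * C * F) $$ (a, b) = (C $$ (a, b) + (if a = i then 0 else c a) * C $$ (i, b)) +
          (C $$ (a, i) + (if a = i then 0 else c a) * C $$ (i, i)) * (if b = i then 0 else d b)"
        unfolding E_def F_def by (rule elementary_product[OF cE(5) i ab])
      also have "\<dots> = B $$ (a, b)"
        using ab i ct[of a] dt[of b] G(7)[OF i] cd[of a b]
        by (cases "a = i"; cases "b = i") (auto simp: C_def mult.assoc)
      finally show "(E * C * F) $$ (a, b) = B $$ (a, b)" .
    qed (use B cE in auto)
    have C_eq: "C = E' * B * F'"
    proof -
      have "E' * B * F' = (E' * E) * C * (F * F')"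
        unfolding ECF[symmetric] using cE by (smt (verit) assoc_mult_mat mult_carrier_mat)
      then show ?thesis unfolding inv using cE by simp
    qed
    have "G (Suc k) (X * E) (F * Y) C"
      unfolding G_def
    proof (intro conjI allI impI)
      show "A = X * E * C * (F * Y)"
        unfolding G(1) ECF[symmetric] using cE Xc Yc by (smt (verit) assoc_mult_mat mult_carrier_mat)
      show "imat n (X * E)" "imat n (F * Y)" using iE G by (auto intro: imat_mult)
      have "unip n ?p E" by (rule unipI) (use c0 in \<open>auto simp: E_def\<close>)
      then show "unip n ?p (X * E)" by (rule unip_mult[OF G(4)]) auto
      have "unip n ?q F" by (rule unipI) (use d0 in \<open>auto simp: F_def\<close>)
      then show "unip n ?q (F * Y)" by (rule unip_mult[OF _ G(5)]) auto
      \<comment> \<open>A nonzero correction needs \<open>a < i\<close> and \<open>i < b\<close>. So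
        elimination changes only entries strictly above the diagonal and keeps the diagonal
        weights.\<close>
      have cB: "c a * B $$ (i, b) = 0" if "a < n" "b < n" "a \<noteq> i" "b \<noteq> i" "b \<le> a" for a b
      proof (cases "a < i")
        case True
        then show ?thesis using patD(2)[OF G(6) i that(2)] that by simp
      next
        case False
        then show ?thesis using c0[of a] that by simp
      qed
      show "pat n (\<le>) C"
        unfolding pat_def
      proof (intro conjI allI impI)
        fix a b assume "a < n" "b < n" "\<not> a \<le> b"
        then show "C $$ (a, b) = 0" using cB[of a b] patD(2)[OF G(6), of a b] by (auto simp: C_def)
      qed (rule cE)
      show "C $$ (a, a) = tpow (w a)" if "a < n" for a
        using that cB[of a a] G(7)[of a] by (auto simp: C_def)
      have "C = (E' * X') * Dmat n w * (Y' * F')"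
        unfolding C_eq G(8) using cE imatD(1)[OF G(9)] imatD(1)[OF G(10)] Dmat_carrier[of n w]
        by (smt (verit) assoc_mult_mat mult_carrier_mat)
      then show "\<exists>X' Y'. C = X' * Dmat n w * Y' \<and> imat n X' \<and> imat n Y'"
        using imat_mult[OF iE(3) G(9)] imat_mult[OF G(10) iE(4)] by blast
      fix l j assume l: "l < Suc k" and j: "j < n" "j \<noteq> e l"
      have el: "e l < n" using en l kn by simp
      show "C $$ (e l, j) = 0"
      proof (cases "l = k")
        case True
        then show ?thesis using j i by (auto simp: C_def i_def)
      next
        case False
        then have lk: "l < k" using l by simp
        have "c (e l) = 0" using G(11)[OF lk i ne[OF lk, symmetric]] by (simp add: c_def)
        then show ?thesis using G(11)[OF lk j] j el ne[OF lk] by (auto simp: C_def)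
      qed
      show "C $$ (j, e l) = 0"
      proof (cases "l = k")
        case True
        then show ?thesis using j i by (auto simp: C_def i_def)
      next
        case False
        then have lk: "l < k" using l by simp
        have "B $$ (i, e l) = 0" using G(11)[OF lk i ne[OF lk, symmetric]] by simp
        then show ?thesis using G(11)[OF lk j] j el ne[OF lk] by (auto simp: C_def)
      qed
    qed
    then show ?case by blast
  qed
  from this[of n] obtain X Y B where "G n X Y B" by auto
  then have G: "A = X * B * Y" "imat n X" "imat n Y" "unip n ?p X" "unip n ?q Y" "pat n (\<le>) B"
    "\<And>i. i < n \<Longrightarrow> B $$ (i, i) = tpow (w i)"
    "\<And>l j. l < n \<Longrightarrow> j < n \<Longrightarrow> j \<noteq> e l \<Longrightarrow> B $$ (e l, j) = 0" unfolding G_def by blast+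
  have "B = Dmat n w"
  proof (rule eq_matI)
    fix a b assume "a < dim_row (Dmat n w)" "b < dim_col (Dmat n w)"
    then have ab: "a < n" "b < n" by (auto simp: mat_diag_def)
    then have "a \<in> e ` {..<n}" using bij by (auto simp: bij_betw_def)
    then obtain l where "l < n" "a = e l" by auto
    then show "B $$ (a, b) = Dmat n w $$ (a, b)" using G(7)[OF ab(1)] G(8)[of l b] ab by (auto simp: mat_diag_def)
  qed (use patD(1)[OF G(6)] in \<open>auto simp: mat_diag_def\<close>)
  with G show ?thesis by (intro that[of X Y]) auto
qed

section \<open>Unipotent groups\<close>

abbreviation line_gens :: "(('a::field \<Rightarrow> 'a) \<times> 'a fls) set" where
  "line_gens \<equiv> {(\<lambda>s. s, fls_X)}"

text \<open>Realizability over \<open>line_gens\<close> certifies that both sides are polynomials in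
  \<open>s\<close>, so agreement on an infinite set suffices.\<close>

lemma line_eq:
  fixes f g :: "'a::field_char_0 \<Rightarrow> 'a"
  assumes "realizes UNIV line_gens f v" "realizes UNIV line_gens g w" "infinite Z" "\<And>s. s \<in> Z \<Longrightarrow> f s = g s"
  shows "f s = g s"
proof -
  obtain p where p: "\<And>s. f s - g s = poly p s" using realizes_line[OF realizes_diff[OF assms(1,2)]] by auto
  have "Z \<subseteq> {s. poly p s = 0}" using assms(4) p[symmetric] by auto
  then have "p = 0" using assms(3) poly_roots_finite[of p] finite_subset by blast
  then show ?thesis using p[of s] by simp
qed

lemma line_eq_mat:
  fixes F G :: "'a::field_char_0 \<Rightarrow> 'a mat"
  assumes F: "mrealizes UNIV line_gens n m F V" and G: "mrealizes UNIV line_gens n m G W"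
    and "infinite Z" "\<And>s. s \<in> Z \<Longrightarrow> F s = G s"
  shows "F s = G s"
proof (rule eq_matI)
  have c: "F s \<in> carrier_mat n m" "G s \<in> carrier_mat n m" using mrealizesD(2)[OF F] mrealizesD(2)[OF G] by auto
  fix i j assume "i < dim_row (G s)" "j < dim_col (G s)"
  then have ij: "i < n" "j < m" using c by auto
  show "F s $$ (i, j) = G s $$ (i, j)"
    by (rule line_eq[OF mrealizesD(3)[OF F ij] mrealizesD(3)[OF G ij] assms(3)]) (simp add: assms(4))
qed (use mrealizesD(2)[OF F, of s] mrealizesD(2)[OF G, of s] in auto)

lemma infinite_nats: "infinite (range (of_nat :: nat \<Rightarrow> 'a::field_char_0))"
proof
  assume "finite (range (of_nat :: nat \<Rightarrow> 'a))"
  then have "finite (UNIV :: nat set)" by (rule finite_imageD) (simp add: inj_on_def)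
  then show False by simp
qed

lemma infinite_nonzero: "infinite {s :: 'a::field_char_0. s \<noteq> 0}"
proof -
  have "{s :: 'a. s \<noteq> 0} = UNIV - {0}" by auto
  then show ?thesis using infinite_UNIV_char_0[where ?'a = 'a] by simp
qed

lemma realizes_line_id: "realizes Z line_gens (\<lambda>s. s) fls_X" by (rule realizes_gen) simp

lemma mrealizes_line_smult:
  "X \<in> carrier_mat n m \<Longrightarrow> mrealizes Z line_gens n m (\<lambda>s. s \<cdot>\<^sub>m X) (fls_X \<cdot>\<^sub>m map_mat fls_const X)"
  by (intro mrealizes_smult realizes_line_id mrealizes_const)

lemma mrealizes_mexp:
  "mrealizes Z B n n F V \<Longrightarrow> mrealizes Z B n n (\<lambda>x. mexp id m (F x)) (mexp fls_const m V)"
  unfolding mexp_def by (rule mrealizes_fev)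

lemma mrealizes_mlog:
  assumes "mrealizes Z B n n F V" shows "mrealizes Z B n n (\<lambda>x. mlog id m (F x)) (mlog fls_const m V)"
proof -
  have "mrealizes Z B n n (\<lambda>x. fev id (fps_ln 1) m (F x - 1\<^sub>m n)) (fev fls_const (fps_ln 1) m (V - 1\<^sub>m n))"
    by (intro mrealizes_fev mrealizes_minus mrealizes_one assms)
  then have "mrealizes Z B n n (\<lambda>x. fev id (fps_ln 1) m (F x - 1\<^sub>m n)) (mlog fls_const m V)"
    by (simp only: mlog_def mrealizesD(4)[OF assms])
  then show ?thesis by (rule mrealizes_cong) (simp only: mlog_def mrealizesD(6)[OF assms])
qed

text \<open>For determinant one the inverse determinant is the constant \<open>1\<close>, which is
  realized anyway. By \<open>unipotent_group_nilp\<close> this covers all families with values in a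
  unipotent group.\<close>

lemma mrealizes_eval_map_det1:
  assumes pt: "fls_point Z B" and F: "mrealizes Z B N N F V" and d: "\<And>x. x \<in> Z \<Longrightarrow> det (F x) = 1"
    and "\<rho> \<in> carrier_mat n n" "fst ` elements_mat \<rho> \<subseteq> entry_polys N"
  shows "mrealizes Z B n n (\<lambda>x. eval_map id \<rho> (F x)) (eval_map fls_const \<rho> V)" "det V = 1"
proof -
  show V: "det V = 1"
    by (rule fls_point_unique[OF pt realizes_det[OF F] realizes_one]) (rule d)
  have "realizes Z B (\<lambda>x. inverse (det (F x))) 1" by (rule realizes_cong[OF realizes_one]) (simp add: d)
  then have "realizes Z B (\<lambda>x. inverse (det (F x))) (inverse (det V))" by (simp add: V)
  then show "mrealizes Z B n n (\<lambda>x. eval_map id \<rho> (F x)) (eval_map fls_const \<rho> V)"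
    by (rule mrealizes_eval_map[OF F _ assms(4,5)])
qed

text \<open>Isolates the first order part. The quadratic remainder is what
  \<open>log_exp_exp\<close> divides by \<open>s\<close> and what \<open>decompose\<close> pushes to
  a higher superdiagonal.\<close>

lemma fps_split2: "f = fps_const (fps_nth f 0) + fps_const (fps_nth f 1) * fps_X + fps_X * fps_X * fps_shift 2 (f :: 'a::comm_ring_1 fps)"
proof (rule fps_ext)
  fix k :: nat
  show "fps_nth f k = fps_nth (fps_const (fps_nth f 0) + fps_const (fps_nth f 1) * fps_X + fps_X * fps_X * fps_shift 2 f) k"
  proof (cases k rule: nat.exhaust)
    case (Suc l)
    then show ?thesis by (cases l) (auto simp: mult.assoc)
  qed (simp add: mult.assoc)
qed

lemma (in fev_nil) fev_const_mult: "fev h (fps_const c * f) m A = h c \<cdot>\<^sub>m fev h f m A"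
  by (rule eq_matI) (auto simp: fev_def hom_mult sum_distrib_left mult.assoc)

lemma (in fev_nil) fev_expand:
  "fev h f m A = h (fps_nth f 0) \<cdot>\<^sub>m 1\<^sub>m n + h (fps_nth f 1) \<cdot>\<^sub>m A + A * A * fev h (fps_shift 2 f) m A"
proof -
  have "fev h f m A = fev h (fps_const (fps_nth f 0) * 1 + fps_const (fps_nth f 1) * fps_X + fps_X * fps_X * fps_shift 2 f) m A"
    using fps_split2[of f] by (simp only: mult_1_right)
  then show ?thesis unfolding fev_add fev_const_mult unfolding fev_mult fev_one fev_X .
qed

context mexp_nil begin

lemma mexp_expand:
  assumes "nilp A" shows "mexp h m A = 1\<^sub>m n + A + A * A * fev h (fps_shift 2 (fps_exp 1)) m A"
proof -
  have s: "(1 :: 'b) \<cdot>\<^sub>m B = B" for B by (rule eq_matI) auto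
  show ?thesis unfolding mexp_def using fev_nil.fev_expand[OF fn[OF assms], of "fps_exp 1"] by (simp add: s)
qed

lemma mlog_expand:
  assumes "A \<in> carrier_mat n n" "nilp (A - 1\<^sub>m n)"
  shows "mlog h m A = (A - 1\<^sub>m n) + (A - 1\<^sub>m n) * (A - 1\<^sub>m n) * fev h (fps_shift 2 (fps_ln 1)) m (A - 1\<^sub>m n)"
proof -
  have "dim_row A = n" using assms(1) by auto
  then have "mlog h m A = fev h (fps_ln 1) m (A - 1\<^sub>m n)" by (simp only: mlog_def)
  also have "\<dots> = h 0 \<cdot>\<^sub>m 1\<^sub>m n + h 1 \<cdot>\<^sub>m (A - 1\<^sub>m n) + (A - 1\<^sub>m n) * (A - 1\<^sub>m n) * fev h (fps_shift 2 (fps_ln 1)) m (A - 1\<^sub>m n)"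
    using fev_nil.fev_expand[OF fn[OF assms(2)], of "fps_ln 1"] unfolding fps_ln_nth by simp
  also have "h 0 \<cdot>\<^sub>m 1\<^sub>m n + h 1 \<cdot>\<^sub>m (A - 1\<^sub>m n) = A - 1\<^sub>m n" using assms(1) by (intro eq_matI) auto
  finally show ?thesis .
qed

end

text \<open>For the trivial torus, \<open>torus_unipotent_triangular\<close> becomes Kolchin's
  theorem.\<close>

lemma torus_action_trivial: "torus_action n (\<lambda>_. 1\<^sub>m n) {0} (\<lambda>_. 1\<^sub>m n)"
  by unfold_locales auto

lemma det_upat:
  assumes "A \<in> carrier_mat n n" "upat n 1 (A - (1\<^sub>m n :: 'b::comm_ring_1 mat))" shows "det A = 1"
proof -
  have u: "unip n (\<lambda>i j. i + 1 \<le> j) A" using assms by (simp add: unip_def)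
  have "det A = prod_list (diag_mat A)"
    by (rule det_upper_triangular[of _ n]) (use assms(1) in \<open>auto simp: upper_triangular_def intro!: unipD(2)[OF u]\<close>)
  also have "\<dots> = (\<Prod>i<n. A $$ (i, i))" using assms(1) by (simp add: prod_list_diag_prod atLeast0LessThan)
  also have "\<dots> = 1" using unipD(3)[OF u] by simp
  finally show ?thesis .
qed

text \<open>\<open>unipotent_group\<close> lets the exponent depend on the element. Simultaneous
  triangularization makes it uniform, so that one truncation order serves all of
  \<open>U\<close>.\<close>

lemma unipotent_group_nilp:
  fixes U :: "'a::{alg_closed_field,field_char_0} mat set"
  assumes "subgroup U (GL N)" "unipotent_group N U" "x \<in> U"
  shows "(x - 1\<^sub>m N) ^\<^sub>m N = 0\<^sub>m N N" "det x = 1"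
proof -
  note S = subgroup_GL_D[OF assms(1)]
  obtain P P' and w :: "nat \<Rightarrow> int" where P: "P \<in> carrier_mat N N" "P' \<in> carrier_mat N N" "P * P' = 1\<^sub>m N" "P' * P = 1\<^sub>m N"
    and up: "\<And>a. a \<in> U \<Longrightarrow> upat N 1 (P' * a * P - 1\<^sub>m N)"
  proof (rule torus_action.torus_unipotent_triangular[OF torus_action_trivial[of N], of U])
    show "U \<subseteq> carrier_mat N N" by (rule S(5))
    show "1\<^sub>m N * a * 1\<^sub>m N \<in> U" if "a \<in> U" for a using that S(5) by auto
  qed (use S(2) assms(2) in \<open>auto simp: unipotent_group_def\<close>)
  have x: "x \<in> carrier_mat N N" using S(5) assms(3) by auto
  have PxP: "P' * x * P \<in> carrier_mat N N" using P x by auto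
  have e: "P * (P' * x * P) * P' = x" by (rule conj_back[OF P(1,2) x P(3)])
  have "det (P' * x * P) = 1" by (rule det_upat[OF PxP up[OF assms(3)]])
  moreover have "det (P' * x * P) = det P' * det P * det x" using P x by (simp add: det_mult[of _ N])
  moreover have "det P' * det P = 1" using P det_mult[OF P(2,1)] by (simp add: det_one)
  ultimately show "det x = 1" by simp
  have d: "P * (P' * x * P - 1\<^sub>m N) * P' = x - 1\<^sub>m N"
  proof -
    have "P * (P' * x * P - 1\<^sub>m N) = P * (P' * x * P) - P * 1\<^sub>m N" by (rule mult_minus_distrib_mat[OF P(1) PxP one_carrier_mat])
    then have "P * (P' * x * P - 1\<^sub>m N) * P' = (P * (P' * x * P) - P) * P'" using P(1) by simp
    also have "\<dots> = P * (P' * x * P) * P' - P * P'"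
      by (rule minus_mult_distrib_mat[OF mult_carrier_mat[OF P(1) PxP] P(1,2)])
    finally show ?thesis unfolding e P(3) .
  qed
  have "(P' * x * P - 1\<^sub>m N) ^\<^sub>m N = 0\<^sub>m N N" by (rule upat_nilpotent[OF up[OF assms(3)]])
  then have "(P * (P' * x * P - 1\<^sub>m N) * P') ^\<^sub>m N = 0\<^sub>m N N"
    unfolding pow_mat_conj[OF P(1,2) minus_carrier_mat[OF one_carrier_mat] P(4,3)] using P by simp
  then show "(x - 1\<^sub>m N) ^\<^sub>m N = 0\<^sub>m N N" unfolding d .
qed

text \<open>\<open>m\<close> is the truncation order of exp and log. It is only bounded from below,
  so that one \<open>m\<close> can serve both \<open>U\<close> and its image in another
  dimension.\<close>

locale closed_unipotent =
  fixes N :: nat and U :: "'a::{alg_closed_field,field_char_0} mat set" and m :: nat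
  assumes U: "subgroup U (GL N)" and closed: "zariski_closed N U" and uni: "unipotent_group N U" and Nm: "N < m"
begin

lemmas S = subgroup_GL_D[OF U]

sublocale E: mexp_nil id N m
  using Nm by (intro mexp_nil.intro comm_ring_hom_id mexp_nil_axioms.intro) simp

lemma nilp: assumes "x \<in> U" shows "x \<in> carrier_mat N N" "x - 1\<^sub>m N \<in> carrier_mat N N \<and> (x - 1\<^sub>m N) ^\<^sub>m m = 0\<^sub>m N N" "det x = 1"
proof -
  show "x \<in> carrier_mat N N" using S(5) assms by auto
  show "x - 1\<^sub>m N \<in> carrier_mat N N \<and> (x - 1\<^sub>m N) ^\<^sub>m m = 0\<^sub>m N N"
    using pow_mat_zero_ge[OF minus_carrier_mat[OF one_carrier_mat] unipotent_group_nilp(1)[OF U uni assms], of m] Nm by auto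
  show "det x = 1" by (rule unipotent_group_nilp(2)[OF U uni assms])
qed

abbreviation lg where "lg x \<equiv> mlog id m x"

lemma lg: assumes "x \<in> U" shows "lg x \<in> carrier_mat N N \<and> lg x ^\<^sub>m m = 0\<^sub>m N N" "mexp id m (lg x) = x"
  using E.mlog_nilp[OF nilp(1,2)[OF assms]] E.mexp_mlog[OF nilp(1,2)[OF assms]] by auto

lemma U_closedI:
  assumes "A \<in> carrier_mat N N" "det A \<noteq> 0" "\<And>p. p \<in> entry_polys N \<Longrightarrow> (\<And>x. x \<in> U \<Longrightarrow> eval_poly id p x = 0) \<Longrightarrow> eval_poly id p A = 0"
  shows "A \<in> U"
proof -
  obtain T where T: "T \<subseteq> entry_polys N" "U = {A \<in> carrier (GL N). \<forall>p \<in> T. eval_poly id p A = 0}"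
    using closed unfolding zariski_closed_def by blast
  have "eval_poly id p A = 0" if "p \<in> T" for p
    by (rule assms(3)) (use that T in blast)+
  moreover have "A \<in> carrier (GL N)" using assms(1,2) by (simp add: GL_carrier_det)
  ultimately show ?thesis using T(2) by blast
qed

text \<open>Along the family \<open>F\<close> the equations of \<open>U\<close> become polynomials
  in \<open>s\<close>, which vanish identically once they vanish infinitely often.\<close>

lemma line_in_U:
  assumes F: "mrealizes UNIV line_gens N N F V" and "infinite Z" "\<And>s. s \<in> Z \<Longrightarrow> F s \<in> U" "det (F r) \<noteq> 0"
  shows "F r \<in> U"
proof (rule U_closedI)
  show "F r \<in> carrier_mat N N" using mrealizesD(2)[OF F] by simp
  fix p assume p: "p \<in> entry_polys N" "\<And>x. x \<in> U \<Longrightarrow> eval_poly id p x = 0"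
  show "eval_poly id p (F r) = 0"
    by (rule line_eq[OF realizes_eval_poly[OF F p(1)] realizes_zero assms(2)]) (rule p(2)[OF assms(3)])
qed (rule assms(4))

lemma U_pow: "x \<in> U \<Longrightarrow> x ^\<^sub>m k \<in> U"
proof (induction k)
  case 0
  then show ?case using S(3) nilp(1)[of x] by auto
qed (simp add: S(2))

lemma mexp_det: assumes "X \<in> carrier_mat N N \<and> X ^\<^sub>m m = 0\<^sub>m N N" shows "det (mexp id m X) \<noteq> 0"
proof -
  have "id (-1) \<cdot>\<^sub>m X \<in> carrier_mat N N \<and> (id (-1) \<cdot>\<^sub>m X) ^\<^sub>m m = 0\<^sub>m N N" by (rule E.nilp_smult[OF assms])
  from mat_mult_one_det(1)[OF E.mexp_nilp(2)[OF assms] E.mexp_nilp(2)[OF this] E.mexp_minus(1)[OF assms]]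
  show ?thesis .
qed

text \<open>At natural numbers the family runs through the powers of \<open>x\<close>. These are
  infinitely many parameters in characteristic 0, so closedness extends membership to all
  \<open>s\<close>.\<close>

lemma exp_in_U: assumes x: "x \<in> U" shows "mexp id m (s \<cdot>\<^sub>m lg x) \<in> U"
proof (rule line_in_U[OF _ infinite_nats])
  have c: "lg x \<in> carrier_mat N N" using lg[OF x] by simp
  show "mrealizes UNIV line_gens N N (\<lambda>s. mexp id m (s \<cdot>\<^sub>m lg x)) (mexp fls_const m (fls_X \<cdot>\<^sub>m map_mat fls_const (lg x)))"
    by (intro mrealizes_mexp mrealizes_line_smult c)
  show "det (mexp id m (s \<cdot>\<^sub>m lg x)) \<noteq> 0" by (rule mexp_det[OF E.nilp_smult[OF lg(1)[OF x]]])
  fix s :: 'a assume "s \<in> range of_nat"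
  then obtain k where "s = of_nat k" by auto
  then show "mexp id m (s \<cdot>\<^sub>m lg x) \<in> U" using E.mexp_of_nat[OF lg(1)[OF x], of k] lg(2)[OF x] U_pow[OF x] by simp
qed

text \<open>The eigenvalues \<open>l\<close> of \<open>\<rho>(x)\<close> satisfy \<open>l^k = q(k)\<close> for a polynomial \<open>q\<close>; comparing leading
  coefficients in \<open>q(k + 1) = l q(k)\<close> gives \<open>l = 1\<close>.\<close>

lemma rep_unipotent:
  assumes hom: "algebraic_hom N U n (carrier (GL n)) \<rho>" and x: "x \<in> U"
  shows "(eval_map id \<rho> x - 1\<^sub>m n) ^\<^sub>m n = 0\<^sub>m n n"
proof -
  note D = algebraic_homD[OF hom]
  let ?A = "eval_map id \<rho> x"
  have A: "?A \<in> carrier_mat n n" "det ?A \<noteq> 0" using D(3)[OF x] by (auto simp: GL_carrier_det)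
  have Apow: "eval_map id \<rho> (x ^\<^sub>m k) = ?A ^\<^sub>m k" for k
  proof (induction k)
    case 0
    have "x ^\<^sub>m 0 = 1\<^sub>m N" "?A ^\<^sub>m 0 = 1\<^sub>m n" using nilp(1)[OF x] A(1) by auto
    then show ?case using algebraic_hom_one[OF hom U subset_refl] by (simp only:)
  next
    case (Suc k)
    then show ?case using D(4)[OF U_pow[OF x] x] by (simp only: pow_mat.simps)
  qed
  obtain P P' where P: "P \<in> carrier_mat n n" "P' \<in> carrier_mat n n" "P * P' = 1\<^sub>m n" "P' * P = 1\<^sub>m n"
    and T: "pat n (\<le>) (P' * ?A * P)" using triangularize[OF A(1)] .
  let ?T = "P' * ?A * P"
  have Tc: "?T \<in> carrier_mat n n" by (rule patD(1)[OF T])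
  have T1: "?T $$ (i, i) = 1" if i: "i < n" for i
  proof -
    define l where "l = ?T $$ (i, i)"
    have c: "lg x \<in> carrier_mat N N" using lg[OF x] by simp
    have dt: "det ?T \<noteq> 0"
    proof -
      have "det P' * det P = 1" using det_mult[OF P(2,1)] P by (simp add: det_one)
      then have "det P' \<noteq> 0" "det P \<noteq> 0" by auto
      then show ?thesis using P A by (simp add: det_mult[of _ n])
    qed
    have "det ?T = (\<Prod>j<n. ?T $$ (j, j))"
    proof -
      have "upper_triangular ?T" unfolding upper_triangular_def carrier_matD(1)[OF Tc]
        by (intro allI impI patD(2)[OF T]) auto
      from det_upper_triangular[OF this Tc] show ?thesis
        unfolding prod_list_diag_prod carrier_matD(1)[OF Tc] atLeast0LessThan .
    qed
    with dt i have l0: "l \<noteq> 0" by (auto simp: l_def)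
    \<comment> \<open>The polynomial \<open>q\<close> is the diagonal entry of
      \<open>\<rho> (exp (s log x))\<close> in the triangularizing basis. It is polynomial in
      \<open>s\<close> because the determinant is one along this line, so the denominators of
      \<open>\<rho>\<close> disappear.\<close>
    have "mrealizes UNIV line_gens N N (\<lambda>s. mexp id m (s \<cdot>\<^sub>m lg x)) (mexp fls_const m (fls_X \<cdot>\<^sub>m map_mat fls_const (lg x)))"
      by (intro mrealizes_mexp mrealizes_line_smult c)
    from mrealizes_eval_map_det1(1)[OF fls_point_line[OF infinite_UNIV_char_0] this nilp(3)[OF exp_in_U[OF x]] D(1,2)]
    have "mrealizes UNIV line_gens n n (\<lambda>s. P' * eval_map id \<rho> (mexp id m (s \<cdot>\<^sub>m lg x)) * P)
       (map_mat fls_const P' * eval_map fls_const \<rho> (mexp fls_const m (fls_X \<cdot>\<^sub>m map_mat fls_const (lg x))) * map_mat fls_const P)"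
      by (intro mrealizes_mult[where m = n] mrealizes_const P)
    from realizes_line[OF mrealizesD(3)[OF this i i]] obtain q where
      q: "\<And>s. (P' * eval_map id \<rho> (mexp id m (s \<cdot>\<^sub>m lg x)) * P) $$ (i, i) = poly q s" by blast
    have qk: "poly q (of_nat k) = l ^ k" for k
    proof -
      have "poly q (of_nat k) = (P' * ?A ^\<^sub>m k * P) $$ (i, i)"
        unfolding q[symmetric] using E.mexp_of_nat[OF lg(1)[OF x], of k] by (simp add: lg(2)[OF x] Apow)
      also have "\<dots> = l ^ k" unfolding pow_mat_conj[OF P(2,1) A(1) P(3,4), symmetric] l_def by (rule upper_pow_diag[OF T i])
      finally show ?thesis .
    qed
    have "pcompose q [:1, 1:] = Polynomial.smult l q"
    proof (rule ccontr)
      assume "\<not> ?thesis"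
      then have nz: "pcompose q [:1, 1:] - Polynomial.smult l q \<noteq> 0" by simp
      have "range of_nat \<subseteq> {s. poly (pcompose q [:1, 1:] - Polynomial.smult l q) s = 0}"
      proof
        fix s :: 'a assume "s \<in> range of_nat"
        then obtain k where k: "s = of_nat k" by auto
        have "poly q (of_nat (Suc k)) = l * poly q (of_nat k)" by (simp only: qk power_Suc)
        then show "s \<in> {s. poly (pcompose q [:1, 1:] - Polynomial.smult l q) s = 0}" by (simp add: k poly_pcompose)
      qed
      then show False using poly_roots_finite[OF nz] infinite_nats finite_subset by blast
    qed
    then have "lead_coeff (pcompose q [:1, 1:]) = l * lead_coeff q" by simp
    moreover have "lead_coeff (pcompose q [:1, 1:]) = lead_coeff q" by (subst lead_coeff_comp) auto
    moreover have "q \<noteq> 0" using qk[of 0] by auto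
    ultimately show ?thesis by (simp add: l_def)
  qed
  have "upat n 1 (?T - 1\<^sub>m n)"
    unfolding pat_def
  proof (intro conjI allI impI)
    show "?T - 1\<^sub>m n \<in> carrier_mat n n" by (rule minus_carrier_mat[OF one_carrier_mat])
    fix i j assume ij: "i < n" "j < n" "\<not> i + 1 \<le> j"
    have e: "(?T - 1\<^sub>m n) $$ (i, j) = ?T $$ (i, j) - (if i = j then 1 else 0)"
      by (subst index_minus_mat) (use ij in auto)
    show "(?T - 1\<^sub>m n) $$ (i, j) = 0"
    proof (cases "i = j")
      case True
      then show ?thesis unfolding e using T1[OF ij(1)] by simp
    next
      case False
      then show ?thesis unfolding e using patD(2)[OF T ij(1,2)] ij(3) by simp
    qed
  qed
  then have nil: "(?T - 1\<^sub>m n) ^\<^sub>m n = 0\<^sub>m n n" by (rule upat_nilpotent)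
  have d: "P' * (?A - 1\<^sub>m n) * P = ?T - 1\<^sub>m n"
  proof -
    have "P' * (?A - 1\<^sub>m n) = P' * ?A - P' * 1\<^sub>m n" by (rule mult_minus_distrib_mat[OF P(2) A(1) one_carrier_mat])
    then have "P' * (?A - 1\<^sub>m n) * P = (P' * ?A - P') * P" using P(2) by simp
    also have "\<dots> = P' * ?A * P - P' * P"
      by (rule minus_mult_distrib_mat[OF mult_carrier_mat[OF P(2) A(1)] P(2,1)])
    finally show ?thesis unfolding P(4) .
  qed
  have A1: "?A - 1\<^sub>m n \<in> carrier_mat n n" by (rule minus_carrier_mat[OF one_carrier_mat])
  have "P' * (?A - 1\<^sub>m n) ^\<^sub>m n * P = 0\<^sub>m n n"
    unfolding pow_mat_conj[OF P(2,1) A1 P(3,4), symmetric] d by (rule nil)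
  then show ?thesis using conj_back[OF P(1,2) pow_carrier_mat[OF A1] P(3), of n] P(1,2) by simp
qed

end

section \<open>The logarithm of a product of exponentials to first order\<close>

lemma one_plus_smult_mult:
  fixes U V :: "'b::comm_ring_1 mat"
  assumes U: "U \<in> carrier_mat k k" and V: "V \<in> carrier_mat k k"
  shows "(1\<^sub>m k + s \<cdot>\<^sub>m U) * (1\<^sub>m k + s \<cdot>\<^sub>m V) - 1\<^sub>m k = s \<cdot>\<^sub>m (U + V + s \<cdot>\<^sub>m (U * V))"
proof -
  have "(1\<^sub>m k + s \<cdot>\<^sub>m U) * (1\<^sub>m k + s \<cdot>\<^sub>m V) = 1\<^sub>m k * (1\<^sub>m k + s \<cdot>\<^sub>m V) + (s \<cdot>\<^sub>m U) * (1\<^sub>m k + s \<cdot>\<^sub>m V)"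
    by (rule add_mult_distrib_mat) (use U V in auto)
  also have "(s \<cdot>\<^sub>m U) * (1\<^sub>m k + s \<cdot>\<^sub>m V) = (s \<cdot>\<^sub>m U) * 1\<^sub>m k + (s \<cdot>\<^sub>m U) * (s \<cdot>\<^sub>m V)"
    by (rule mult_add_distrib_mat) (use U V in auto)
  also have "(s \<cdot>\<^sub>m U) * (s \<cdot>\<^sub>m V) = s \<cdot>\<^sub>m (s \<cdot>\<^sub>m (U * V))"
  proof -
    have "(s \<cdot>\<^sub>m U) * (s \<cdot>\<^sub>m V) = s \<cdot>\<^sub>m (U * (s \<cdot>\<^sub>m V))" by (rule mult_smult_assoc_mat) (use U V in auto)
    also have "U * (s \<cdot>\<^sub>m V) = s \<cdot>\<^sub>m (U * V)" by (rule mult_smult_distrib) (use U V in auto)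
    finally show ?thesis .
  qed
  finally show ?thesis using U V by (intro eq_matI) (auto simp: algebra_simps simp del: index_mult_mat(1))
qed

lemma smult_square_mult:
  fixes A G :: "'b::comm_ring_1 mat"
  assumes A: "A \<in> carrier_mat k k" and G: "G \<in> carrier_mat k k"
  shows "(s \<cdot>\<^sub>m A) * (s \<cdot>\<^sub>m A) * G = s \<cdot>\<^sub>m (s \<cdot>\<^sub>m (A * A * G))"
proof -
  have "(s \<cdot>\<^sub>m A) * (s \<cdot>\<^sub>m A) = s \<cdot>\<^sub>m (A * (s \<cdot>\<^sub>m A))" by (rule mult_smult_assoc_mat) (use A in auto)
  also have "A * (s \<cdot>\<^sub>m A) = s \<cdot>\<^sub>m (A * A)" by (rule mult_smult_distrib) (use A in auto)
  finally have "(s \<cdot>\<^sub>m A) * (s \<cdot>\<^sub>m A) * G = (s \<cdot>\<^sub>m (s \<cdot>\<^sub>m (A * A))) * G" by simp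
  also have "\<dots> = s \<cdot>\<^sub>m ((s \<cdot>\<^sub>m (A * A)) * G)" by (rule mult_smult_assoc_mat) (use A G in auto)
  also have "(s \<cdot>\<^sub>m (A * A)) * G = s \<cdot>\<^sub>m (A * A * G)" by (rule mult_smult_assoc_mat) (use A G in auto)
  finally show ?thesis .
qed

lemma smult_add_smult:
  fixes A B :: "'b::comm_ring_1 mat"
  assumes "A \<in> carrier_mat k k" "B \<in> carrier_mat k k"
  shows "s \<cdot>\<^sub>m A + s \<cdot>\<^sub>m (s \<cdot>\<^sub>m B) = s \<cdot>\<^sub>m (A + s \<cdot>\<^sub>m B)"
    "1\<^sub>m k + s \<cdot>\<^sub>m A + s \<cdot>\<^sub>m (s \<cdot>\<^sub>m B) = 1\<^sub>m k + s \<cdot>\<^sub>m (A + s \<cdot>\<^sub>m B)"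
  using assms by (auto simp: algebra_simps intro!: eq_matI)

lemma square_mult_carrier:
  "A \<in> carrier_mat k k \<Longrightarrow> B \<in> carrier_mat k k \<Longrightarrow> A * A * B \<in> carrier_mat k k"
  by (meson mult_carrier_mat)

text \<open>\<open>log (exp (s X) exp (s Y))\<close> equals \<open>s L(s)\<close> with \<open>L\<close> polynomial and \<open>L 0 = X + Y\<close>.\<close>

lemma log_exp_exp:
  fixes X Y :: "'a::field_char_0 mat"
  assumes m: "0 < m" and X: "X \<in> carrier_mat k k \<and> X ^\<^sub>m m = 0\<^sub>m k k" and Y: "Y \<in> carrier_mat k k \<and> Y ^\<^sub>m m = 0\<^sub>m k k"
    and nil: "\<And>s. (mexp id m (s \<cdot>\<^sub>m X) * mexp id m (s \<cdot>\<^sub>m Y) - 1\<^sub>m k) ^\<^sub>m m = 0\<^sub>m k k"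
  obtains L V where "mrealizes UNIV line_gens k k L V" "L 0 = X + Y"
    "\<And>s. s \<cdot>\<^sub>m L s = mlog id m (mexp id m (s \<cdot>\<^sub>m X) * mexp id m (s \<cdot>\<^sub>m Y))"
proof -
  interpret E: mexp_nil "id :: 'a \<Rightarrow> 'a" k m
    using m by (intro mexp_nil.intro comm_ring_hom_id mexp_nil_axioms.intro)
  let ?ee = "fps_shift 2 (fps_exp 1) :: 'a fps" and ?ll = "fps_shift 2 (fps_ln 1) :: 'a fps"
  \<comment> \<open>\<open>u A s\<close> is \<open>(exp (s A) - 1) / s\<close>, written without
    division so that it is polynomial in \<open>s\<close>. In the same way \<open>C\<close> divides
    the product minus the identity, and \<open>L\<close> its logarithm, by \<open>s\<close>.\<close>
  define u where "u A s = A + s \<cdot>\<^sub>m (A * A * fev id ?ee m (s \<cdot>\<^sub>m A))" for A :: "'a mat" and s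
  define u' where "u' A = map_mat fls_const A + fls_X \<cdot>\<^sub>m (map_mat fls_const A * map_mat fls_const A * fev fls_const ?ee m (fls_X \<cdot>\<^sub>m map_mat fls_const A))" for A :: "'a mat"
  have ur: "mrealizes UNIV line_gens k k (u A) (u' A)" if "A \<in> carrier_mat k k" for A
    unfolding u_def u'_def using that
    by (intro mrealizes_add mrealizes_const mrealizes_smult mrealizes_mult[where m = k] mrealizes_fev realizes_line_id mrealizes_line_smult)
  have uc: "u A s \<in> carrier_mat k k" if "A \<in> carrier_mat k k" for A s using mrealizesD(2)[OF ur[OF that]] by simp
  have ex: "mexp id m (s \<cdot>\<^sub>m A) = 1\<^sub>m k + s \<cdot>\<^sub>m u A s" if A: "A \<in> carrier_mat k k \<and> A ^\<^sub>m m = 0\<^sub>m k k" for A s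
  proof -
    have g: "fev id ?ee m (s \<cdot>\<^sub>m A) \<in> carrier_mat k k" using A by simp
    have "mexp id m (s \<cdot>\<^sub>m A) = 1\<^sub>m k + s \<cdot>\<^sub>m A + (s \<cdot>\<^sub>m A) * (s \<cdot>\<^sub>m A) * fev id ?ee m (s \<cdot>\<^sub>m A)"
      by (rule E.mexp_expand[OF E.nilp_smult[OF A]])
    also have "(s \<cdot>\<^sub>m A) * (s \<cdot>\<^sub>m A) * fev id ?ee m (s \<cdot>\<^sub>m A) = s \<cdot>\<^sub>m (s \<cdot>\<^sub>m (A * A * fev id ?ee m (s \<cdot>\<^sub>m A)))"
      by (rule smult_square_mult) (use A g in auto)
    also have "1\<^sub>m k + s \<cdot>\<^sub>m A + \<dots> = 1\<^sub>m k + s \<cdot>\<^sub>m u A s"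
      unfolding u_def by (rule smult_add_smult(2)) (use A square_mult_carrier[OF _ g] in blast)+
    finally show ?thesis .
  qed
  define C where "C s = u X s + u Y s + s \<cdot>\<^sub>m (u X s * u Y s)" for s
  define C' where "C' = u' X + u' Y + fls_X \<cdot>\<^sub>m (u' X * u' Y)"
  have Cr: "mrealizes UNIV line_gens k k C C'"
    unfolding C_def C'_def using X Y
    by (intro mrealizes_add mrealizes_smult mrealizes_mult[where m = k] realizes_line_id ur) auto
  have Cc: "C s \<in> carrier_mat k k" for s using mrealizesD(2)[OF Cr] by simp
  define z where "z s = mexp id m (s \<cdot>\<^sub>m X) * mexp id m (s \<cdot>\<^sub>m Y)" for s
  have zc: "z s \<in> carrier_mat k k" for s unfolding z_def
    by (rule mult_carrier_mat[OF E.mexp_nilp(2)[OF E.nilp_smult[OF X]] E.mexp_nilp(2)[OF E.nilp_smult[OF Y]]])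
  have zB: "z s - 1\<^sub>m k = s \<cdot>\<^sub>m C s" for s
    unfolding z_def C_def ex[OF X] ex[OF Y] by (rule one_plus_smult_mult) (use uc X Y in auto)
  define L where "L s = C s + s \<cdot>\<^sub>m (C s * C s * fev id ?ll m (s \<cdot>\<^sub>m C s))" for s
  have "mrealizes UNIV line_gens k k L (C' + fls_X \<cdot>\<^sub>m (C' * C' * fev fls_const ?ll m (fls_X \<cdot>\<^sub>m C')))"
    unfolding L_def by (intro mrealizes_add mrealizes_smult mrealizes_mult[where m = k] realizes_line_id mrealizes_fev Cr)
  moreover have "L 0 = X + Y"
  proof -
    have z0: "A + 0 \<cdot>\<^sub>m B = A" if "A \<in> carrier_mat k k" "B \<in> carrier_mat k k" for A B :: "'a mat"
      using that by (intro eq_matI) auto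
    have u0: "u A 0 = A" if "A \<in> carrier_mat k k" for A unfolding u_def
      by (rule z0[OF that square_mult_carrier[OF that fev_carrier[OF smult_carrier_mat[OF that]]]])
    have XY: "X \<in> carrier_mat k k" "Y \<in> carrier_mat k k" using X Y by auto
    have "C 0 = X + Y" unfolding C_def u0[OF XY(1)] u0[OF XY(2)]
      by (rule z0[OF add_carrier_mat[OF XY(2)] mult_carrier_mat[OF XY]])
    moreover have "L 0 = C 0" unfolding L_def
      by (rule z0[OF Cc square_mult_carrier[OF Cc fev_carrier[OF smult_carrier_mat[OF Cc]]]])
    ultimately show ?thesis by simp
  qed
  moreover have "s \<cdot>\<^sub>m L s = mlog id m (z s)" for s
  proof -
    have n: "z s - 1\<^sub>m k \<in> carrier_mat k k \<and> (z s - 1\<^sub>m k) ^\<^sub>m m = 0\<^sub>m k k"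
      using nil[of s] minus_carrier_mat[OF one_carrier_mat, of "z s" k] by (simp add: z_def)
    have g: "fev id ?ll m (s \<cdot>\<^sub>m C s) \<in> carrier_mat k k" using Cc by simp
    have "mlog id m (z s) = s \<cdot>\<^sub>m C s + (s \<cdot>\<^sub>m C s) * (s \<cdot>\<^sub>m C s) * fev id ?ll m (s \<cdot>\<^sub>m C s)"
      using E.mlog_expand[OF zc n] unfolding zB .
    also have "(s \<cdot>\<^sub>m C s) * (s \<cdot>\<^sub>m C s) * fev id ?ll m (s \<cdot>\<^sub>m C s) = s \<cdot>\<^sub>m (s \<cdot>\<^sub>m (C s * C s * fev id ?ll m (s \<cdot>\<^sub>m C s)))"
      by (rule smult_square_mult) (use Cc g in auto)
    also have "s \<cdot>\<^sub>m C s + \<dots> = s \<cdot>\<^sub>m L s"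
      unfolding L_def by (rule smult_add_smult(1)[OF Cc square_mult_carrier[OF Cc g]])
    finally show ?thesis by (rule sym)
  qed
  ultimately show ?thesis using that unfolding z_def by blast
qed

text \<open>A linear map between spaces of matrices, given by coefficients in the base field so that
  it can be applied over Laurent series as well, where it preserves integrality.\<close>

definition lmap :: "('a \<Rightarrow> 'b::comm_ring_1) \<Rightarrow> (nat \<Rightarrow> nat \<Rightarrow> nat \<Rightarrow> nat \<Rightarrow> 'a) \<Rightarrow> nat \<Rightarrow> nat \<Rightarrow> 'b mat \<Rightarrow> 'b mat" where
  "lmap h c a n L = mat a a (\<lambda>(i, j). \<Sum>k<n. \<Sum>l<n. h (c i j k l) * L $$ (k, l))"

lemma lmap_carrier [simp]: "lmap h c a n L \<in> carrier_mat a a" by (simp add: lmap_def)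

lemma mrealizes_lmap:
  assumes "mrealizes Z B n n F V"
  shows "mrealizes Z B a a (\<lambda>x. lmap id c a n (F x)) (lmap fls_const c a n V)"
  unfolding lmap_def
  by (intro mrealizes_mat, unfold split id_apply, intro realizes_sum realizes_cmult mrealizesD(3)[OF assms]) auto

lemma imat_lmap: assumes "imat n V" shows "imat a (lmap fls_const c a n V)"
  unfolding imat_def lmap_def
  by (auto intro!: fls_int_sum fls_int_intros(7) imatD(2)[OF assms])

lemma sum_fun_apply: "(\<Sum>i\<in>I. f i) x = (\<Sum>i\<in>I. f i x :: 'b::comm_monoid_add)"
  by (induction I rule: infinite_finite_induct) (auto simp: plus_fun_def zero_fun_def)

text \<open>\<open>W\<close> is a linear space on which the second component determines the first.
  The inverse of the second projection is extended from its image to all \<open>n \<times> n\<close>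
  matrices, still with values in \<open>W\<close>: \<open>c\<close> and \<open>d\<close> are the
  coefficients of its two components, so that \<open>d\<close> is a projection onto the
  image.\<close>

lemma left_inverse_coeffs:
  fixes W :: "('a::field mat \<times> 'a mat) set"
  assumes car: "\<And>X Y. (X, Y) \<in> W \<Longrightarrow> X \<in> carrier_mat N N \<and> Y \<in> carrier_mat n n"
    and zero: "(0\<^sub>m N N, 0\<^sub>m n n) \<in> W"
    and add: "\<And>X Y X' Y'. (X, Y) \<in> W \<Longrightarrow> (X', Y') \<in> W \<Longrightarrow> (X + X', Y + Y') \<in> W"
    and scale: "\<And>X Y s. (X, Y) \<in> W \<Longrightarrow> (s \<cdot>\<^sub>m X, s \<cdot>\<^sub>m Y) \<in> W"
    and inj: "\<And>X X' Y. (X, Y) \<in> W \<Longrightarrow> (X', Y) \<in> W \<Longrightarrow> X = X'"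
  obtains c d where "\<And>X Y. (X, Y) \<in> W \<Longrightarrow> X = lmap id c N n Y \<and> Y = lmap id d n n Y"
    "\<And>L. L \<in> carrier_mat n n \<Longrightarrow> (lmap id c N n L, lmap id d n n L) \<in> W"
proof -
  let ?sc = "\<lambda>s (f :: bool \<times> nat \<times> nat \<Rightarrow> 'a) i. s * f i"
  interpret V: vector_space ?sc
    by unfold_locales (auto simp: fun_eq_iff algebra_simps)
  interpret VP: vector_space_pair ?sc ?sc ..
  \<comment> \<open>A pair of matrices becomes one function on tagged indices, so that
    \<open>W\<close> turns into a subspace of a single vector space and \<open>f\<close> forgets the
    first component.\<close>
  define enc where "enc X Y = (\<lambda>(b, i, j). if b then (if i < N \<and> j < N then X $$ (i, j) else 0)
      else (if i < n \<and> j < n then Y $$ (i, j) else 0))" for X Y :: "'a mat"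
  define W' where "W' = (\<lambda>(X, Y). enc X Y) ` W"
  define f where "f v = (\<lambda>(b, i, j). if b then 0 else v (b, i, j))" for v :: "bool \<times> nat \<times> nat \<Rightarrow> 'a"
  have f: "Vector_Spaces.linear ?sc ?sc f"
    unfolding Vector_Spaces.linear_iff
    by (intro conjI V.vector_space_axioms) (auto simp: f_def fun_eq_iff)
  have enc_eq: "X = X' \<and> Y = Y'"
    if "enc X Y = enc X' Y'" "X \<in> carrier_mat N N" "X' \<in> carrier_mat N N" "Y \<in> carrier_mat n n" "Y' \<in> carrier_mat n n" for X X' Y Y'
  proof
    show "X = X'"
    proof (rule eq_matI)
      fix i j assume "i < dim_row X'" "j < dim_col X'"
      then show "X $$ (i, j) = X' $$ (i, j)" using fun_cong[OF that(1), of "(True, i, j)"] that(2,3) by (auto simp: enc_def)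
    qed (use that in auto)
    show "Y = Y'"
    proof (rule eq_matI)
      fix i j assume "i < dim_row Y'" "j < dim_col Y'"
      then show "Y $$ (i, j) = Y' $$ (i, j)" using fun_cong[OF that(1), of "(False, i, j)"] that(4,5) by (auto simp: enc_def)
    qed (use that in auto)
  qed
  have f_enc: "f (enc X Y) = enc (0\<^sub>m N N) Y" for X Y by (auto simp: f_def enc_def fun_eq_iff)
  have sub: "V.subspace W'"
  proof (rule V.subspaceI)
    have "enc (0\<^sub>m N N) (0\<^sub>m n n) = 0" by (auto simp: enc_def fun_eq_iff)
    then show "0 \<in> W'" using zero unfolding W'_def by force
    show "x + y \<in> W'" if xy: "x \<in> W'" "y \<in> W'" for x y
    proof -
      obtain X Y X' Y' where e: "x = enc X Y" "y = enc X' Y'" "(X, Y) \<in> W" "(X', Y') \<in> W" using xy by (auto simp: W'_def)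
      have "x + y = enc (X + X') (Y + Y')" unfolding e using car[OF e(3)] car[OF e(4)] by (auto simp: enc_def fun_eq_iff)
      with add[OF e(3,4)] show ?thesis unfolding W'_def by force
    qed
    show "?sc s x \<in> W'" if x: "x \<in> W'" for s x
    proof -
      obtain X Y where e: "x = enc X Y" "(X, Y) \<in> W" using x by (auto simp: W'_def)
      have "?sc s x = enc (s \<cdot>\<^sub>m X) (s \<cdot>\<^sub>m Y)" unfolding e using car[OF e(2)] by (auto simp: enc_def fun_eq_iff)
      with scale[OF e(2), of s] show ?thesis unfolding W'_def by force
    qed
  qed
  have "inj_on f W'"
  proof (rule inj_onI)
    fix x y assume xy: "x \<in> W'" "y \<in> W'" "f x = f y"
    obtain X Y X' Y' where e: "x = enc X Y" "y = enc X' Y'" "(X, Y) \<in> W" "(X', Y') \<in> W" using xy by (auto simp: W'_def)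
    have "Y = Y'" using xy(3) unfolding e f_enc using enc_eq[of "0\<^sub>m N N" Y "0\<^sub>m N N" Y'] car[OF e(3)] car[OF e(4)] by simp
    with inj[OF e(3)] e(4) show "x = y" unfolding e by simp
  qed
  from VP.linear_exists_left_inverse_on[OF f sub this] obtain g where
    g: "\<And>v. g v \<in> W'" "Vector_Spaces.linear ?sc ?sc g" "\<And>v. v \<in> W' \<Longrightarrow> g (f v) = v" by blast
  interpret G: Vector_Spaces.linear ?sc ?sc g by (rule g(2))
  define \<delta> where "\<delta> k l = (\<lambda>x. if x = (False, k, l) then 1 else (0 :: 'a))" for k l :: nat
  define c where "c i j k l = g (\<delta> k l) (True, i, j)" for i j k l
  define d where "d i j k l = g (\<delta> k l) (False, i, j)" for i j k l
  have gL: "g (enc (0\<^sub>m N N) L) x = (\<Sum>k<n. \<Sum>l<n. g (\<delta> k l) x * L $$ (k, l))" for L x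
  proof -
    have "enc (0\<^sub>m N N) L = (\<Sum>k<n. \<Sum>l<n. ?sc (L $$ (k, l)) (\<delta> k l))"
    proof
      fix x :: "bool \<times> nat \<times> nat"
      obtain b i j where x: "x = (b, i, j)" by (cases x) auto
      have "(\<Sum>k<n. \<Sum>l<n. ?sc (L $$ (k, l)) (\<delta> k l)) x = (\<Sum>k<n. \<Sum>l<n. L $$ (k, l) * \<delta> k l x)"
        by (simp only: sum_fun_apply)
      also have "\<dots> = (\<Sum>k<n. if k = i then (if \<not> b \<and> j < n then L $$ (k, j) else 0) else 0)"
      proof (rule sum.cong[OF refl])
        fix k
        have "(\<Sum>l<n. L $$ (k, l) * \<delta> k l x) = (\<Sum>l<n. if l = j then (if \<not> b \<and> k = i then L $$ (k, l) else 0) else 0)"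
          by (rule sum.cong[OF refl]) (auto simp: \<delta>_def x)
        then show "(\<Sum>l<n. L $$ (k, l) * \<delta> k l x) = (if k = i then (if \<not> b \<and> j < n then L $$ (k, j) else 0) else 0)"
          by (simp add: sum.delta)
      qed
      also have "\<dots> = enc (0\<^sub>m N N) L x" by (simp add: sum.delta enc_def x)
      finally show "enc (0\<^sub>m N N) L x = (\<Sum>k<n. \<Sum>l<n. ?sc (L $$ (k, l)) (\<delta> k l)) x" by simp
    qed
    then have "g (enc (0\<^sub>m N N) L) = (\<Sum>k<n. \<Sum>l<n. ?sc (L $$ (k, l)) (g (\<delta> k l)))"
      by (simp only: G.sum G.scale)
    then show ?thesis by (simp only: sum_fun_apply mult.commute)
  qed
  have dec: "enc X Y = g (enc (0\<^sub>m N N) L) \<Longrightarrow> X \<in> carrier_mat N N \<Longrightarrow> Y \<in> carrier_mat n n \<Longrightarrow>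
      X = lmap id c N n L \<and> Y = lmap id d n n L" for X Y L
  proof (intro conjI eq_matI)
    assume e: "enc X Y = g (enc (0\<^sub>m N N) L)" and c: "X \<in> carrier_mat N N" "Y \<in> carrier_mat n n"
    show "X $$ (i, j) = lmap id c N n L $$ (i, j)" if "i < dim_row (lmap id c N n L)" "j < dim_col (lmap id c N n L)" for i j
      using that fun_cong[OF e, of "(True, i, j)"] unfolding gL by (simp add: lmap_def enc_def c_def)
    show "Y $$ (i, j) = lmap id d n n L $$ (i, j)" if "i < dim_row (lmap id d n n L)" "j < dim_col (lmap id d n n L)" for i j
      using that fun_cong[OF e, of "(False, i, j)"] unfolding gL by (simp add: lmap_def enc_def d_def)
  qed (auto simp: lmap_def)
  show ?thesis
  proof (rule that)
    fix X Y assume XY: "(X, Y) \<in> W"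
    then have "enc X Y \<in> W'" unfolding W'_def by force
    from g(3)[OF this] have "enc X Y = g (enc (0\<^sub>m N N) Y)" unfolding f_enc by simp
    then show "X = lmap id c N n Y \<and> Y = lmap id d n n Y" using dec car[OF XY] by blast
  next
    fix L :: "'a mat" assume "L \<in> carrier_mat n n"
    obtain X Y where XY: "(X, Y) \<in> W" "g (enc (0\<^sub>m N N) L) = enc X Y" using g(1)[of "enc (0\<^sub>m N N) L"] by (auto simp: W'_def)
    with dec[of X Y L] car[OF XY(1)] show "(lmap id c N n L, lmap id d n n L) \<in> W" by auto
  qed
qed

section \<open>Representations of unipotent groups on logarithms\<close>

locale unip_rep = closed_unipotent N U m
  for N and U :: "'a::{alg_closed_field,field_char_0} mat set" and m +
  fixes n :: nat and \<rho> :: "'a regular_map" and P P' :: "'a mat"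
  assumes hom: "algebraic_hom N U n (carrier (GL n)) \<rho>"
    and P: "P \<in> carrier_mat n n" "P' \<in> carrier_mat n n" "P * P' = 1\<^sub>m n" "P' * P = 1\<^sub>m n"
    and tri: "\<And>x. x \<in> U \<Longrightarrow> upat n 1 (P' * eval_map id \<rho> x * P - 1\<^sub>m n)"
    and nm: "n < m"
begin

lemmas D = algebraic_homD[OF hom]

sublocale En: mexp_nil "id :: 'a \<Rightarrow> 'a" n m
  using nm by (intro mexp_nil.intro comm_ring_hom_id mexp_nil_axioms.intro) simp

definition R :: "'a mat \<Rightarrow> 'a mat" where "R x = P' * eval_map id \<rho> x * P"

definition R' :: "'a fls mat \<Rightarrow> 'a fls mat" where
  "R' V = map_mat fls_const P' * eval_map fls_const \<rho> V * map_mat fls_const P"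

abbreviation lR where "lR x \<equiv> mlog id m (R x)"

lemma eval_carrier: "eval_map id \<rho> x \<in> carrier_mat n n" using D(1) by (auto simp: eval_map_def)

lemma R_carrier: "R x \<in> carrier_mat n n" unfolding R_def using P(1,2) eval_carrier by (meson mult_carrier_mat)

lemma R_tri: "x \<in> U \<Longrightarrow> upat n 1 (R x - 1\<^sub>m n)" unfolding R_def by (rule tri)

lemma upat_nilp: "upat n 1 A \<Longrightarrow> A \<in> carrier_mat n n \<and> A ^\<^sub>m m = 0\<^sub>m n n"
  using pow_mat_zero_ge[OF patD(1) upat_nilpotent, of n _ A m] patD(1)[where A = A] nm by (metis less_imp_le)

lemma R_nilp: "x \<in> U \<Longrightarrow> R x - 1\<^sub>m n \<in> carrier_mat n n \<and> (R x - 1\<^sub>m n) ^\<^sub>m m = 0\<^sub>m n n"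
  using upat_nilp[OF R_tri] .

lemma R_mult: assumes "x \<in> U" "y \<in> U" shows "R (x * y) = R x * R y"
  unfolding R_def D(4)[OF assms] by (rule mult_mat_conj[OF P(2,1) eval_carrier eval_carrier P(3), symmetric])

lemma lR_tri: assumes "x \<in> U" shows "upat n 1 (lR x)"
proof -
  have "lR x = fev id (fps_ln 1) m (R x - 1\<^sub>m n)" unfolding mlog_def carrier_matD(1)[OF R_carrier] ..
  moreover have "upat n 1 (fev id (fps_ln 1) m (R x - 1\<^sub>m n))"
    by (rule pat_fev[OF R_tri[OF assms]]) auto
  ultimately show ?thesis by simp
qed

lemma lR: assumes "x \<in> U" shows "lR x \<in> carrier_mat n n \<and> lR x ^\<^sub>m m = 0\<^sub>m n n" "mexp id m (lR x) = R x"
  using upat_nilp[OF lR_tri[OF assms]] En.mexp_mlog[OF R_carrier R_nilp[OF assms]] by auto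

lemma R_pow: assumes x: "x \<in> U" shows "R (x ^\<^sub>m k) = R x ^\<^sub>m k"
proof (induction k)
  case 0
  have "x ^\<^sub>m 0 = 1\<^sub>m N" "R x ^\<^sub>m 0 = 1\<^sub>m n" using nilp(1)[OF x] R_carrier[of x] by auto
  moreover have "R (1\<^sub>m N) = 1\<^sub>m n"
    unfolding R_def algebraic_hom_one[OF hom U subset_refl] using P by simp
  ultimately show ?case by (simp only:)
next
  case (Suc k)
  then show ?case using R_mult[OF U_pow[OF x] x] by (simp only: pow_mat.simps)
qed

lemma mrealizes_R:
  assumes "fls_point Z B" "mrealizes Z B N N F V" "\<And>x. x \<in> Z \<Longrightarrow> F x \<in> U"
  shows "mrealizes Z B n n (\<lambda>x. R (F x)) (R' V)"
  unfolding R_def R'_def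
  by (intro mrealizes_mult[where m = n] mrealizes_const P mrealizes_eval_map_det1(1)[OF assms(1,2) nilp(3)[OF assms(3)] D(1,2)])

lemma line_point: "fls_point (UNIV :: 'a set) line_gens" by (rule fls_point_line[OF infinite_UNIV_char_0])

text \<open>Both sides are polynomial in \<open>s\<close> and agree at natural numbers, where they
  are powers of \<open>R x\<close>. So the passage from \<open>lg x\<close> to \<open>lR x\<close>,
  the differential of the representation, respects scaling.\<close>

lemma R_exp: assumes x: "x \<in> U" shows "R (mexp id m (s \<cdot>\<^sub>m lg x)) = mexp id m (s \<cdot>\<^sub>m lR x)"
proof (rule line_eq_mat[OF _ _ infinite_nats])
  have c: "lg x \<in> carrier_mat N N" "lR x \<in> carrier_mat n n" using lg[OF x] lR[OF x] by auto
  have "mrealizes UNIV line_gens N N (\<lambda>s. mexp id m (s \<cdot>\<^sub>m lg x)) (mexp fls_const m (fls_X \<cdot>\<^sub>m map_mat fls_const (lg x)))"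
    by (intro mrealizes_mexp mrealizes_line_smult c)
  from mrealizes_R[OF line_point this exp_in_U[OF x]]
  show "mrealizes UNIV line_gens n n (\<lambda>s. R (mexp id m (s \<cdot>\<^sub>m lg x))) (R' (mexp fls_const m (fls_X \<cdot>\<^sub>m map_mat fls_const (lg x))))" .
  show "mrealizes UNIV line_gens n n (\<lambda>s. mexp id m (s \<cdot>\<^sub>m lR x)) (mexp fls_const m (fls_X \<cdot>\<^sub>m map_mat fls_const (lR x)))"
    by (intro mrealizes_mexp mrealizes_line_smult c)
  fix s :: 'a assume "s \<in> range of_nat"
  then obtain k where k: "s = of_nat k" by auto
  have "mexp id m (s \<cdot>\<^sub>m lg x) = x ^\<^sub>m k" using E.mexp_of_nat[OF lg(1)[OF x], of k] lg(2)[OF x] k by simp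
  moreover have "mexp id m (s \<cdot>\<^sub>m lR x) = R x ^\<^sub>m k" using En.mexp_of_nat[OF lR(1)[OF x], of k] lR(2)[OF x] k by simp
  ultimately show "R (mexp id m (s \<cdot>\<^sub>m lg x)) = mexp id m (s \<cdot>\<^sub>m lR x)" using R_pow[OF x] by simp
qed

lemma smult_closed:
  assumes x: "x \<in> U" shows "\<exists>z\<in>U. lg z = s \<cdot>\<^sub>m lg x \<and> lR z = s \<cdot>\<^sub>m lR x"
proof (intro bexI conjI)
  show "mexp id m (s \<cdot>\<^sub>m lg x) \<in> U" by (rule exp_in_U[OF x])
  show "lg (mexp id m (s \<cdot>\<^sub>m lg x)) = s \<cdot>\<^sub>m lg x" by (rule E.mlog_mexp[OF E.nilp_smult[OF lg(1)[OF x]]])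
  show "lR (mexp id m (s \<cdot>\<^sub>m lg x)) = s \<cdot>\<^sub>m lR x"
    unfolding R_exp[OF x] by (rule En.mlog_mexp[OF En.nilp_smult[OF lR(1)[OF x]]])
qed

text \<open>The logarithms of \<open>U\<close> form a cone, which is closed under \<open>L 0 = lim log (exp (s X) exp (s Y)) / s\<close>.\<close>

lemma add_closed:
  assumes x: "x \<in> U" and y: "y \<in> U" shows "\<exists>z\<in>U. lg z = lg x + lg y \<and> lR z = lR x + lR y"
proof -
  let ?e = "\<lambda>x s. mexp id m (s \<cdot>\<^sub>m lg x)"
  have eU: "?e x s * ?e y s \<in> U" for s by (intro S(2) exp_in_U x y)
  have eR: "R (?e x s * ?e y s) = mexp id m (s \<cdot>\<^sub>m lR x) * mexp id m (s \<cdot>\<^sub>m lR y)" for s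
    using R_mult[OF exp_in_U[OF x] exp_in_U[OF y]] R_exp[OF x] R_exp[OF y] by simp
  have m0: "0 < m" using nm by simp
  obtain L V where L: "mrealizes UNIV line_gens N N L V" "L 0 = lg x + lg y" "\<And>s. s \<cdot>\<^sub>m L s = lg (?e x s * ?e y s)"
    using log_exp_exp[OF m0 lg(1)[OF x] lg(1)[OF y]] nilp(2)[OF eU] by blast
  obtain L2 V2 where L2: "mrealizes UNIV line_gens n n L2 V2" "L2 0 = lR x + lR y"
    "\<And>s. s \<cdot>\<^sub>m L2 s = mlog id m (mexp id m (s \<cdot>\<^sub>m lR x) * mexp id m (s \<cdot>\<^sub>m lR y))"
    using log_exp_exp[OF m0 lR(1)[OF x] lR(1)[OF y]] R_nilp[OF eU] unfolding eR by blast
  have c: "L s \<in> carrier_mat N N" "L2 s \<in> carrier_mat n n" for s using mrealizesD(2)[OF L(1)] mrealizesD(2)[OF L2(1)] by auto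
  have inv: "s \<noteq> 0 \<Longrightarrow> inverse s \<cdot>\<^sub>m (s \<cdot>\<^sub>m A) = A" for s :: 'a and A by (intro eq_matI) auto
  have Ls: "L s = inverse s \<cdot>\<^sub>m lg (?e x s * ?e y s)" if "s \<noteq> 0" for s unfolding L(3)[symmetric] by (rule inv[OF that, symmetric])
  have L2s: "L2 s = inverse s \<cdot>\<^sub>m lR (?e x s * ?e y s)" if "s \<noteq> 0" for s
    unfolding eR L2(3)[symmetric] by (rule inv[OF that, symmetric])
  \<comment> \<open>The value at \<open>0\<close> is reached only as a limit. Nilpotency, membership
    of the exponential in \<open>U\<close> and compatibility with \<open>R\<close> are known for
    \<open>s \<noteq> 0\<close> and extend to \<open>0\<close> because everything is polynomial in
    \<open>s\<close>.\<close>
  have "L 0 ^\<^sub>m m = 0\<^sub>m N N"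
    by (rule line_eq_mat[OF mrealizes_pow[OF L(1)] mrealizes_zero infinite_nonzero]) (use Ls E.nilp_smult[OF lg(1)[OF eU]] in auto)
  then have nil: "L 0 \<in> carrier_mat N N \<and> L 0 ^\<^sub>m m = 0\<^sub>m N N" using c by simp
  have LU: "mexp id m (L s) \<in> U" if "s \<noteq> 0" for s unfolding Ls[OF that] by (rule exp_in_U[OF eU])
  have LU0: "mexp id m (L 0) \<in> U"
    by (rule line_in_U[OF mrealizes_mexp[OF L(1)] infinite_nonzero LU mexp_det[OF nil]]) simp
  have LU': "mexp id m (L s) \<in> U" for s using LU LU0 by (cases "s = 0") auto
  have "R (mexp id m (L 0)) = mexp id m (L2 0)"
  proof (rule line_eq_mat[OF mrealizes_R[OF line_point mrealizes_mexp[OF L(1)] LU'] mrealizes_mexp[OF L2(1)] infinite_nonzero])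
    fix s :: 'a assume "s \<in> {s. s \<noteq> 0}"
    then have s: "s \<noteq> 0" by simp
    show "R (mexp id m (L s)) = mexp id m (L2 s)" unfolding Ls[OF s] L2s[OF s] by (rule R_exp[OF eU])
  qed
  then have "lR (mexp id m (L 0)) = mlog id m (mexp id m (lR x + lR y))" by (simp only: L2(2))
  also have "\<dots> = lR x + lR y" by (rule En.mlog_mexp[OF upat_nilp[OF pat_add[OF lR_tri[OF x] lR_tri[OF y]]]])
  finally have 1: "lR (mexp id m (L 0)) = lR x + lR y" .
  have "lg (mexp id m (L 0)) = L 0" by (rule E.mlog_mexp[OF nil])
  with 1 LU0 L(2) show ?thesis by metis
qed

text \<open>Injectivity enters here: \<open>lR x\<close> determines \<open>R x\<close>, hence
  \<open>x\<close> and \<open>lg x\<close>. By \<open>smult_closed\<close> and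
  \<open>add_closed\<close> the pairs of logarithms form a linear space, so \<open>lg x\<close> can
  be recovered linearly from \<open>lR x\<close>.\<close>

lemma coeffs_exist:
  assumes inj: "inj_on (eval_map id \<rho>) U"
  obtains c d where "\<And>x. x \<in> U \<Longrightarrow> lg x = lmap id c N n (lR x) \<and> lR x = lmap id d n n (lR x)"
    "\<And>L. L \<in> carrier_mat n n \<Longrightarrow> \<exists>x\<in>U. lmap id c N n L = lg x \<and> lmap id d n n L = lR x"
proof -
  define W where "W = (\<lambda>x. (lg x, lR x)) ` U"
  have zero: "0 \<cdot>\<^sub>m A = 0\<^sub>m k k" if "A \<in> carrier_mat k k" for A :: "'a mat" and k using that by (intro eq_matI) auto
  obtain c d where cd: "\<And>X Y. (X, Y) \<in> W \<Longrightarrow> X = lmap id c N n Y \<and> Y = lmap id d n n Y"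
    "\<And>L. L \<in> carrier_mat n n \<Longrightarrow> (lmap id c N n L, lmap id d n n L) \<in> W"
  proof (rule left_inverse_coeffs[of W N n])
    show "X \<in> carrier_mat N N \<and> Y \<in> carrier_mat n n" if "(X, Y) \<in> W" for X Y using that lg lR by (auto simp: W_def)
    obtain z where z: "z \<in> U" "lg z = 0 \<cdot>\<^sub>m lg (1\<^sub>m N)" "lR z = 0 \<cdot>\<^sub>m lR (1\<^sub>m N)" using smult_closed[OF S(3), of 0] by blast
    have "lg z = 0\<^sub>m N N" unfolding z(2) by (rule zero[OF conjunct1[OF lg(1)[OF S(3)]]])
    moreover have "lR z = 0\<^sub>m n n" unfolding z(3) by (rule zero[OF conjunct1[OF lR(1)[OF S(3)]]])
    ultimately show "(0\<^sub>m N N, 0\<^sub>m n n) \<in> W" unfolding W_def using z(1) by (intro image_eqI[of _ _ z]) (simp_all only:)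
    show "(X + X', Y + Y') \<in> W" if XY: "(X, Y) \<in> W" "(X', Y') \<in> W" for X Y X' Y'
    proof -
      obtain x y where "x \<in> U" "y \<in> U" "X = lg x" "Y = lR x" "X' = lg y" "Y' = lR y" using XY by (auto simp: W_def)
      moreover from this obtain z where "z \<in> U" "lg z = lg x + lg y" "lR z = lR x + lR y" using add_closed by blast
      ultimately show ?thesis unfolding W_def by (intro image_eqI[of _ _ z]) (simp_all only:)
    qed
    show "(s \<cdot>\<^sub>m X, s \<cdot>\<^sub>m Y) \<in> W" if XY: "(X, Y) \<in> W" for X Y s
    proof -
      obtain x where "x \<in> U" "X = lg x" "Y = lR x" using XY by (auto simp: W_def)
      moreover from this obtain z where "z \<in> U" "lg z = s \<cdot>\<^sub>m lg x" "lR z = s \<cdot>\<^sub>m lR x" using smult_closed by blast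
      ultimately show ?thesis unfolding W_def by (intro image_eqI[of _ _ z]) (simp_all only:)
    qed
    show "X = X'" if XY: "(X, Y) \<in> W" "(X', Y) \<in> W" for X X' Y
    proof -
      obtain x y where xy: "x \<in> U" "y \<in> U" "X = lg x" "Y = lR x" "X' = lg y" "Y = lR y" using XY by (auto simp: W_def)
      have "R x = R y" using lR(2)[OF xy(1)] lR(2)[OF xy(2)] xy(4,6) by simp
      then have "P * R x * P' = P * R y * P'" by simp
      then have "eval_map id \<rho> x = eval_map id \<rho> y" unfolding R_def conj_back[OF P(1,2) eval_carrier P(3)] .
      with inj xy show ?thesis by (metis inj_onD)
    qed
  qed blast
  show ?thesis
  proof (rule that)
    show "lg x = lmap id c N n (lR x) \<and> lR x = lmap id d n n (lR x)" if "x \<in> U" for x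
      by (rule cd(1)) (use that in \<open>auto simp: W_def\<close>)
    show "\<exists>x\<in>U. lmap id c N n L = lg x \<and> lmap id d n n L = lR x" if "L \<in> carrier_mat n n" for L
      using cd(2)[OF that] by (auto simp: W_def)
  qed
qed

end

lemma lmap_smult: "V \<in> carrier_mat n n \<Longrightarrow> lmap h c a n (s \<cdot>\<^sub>m V) = s \<cdot>\<^sub>m lmap h c a n V"
  by (rule eq_matI) (auto simp: lmap_def sum_distrib_left mult_ac)

lemma lmap_minus:
  "V \<in> carrier_mat n n \<Longrightarrow> W \<in> carrier_mat n n \<Longrightarrow> lmap h c a n (V - W) = lmap h c a n V - lmap h c a n W"
  by (rule eq_matI) (auto simp: lmap_def algebra_simps sum_subtractf)

lemma one_plus_mult:
  fixes U V :: "'b::comm_ring_1 mat"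
  assumes "U \<in> carrier_mat k k" "V \<in> carrier_mat k k"
  shows "(1\<^sub>m k + U) * (1\<^sub>m k + V) = 1\<^sub>m k + (U + V + U * V)"
proof -
  have "(1\<^sub>m k + U) * (1\<^sub>m k + V) = 1\<^sub>m k * (1\<^sub>m k + V) + U * (1\<^sub>m k + V)"
    by (rule add_mult_distrib_mat) (use assms in auto)
  also have "U * (1\<^sub>m k + V) = U * 1\<^sub>m k + U * V"
    by (rule mult_add_distrib_mat) (use assms in auto)
  finally show ?thesis using assms by (intro eq_matI) (auto simp: algebra_simps simp del: index_mult_mat(1))
qed

lemma fev_upat_0:
  assumes "upat n k (A :: 'b::comm_ring_1 mat)" "0 < k" shows "upat n 0 (fev h f m A)"
proof -
  have "upat n 0 A" by (rule pat_mono[OF assms(1)]) simp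
  have A: "A \<in> carrier_mat n n" by (rule patD(1)[OF assms(1)])
  show ?thesis unfolding pat_def
  proof (intro conjI allI impI)
    show "fev h f m A \<in> carrier_mat n n" using A by simp
    fix i j assume ij: "i < n" "j < n" "\<not> i + 0 \<le> j"
    have "(A ^\<^sub>m l) $$ (i, j) = 0" for l
    proof (cases "l = 0")
      case False
      have "upat n 0 (A ^\<^sub>m l)" by (rule pat_pow[OF \<open>upat n 0 A\<close>]) (use False in auto)
      then show ?thesis using ij by (rule patD(2))
    qed (use ij A in auto)
    then show "fev h f m A $$ (i, j) = 0" unfolding fev_index[OF A ij(1,2)] by simp
  qed
qed

lemma upat_point:
  assumes pt: "fls_point Z B" and F: "mrealizes Z B n n F V" and "\<And>x. x \<in> Z \<Longrightarrow> upat n k (F x)"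
  shows "upat n k V"
  unfolding pat_def
proof (intro conjI allI impI)
  fix i j assume ij: "i < n" "j < n" "\<not> i + k \<le> j"
  show "V $$ (i, j) = 0"
    by (rule fls_point_unique[OF pt mrealizesD(3)[OF F ij(1,2)] realizes_zero])
      (rule patD(2)[OF assms(3) ij])
qed (rule mrealizesD(1)[OF F])

context unip_rep
begin

lemma R'_carrier: "R' V \<in> carrier_mat n n"
  unfolding R'_def using P(1,2) D(1) by (auto simp: eval_map_def)

lemma R'_mult: assumes "x \<in> laurent_points N U" "y \<in> laurent_points N U" shows "R' (x * y) = R' x * R' y"
proof -
  have c: "eval_map fls_const \<rho> z \<in> carrier_mat n n" for z using D(1) by (auto simp: eval_map_def)
  note PF = GL_power_series_const[OF P]
  show ?thesis
    unfolding R'_def eval_map_laurent_mult[OF hom U subset_refl assms]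
    by (rule mult_mat_conj[OF _ _ c c PF(2), symmetric]) (use P in auto)
qed

lemma R'_upat:
  assumes x: "x \<in> laurent_points N U" shows "upat n 1 (R' x - 1\<^sub>m n)"
proof -
  note pt = fls_point_laurent[OF S(1) x]
  show ?thesis
    by (rule upat_point[OF pt mrealizes_minus[OF mrealizes_R[OF pt mrealizes_GL_gens[OF laurent_points_GL[OF x] S(1)]] mrealizes_one]])
      (assumption, rule R_tri)
qed

end

section \<open>The grading of the logarithms by torus weights\<close>

locale unip_rep_graded = unip_rep N U m n \<rho> P P'
  for N and U :: "'a::{alg_closed_field,field_char_0} mat set" and m n \<rho> P P' +
  fixes c d :: "nat \<Rightarrow> nat \<Rightarrow> nat \<Rightarrow> nat \<Rightarrow> 'a" and w :: "nat \<Rightarrow> int"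
  assumes cd1: "\<And>x. x \<in> U \<Longrightarrow> lg x = lmap id c N n (lR x) \<and> lR x = lmap id d n n (lR x)"
    and cd2: "\<And>L. L \<in> carrier_mat n n \<Longrightarrow> \<exists>x\<in>U. lmap id c N n L = lg x \<and> lmap id d n n L = lR x"
    and gr: "\<And>x s. x \<in> U \<Longrightarrow> s \<noteq> 0 \<Longrightarrow>
      \<exists>z\<in>U. R z = mat_diag n (\<lambda>i. s powi w i) * R x * mat_diag n (\<lambda>i. s powi (- w i))"
begin

text \<open>Under conjugation by the torus the entry \<open>(i, j)\<close> has weight
  \<open>w i - w j\<close>; this is the projection to the weights \<open>\<ge> 0\<close>.\<close>

definition prj :: "'b::zero mat \<Rightarrow> 'b mat" where
  "prj L = mat n n (\<lambda>(i, j). if w j \<le> w i then L $$ (i, j) else 0)"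

lemma prj_carrier: "prj L \<in> carrier_mat n n" by (simp add: prj_def)

lemma mrealizes_prj:
  assumes "mrealizes Z B n n F V" shows "mrealizes Z B n n (\<lambda>x. prj (F x)) (prj V)"
  unfolding prj_def
proof (rule mrealizes_mat)
  fix i j assume ij: "i < n" "j < n"
  show "realizes Z B (\<lambda>x. case (i, j) of (i, j) \<Rightarrow> if w j \<le> w i then F x $$ (i, j) else 0)
      (case (i, j) of (i, j) \<Rightarrow> if w j \<le> w i then V $$ (i, j) else 0)"
    using mrealizesD(3)[OF assms ij] realizes_zero[of Z B] by (cases "w j \<le> w i") simp_all
qed

text \<open>Comparing coefficients of \<open>s\<close> in the conjugates by the torus shows that the image of the
  projection \<open>lmap id d n n\<close> is a graded subspace.\<close>

lemma graded:
  assumes L: "L \<in> carrier_mat n n"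
  shows "lmap id d n n (prj (lmap id d n n L)) = prj (lmap id d n n L)"
proof -
  obtain x where x: "x \<in> U" "lmap id d n n L = lR x" using cd2[OF L] by blast
  define Y where "Y = lR x"
  have Y: "Y \<in> carrier_mat n n" using lR(1)[OF x(1)] by (simp add: Y_def)
  define D' where "D' = (\<lambda>s i. s powi w i :: 'a)"
  have conj: "(\<Sum>k<n. \<Sum>l<n. d a b k l * (s powi (w k - w l) * Y $$ (k, l))) = s powi (w a - w b) * Y $$ (a, b)"
    if s: "s \<noteq> 0" and ab: "a < n" "b < n" for s a b
  proof -
    define E where "E = mat_diag n (\<lambda>i. s powi w i)"
    define F where "F = mat_diag n (\<lambda>i. s powi (- w i))"
    have EF: "E \<in> carrier_mat n n" "F \<in> carrier_mat n n" "E * F = 1\<^sub>m n" "F * E = 1\<^sub>m n"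
      using s by (auto simp: E_def F_def power_int_minus mat_diag_one[symmetric] simp del: mat_diag_one)
    obtain z where z: "z \<in> U" "R z = E * R x * F" using gr[OF x(1) s] unfolding E_def F_def by blast
    have "R z - 1\<^sub>m n = E * (R x - 1\<^sub>m n) * F"
    proof -
      have "E * (R x - 1\<^sub>m n) = E * R x - E * 1\<^sub>m n" by (rule mult_minus_distrib_mat[OF EF(1) R_carrier one_carrier_mat])
      then have "E * (R x - 1\<^sub>m n) * F = (E * R x - E) * F" using EF by simp
      also have "\<dots> = E * R x * F - E * F" by (rule minus_mult_distrib_mat[OF mult_carrier_mat[OF EF(1) R_carrier] EF(1,2)])
      finally show ?thesis unfolding z(2) EF(3) by simp
    qed
    then have "lR z = E * Y * F"
      unfolding Y_def mlog_def carrier_matD(1)[OF R_carrier]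
      using fev_conj[OF EF(1,2) minus_carrier_mat[OF one_carrier_mat] EF(4,3)] by simp
    then have zY: "lR z $$ (k, l) = s powi (w k - w l) * Y $$ (k, l)" if "k < n" "l < n" for k l
    proof -
      have "E * Y = mat n n (\<lambda>(i, j). s powi w i * Y $$ (i, j))" unfolding E_def by (rule mat_diag_mult_left[OF Y])
      then have "E * Y * F = mat n n (\<lambda>(i, j). s powi w i * Y $$ (i, j) * s powi (- w j))"
        unfolding F_def by (subst mat_diag_mult_right[of _ n]) (auto intro!: eq_matI)
      then show ?thesis using \<open>lR z = E * Y * F\<close> that s by (simp add: power_int_diff power_int_minus field_simps)
    qed
    have "lR z $$ (a, b) = lmap id d n n (lR z) $$ (a, b)" using cd1[OF z(1)] by metis
    also have "\<dots> = (\<Sum>k<n. \<Sum>l<n. d a b k l * lR z $$ (k, l))" using ab by (simp add: lmap_def)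
    also have "\<dots> = (\<Sum>k<n. \<Sum>l<n. d a b k l * (s powi (w k - w l) * Y $$ (k, l)))"
      by (intro sum.cong refl) (simp only: zY lessThan_iff)
    finally show ?thesis unfolding zY[OF ab] by simp
  qed
  define K where "K = (\<lambda>(k, l). w k - w l) ` ({..<n} \<times> {..<n})"
  have K: "finite K" by (simp add: K_def)
  have inK: "w k - w l \<in> K" if "k < n" "l < n" for k l using that by (auto simp: K_def)
  show ?thesis
  proof (rule eq_matI)
    fix a b assume "a < dim_row (prj (lmap id d n n L))" "b < dim_col (prj (lmap id d n n L))"
    then have ab: "a < n" "b < n" by (auto simp: prj_def)
    \<comment> \<open>The coefficient of \<open>s powi e\<close> in the difference of the two sides
      of \<open>conj\<close>.\<close>
    define C where "C e = (\<Sum>k<n. \<Sum>l<n. if w k - w l = e then d a b k l * Y $$ (k, l) else 0) -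
      (if w a - w b = e then Y $$ (a, b) else 0)" for e
    have pick: "(\<Sum>e\<in>K'. f e * (\<Sum>k<n. \<Sum>l<n. if w k - w l = e then g k l else 0)) =
        (\<Sum>k<n. \<Sum>l<n. if w k - w l \<in> K' then f (w k - w l) * g k l else 0)"
      if K': "finite K'" for K' and f :: "int \<Rightarrow> 'a" and g
    proof -
      have "(\<Sum>e\<in>K'. f e * (\<Sum>k<n. \<Sum>l<n. if w k - w l = e then g k l else 0)) =
          (\<Sum>e\<in>K'. \<Sum>k<n. \<Sum>l<n. if e = w k - w l then f (w k - w l) * g k l else 0)"
        unfolding sum_distrib_left by (intro sum.cong refl) auto
      also have "\<dots> = (\<Sum>k<n. \<Sum>e\<in>K'. \<Sum>l<n. if e = w k - w l then f (w k - w l) * g k l else 0)"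
        by (rule sum.swap)
      also have "\<dots> = (\<Sum>k<n. \<Sum>l<n. \<Sum>e\<in>K'. if e = w k - w l then f (w k - w l) * g k l else 0)"
        by (rule sum.cong[OF refl], rule sum.swap)
      finally show ?thesis using K' by (simp add: sum.delta)
    qed
    have C0: "C e = 0" if e: "e \<in> K" for e
    proof (rule laurent_poly_zero[OF K _ e])
      fix s :: 'a assume s: "s \<noteq> 0"
      have "(\<Sum>e\<in>K. s powi e * C e) = (\<Sum>e\<in>K. s powi e * (\<Sum>k<n. \<Sum>l<n. if w k - w l = e then d a b k l * Y $$ (k, l) else 0)) -
          (\<Sum>e\<in>K. if e = w a - w b then s powi e * Y $$ (a, b) else 0)"
        unfolding C_def sum_subtractf[symmetric] by (intro sum.cong refl) (auto simp: algebra_simps)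
      also have "(\<Sum>e\<in>K. if e = w a - w b then s powi e * Y $$ (a, b) else 0) = s powi (w a - w b) * Y $$ (a, b)"
        using K inK[OF ab] by (simp add: sum.delta)
      also have "(\<Sum>e\<in>K. s powi e * (\<Sum>k<n. \<Sum>l<n. if w k - w l = e then d a b k l * Y $$ (k, l) else 0)) =
          (\<Sum>k<n. \<Sum>l<n. d a b k l * (s powi (w k - w l) * Y $$ (k, l)))"
        unfolding pick[OF K] using inK by (intro sum.cong refl) (auto simp: mult_ac)
      also have "\<dots> = s powi (w a - w b) * Y $$ (a, b)" by (rule conj[OF s ab])
      finally show "(\<Sum>e\<in>K. s powi e * C e) = 0" by simp
    qed
    \<comment> \<open>Adding up the coefficients with exponent \<open>\<ge> 0\<close> reassembles
      exactly the entries kept by \<open>prj\<close>.\<close>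
    define K' where "K' = {e \<in> K. 0 \<le> e}"
    have K': "finite K'" using K by (simp add: K'_def)
    have "0 = (\<Sum>e\<in>K'. C e)" using C0 by (simp add: K'_def)
    also have "\<dots> = (\<Sum>e\<in>K'. 1 * (\<Sum>k<n. \<Sum>l<n. if w k - w l = e then d a b k l * Y $$ (k, l) else 0)) -
        (\<Sum>e\<in>K'. if e = w a - w b then Y $$ (a, b) else 0)"
      unfolding C_def sum_subtractf[symmetric] by (intro sum.cong refl) auto
    also have "(\<Sum>e\<in>K'. if e = w a - w b then Y $$ (a, b) else 0) = (if w b \<le> w a then Y $$ (a, b) else 0)"
      using K' inK[OF ab] by (simp add: sum.delta K'_def)
    also have "(\<Sum>e\<in>K'. 1 * (\<Sum>k<n. \<Sum>l<n. if w k - w l = e then d a b k l * Y $$ (k, l) else 0)) =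
        (\<Sum>k<n. \<Sum>l<n. d a b k l * prj Y $$ (k, l))"
      unfolding pick[OF K'] using inK by (intro sum.cong refl) (auto simp: K'_def prj_def)
    finally have "(\<Sum>k<n. \<Sum>l<n. d a b k l * prj Y $$ (k, l)) = prj Y $$ (a, b)" using ab by (simp add: prj_def)
    then show "lmap id d n n (prj (lmap id d n n L)) $$ (a, b) = prj (lmap id d n n L) $$ (a, b)"
      unfolding x(2) Y_def[symmetric] using ab by (simp add: lmap_def)
  qed (auto simp: lmap_def prj_def)
qed

abbreviation "lR' \<equiv> \<lambda>V. mlog fls_const m (R' V)"
abbreviation "ex' \<equiv> mexp (fls_const :: 'a \<Rightarrow> 'a fls) m"
abbreviation "\<sigma> \<equiv> lmap (fls_const :: 'a \<Rightarrow> 'a fls) c N n"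
abbreviation "\<pi> \<equiv> lmap (fls_const :: 'a \<Rightarrow> 'a fls) d n n"

lemma mexp_nil_fls: "mexp_nil (fls_const :: 'a \<Rightarrow> 'a fls) m"
  using nm by (auto intro!: mexp_nil.intro fls_const.comm_ring_hom_axioms mexp_nil_axioms.intro)

text \<open>The formulas that recover \<open>x\<close> from its image over the base field have
  constant coefficients, so they hold at every Laurent point of \<open>U\<close>.\<close>

lemma laurent_U:
  assumes x: "x \<in> laurent_points N U"
  shows "ex' (\<sigma> (lR' x)) = x" "\<pi> (lR' x) = lR' x" "upat n 1 (R' x - 1\<^sub>m n)"
proof -
  note pt = fls_point_laurent[OF S(1) x]
  note F = mrealizes_GL_gens[OF laurent_points_GL[OF x] S(1)]
  have RF: "mrealizes U (GL_gens N x) n n R (R' x)" by (rule mrealizes_R[OF pt F])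
  note LF = mrealizes_mlog[OF RF]
  show "ex' (\<sigma> (lR' x)) = x"
  proof (rule fls_point_unique_mat[OF pt mrealizes_mexp[OF mrealizes_lmap[OF LF]] F])
    show "mexp id m (lmap id c N n (lR x)) = x" if "x \<in> U" for x using cd1[OF that] lg(2)[OF that] by metis
  qed
  show "\<pi> (lR' x) = lR' x"
  proof (rule fls_point_unique_mat[OF pt mrealizes_lmap[OF LF] LF])
    show "lmap id d n n (lR x) = lR x" if "x \<in> U" for x using cd1[OF that] by metis
  qed
  show "upat n 1 (R' x - 1\<^sub>m n)"
    by (rule R'_upat[OF x])
qed

text \<open>\<open>V\<close> is a point of the affine space of all matrices, so what
  \<open>cd2\<close> and \<open>graded\<close> give over the base field holds for \<open>V\<close>.
  In this way Laurent points of \<open>U\<close> are produced from linear data.\<close>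

lemma exp_laurent:
  assumes V: "V \<in> carrier_mat n n"
  shows "ex' (\<sigma> V) \<in> laurent_points N U" "R' (ex' (\<sigma> V)) = ex' (\<pi> V)" "upat n 1 (\<pi> V)" "\<sigma> V ^\<^sub>m m = 0\<^sub>m N N"
    "\<pi> (prj (\<pi> V)) = prj (\<pi> V)"
proof -
  note pt = fls_point_mats[OF V]
  have F: "mrealizes (carrier_mat n n) (mat_gens n n V) n n (\<lambda>A. A) V"
    by (rule mrealizes_mat_gens[OF V]) auto
  note sF = mrealizes_lmap[OF F, of N c] and pF = mrealizes_lmap[OF F, of n d]
  have exU: "mexp id m (lmap id c N n L) \<in> U" "R (mexp id m (lmap id c N n L)) = mexp id m (lmap id d n n L)"
    "upat n 1 (lmap id d n n L)" "lmap id c N n L ^\<^sub>m m = 0\<^sub>m N N" if L: "L \<in> carrier_mat n n" for L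
  proof -
    obtain x where x: "x \<in> U" "lmap id c N n L = lg x" "lmap id d n n L = lR x" using cd2[OF L] by blast
    show "mexp id m (lmap id c N n L) \<in> U" unfolding x(2) lg(2)[OF x(1)] by (rule x(1))
    show "R (mexp id m (lmap id c N n L)) = mexp id m (lmap id d n n L)"
      unfolding x(2,3) lg(2)[OF x(1)] lR(2)[OF x(1)] ..
    show "upat n 1 (lmap id d n n L)" unfolding x(3) by (rule lR_tri[OF x(1)])
    show "lmap id c N n L ^\<^sub>m m = 0\<^sub>m N N" unfolding x(2) using lg(1)[OF x(1)] by blast
  qed
  have "det (ex' (\<sigma> V)) = 1"
    by (rule mrealizes_eval_map_det1(2)[OF pt mrealizes_mexp[OF sF] nilp(3)[OF exU(1)] D(1,2)])
  then have d0: "det (ex' (\<sigma> V)) \<noteq> 0" by (rule ssubst) (rule one_neq_zero)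
  show "ex' (\<sigma> V) \<in> laurent_points N U"
    by (rule laurent_pointsI[OF pt mrealizes_mexp[OF sF] exU(1) d0])
  show "R' (ex' (\<sigma> V)) = ex' (\<pi> V)"
    by (rule fls_point_unique_mat[OF pt mrealizes_R[OF pt mrealizes_mexp[OF sF] exU(1)] mrealizes_mexp[OF pF] exU(2)])
  show "upat n 1 (\<pi> V)" by (rule upat_point[OF pt pF exU(3)])
  show "\<sigma> V ^\<^sub>m m = 0\<^sub>m N N" by (rule fls_point_unique_mat[OF pt mrealizes_pow[OF sF] mrealizes_zero exU(4)])
  show "\<pi> (prj (\<pi> V)) = prj (\<pi> V)"
    by (rule fls_point_unique_mat[OF pt mrealizes_lmap[OF mrealizes_prj[OF pF]] mrealizes_prj[OF pF] graded])
qed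

lemma R'_inj: assumes "x \<in> laurent_points N U" "y \<in> laurent_points N U" "R' x = R' y" shows "x = y"
  using laurent_U(1)[OF assms(1)] laurent_U(1)[OF assms(2)] assms(3) by metis

lemma upat_nilp': "upat n 1 A \<Longrightarrow> A \<in> carrier_mat n n \<and> A ^\<^sub>m m = (0\<^sub>m n n :: 'a fls mat)"
  using pow_mat_zero_ge[OF patD(1) upat_nilpotent, of n _ A m] patD(1)[where A = A] nm by (metis less_imp_le)

lemma exp_fixed:
  assumes V: "V \<in> carrier_mat n n" "\<pi> V = V"
  shows "\<exists>x\<in>laurent_points N U. R' x = ex' V" "upat n 1 V"
  using exp_laurent[OF V(1)] V(2) by auto

text \<open>\<open>Pp\<close> collects the positions of torus weight \<open>\<ge> 0\<close> above
  the diagonal, \<open>Pm\<close> those of weight \<open>< 0\<close>. Both relations are transitive,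
  so \<open>unip_mult\<close> applies to them.\<close>

definition "Pp = (\<lambda>i j. i < j \<and> w j \<le> w i)"
definition "Pm = (\<lambda>i j. i < j \<and> w i < w j)"

lemma ex'_unip:
  assumes "upat n 1 V" "pat n Q V" and tr: "\<And>i j k. i < n \<Longrightarrow> j < n \<Longrightarrow> k < n \<Longrightarrow> Q i j \<Longrightarrow> Q j k \<Longrightarrow> Q i k"
  shows "unip n Q (ex' V)"
proof -
  interpret X: mexp_nil "fls_const :: 'a \<Rightarrow> 'a fls" n m by (rule mexp_nil_fls)
  note nl = upat_nilp'[OF assms(1)]
  have "pat n Q (fev fls_const (fps_exp 1 - 1) m V)" by (rule pat_fev[OF assms(2) tr]) simp_all
  then show ?thesis unfolding unip_def X.mexp_minus_one[OF nl] using X.mexp_nilp(2)[OF nl] by blast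
qed

lemma ex'_first_order:
  assumes "upat n k V" "1 \<le> k"
  shows "\<exists>E. ex' V = 1\<^sub>m n + (V + E) \<and> upat n (k + 1) E"
proof -
  interpret X: mexp_nil "fls_const :: 'a \<Rightarrow> 'a fls" n m by (rule mexp_nil_fls)
  have "upat n 1 V" by (rule pat_mono[OF assms(1)]) (use assms(2) in simp)
  note nl = upat_nilp'[OF this]
  let ?G = "fev fls_const (fps_shift 2 (fps_exp 1)) m V"
  have G: "upat n 0 ?G" by (rule fev_upat_0[OF assms(1)]) (use assms(2) in simp)
  have VV: "upat n (k + k) (V * V)" by (rule pat_mult[OF assms(1,1)]) simp
  have "upat n (k + 1) (V * V * ?G)" by (rule pat_mult[OF VV G]) (use assms(2) in simp)
  moreover have "ex' V = 1\<^sub>m n + (V + V * V * ?G)"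
    using X.mexp_expand[OF nl] assoc_add_mat[of "1\<^sub>m n" n n V "V * V * ?G"] nl patD(1)[OF \<open>upat n (k + 1) (V * V * ?G)\<close>] by simp
  ultimately show ?thesis by blast
qed

text \<open>Induction along the superdiagonals. The logarithm splits as \<open>A + B\<close> by
  weights, and both parts are again logarithms from \<open>U\<close> by gradedness;
  \<open>exp (- A) x exp (- B)\<close> is trivial one superdiagonal further. Its factors
  \<open>p\<close> and \<open>q\<close> are then completed to \<open>exp A p\<close> and
  \<open>q exp B\<close>.\<close>

lemma decompose:
  assumes "x \<in> laurent_points N U" "upat n k (R' x - 1\<^sub>m n)" "1 \<le> k"
  shows "\<exists>a\<in>laurent_points N U. \<exists>b\<in>laurent_points N U. R' x = R' a * R' b \<and> unip n Pp (R' a) \<and> unip n Pm (R' b)"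
  using assms
proof (induction "n - k" arbitrary: x k)
  case 0
  interpret X: mexp_nil "fls_const :: 'a \<Rightarrow> 'a fls" n m by (rule mexp_nil_fls)
  have "R' x - 1\<^sub>m n = 0\<^sub>m n n" using 0 by (intro eq_matI) (auto simp: pat_def)
  have R1: "R' x = 1\<^sub>m n"
  proof (rule eq_matI)
    fix i j assume ij: "i < dim_row (1\<^sub>m n)" "j < dim_col (1\<^sub>m n)"
    then have "(R' x - 1\<^sub>m n) $$ (i, j) = 0" unfolding \<open>R' x - 1\<^sub>m n = 0\<^sub>m n n\<close> by simp
    then show "R' x $$ (i, j) = 1\<^sub>m n $$ (i, j)" using ij R'_carrier[of x] by simp
  qed (use R'_carrier[of x] in auto)
  show ?case
  proof (intro bexI conjI)
    \<comment> \<open>When no superdiagonal is left, \<open>R' x\<close> is the identity, so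
      \<open>x\<close> itself can serve as both factors.\<close>
    show "R' x = R' x * R' x" unfolding R1 by simp
    show "unip n Pp (R' x)" "unip n Pm (R' x)" unfolding R1 by (rule unip_one)+
  qed (rule 0)+
next
  case (Suc l)
  interpret X: mexp_nil "fls_const :: 'a \<Rightarrow> 'a fls" n m by (rule mexp_nil_fls)
  define V where "V = lR' x"
  have dR: "dim_row (R' x) = n" using R'_carrier[of x] by (rule carrier_matD)
  have Vk: "upat n k V" unfolding V_def mlog_def dR
    by (rule pat_fev[OF Suc.prems(2)]) (use Suc.prems(3) in auto)
  have V: "V \<in> carrier_mat n n" by (rule patD(1)[OF Vk])
  have \<pi>V: "\<pi> V = V" unfolding V_def by (rule laurent_U(2)[OF Suc.prems(1)])
  define A where "A = prj V"
  define B where "B = V - A"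
  have Ac: "A \<in> carrier_mat n n" unfolding A_def by (rule prj_carrier)
  have Bc: "B \<in> carrier_mat n n" unfolding B_def by (rule minus_carrier_mat[OF Ac])
  have \<pi>A: "\<pi> A = A" unfolding A_def using exp_laurent(5)[OF V] unfolding \<pi>V .
  have \<pi>B: "\<pi> B = B" unfolding B_def lmap_minus[OF V Ac] \<pi>V \<pi>A ..
  have Ak: "upat n k A" using Vk by (auto simp: A_def prj_def pat_def)
  have Bk: "upat n k B" unfolding B_def by (rule pat_minus[OF Vk Ak])
  let ?A = "(- 1) \<cdot>\<^sub>m A" and ?B = "(- 1) \<cdot>\<^sub>m B"
  have sm: "upat n k ((- 1) \<cdot>\<^sub>m C)" if "upat n k C" for C :: "'a fls mat" using that by (auto simp: pat_def)
  have \<pi>s: "\<pi> ((- 1) \<cdot>\<^sub>m C) = (- 1) \<cdot>\<^sub>m C" if "C \<in> carrier_mat n n" "\<pi> C = C" for C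
    using lmap_smult[OF that(1)] that(2) by metis
  have sc: "(- 1) \<cdot>\<^sub>m C \<in> carrier_mat n n" if "C \<in> carrier_mat n n" for C :: "'a fls mat" using that by simp
  obtain a where a: "a \<in> laurent_points N U" "R' a = ex' A" using exp_fixed(1)[OF Ac \<pi>A] by blast
  obtain b where b: "b \<in> laurent_points N U" "R' b = ex' B" using exp_fixed(1)[OF Bc \<pi>B] by blast
  obtain a' where a': "a' \<in> laurent_points N U" "R' a' = ex' ?A" using exp_fixed(1)[OF sc[OF Ac] \<pi>s[OF Ac \<pi>A]] by blast
  obtain b' where b': "b' \<in> laurent_points N U" "R' b' = ex' ?B" using exp_fixed(1)[OF sc[OF Bc] \<pi>s[OF Bc \<pi>B]] by blast
  note A1 = exp_fixed(2)[OF Ac \<pi>A] and B1 = exp_fixed(2)[OF Bc \<pi>B]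
  have neg: "fls_const (- 1) = (- 1 :: 'a fls)" by simp
  have aa: "R' a * R' a' = 1\<^sub>m n" unfolding a a' using X.mexp_minus(1)[OF upat_nilp'[OF A1]] unfolding neg .
  have bb: "R' b' * R' b = 1\<^sub>m n" unfolding b b' using X.mexp_minus(2)[OF upat_nilp'[OF B1]] unfolding neg .
  define y where "y = a' * x * b'"
  have y: "y \<in> laurent_points N U" unfolding y_def by (intro laurent_points_mult[OF U] a' b' Suc.prems(1))
  have Ry: "R' y = R' a' * R' x * R' b'"
    unfolding y_def R'_mult[OF laurent_points_mult[OF U a'(1) Suc.prems(1)] b'(1)] R'_mult[OF a'(1) Suc.prems(1)] ..
  have nx: "R' x - 1\<^sub>m n \<in> carrier_mat n n \<and> (R' x - 1\<^sub>m n) ^\<^sub>m m = 0\<^sub>m n n"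
    by (rule upat_nilp'[OF laurent_U(3)[OF Suc.prems(1)]])
  have xV: "R' x = ex' V" unfolding V_def X.mexp_mlog[OF R'_carrier nx] ..
  obtain ea where ea: "ex' ?A = 1\<^sub>m n + (?A + ea)" "upat n (k + 1) ea" using ex'_first_order[OF sm[OF Ak] Suc.prems(3)] by blast
  obtain eb where eb: "ex' ?B = 1\<^sub>m n + (?B + eb)" "upat n (k + 1) eb" using ex'_first_order[OF sm[OF Bk] Suc.prems(3)] by blast
  obtain ev where ev: "ex' V = 1\<^sub>m n + (V + ev)" "upat n (k + 1) ev" using ex'_first_order[OF Vk Suc.prems(3)] by blast
  note ec = patD(1)[OF ea(2)] patD(1)[OF eb(2)] patD(1)[OF ev(2)]
  have up: "upat n k e" if "upat n (k + 1) e" for e :: "'a fls mat" by (rule pat_mono[OF that]) simp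
  let ?a = "?A + ea" and ?v = "V + ev" and ?b = "?B + eb"
  have ka: "upat n k ?a" by (rule pat_add[OF sm[OF Ak] up[OF ea(2)]])
  have kv: "upat n k ?v" by (rule pat_add[OF Vk up[OF ev(2)]])
  have kb: "upat n k ?b" by (rule pat_add[OF sm[OF Bk] up[OF eb(2)]])
  note cc = patD(1)[OF ka] patD(1)[OF kv] patD(1)[OF kb]
  have two: "upat n (k + 1) (E * F)" if "upat n k E" "upat n k F" for E F :: "'a fls mat"
    by (rule pat_mult[OF that]) (use Suc.prems(3) in simp)
  let ?c = "?a + ?v + ?a * ?v"
  have avc: "?a * ?v \<in> carrier_mat n n" using cc by (meson mult_carrier_mat)
  have kc: "upat n k ?c" by (rule pat_add[OF pat_add[OF ka kv] up[OF two[OF ka kv]]])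
  have "R' y = 1\<^sub>m n + (?c + ?b + ?c * ?b)"
    unfolding Ry a'(2) b'(2) xV ea(1) eb(1) ev(1) one_plus_mult[OF cc(1,2)] by (rule one_plus_mult[OF patD(1)[OF kc] cc(3)])
  moreover have cbc: "?c * ?b \<in> carrier_mat n n" using patD(1)[OF kc] cc(3) by (meson mult_carrier_mat)
  \<comment> \<open>The first order terms \<open>- A\<close>, \<open>V\<close> and
    \<open>- B\<close> cancel because \<open>B = V - A\<close>; what remains lies one superdiagonal
    higher.\<close>
  ultimately have "R' y - 1\<^sub>m n = (ea + eb + ev) + (?a * ?v + ?c * ?b)"
    using ec Ac Bc V avc
    by (intro eq_matI) (auto simp: B_def algebra_simps simp del: index_mult_mat(1))
  moreover have "upat n (k + 1) ((ea + eb + ev) + (?a * ?v + ?c * ?b))"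
    by (rule pat_add[OF pat_add[OF pat_add[OF ea(2) eb(2)] ev(2)] pat_add[OF two[OF ka kv] two[OF kc kb]]])
  ultimately have yk: "upat n (k + 1) (R' y - 1\<^sub>m n)" by simp
  have "\<exists>a\<in>laurent_points N U. \<exists>b\<in>laurent_points N U. R' y = R' a * R' b \<and> unip n Pp (R' a) \<and> unip n Pm (R' b)"
    by (rule Suc.hyps(1)[OF _ y yk]) (use Suc.hyps(2) in auto)
  then obtain p q where pq: "p \<in> laurent_points N U" "q \<in> laurent_points N U" "R' y = R' p * R' q"
    "unip n Pp (R' p)" "unip n Pm (R' q)" by blast
  have "R' x = (R' a * R' a') * R' x * (R' b' * R' b)" unfolding aa bb using R'_carrier[of x] by simp
  also have "\<dots> = R' a * (R' a' * R' x * R' b') * R' b"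
    using R'_carrier by (smt (verit) assoc_mult_mat mult_carrier_mat)
  also have "\<dots> = R' a * R' p * (R' q * R' b)"
    unfolding Ry[symmetric] pq(3) using R'_carrier by (smt (verit) assoc_mult_mat mult_carrier_mat)
  finally have "R' x = R' (a * p) * R' (q * b)" unfolding R'_mult[OF a(1) pq(1)] R'_mult[OF pq(2) b(1)] .
  moreover have "unip n Pp (R' (a * p))"
    unfolding R'_mult[OF a(1) pq(1)] a(2)
  proof (rule unip_mult[OF ex'_unip[OF A1] pq(4)])
    show "pat n Pp A" unfolding pat_def
    proof (intro conjI allI impI)
      fix i j assume ij: "i < n" "j < n" "\<not> Pp i j"
      show "A $$ (i, j) = 0"
      proof (cases "i + 1 \<le> j")
        case True
        then have "\<not> w j \<le> w i" using ij(3) by (auto simp: Pp_def)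
        then show ?thesis using ij by (simp add: A_def prj_def)
      next
        case False
        then show ?thesis by (rule patD(2)[OF A1 ij(1,2)])
      qed
    qed (rule Ac)
  qed (auto simp: Pp_def)
  moreover have "unip n Pm (R' (q * b))"
    unfolding R'_mult[OF pq(2) b(1)] b(2)
  proof (rule unip_mult[OF pq(5) ex'_unip[OF B1]])
    show "pat n Pm B" unfolding pat_def
    proof (intro conjI allI impI)
      fix i j assume ij: "i < n" "j < n" "\<not> Pm i j"
      show "B $$ (i, j) = 0"
      proof (cases "i + 1 \<le> j")
        case True
        then have "w j \<le> w i" using ij(3) by (auto simp: Pm_def)
        then show ?thesis using ij V by (simp add: B_def A_def prj_def)
      next
        case False
        then show ?thesis by (rule patD(2)[OF B1 ij(1,2)])
      qed
    qed (rule Bc)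
  qed (auto simp: Pm_def)
  ultimately show ?case using laurent_points_mult[OF U a(1) pq(1)] laurent_points_mult[OF U pq(2) b(1)] by blast
qed

text \<open>\<open>x\<close> is obtained from \<open>R' x\<close> by log, \<open>\<sigma>\<close>
  and exp, all with coefficients in the base field. Its inverse is the exponential of the negative,
  hence integral too.\<close>

lemma integral_point:
  assumes x: "x \<in> laurent_points N U" and i: "imat n (R' x)"
  shows "x \<in> power_series_points N U"
proof -
  interpret X: mexp_nil "fls_const :: 'a \<Rightarrow> 'a fls" N m by (rule mexp_nil_fls)
  have dR: "dim_row (R' x) = n" using R'_carrier[of x] by (rule carrier_matD)
  have "imat n (R' x - 1\<^sub>m n)" using i imat_one[of n] by (auto simp: imat_def)
  then have lRi: "imat n (lR' x)" unfolding mlog_def dR by (rule imat_fev)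
  note c = imatD(1)[OF lRi]
  let ?V = "\<sigma> (lR' x)"
  have V: "?V \<in> carrier_mat N N \<and> ?V ^\<^sub>m m = 0\<^sub>m N N" using exp_laurent(4)[OF c] by simp
  have Vi: "imat N ?V" by (rule imat_lmap[OF lRi])
  have Vi': "imat N (fls_const (- 1) \<cdot>\<^sub>m ?V)" unfolding imat_def
  proof (intro conjI allI impI)
    show "fls_const (- 1) \<cdot>\<^sub>m ?V \<in> carrier_mat N N" using imatD(1)[OF Vi] by (rule smult_carrier_mat)
    fix i j assume ij: "i < N" "j < N"
    show "fls_int ((fls_const (- 1) \<cdot>\<^sub>m ?V) $$ (i, j))"
      using imatD(2)[OF Vi ij] carrier_matD[OF imatD(1)[OF Vi]] ij by (subst index_smult_mat(1)) (auto intro: fls_int_intros)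
  qed
  have "ex' ?V \<in> GL_power_series N"
    by (rule GL_power_seriesI[OF _ _ X.mexp_minus[OF V]]) (unfold mexp_def, (rule imat_fev Vi Vi')+)
  then show ?thesis using x unfolding laurent_U(1)[OF x] power_series_points_def by simp
qed

text \<open>With \<open>D = Dmat n w\<close> and \<open>R' x = X (D Y D\<^sup>-\<^sup>1) = p q\<close>, the matrix \<open>p\<^sup>-\<^sup>1 X = q (D Y D\<^sup>-\<^sup>1)\<^sup>-\<^sup>1\<close> has weight zero,
  where conjugation by \<open>D\<close> does nothing; so it is integral.\<close>

lemma integral_factorization:
  assumes x: "x \<in> laurent_points N U" and XY: "R' x * Dmat n w = X * Dmat n w * Y" "imat n X" "imat n Y"
    "unip n (\<lambda>i j. i < j \<and> w j \<le> w i) X" "unip n (\<lambda>i j. i < j \<and> w i \<le> w j) Y"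
  obtains a b where "a \<in> power_series_points N U" "b \<in> laurent_points N U" "x = a * b"
    "imat n (Dmat n (\<lambda>i. - w i) * R' b * Dmat n w)"
proof -
  let ?D = "Dmat n w :: 'a fls mat" and ?D' = "Dmat n (\<lambda>i. - w i) :: 'a fls mat"
  have D: "?D \<in> carrier_mat n n" "?D' \<in> carrier_mat n n" "?D * ?D' = 1\<^sub>m n" "?D' * ?D = 1\<^sub>m n"
    by (simp_all add: tpow_minus)
  obtain a b where ab: "a \<in> laurent_points N U" "b \<in> laurent_points N U" "R' x = R' a * R' b" "unip n Pp (R' a)" "unip n Pm (R' b)"
    using decompose[OF x laurent_U(3)[OF x]] by auto
  have XP: "unip n Pp X" using XY(4) unfolding Pp_def .
  let ?q = "\<lambda>i j. i < j \<and> w i \<le> w j"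
  obtain p' where p': "unip n Pp p'" "R' a * p' = 1\<^sub>m n" "p' * R' a = 1\<^sub>m n"
    using unip_inverse[OF ab(4)] by (auto simp: Pp_def)
  obtain Y' where Y': "unip n ?q Y'" "Y * Y' = 1\<^sub>m n" "Y' * Y = 1\<^sub>m n" "imat n Y'"
    using XY(3) by (rule_tac unip_inverse[OF XY(5)]) auto
  note c = unipD(1)[OF p'(1)] unipD(1)[OF Y'(1)] imatD(1)[OF XY(2)] imatD(1)[OF XY(3)] R'_carrier[of a] R'_carrier[of b] R'_carrier[of x]
  define Z where "Z = p' * X"
  have Zc: "Z \<in> carrier_mat n n" unfolding Z_def using c by (meson mult_carrier_mat)
  define T where "T = ?D * Y' * ?D'"
  have Tc: "T \<in> carrier_mat n n" unfolding T_def using c D by (meson mult_carrier_mat)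
  have T: "T $$ (i, j) = tpow (w i - w j) * Y' $$ (i, j)" if "i < n" "j < n" for i j
  proof -
    have "?D * Y' = mat n n (\<lambda>(i, j). tpow (w i) * Y' $$ (i, j))" by (rule mat_diag_mult_left[OF c(2)])
    then have "T = mat n n (\<lambda>(i, j). tpow (w i) * Y' $$ (i, j) * tpow (- w j))"
      unfolding T_def by (subst mat_diag_mult_right[of _ n]) (auto intro!: eq_matI)
    moreover have "(tpow (w i - w j) :: 'a fls) = tpow (w i) * tpow (- w j)" using tpow_add[of "w i" "- w j"] by simp
    ultimately show ?thesis using that by (simp only: index_mat(1) prod.case mult_ac)
  qed
  have xT: "R' x = X * (?D * Y * ?D')"
  proof -
    have "R' x = R' x * (?D * ?D')" unfolding D(3) using c by simp
    also have "\<dots> = (R' x * ?D) * ?D'" by (rule assoc_mult_mat[OF c(7) D(1,2), symmetric])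
    also have "\<dots> = X * (?D * Y * ?D')" unfolding XY(1) using c D(1,2) by (smt (verit) assoc_mult_mat mult_carrier_mat)
    finally show ?thesis .
  qed
  have YT: "(?D * Y * ?D') * T = 1\<^sub>m n"
    unfolding T_def mult_mat_conj[OF D(1,2) c(4,2) D(4)] Y'(2) right_mult_one_mat[OF D(1)] by (rule D(3))
  have DYc: "?D * Y * ?D' \<in> carrier_mat n n" using c D by (meson mult_carrier_mat)
  have ZD: "Z * (?D * Y * ?D') = R' b"
  proof -
    have "Z * (?D * Y * ?D') = p' * (X * (?D * Y * ?D'))" unfolding Z_def by (rule assoc_mult_mat[OF c(1,3) DYc])
    also have "\<dots> = p' * (R' a * R' b)" using xT ab(3) by simp
    also have "\<dots> = (p' * R' a) * R' b" by (rule assoc_mult_mat[OF c(1,5,6), symmetric])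
    finally show ?thesis unfolding p'(3) using c by simp
  qed
  have ZT: "Z = R' b * T"
  proof -
    have "R' b * T = Z * ((?D * Y * ?D') * T)" unfolding ZD[symmetric] by (rule assoc_mult_mat[OF Zc DYc Tc])
    then show ?thesis unfolding YT using Zc by simp
  qed
  have Zp: "unip n Pp Z" unfolding Z_def by (rule unip_mult[OF p'(1) XP]) (auto simp: Pp_def)
  have T0: "T $$ (i, j) = 0" if "i < n" "j < n" "i \<noteq> j" "\<not> ?q i j" for i j
    using T[OF that(1,2)] unipD(2)[OF Y'(1) that] by simp
  have Zsum: "Z $$ (i, j) = (\<Sum>l<n. R' b $$ (i, l) * T $$ (l, j))" if "i < n" "j < n" for i j
    unfolding ZT by (rule index_mult_mat_sum[OF c(6) Tc that])
  \<comment> \<open>In the product \<open>R' b * T\<close> a nonzero term passes through some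
    \<open>l\<close> with \<open>w i \<le> w l\<close> and \<open>w l \<le> w j\<close>, so no
    positive weight \<open>w i - w j\<close> occurs. Negative weights are excluded by
    \<open>Zp\<close>.\<close>
  have Z0: "Z $$ (i, j) = 0" if ij: "i < n" "j < n" "i \<noteq> j" "w i \<noteq> w j" for i j
  proof (cases "Pp i j")
    case True
    then have lt: "w j < w i" using ij(4) by (auto simp: Pp_def)
    have "R' b $$ (i, l) * T $$ (l, j) = 0" if l: "l < n" for l
    proof (cases "i = l \<or> Pm i l")
      case True
      then have "w i \<le> w l" by (auto simp: Pm_def)
      then have "l \<noteq> j" "\<not> ?q l j" using lt by auto
      then show ?thesis using T0[OF l ij(2)] by simp
    next
      case False
      then show ?thesis using unipD(2)[OF ab(5) ij(1) l] by simp
    qed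
    then show ?thesis unfolding Zsum[OF ij(1,2)] by (intro sum.neutral ballI) (simp only: lessThan_iff)
  qed (rule unipD(2)[OF Zp ij(1-3)])
  have Zi: "imat n Z" unfolding imat_def
  proof (intro conjI allI impI)
    fix i j assume ij: "i < n" "j < n"
    show "fls_int (Z $$ (i, j))"
    proof (cases "i = j")
      case True
      then show ?thesis using unipD(3)[OF Zp ij(1)] by (simp add: Pp_def)
    next
      case False
      show ?thesis
      proof (cases "w i = w j")
        case True
        \<comment> \<open>For \<open>w i = w j\<close>, a step of \<open>R' b\<close> to some
          \<open>l \<noteq> i\<close> strictly increases the weight, and \<open>T\<close> cannot
          lower it again. Only \<open>l = i\<close> survives, and there \<open>T\<close> agrees with
          the integral matrix \<open>Y'\<close>.\<close>
        have "R' b $$ (i, l) * T $$ (l, j) = (if l = i then T $$ (i, j) else 0)" if l: "l < n" for l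
        proof (cases "l = i")
          case True
          then show ?thesis using unipD(3)[OF ab(5) ij(1)] by (simp add: Pm_def)
        next
          case li: False
          show ?thesis
          proof (cases "Pm i l")
            case True
            then have "w j < w l" using \<open>w i = w j\<close> by (auto simp: Pm_def)
            then have "l \<noteq> j" "\<not> ?q l j" by auto
            then show ?thesis using T0[OF l ij(2)] li by simp
          next
            case False
            then show ?thesis using unipD(2)[OF ab(5) ij(1) l] li by auto
          qed
        qed
        then have "Z $$ (i, j) = (\<Sum>l<n. if l = i then T $$ (i, j) else 0)"
          unfolding Zsum[OF ij] by (intro sum.cong refl) (simp only: lessThan_iff)
        also have "\<dots> = Y' $$ (i, j)" using ij T[OF ij] True by (simp add: sum.delta)
        finally show ?thesis using imatD(2)[OF Y'(4) ij] by simp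
      next
        case False
        then show ?thesis using Z0[OF ij \<open>i \<noteq> j\<close>] by simp
      qed
    qed
  qed (rule Zc)
  obtain Z' where Z': "unip n Pp Z'" "Z * Z' = 1\<^sub>m n" "imat n Z'"
    using unip_inverse[OF Zp] Zi by (auto simp: Pp_def)
  have "R' a = X * Z'"
  proof -
    have "X = R' a * Z"
      unfolding Z_def assoc_mult_mat[OF c(5,1,3), symmetric] p'(2) using c by simp
    then have "X * Z' = R' a * (Z * Z')" using assoc_mult_mat[OF c(5) Zc unipD(1)[OF Z'(1)]] by simp
    then show ?thesis unfolding Z'(2) using c by simp
  qed
  then have "imat n (R' a)" using imat_mult[OF XY(2) Z'(3)] by simp
  then have aps: "a \<in> power_series_points N U" by (rule integral_point[OF ab(1)])
  have DZ: "?D' * Z * ?D = Z"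
  proof -
    have "?D' * Z = mat n n (\<lambda>(i, j). tpow (- w i) * Z $$ (i, j))" by (rule mat_diag_mult_left[OF Zc])
    then have e: "?D' * Z * ?D = mat n n (\<lambda>(i, j). tpow (- w i) * Z $$ (i, j) * tpow (w j))"
      by (subst mat_diag_mult_right[of _ n]) (auto intro!: eq_matI)
    show ?thesis
    proof (rule eq_matI)
      fix i j assume "i < dim_row Z" "j < dim_col Z"
      then have ij: "i < n" "j < n" using Zc by auto
      have "tpow (- w i) * Z $$ (i, j) * tpow (w j) = Z $$ (i, j)"
      proof (cases "w i = w j")
        case True
        have "tpow (- w i) * Z $$ (i, j) * tpow (w j) = (tpow (- w j) * tpow (w j)) * Z $$ (i, j)"
          unfolding True by (simp only: mult_ac)
        then show ?thesis unfolding tpow_minus by simp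
      next
        case False
        then have "i \<noteq> j" by auto
        then show ?thesis using Z0[OF ij _ False] by simp
      qed
      then show "(?D' * Z * ?D) $$ (i, j) = Z $$ (i, j)" unfolding e using ij by simp
    qed (use Zc in \<open>auto simp: mat_diag_def\<close>)
  qed
  \<comment> \<open>\<open>R' b = Z D Y D'\<close> is substituted from \<open>ZD\<close>; with
    \<open>D' Z D = Z\<close>, conjugating back leaves the integral product
    \<open>Z Y\<close>.\<close>
  have "?D' * R' b * ?D = (?D' * Z * ?D) * Y * (?D' * ?D)"
  proof -
    have DY: "?D * Y \<in> carrier_mat n n" using D(1) c(4) by (rule mult_carrier_mat)
    have ZDY: "Z * (?D * Y) \<in> carrier_mat n n" using Zc DY by (rule mult_carrier_mat)
    have "?D' * R' b * ?D = ?D' * (Z * (?D * Y) * ?D') * ?D"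
      unfolding ZD[symmetric] assoc_mult_mat[OF Zc DY D(2)] ..
    also have "\<dots> = ?D' * (Z * (?D * Y)) * (?D' * ?D)"
      unfolding assoc_mult_mat[OF D(2) ZDY D(2), symmetric]
      by (rule assoc_mult_mat[OF mult_carrier_mat[OF D(2) ZDY] D(2,1)])
    also have "?D' * (Z * (?D * Y)) = ?D' * Z * ?D * Y"
      unfolding assoc_mult_mat[OF Zc D(1) c(4), symmetric] assoc_mult_mat[OF D(2) Zc D(1)]
      by (rule assoc_mult_mat[OF D(2) mult_carrier_mat[OF Zc D(1)] c(4), symmetric])
    finally show ?thesis .
  qed
  also have "\<dots> = Z * Y" unfolding DZ D(4) using Zc c by (metis mult_carrier_mat right_mult_one_mat)
  finally have "imat n (?D' * R' b * ?D)" using imat_mult[OF Zi XY(3)] by simp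
  moreover have "x = a * b"
    by (rule R'_inj[OF x laurent_points_mult[OF U ab(1,2)]]) (simp add: R'_mult[OF ab(1,2)] ab(3))
  ultimately show ?thesis using that aps ab(2) by blast
qed

end

section \<open>Weights\<close>

text \<open>The coefficients are defined for all exponents and vanish outside \<open>K\<close>, so
  that the finite sets belonging to different matrix entries can be merged in
  \<open>torus_action_exists\<close>.\<close>

lemma torus_laurent_form:
  fixes f :: "'a::field_char_0 \<Rightarrow> 'a"
  assumes "realizes {s. s \<noteq> 0} torus_gens f v"
  obtains K c where "finite K" "\<And>k. k \<notin> K \<Longrightarrow> c k = 0" "\<And>s. s \<noteq> 0 \<Longrightarrow> f s = (\<Sum>k\<in>K. s powi k * c k)"
proof -
  obtain g w l where g: "realizes {s. s \<noteq> 0} {(\<lambda>s. s, fls_X)} g w" "\<forall>s. s \<noteq> 0 \<longrightarrow> f s * s ^ l = g s"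
    using realizes_torus[OF assms] by blast
  obtain p where p: "\<forall>s\<in>{s. s \<noteq> 0}. g s = poly p s" using realizes_line[OF g(1)] by blast
  define h where "h i = int i - int l" for i
  have hinj: "inj_on h I" for I by (auto simp: h_def inj_on_def)
  define c where "c k = (if - int l \<le> k then coeff p (nat (k + int l)) else 0)" for k
  have ch: "c (h i) = coeff p i" for i by (simp add: c_def h_def)
  show thesis
  proof (rule that)
    show "finite (h ` {..degree p})" by simp
    show "c k = 0" if "k \<notin> h ` {..degree p}" for k
    proof (cases "- int l \<le> k")
      case True
      then have "k = h (nat (k + int l))" by (simp add: h_def)
      then have "\<not> nat (k + int l) \<le> degree p" using that by (metis atMost_iff image_eqI)
      then show ?thesis by (simp add: c_def coeff_eq_0)
    qed (simp add: c_def)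
    fix s :: 'a assume s: "s \<noteq> 0"
    have "f s * s ^ l = (\<Sum>i\<le>degree p. coeff p i * s ^ i)" using g(2) p s by (simp add: poly_altdef)
    then have "f s = (\<Sum>i\<le>degree p. coeff p i * s ^ i) / s ^ l" using s by (simp add: field_simps)
    also have "\<dots> = (\<Sum>i\<le>degree p. s powi h i * c (h i))"
      unfolding sum_divide_distrib ch using s by (intro sum.cong refl) (simp add: h_def power_int_diff)
    also have "\<dots> = (\<Sum>k\<in>h ` {..degree p}. s powi k * c k)" by (simp add: sum.reindex[OF hinj])
    finally show "f s = (\<Sum>k\<in>h ` {..degree p}. s powi k * c k)" .
  qed
qed

lemma torus_action_exists:
  fixes \<alpha> :: "'a::{alg_closed_field,field_char_0} \<Rightarrow> 'a mat"
  assumes \<alpha>: "torus_eval \<alpha> V n" "\<alpha> 1 = 1\<^sub>m n" "\<And>s r. s \<noteq> 0 \<Longrightarrow> r \<noteq> 0 \<Longrightarrow> \<alpha> (s * r) = \<alpha> s * \<alpha> r"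
  obtains K E where "torus_action n \<alpha> K E"
proof -
  define Q where "Q i j K c \<longleftrightarrow> finite K \<and> (\<forall>k. k \<notin> K \<longrightarrow> c k = 0) \<and>
    (\<forall>s. s \<noteq> 0 \<longrightarrow> \<alpha> s $$ (i, j) = (\<Sum>k\<in>K. s powi k * c k))" for i j K and c :: "int \<Rightarrow> 'a"
  have "\<exists>K c. Q i j K c" if ij: "i < n" "j < n" for i j
    unfolding Q_def by (rule torus_laurent_form[OF mrealizesD(3)[OF \<alpha>(1) ij]]) blast
  then have "\<forall>i j. \<exists>K c. i < n \<longrightarrow> j < n \<longrightarrow> Q i j K c" by blast
  then obtain K c where "\<And>i j. i < n \<longrightarrow> j < n \<longrightarrow> Q i j (K i j) (c i j)" by metis
  then have Kc: "\<And>i j. i < n \<Longrightarrow> j < n \<Longrightarrow> finite (K i j)"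
    "\<And>i j k. i < n \<Longrightarrow> j < n \<Longrightarrow> k \<notin> K i j \<Longrightarrow> c i j k = 0"
    "\<And>i j s. i < n \<Longrightarrow> j < n \<Longrightarrow> s \<noteq> 0 \<Longrightarrow> \<alpha> s $$ (i, j) = (\<Sum>k\<in>K i j. s powi k * c i j k)"
    unfolding Q_def by blast+
  define K' where "K' = (\<Union>i<n. \<Union>j<n. K i j)"
  have "torus_action n \<alpha> K' (\<lambda>k. mat n n (\<lambda>(i, j). c i j k))"
  proof
    show "\<alpha> s \<in> carrier_mat n n" if "s \<noteq> 0" for s using mrealizesD(2)[OF \<alpha>(1)] that by simp
    show K': "finite K'" using Kc(1) by (auto simp: K'_def)
    show "\<alpha> s $$ (i, j) = (\<Sum>k\<in>K'. s powi k * mat n n (\<lambda>(i, j). c i j k) $$ (i, j))"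
      if s: "s \<noteq> 0" and ij: "i < n" "j < n" for s i j
    proof -
      have "\<alpha> s $$ (i, j) = (\<Sum>k\<in>K i j. s powi k * c i j k)" by (rule Kc(3)[OF ij s])
      also have "\<dots> = (\<Sum>k\<in>K'. s powi k * c i j k)"
        by (rule sum.mono_neutral_left[OF K']) (use ij Kc(2) in \<open>auto simp: K'_def\<close>)
      finally show ?thesis using ij by simp
    qed
  qed (use \<alpha> in auto)
  then show thesis by (rule that)
qed

lemma mult_diag_mult_index:
  assumes "P \<in> carrier_mat n n" "P' \<in> carrier_mat n n" "i < n" "j < n"
  shows "(P * mat_diag n f * P') $$ (i, j) = (\<Sum>k<n. P $$ (i, k) * f k * (P' $$ (k, j) :: 'b::comm_ring_1))"
proof -
  have "P * mat_diag n f = mat n n (\<lambda>(i, j). P $$ (i, j) * f j)" by (rule mat_diag_mult_right[OF assms(1)])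
  then show ?thesis using assms(2-4) by (subst index_mult_mat_sum[of _ n n _ n]) (auto simp: mat_diag_def)
qed

text \<open>\<open>Q\<close> is \<open>P\<close> with permuted columns. It does not depend on
  \<open>f\<close>, so one change of basis serves all parameters \<open>s\<close>.\<close>

lemma permute_diag:
  fixes P P' :: "'b::field mat"
  assumes p: "bij_betw p {..<n} {..<n}" and P: "P \<in> carrier_mat n n" "P' \<in> carrier_mat n n" "P * P' = 1\<^sub>m n"
  obtains Q Q' where "Q \<in> carrier_mat n n" "Q' \<in> carrier_mat n n" "Q * Q' = 1\<^sub>m n" "Q' * Q = 1\<^sub>m n"
    "\<And>f. Q * mat_diag n (\<lambda>i. f (p i)) * Q' = P * mat_diag n f * P'"
proof -
  define Q where "Q = mat n n (\<lambda>(i, j). P $$ (i, p j))"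
  define Q' where "Q' = mat n n (\<lambda>(i, j). P' $$ (p i, j))"
  have Q: "Q \<in> carrier_mat n n" "Q' \<in> carrier_mat n n" by (simp_all add: Q_def Q'_def)
  have f: "Q * mat_diag n (\<lambda>i. f (p i)) * Q' = P * mat_diag n f * P'" for f
  proof (rule eq_matI)
    fix i j assume "i < dim_row (P * mat_diag n f * P')" "j < dim_col (P * mat_diag n f * P')"
    then have ij: "i < n" "j < n" using P by auto
    have "(Q * mat_diag n (\<lambda>i. f (p i)) * Q') $$ (i, j) = (\<Sum>k<n. Q $$ (i, k) * f (p k) * Q' $$ (k, j))"
      by (rule mult_diag_mult_index[OF Q ij])
    also have "\<dots> = (\<Sum>k<n. P $$ (i, p k) * f (p k) * P' $$ (p k, j))"
      using ij by (intro sum.cong refl) (simp add: Q_def Q'_def)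
    also have "\<dots> = (\<Sum>k<n. P $$ (i, k) * f k * P' $$ (k, j))"
      by (rule sum.reindex_bij_betw[OF p])
    also have "\<dots> = (P * mat_diag n f * P') $$ (i, j)" by (rule mult_diag_mult_index[OF P(1,2) ij, symmetric])
    finally show "(Q * mat_diag n (\<lambda>i. f (p i)) * Q') $$ (i, j) = (P * mat_diag n f * P') $$ (i, j)" .
  qed (use P Q in auto)
  have "Q * Q' = 1\<^sub>m n" using f[of "\<lambda>_. 1"] Q P by simp
  then show thesis using that[OF Q _ mat_mult_left_right_inverse[OF Q] f] by blast
qed

lemma GL_conjugateI:
  assumes "P \<in> carrier_mat n n" "P' \<in> carrier_mat n n" "P * P' = 1\<^sub>m n" "P' * P = 1\<^sub>m n"
    and "\<And>s. s \<noteq> 0 \<Longrightarrow> \<beta> s = P * \<alpha> s * P'"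
  shows "GL_conjugate n \<alpha> \<beta>"
proof -
  have d: "det P \<noteq> 0" using mat_mult_one_det(1)[OF assms(1-3)] .
  then have "P \<in> carrier (GL n)" using assms(1) by (simp add: GL_carrier_det)
  moreover have "inv\<^bsub>GL n\<^esub> P = P'"
    using GL_inv[OF \<open>P \<in> carrier (GL n)\<close>] minv[OF assms(1) d]
      mat_inverse_unique[OF assms(1) _ assms(2) _ assms(3)] by metis
  ultimately show ?thesis unfolding GL_conjugate_def using assms(5) by (intro bexI[of _ P]) auto
qed

lemma GL_conjugateE:
  assumes "GL_conjugate n \<alpha> (\<beta> :: 'a::field \<Rightarrow> 'a mat)"
  obtains P P' where "P \<in> carrier_mat n n" "P' \<in> carrier_mat n n" "P * P' = 1\<^sub>m n" "P' * P = 1\<^sub>m n"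
    "\<And>s. s \<noteq> 0 \<Longrightarrow> \<beta> s = P * \<alpha> s * P'"
proof -
  obtain P where P: "P \<in> carrier (GL n)" "\<And>s. s \<noteq> 0 \<Longrightarrow> \<beta> s = P * \<alpha> s * inv\<^bsub>GL n\<^esub> P"
    using assms unfolding GL_conjugate_def by blast
  have c: "P \<in> carrier_mat n n" "det P \<noteq> 0" using P(1) by (auto simp: GL_carrier_det)
  show thesis
    by (rule that[of P "minv P"]) (use P(2) c minv[OF c] GL_inv[OF P(1)] in auto)
qed

lemma has_weights_decreasing:
  assumes e: "increasing_order n w e"
    and P: "P \<in> carrier_mat n n" "P' \<in> carrier_mat n n" "P * P' = 1\<^sub>m n"
    and \<alpha>: "\<And>s. s \<noteq> 0 \<Longrightarrow> \<alpha> s = P * mat_diag n (\<lambda>i. s powi w i) * P'"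
  shows "has_weights n \<alpha> (map (\<lambda>i. w (e (n - Suc i))) [0..<n])" (is "has_weights n \<alpha> ?l")
  unfolding has_weights_def
proof (intro conjI)
  show "length ?l = n" by simp
  show "sorted_wrt (\<ge>) ?l"
    using e by (auto simp: sorted_wrt_iff_nth_less increasing_order_def)
  have "bij_betw (\<lambda>i. n - Suc i) {..<n} {..<n}"
    by (rule bij_betw_byWitness[of _ "\<lambda>i. n - Suc i"]) auto
  then have p: "bij_betw (\<lambda>i. e (n - Suc i)) {..<n} {..<n}"
    using e bij_betw_trans[of "\<lambda>i. n - Suc i" _ _ e] by (auto simp: increasing_order_def comp_def)
  obtain Q Q' where Q: "Q \<in> carrier_mat n n" "Q' \<in> carrier_mat n n" "Q * Q' = 1\<^sub>m n" "Q' * Q = 1\<^sub>m n"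
    and f: "\<And>f. Q * mat_diag n (\<lambda>i. f (e (n - Suc i))) * Q' = P * mat_diag n f * P'"
    using permute_diag[OF p P] by blast
  show "GL_conjugate n (\<lambda>s. mat_diag n (\<lambda>i. s powi (?l ! i))) \<alpha>"
  proof (rule GL_conjugateI[OF Q])
    fix s :: 'a assume s: "s \<noteq> 0"
    have "mat_diag n (\<lambda>i. s powi (?l ! i)) = mat_diag n (\<lambda>i. s powi w (e (n - Suc i)))"
      by (auto intro!: eq_matI simp: mat_diag_def)
    then show "\<alpha> s = Q * mat_diag n (\<lambda>i. s powi (?l ! i)) * Q'"
      using f[of "\<lambda>i. s powi w i"] \<alpha>[OF s] by simp
  qed
qed

text \<open>Minors control the smallest weights, while dominance concerns the largest; the two are
  complementary once the totals are known to agree.\<close>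

lemma sum_largest:
  fixes W :: "nat \<Rightarrow> int"
  assumes "k \<le> n"
  shows "sum_list (take k (map (\<lambda>i. W (n - Suc i)) [0..<n])) = (\<Sum>i<n. W i) - (\<Sum>i<n - k. W i)"
proof -
  have "sum_list (take k (map (\<lambda>i. W (n - Suc i)) [0..<n])) = (\<Sum>i<k. W (n - Suc i))"
    using assms by (simp add: take_map interv_sum_list_conv_sum_set_nat atLeast0LessThan)
  also have "\<dots> = (\<Sum>i\<in>{n - k..<n}. W i)"
    by (rule sum.reindex_bij_witness[of _ "\<lambda>i. n - Suc i" "\<lambda>i. n - Suc i"]) (use assms in auto)
  also have "\<dots> = (\<Sum>i<n. W i) - (\<Sum>i<n - k. W i)"
  proof -
    have "{..<n} = {..<n - k} \<union> {n - k..<n}" using assms by auto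
    moreover have "(\<Sum>i\<in>{..<n - k} \<union> {n - k..<n}. W i) = (\<Sum>i<n - k. W i) + (\<Sum>i\<in>{n - k..<n}. W i)"
      by (rule sum.union_disjoint) auto
    ultimately show ?thesis by simp
  qed
  finally show ?thesis .
qed

section \<open>Double cosets and conjugacy classes of cocharacters\<close>

lemma double_cosetI: "a \<in> K \<Longrightarrow> b \<in> K \<Longrightarrow> a * x * b \<in> double_coset K x"
  by (auto simp: double_coset_def)

lemma double_coset_sym:
  assumes x: "x \<in> carrier_mat n n" and y: "y \<in> double_coset (GL_power_series n) x"
  shows "x \<in> double_coset (GL_power_series n) y"
proof -
  obtain a b where ab: "a \<in> GL_power_series n" "b \<in> GL_power_series n" "y = a * x * b"
    using y by (auto simp: double_coset_def)
  note a = GL_power_series_minv[OF ab(1)] and b = GL_power_series_minv[OF ab(2)]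
  note ia = minv[OF a(3,4)] and ib = minv[OF b(3,4)]
  have ax: "a * x \<in> carrier_mat n n" using a(3) x by (rule mult_carrier_mat)
  have "minv a * y * minv b = minv a * (a * x * b * minv b)"
    unfolding ab(3) by (rule assoc_mult_mat[OF ia(1) mult_carrier_mat[OF ax b(3)] ib(1)])
  also have "a * x * b * minv b = a * x * (b * minv b)" by (rule assoc_mult_mat[OF ax b(3) ib(1)])
  also have "minv a * (a * x * (b * minv b)) = (minv a * a) * x"
    unfolding ib(2) right_mult_one_mat[OF ax] by (rule assoc_mult_mat[OF ia(1) a(3) x, symmetric])
  finally have "minv a * y * minv b = x" unfolding ia(3) using x by simp
  then show ?thesis using double_cosetI[OF a(5) b(5), of y] by simp
qed

lemma double_coset_trans:
  assumes x: "x \<in> carrier_mat n n" and y: "y \<in> double_coset (GL_power_series n) x"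
    and z: "z \<in> double_coset (GL_power_series n) y"
  shows "z \<in> double_coset (GL_power_series n) x"
proof -
  obtain a b where ab: "a \<in> GL_power_series n" "b \<in> GL_power_series n" "y = a * x * b"
    using y by (auto simp: double_coset_def)
  obtain c d where cd: "c \<in> GL_power_series n" "d \<in> GL_power_series n" "z = c * y * d"
    using z by (auto simp: double_coset_def)
  have c: "a \<in> carrier_mat n n" "b \<in> carrier_mat n n" "c \<in> carrier_mat n n" "d \<in> carrier_mat n n"
    using GL_power_series_minv(3) ab cd by auto
  have "z = (c * a) * x * (b * d)"
  proof -
    have ax: "a * x \<in> carrier_mat n n" using c(1) x by (rule mult_carrier_mat)
    have "z = c * (a * x * b) * d" unfolding cd(3) ab(3) ..
    also have "c * (a * x * b) = c * (a * x) * b" by (rule assoc_mult_mat[OF c(3) ax c(2), symmetric])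
    also have "c * (a * x) = c * a * x" by (rule assoc_mult_mat[OF c(3,1) x, symmetric])
    also have "c * a * x * b * d = c * a * x * (b * d)"
      by (rule assoc_mult_mat[OF mult_carrier_mat[OF mult_carrier_mat[OF c(3,1)] x] c(2,4)])
    finally show ?thesis .
  qed
  then show ?thesis using double_cosetI GL_power_series_mult ab cd by metis
qed

lemma pat_Dmat: "pat n (\<le>) (Dmat n w)" by (auto simp: pat_def mat_diag_def)

lemma Dmat_index: "i < n \<Longrightarrow> Dmat n w $$ (i, i) = tpow (w i)" by (simp add: mat_diag_def)

lemma double_cosetE:
  assumes "y \<in> double_coset K x" obtains a b where "a \<in> K" "b \<in> K" "y = a * x * b"
  using assms by (auto simp: double_coset_def)

lemma weights_leI:
  fixes A :: "'a::field fls mat"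
  assumes A: "pat n (\<le>) A" "\<And>i. i < n \<Longrightarrow> A $$ (i, i) = tpow (w i)" "A \<in> double_coset (GL_power_series n) (Dmat n v)"
    and P: "P \<in> carrier_mat n n" "P' \<in> carrier_mat n n" "P * P' = 1\<^sub>m n"
      "\<And>s. s \<noteq> 0 \<Longrightarrow> \<alpha> s = P * mat_diag n (\<lambda>i. s powi w i) * P'"
    and Q: "Q \<in> carrier_mat n n" "Q' \<in> carrier_mat n n" "Q * Q' = 1\<^sub>m n"
      "\<And>s. s \<noteq> 0 \<Longrightarrow> \<beta> s = Q * mat_diag n (\<lambda>i. s powi v i) * Q'"
  shows "weights_le n \<alpha> \<beta>"
proof -
  obtain e e' where e: "increasing_order n w e" "increasing_order n v e'" using increasing_order_exists by metis
  obtain X Y where XY: "X \<in> GL_power_series n" "Y \<in> GL_power_series n" "A = X * Dmat n v * Y"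
    using A(3) by (rule double_cosetE)
  have tot: "(\<Sum>i<n. f (p i)) = (\<Sum>i<n. f i)" if "increasing_order n f p" for f p
    using that sum.reindex_bij_betw[of p "{..<n}" "{..<n}" f] by (auto simp: increasing_order_def)
  have eq: "(\<Sum>i<n. v (e' i)) = (\<Sum>i<n. w (e i))"
    unfolding tot[OF e(1)] tot[OF e(2)] by (rule sum_weights_eq[OF A(1,2) XY(3,1,2)])
  show ?thesis unfolding weights_le_def
  proof (intro exI conjI ballI)
    show "has_weights n \<alpha> (map (\<lambda>i. w (e (n - Suc i))) [0..<n])" by (rule has_weights_decreasing[OF e(1) P])
    show "has_weights n \<beta> (map (\<lambda>i. v (e' (n - Suc i))) [0..<n])" by (rule has_weights_decreasing[OF e(2) Q])
    fix k assume "k \<in> {1..n}"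
    then have k: "k \<le> n" by simp
    have "(\<Sum>i<n - k. v (e' i)) \<le> (\<Sum>i<n - k. w (e i))"
      by (rule dominance_sum[OF A(1,2) XY(3) GL_power_series_minv(1)[OF XY(1)] GL_power_series_minv(1)[OF XY(2)] e diff_le_self])
    then show "sum_list (take k (map (\<lambda>i. w (e (n - Suc i))) [0..<n])) \<le> sum_list (take k (map (\<lambda>i. v (e' (n - Suc i))) [0..<n]))"
      unfolding sum_largest[OF k, of "\<lambda>i. w (e i)"] sum_largest[OF k, of "\<lambda>i. v (e' i)"] using eq by simp
  qed
qed

text \<open>Uniqueness in the Cartan decomposition of the general linear group: dominance in both
  directions makes the sorted weights equal, and diagonal cocharacters with equal sorted weights are
  conjugate by a permutation.\<close>

lemma GL_conjugate_if_same_double_coset: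
  assumes vw: "Dmat n w \<in> double_coset (GL_power_series n) (Dmat n v :: 'a::field fls mat)"
    and P: "P \<in> carrier_mat n n" "P' \<in> carrier_mat n n" "P * P' = 1\<^sub>m n" "P' * P = 1\<^sub>m n"
      "\<And>s :: 'a. s \<noteq> 0 \<Longrightarrow> \<alpha> s = P * mat_diag n (\<lambda>i. s powi w i) * P'"
    and Q: "Q \<in> carrier_mat n n" "Q' \<in> carrier_mat n n" "Q * Q' = 1\<^sub>m n" "Q' * Q = 1\<^sub>m n"
      "\<And>s. s \<noteq> 0 \<Longrightarrow> \<beta> s = Q * mat_diag n (\<lambda>i. s powi v i) * Q'"
  shows "GL_conjugate n \<beta> \<alpha>"
proof -
  obtain e e' where e: "increasing_order n w e" "increasing_order n v e'" using increasing_order_exists by metis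
  have dom: "(\<Sum>i<k. v (e' i)) \<le> (\<Sum>i<k. w (e i))"
    if c: "Dmat n w \<in> double_coset (GL_power_series n) (Dmat n v :: 'a fls mat)"
      and e: "increasing_order n w e" "increasing_order n v e'" and k: "k \<le> n" for v w e e' k
  proof -
    obtain X Y where XY: "X \<in> GL_power_series n" "Y \<in> GL_power_series n" "(Dmat n w :: 'a fls mat) = X * Dmat n v * Y"
      using c by (rule double_cosetE)
    show ?thesis
      by (rule dominance_sum[OF pat_Dmat Dmat_index XY(3) GL_power_series_minv(1)[OF XY(1)] GL_power_series_minv(1)[OF XY(2)] e k])
  qed
  have sums: "(\<Sum>i<k. v (e' i)) = (\<Sum>i<k. w (e i))" if "k \<le> n" for k
    using dom[OF vw e that] dom[OF double_coset_sym[OF Dmat_carrier vw] e(2,1) that] by simp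
  have same: "v (e' i) = w (e i)" if "i < n" for i
    using sums[of i] sums[of "Suc i"] that by simp
  have b: "bij_betw e {..<n} {..<n}" "bij_betw e' {..<n} {..<n}" using e by (auto simp: increasing_order_def)
  obtain R R' where R: "R \<in> carrier_mat n n" "R' \<in> carrier_mat n n" "R * R' = 1\<^sub>m n" "R' * R = 1\<^sub>m n"
    and fR: "\<And>f. R * mat_diag n (\<lambda>i. f (e i)) * R' = P * mat_diag n f * P'"
    using permute_diag[OF b(1) P(1-3)] by blast
  obtain S S' where S: "S \<in> carrier_mat n n" "S' \<in> carrier_mat n n" "S * S' = 1\<^sub>m n" "S' * S = 1\<^sub>m n"
    and fS: "\<And>f. S * mat_diag n (\<lambda>i. f (e' i)) * S' = Q * mat_diag n f * Q'"
    using permute_diag[OF b(2) Q(1-3)] by blast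
  have RS: "R * S' \<in> carrier_mat n n" "S * R' \<in> carrier_mat n n" using R S by (meson mult_carrier_mat)+
  show ?thesis
  proof (rule GL_conjugateI[OF RS])
    have one: "A * B * (C * D) = 1\<^sub>m n"
      if "A \<in> carrier_mat n n" "B \<in> carrier_mat n n" "C \<in> carrier_mat n n" "D \<in> carrier_mat n n"
        "B * C = 1\<^sub>m n" "A * D = 1\<^sub>m n" for A B C D :: "'a mat"
    proof -
      have "A * B * (C * D) = A * (B * C) * D" using that(1-4) by (smt (verit) assoc_mult_mat mult_carrier_mat)
      then show ?thesis using that by simp
    qed
    show "R * S' * (S * R') = 1\<^sub>m n" "S * R' * (R * S') = 1\<^sub>m n" by (rule one; fact R S)+
    fix s :: 'a assume s: "s \<noteq> 0"
    let ?D = "mat_diag n (\<lambda>i. s powi w (e i))"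
    have D: "mat_diag n (\<lambda>i. s powi v (e' i)) = ?D" using same by (auto intro!: eq_matI simp: mat_diag_def)
    have "\<beta> s = S * ?D * S'" using Q(5)[OF s] fS[of "\<lambda>i. s powi v i"] D by simp
    then have "S' * \<beta> s * S = ?D" using conj_back[OF S(2,1) mat_diag_dim S(4)] by simp
    then have "R * (S' * \<beta> s * S) * R' = \<alpha> s" using P(5)[OF s] fR[of "\<lambda>i. s powi w i"] by simp
    moreover have "\<beta> s \<in> carrier_mat n n" using Q(5)[OF s] Q(1,2) by (metis mat_diag_dim mult_carrier_mat)
    then have "R * (S' * \<beta> s * S) * R' = (R * S') * \<beta> s * (S * R')"
      using R(1,2) S(1,2) by (smt (verit) assoc_mult_mat mult_carrier_mat)
    ultimately show "\<alpha> s = R * S' * \<beta> s * (S * R')" by simp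
  qed
qed

section \<open>The inequality and the case of equality\<close>

lemma algebraic_hom_restrict:
  "algebraic_hom N G n H \<rho> \<Longrightarrow> U \<subseteq> G \<Longrightarrow> algebraic_hom N U n H \<rho>"
  by (auto simp: algebraic_hom_def hom_def subset_iff)

theorem theorem3p5p1:
  fixes N n :: nat
    and G M U :: "'a::{alg_closed_field, field_char_0} mat set"
    and g m u :: "'a fls mat"
    and \<mu> \<nu> \<rho> :: "'a regular_map"
  assumes "linear_algebraic_group N G" and "zariski_connected N G"
    and "levi_decomposition N G M U"
    and "g \<in> laurent_points N G"
    and "m \<in> laurent_points N M" and "u \<in> laurent_points N U" and "g = m * u"
    and "cocharacter N M \<mu>"
    and "m \<in> double_coset (power_series_points N M) (t_power \<mu>)"
    and "algebraic_representation N G n \<rho>"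
    and "cocharacter n (carrier (GL n)) \<nu>"
    and "eval_map fls_const \<rho> g \<in> double_coset (GL_power_series n) (t_power \<nu>)"
  shows "weights_le n (eval_map id \<rho> \<circ> cochar_fun \<mu>) (cochar_fun \<nu>) \<and>
    (faithful G \<rho> \<longrightarrow>
      (GL_conjugate n (cochar_fun \<nu>) (eval_map id \<rho> \<circ> cochar_fun \<mu>) \<longleftrightarrow>
        g \<in> double_coset (power_series_points N G) (t_power \<mu>)))"
proof -
  let ?K = "GL_power_series n :: 'a fls mat set"
  let ?E = "eval_map fls_const \<rho> :: 'a fls mat \<Rightarrow> 'a fls mat"
  define \<alpha> where "\<alpha> = eval_map id \<rho> \<circ> cochar_fun \<mu>"
  have \<alpha>_def': "\<alpha> s = eval_map id \<rho> (cochar_fun \<mu> s)" for s unfolding \<alpha>_def o_apply ..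
  define \<beta> where "\<beta> = cochar_fun \<nu>"
  define T where "T = t_power \<mu>"
  have hom: "algebraic_hom N G n (carrier (GL n)) \<rho>"
    using assms(10) unfolding algebraic_representation_def .
  have sG: "subgroup G (GL N)" using assms(1) by (simp add: linear_algebraic_group_def)
  have sM: "subgroup M (GL N)"
    using assms(3) by (simp add: levi_decomposition_def reductive_def linear_algebraic_group_def)
  have U: "subgroup U (GL N)" "zariski_closed N U" "unipotent_group N U" "U \<lhd> (GL N)\<lparr>carrier := G\<rparr>"
    using assms(3) by (simp_all add: levi_decomposition_def unipotent_radical_def
      connected_normal_unipotent_def linear_algebraic_group_def)
  note SG = subgroup_GL_D[OF sG] and SM = subgroup_GL_D[OF sM] and SU = subgroup_GL_D[OF U(1)]
  have UG: "U \<subseteq> G" using subgroup.subset[OF normal_imp_subgroup[OF U(4)]] by simp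
  have MG: "M \<subseteq> G"
  proof
    fix a assume a: "a \<in> M"
    have "a * 1\<^sub>m N \<in> M <#>\<^bsub>GL N\<^esub> U" using a SU(3) by (auto simp: set_mult_def)
    then show "a \<in> G" using assms(3) a SM(5) by (auto simp: levi_decomposition_def)
  qed
  have nrm: "a * b * minv a \<in> U" if "a \<in> M" "b \<in> U" for a b
  proof -
    have aG: "a \<in> G" using that MG by auto
    have "a * b * inv\<^bsub>(GL N)\<lparr>carrier := G\<rparr>\<^esub> a \<in> U"
      using normal.inv_op_closed2[OF U(4), of a b] that aG by simp
    then show ?thesis
      using group.m_inv_consistent[OF group_GL sG aG] GL_inv[of a N] aG SG(1) by auto
  qed
  have lc: "y \<in> carrier_mat N N" "det y \<noteq> 0" if "y \<in> laurent_points N H" for y :: "'a fls mat" and H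
    using laurent_points_GL[OF that] by (auto simp: GL_carrier_det)
  have ps: "y \<in> laurent_points N H" if "y \<in> power_series_points N H" for y :: "'a fls mat" and H
    using that by (simp add: power_series_points_def)
  have ps_mono: "y \<in> power_series_points N G" if "y \<in> power_series_points N H" "H \<subseteq> G" for y H
    using that laurent_points_mono[OF that(2)] by (auto simp: power_series_points_def)
  have cM: "cochar_fun \<mu> s \<in> M" if "s \<noteq> 0" for s using cocharacterD(1)[OF assms(8) SM(1) that] .
  have cmul: "cochar_fun \<mu> (s * r) = cochar_fun \<mu> s * cochar_fun \<mu> r" if "s \<noteq> 0" "r \<noteq> 0" for s r
    using cocharacterD(2)[OF assms(8) SM(1) that] .
  have cinv: "minv (cochar_fun \<mu> s) = cochar_fun \<mu> (inverse s)" if s: "s \<noteq> 0" for s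
  proof (rule mat_inverse_unique)
    have c: "cochar_fun \<mu> s \<in> carrier_mat N N" "det (cochar_fun \<mu> s) \<noteq> 0" using cM[OF s] SM(5,6) by auto
    show "cochar_fun \<mu> s \<in> carrier_mat N N" "minv (cochar_fun \<mu> s) \<in> carrier_mat N N"
      "minv (cochar_fun \<mu> s) * cochar_fun \<mu> s = 1\<^sub>m N" using c minv[OF c] by auto
    show "cochar_fun \<mu> (inverse s) \<in> carrier_mat N N" using cM[of "inverse s"] s SM(5) by auto
    show "cochar_fun \<mu> s * cochar_fun \<mu> (inverse s) = 1\<^sub>m N"
      using cmul[of s "inverse s"] s cocharacterD(3)[OF assms(8) SM(1)] by simp
  qed
  have conjU: "cochar_fun \<mu> s * a * cochar_fun \<mu> (inverse s) \<in> U" if "s \<noteq> 0" "a \<in> U" for s a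
    using nrm[OF cM[OF that(1)] that(2)] cinv[OF that(1)] by simp
  have eM: "eval_map id \<rho> (a * b) = eval_map id \<rho> a * eval_map id \<rho> b" if "a \<in> G" "b \<in> G" for a b
    using algebraic_homD(4)[OF hom that] .
  have ec: "eval_map id \<rho> a \<in> carrier_mat n n" for a using algebraic_homD(1)[OF hom] by (auto simp: eval_map_def)
  have \<alpha>U: "eval_map id \<rho> (cochar_fun \<mu> s * a * cochar_fun \<mu> (inverse s)) = \<alpha> s * eval_map id \<rho> a * \<alpha> (inverse s)"
    if "s \<noteq> 0" "a \<in> U" for s a
  proof -
    have mem: "cochar_fun \<mu> s \<in> G" "a \<in> G" "cochar_fun \<mu> (inverse s) \<in> G"
      using cM[OF that(1)] cM[of "inverse s"] that MG UG by auto
    show ?thesis unfolding \<alpha>_def' eM[OF SG(2)[OF mem(1,2)] mem(3)] eM[OF mem(1,2)] ..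
  qed
  have homU: "algebraic_hom N U n (carrier (GL n)) \<rho>" by (rule algebraic_hom_restrict[OF hom UG])
  \<comment> \<open>One truncation order exceeding both dimensions, as
    \<open>closed_unipotent\<close> and \<open>unip_rep\<close> require.\<close>
  define l where "l = N + n + 1"
  interpret CU: closed_unipotent N U l by (rule closed_unipotent.intro[OF U(1-3)]) (simp add: l_def)
  have \<alpha>ev: "torus_eval \<alpha> (?E T) n"
    unfolding T_def \<alpha>_def comp_def by (rule torus_eval_rep[OF assms(8) SM(1) hom])
  have \<alpha>1: "\<alpha> 1 = 1\<^sub>m n"
    unfolding \<alpha>_def' cocharacterD(3)[OF assms(8) SM(1)] by (rule algebraic_hom_one[OF hom sG subset_refl])
  have \<alpha>m: "\<alpha> (s * r) = \<alpha> s * \<alpha> r" if "s \<noteq> 0" "r \<noteq> 0" for s r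
    unfolding \<alpha>_def' cmul[OF that] by (rule eM) (use cM that MG in auto)
  obtain Ka Ea where "torus_action n \<alpha> Ka Ea" using torus_action_exists[OF \<alpha>ev \<alpha>1 \<alpha>m] by blast
  then interpret TA: torus_action n \<alpha> Ka Ea .
  have H1: "eval_map id \<rho> ` U \<subseteq> carrier_mat n n" using ec by blast
  have H2: "a * b \<in> eval_map id \<rho> ` U" if ab: "a \<in> eval_map id \<rho> ` U" "b \<in> eval_map id \<rho> ` U" for a b
  proof -
    obtain x y where xy: "a = eval_map id \<rho> x" "x \<in> U" "b = eval_map id \<rho> y" "y \<in> U" using ab by blast
    have "a * b = eval_map id \<rho> (x * y)" unfolding xy(1,3) by (rule eM[symmetric]) (use xy UG in auto)
    then show ?thesis using SU(2)[OF xy(2,4)] by (rule image_eqI)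
  qed
  have H3: "\<exists>k. (a - 1\<^sub>m n) ^\<^sub>m k = 0\<^sub>m n n" if "a \<in> eval_map id \<rho> ` U" for a
    using that CU.rep_unipotent[OF homU] by blast
  have H4: "\<alpha> (inverse s) * a * \<alpha> s \<in> eval_map id \<rho> ` U" if a: "a \<in> eval_map id \<rho> ` U" and s: "s \<noteq> 0" for a s
  proof -
    obtain x where x: "a = eval_map id \<rho> x" "x \<in> U" using a by blast
    have "inverse s \<noteq> 0" using s by simp
    from \<alpha>U[OF this x(2)] conjU[OF this x(2)] show ?thesis
      unfolding x(1) inverse_inverse_eq by (metis image_eqI)
  qed
  obtain P P' w where P: "P \<in> carrier_mat n n" "P' \<in> carrier_mat n n" "P * P' = 1\<^sub>m n" "P' * P = 1\<^sub>m n"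
    and Ptri: "\<And>a. a \<in> eval_map id \<rho> ` U \<Longrightarrow> upat n 1 (P' * a * P - 1\<^sub>m n)"
    and Pdiag: "\<And>s. s \<noteq> 0 \<Longrightarrow> P' * \<alpha> s * P = mat_diag n (\<lambda>i. s powi w i)"
    by (rule TA.torus_unipotent_triangular[OF H1 H2 H3 H4]) blast+
  interpret UR: unip_rep N U l n \<rho> P P'
  proof
    show "upat n 1 (P' * eval_map id \<rho> x * P - 1\<^sub>m n)" if "x \<in> U" for x using that by (intro Ptri imageI)
  qed (use homU P in \<open>simp_all add: l_def\<close>)
  have \<alpha>P: "\<alpha> s = P * mat_diag n (\<lambda>i. s powi w i) * P'" if "s \<noteq> 0" for s
    using conj_back[OF P(1,2) TA.\<alpha>[OF that] P(3)] unfolding Pdiag[OF that] by simp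
  let ?P = "map_mat fls_const P :: 'a fls mat" and ?P' = "map_mat fls_const P' :: 'a fls mat"
  let ?D = "Dmat n w :: 'a fls mat" and ?D' = "Dmat n (\<lambda>i. - w i) :: 'a fls mat"
  have PF: "?P \<in> ?K" "?P' \<in> ?K" "?P * ?P' = 1\<^sub>m n" "?P' * ?P = 1\<^sub>m n"
    using GL_power_series_const[OF P] GL_power_series_const[OF P(2,1,4,3)] by auto
  have Pc: "?P \<in> carrier_mat n n" "?P' \<in> carrier_mat n n" using P by auto
  have DD: "?D' * ?D = 1\<^sub>m n" by (simp add: tpow_minus)
  have ET: "?E T = ?P * ?D * ?P'"
    unfolding tpow_def by (rule torus_eval_conj_diag[OF \<alpha>ev P(1,2) \<alpha>P])
  have Ec: "?E y \<in> carrier_mat n n" for y using algebraic_homD(1)[OF hom] by (auto simp: eval_map_def)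
  have Em: "?E (y * z) = ?E y * ?E z" if "y \<in> laurent_points N G" "z \<in> laurent_points N G" for y z
    by (rule eval_map_laurent_mult[OF hom sG subset_refl that])
  have EK: "?E y \<in> ?K" if "y \<in> power_series_points N G" for y
    by (rule eval_map_power_series[OF hom sG subset_refl that])
  have \<beta>ev: "torus_eval \<beta> (t_power \<nu>) n" unfolding \<beta>_def by (rule cocharacterD(4)[OF assms(11) subset_refl])
  have tc: "t_power \<nu> \<in> carrier_mat n n" by (rule mrealizesD(1)[OF \<beta>ev])
  have \<beta>1: "\<beta> 1 = 1\<^sub>m n" unfolding \<beta>_def by (rule cocharacterD(3)[OF assms(11) subset_refl])
  have \<beta>m: "\<beta> (s * r) = \<beta> s * \<beta> r" if "s \<noteq> 0" "r \<noteq> 0" for s r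
    unfolding \<beta>_def by (rule cocharacterD(2)[OF assms(11) subset_refl that])
  obtain Kb Eb where "torus_action n \<beta> Kb Eb" using torus_action_exists[OF \<beta>ev \<beta>1 \<beta>m] by blast
  then interpret TB: torus_action n \<beta> Kb Eb .
  \<comment> \<open>With the empty set in place of \<open>H\<close>, the triangularization theorem
    just diagonalizes the cocharacter \<open>\<nu>\<close>.\<close>
  obtain Q Q' v where Q: "Q \<in> carrier_mat n n" "Q' \<in> carrier_mat n n" "Q * Q' = 1\<^sub>m n" "Q' * Q = 1\<^sub>m n"
    and Qdiag: "\<And>s. s \<noteq> 0 \<Longrightarrow> Q' * \<beta> s * Q = mat_diag n (\<lambda>i. s powi v i)"
    by (rule TB.torus_unipotent_triangular[of "{}"]) auto
  have \<beta>Q: "\<beta> s = Q * mat_diag n (\<lambda>i. s powi v i) * Q'" if "s \<noteq> 0" for s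
    using conj_back[OF Q(1,2) TB.\<alpha>[OF that] Q(3)] unfolding Qdiag[OF that] by simp
  have t\<nu>: "t_power \<nu> \<in> double_coset ?K (Dmat n v)"
  proof -
    have "t_power \<nu> = map_mat fls_const Q * Dmat n v * map_mat fls_const Q'"
      unfolding tpow_def by (rule torus_eval_conj_diag[OF \<beta>ev Q(1,2) \<beta>Q])
    then show ?thesis
      using double_cosetI[OF GL_power_series_const(1)[OF Q] GL_power_series_const(1)[OF Q(2,1,4,3)], of "Dmat n v"] by (simp only:)
  qed
  obtain k1 k2 where k: "k1 \<in> power_series_points N M" "k2 \<in> power_series_points N M" "m = k1 * T * k2"
    using assms(9) unfolding T_def by (rule double_cosetE)
  have TM: "T \<in> laurent_points N M" unfolding T_def by (rule t_power_laurent[OF assms(8) sM])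
  \<comment> \<open>Moving \<open>u\<close> to the left of \<open>k2\<close> gives
    \<open>g = k1 (T x) k2\<close>, with \<open>x\<close> still in \<open>U\<close> by
    normality.\<close>
  define x where "x = k2 * u * minv k2"
  have x: "x \<in> laurent_points N U"
    unfolding x_def by (rule laurent_points_conj[OF sM U(1) nrm ps[OF k(2)] assms(6)])
  note Tc = lc[OF TM] and xc = lc[OF x] and k1c = lc[OF ps[OF k(1)]] and k2c = lc[OF ps[OF k(2)]] and uc = lc[OF assms(6)]
  note iT = minv[OF Tc] and ik = minv[OF k2c]
  have xk: "x * k2 = k2 * u"
  proof -
    have "x * k2 = k2 * u * (minv k2 * k2)"
      unfolding x_def by (rule assoc_mult_mat[OF mult_carrier_mat[OF k2c(1) uc(1)] ik(1) k2c(1)])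
    then show ?thesis unfolding ik(3) right_mult_one_mat[OF mult_carrier_mat[OF k2c(1) uc(1)]] .
  qed
  have gx: "g = k1 * (T * x) * k2"
  proof -
    have "k1 * (T * x) * k2 = k1 * T * (x * k2)"
      using k1c(1) Tc(1) xc(1) k2c(1) by (smt (verit) assoc_mult_mat mult_carrier_mat)
    also have "\<dots> = k1 * T * k2 * u"
      unfolding xk using k1c(1) Tc(1) uc(1) k2c(1) by (smt (verit) assoc_mult_mat mult_carrier_mat)
    finally show ?thesis using assms(7) k(3) by simp
  qed
  note inG = laurent_points_mono[OF MG, THEN subsetD] laurent_points_mono[OF UG, THEN subsetD]
  note G1 = inG(1)[OF ps[OF k(1)]] and G2 = inG(1)[OF ps[OF k(2)]] and GT = inG(1)[OF TM] and Gx = inG(2)[OF x]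
  have GTx: "T * x \<in> laurent_points N G" by (rule laurent_points_mult[OF sG GT Gx])
  let ?A = "?D * UR.R' x"
  have R'c: "UR.R' y \<in> carrier_mat n n" for y by (rule UR.R'_carrier)
  have Ac: "?A \<in> carrier_mat n n" by (rule mult_carrier_mat[OF Dmat_carrier R'c])
  have ER: "?E y * ?P = ?P * UR.R' y" for y
  proof -
    have "?P * UR.R' y = (?P * ?P') * (?E y * ?P)"
      unfolding UR.R'_def using Pc Ec by (smt (verit) assoc_mult_mat mult_carrier_mat)
    then show ?thesis unfolding PF(3) left_mult_one_mat[OF mult_carrier_mat[OF Ec Pc(1)]] by (rule sym)
  qed
  have PE: "?P' * ?E y = UR.R' y * ?P'" for y
  proof -
    have "UR.R' y * ?P' = (?P' * ?E y) * (?P * ?P')"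
      unfolding UR.R'_def using Pc Ec by (smt (verit) assoc_mult_mat mult_carrier_mat)
    then show ?thesis unfolding PF(3) right_mult_one_mat[OF mult_carrier_mat[OF Pc(2) Ec]] by (rule sym)
  qed
  have Eg: "?E g = (?E k1 * ?P) * ?A * (?P' * ?E k2)"
  proof -
    have "?E g = ?E k1 * (?E T * ?E x) * ?E k2"
      unfolding gx Em[OF laurent_points_mult[OF sG G1 GTx] G2] Em[OF G1 GTx] Em[OF GT Gx] ..
    also have "?E T * ?E x = ?P * ?D * (?P' * ?E x)"
      unfolding ET by (rule assoc_mult_mat[OF mult_carrier_mat[OF Pc(1) Dmat_carrier] Pc(2) Ec])
    also have "\<dots> = ?P * (?A * ?P')"
      unfolding PE using Pc Dmat_carrier[of n w] R'c[of x] by (smt (verit) assoc_mult_mat mult_carrier_mat)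
    also have "?E k1 * (?P * (?A * ?P')) * ?E k2 = (?E k1 * ?P) * ?A * (?P' * ?E k2)"
      using Pc Ac Ec[of k1] Ec[of k2] by (smt (verit) assoc_mult_mat mult_carrier_mat)
    finally show ?thesis .
  qed
  have gA: "?E g \<in> double_coset ?K ?A"
    unfolding Eg by (intro double_cosetI GL_power_series_mult EK PF ps_mono[OF k(1) MG] ps_mono[OF k(2) MG])
  have Ag: "?A \<in> double_coset ?K (?E g)" by (rule double_coset_sym[OF Ac gA])
  have A\<nu>: "?A \<in> double_coset ?K (t_power \<nu>)" by (rule double_coset_trans[OF tc assms(12) Ag])
  have Atri: "pat n (\<le>) ?A" and Adiag: "\<And>i. i < n \<Longrightarrow> ?A $$ (i, i) = tpow (w i)"
  proof -
    have e: "?A $$ (i, j) = tpow (w i) * UR.R' x $$ (i, j)" if "i < n" "j < n" for i j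
      using that by (subst mat_diag_mult_left[OF R'c]) simp
    have r: "UR.R' x $$ (i, j) = (if i = j then 1 else 0)" if ij: "i < n" "j < n" "\<not> i + 1 \<le> j" for i j
    proof -
      have "(UR.R' x - 1\<^sub>m n) $$ (i, j) = 0" by (rule patD(2)[OF UR.R'_upat[OF x] ij])
      then show ?thesis using ij R'c[of x] by (simp split: if_splits)
    qed
    show "pat n (\<le>) ?A" unfolding pat_def using e r Ac by auto
    show "?A $$ (i, i) = tpow (w i)" if "i < n" for i using e[OF that that] r[OF that that] by simp
  qed
  have le: "weights_le n \<alpha> \<beta>"
    by (rule weights_leI[OF Atri Adiag double_coset_trans[OF Dmat_carrier t\<nu> A\<nu>] P(1-3) \<alpha>P Q(1-3) \<beta>Q])
  have ETD: "?E T \<in> double_coset ?K ?D" unfolding ET by (rule double_cosetI[OF PF(1,2)])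
  have if_mem: "GL_conjugate n \<beta> \<alpha>" if mem: "g \<in> double_coset (power_series_points N G) T"
  proof -
    obtain a b where ab: "a \<in> power_series_points N G" "b \<in> power_series_points N G" "g = a * T * b"
      using mem by (rule double_cosetE)
    have "?E g = ?E a * ?E T * ?E b"
      unfolding ab(3) Em[OF laurent_points_mult[OF sG ps[OF ab(1)] GT] ps[OF ab(2)]] Em[OF ps[OF ab(1)] GT] ..
    then have "?E g \<in> double_coset ?K (?E T)" using double_cosetI EK ab by metis
    then have "?E g \<in> double_coset ?K ?D" by (rule double_coset_trans[OF Dmat_carrier ETD])
    then have Dg: "?D \<in> double_coset ?K (?E g)" by (rule double_coset_sym[OF Dmat_carrier])
    have "?D \<in> double_coset ?K (Dmat n v)"
      by (rule double_coset_trans[OF Dmat_carrier t\<nu> double_coset_trans[OF tc assms(12) Dg]])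
    then show ?thesis by (rule GL_conjugate_if_same_double_coset[OF _ P \<alpha>P Q \<beta>Q])
  qed
  \<comment> \<open>Conjugation by \<open>T\<close> inside the group corresponds to conjugation by
    the diagonal matrix \<open>D\<close> on the values of \<open>R'\<close>.\<close>
  have RT: "UR.R' y * ?D = ?D * UR.R' z"
    if "y \<in> laurent_points N U" "z \<in> laurent_points N U" "y * T = T * z" for y z
  proof -
    have "?E y * ?E T = ?E T * ?E z"
      using Em[OF inG(2)[OF that(1)] GT] Em[OF GT inG(2)[OF that(2)]] that(3) by simp
    then have "?P' * (?E y * (?P * ?D * ?P')) * ?P = ?P' * (?P * ?D * ?P' * ?E z) * ?P" unfolding ET by simp
    moreover have "?P' * (?E y * (?P * ?D * ?P')) * ?P = UR.R' y * ?D"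
    proof -
      have "?E y * (?P * ?D * ?P') = ?E y * ?P * ?D * ?P'"
        using Pc(1,2) Ec[of y] Dmat_carrier[of n w] by (smt (verit) assoc_mult_mat mult_carrier_mat)
      also have "\<dots> = ?P * (UR.R' y * ?D) * ?P'"
        unfolding ER by (simp only: assoc_mult_mat[OF Pc(1) R'c Dmat_carrier])
      finally show ?thesis
        using conj_back[OF Pc(2,1) mult_carrier_mat[OF R'c Dmat_carrier] PF(4)] by simp
    qed
    moreover have "?P' * (?P * ?D * ?P' * ?E z) * ?P = ?D * UR.R' z"
    proof -
      have "?P * ?D * ?P' * ?E z = ?P * ?D * (?P' * ?E z)"
        by (rule assoc_mult_mat[OF mult_carrier_mat[OF Pc(1) Dmat_carrier] Pc(2) Ec])
      also have "\<dots> = ?P * (?D * UR.R' z) * ?P'"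
        unfolding PE using Pc(1,2) R'c[of z] Dmat_carrier[of n w] by (smt (verit) assoc_mult_mat mult_carrier_mat)
      finally show ?thesis
        using conj_back[OF Pc(2,1) mult_carrier_mat[OF Dmat_carrier R'c] PF(4)] by simp
    qed
    ultimately show ?thesis by simp
  qed
  have only_if: "g \<in> double_coset (power_series_points N G) T" if faith: "faithful G \<rho>" and conj: "GL_conjugate n \<beta> \<alpha>"
  proof -
    have "inj_on (eval_map id \<rho>) U" using faith UG unfolding faithful_def by (rule inj_on_subset)
    then obtain c d where cd: "\<And>x. x \<in> U \<Longrightarrow> mlog id l x = lmap id c N n (mlog id l (UR.R x)) \<and>
        mlog id l (UR.R x) = lmap id d n n (mlog id l (UR.R x))"
      "\<And>L. L \<in> carrier_mat n n \<Longrightarrow> \<exists>x\<in>U. lmap id c N n L = mlog id l x \<and> lmap id d n n L = mlog id l (UR.R x)"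
      using UR.coeffs_exist by metis
    interpret UG: unip_rep_graded N U l n \<rho> P P' c d w
    proof
      fix y s assume y: "y \<in> U" and s: "s \<noteq> (0 :: 'a)"
      let ?z = "cochar_fun \<mu> s * y * cochar_fun \<mu> (inverse s)"
      have is0: "inverse s \<noteq> 0" using s by simp
      have a: "\<alpha> s \<in> carrier_mat n n" "\<alpha> (inverse s) \<in> carrier_mat n n" "eval_map id \<rho> y \<in> carrier_mat n n"
        using TA.\<alpha> s ec by auto
      have "UR.R ?z = (P' * \<alpha> s * P) * UR.R y * (P' * \<alpha> (inverse s) * P)"
        unfolding UR.R_def \<alpha>U[OF s y] mult_mat_conj[OF P(2,1) a(1,3) P(3)]
        by (rule mult_mat_conj[OF P(2,1) mult_carrier_mat[OF a(1,3)] a(2) P(3), symmetric])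
      also have "P' * \<alpha> (inverse s) * P = mat_diag n (\<lambda>i. s powi (- w i))"
        unfolding Pdiag[OF is0] by (simp add: power_int_minus power_int_inverse)
      finally show "\<exists>z\<in>U. UR.R z = mat_diag n (\<lambda>i. s powi w i) * UR.R y * mat_diag n (\<lambda>i. s powi (- w i))"
        unfolding Pdiag[OF s] using conjU[OF s y] by (intro bexI[of _ ?z])
    qed (rule cd, assumption)+
    obtain S S' where S: "S \<in> carrier_mat n n" "S' \<in> carrier_mat n n" "S * S' = 1\<^sub>m n" "S' * S = 1\<^sub>m n"
      and \<alpha>S: "\<And>s. s \<noteq> 0 \<Longrightarrow> \<alpha> s = S * \<beta> s * S'" using conj by (rule GL_conjugateE) blast
    have SP: "S' * P \<in> carrier_mat n n" "P' * S \<in> carrier_mat n n" using S P by (meson mult_carrier_mat)+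
    have SP1: "S' * P * (P' * S) = 1\<^sub>m n"
    proof -
      have "S' * P * (P' * S) = S' * (P * P') * S" using S(1,2) P(1,2) by (smt (verit) assoc_mult_mat mult_carrier_mat)
      then show ?thesis unfolding P(3) using S by simp
    qed
    have \<beta>S: "\<beta> s = (S' * P) * mat_diag n (\<lambda>i. s powi w i) * (P' * S)" if s: "s \<noteq> 0" for s
    proof -
      have "\<beta> s = S' * (P * mat_diag n (\<lambda>i. s powi w i) * P') * S"
        using conj_back[OF S(2,1) TB.\<alpha>[OF s] S(4)] \<alpha>S[OF s] \<alpha>P[OF s] by simp
      then show ?thesis
        using S(1,2) P(1,2) mat_diag_dim[of n "\<lambda>i. s powi w i"] by (smt (verit) assoc_mult_mat mult_carrier_mat)
    qed
    have SP2: "P' * S * (S' * P) = 1\<^sub>m n" by (rule mat_mult_left_right_inverse[OF SP SP1])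
    have "t_power \<nu> \<in> double_coset ?K ?D"
    proof -
      have "t_power \<nu> = map_mat fls_const (S' * P) * ?D * map_mat fls_const (P' * S)"
        unfolding tpow_def by (rule torus_eval_conj_diag[OF \<beta>ev SP \<beta>S])
      then show ?thesis
        using double_cosetI[OF GL_power_series_const(1)[OF SP SP1 SP2] GL_power_series_const(1)[OF SP(2,1) SP2 SP1], of ?D] by (simp only:)
    qed
    then have "?A \<in> double_coset ?K ?D" by (rule double_coset_trans[OF Dmat_carrier _ A\<nu>])
    then obtain X0 Y0 where XY0: "X0 \<in> ?K" "Y0 \<in> ?K" "?A = X0 * ?D * Y0" by (rule double_cosetE)
    obtain X Y where XY: "?A = X * ?D * Y" "imat n X" "imat n Y"
      "unip n (\<lambda>i j. i < j \<and> w j \<le> w i) X" "unip n (\<lambda>i j. i < j \<and> w i \<le> w j) Y"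
      by (rule elimination[OF Atri Adiag XY0(3) GL_power_series_minv(1)[OF XY0(1)] GL_power_series_minv(1)[OF XY0(2)]])
    \<comment> \<open>\<open>integral_factorization\<close> expects the diagonal matrix on the
      right. Since \<open>R' y D = D R' x\<close>, it is applied to the conjugate \<open>y\<close>
      and not to \<open>x\<close>.\<close>
    define y where "y = T * x * minv T"
    have y: "y \<in> laurent_points N U" unfolding y_def by (rule laurent_points_conj[OF sM U(1) nrm TM x])
    have yT: "y * T = T * x"
    proof -
      have "y * T = T * x * (minv T * T)"
        unfolding y_def by (rule assoc_mult_mat[OF mult_carrier_mat[OF Tc(1) xc(1)] iT(1) Tc(1)])
      then show ?thesis unfolding iT(3) right_mult_one_mat[OF mult_carrier_mat[OF Tc(1) xc(1)]] .
    qed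
    obtain a b where ab: "a \<in> power_series_points N U" "b \<in> laurent_points N U" "y = a * b"
      "imat n (?D' * UR.R' b * ?D)"
      by (rule UG.integral_factorization[OF y _ XY(2-5)]) (use RT[OF y x yT] XY(1) in auto)
    have iTM: "minv T \<in> laurent_points N M" by (rule laurent_points_minv[OF sM TM])
    have iiT: "minv (minv T) = T"
      by (rule mat_inverse_unique[OF iT(1) minv(1)[OF iT(1) det_minv(2)[OF Tc]] Tc(1) minv(3)[OF iT(1) det_minv(2)[OF Tc]] iT(3)])
    define b' where "b' = minv T * b * T"
    have b': "b' \<in> laurent_points N U"
      using laurent_points_conj[OF sM U(1) nrm iTM ab(2)] unfolding b'_def iiT .
    note bc = lc(1)[OF ab(2)] and ac = lc(1)[OF ps[OF ab(1)]] and b'c = lc(1)[OF b']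
    have bT: "b * T = T * b'"
    proof -
      have "T * b' = (T * minv T) * (b * T)"
        unfolding b'_def using Tc(1) iT(1) bc by (smt (verit) assoc_mult_mat mult_carrier_mat)
      then show ?thesis unfolding iT(2) left_mult_one_mat[OF mult_carrier_mat[OF bc Tc(1)]] by (rule sym)
    qed
    have "?D' * UR.R' b * ?D = UR.R' b'"
    proof -
      have "?D' * UR.R' b * ?D = ?D' * (?D * UR.R' b')"
        unfolding RT[OF ab(2) b' bT, symmetric] by (rule assoc_mult_mat[OF Dmat_carrier R'c Dmat_carrier])
      also have "\<dots> = (?D' * ?D) * UR.R' b'" by (rule assoc_mult_mat[OF Dmat_carrier Dmat_carrier R'c, symmetric])
      finally show ?thesis unfolding DD using R'c[of b'] by simp
    qed
    then have "b' \<in> power_series_points N U" using UG.integral_point[OF b'] ab(4) by simp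
    then have kab: "k1 * a \<in> power_series_points N G" "b' * k2 \<in> power_series_points N G"
      using power_series_points_mult[OF sG] ps_mono ab(1) k UG MG by blast+
    have "g = (k1 * a) * T * (b' * k2)"
    proof -
      have "T * x = a * (b * T)" unfolding yT[symmetric] ab(3) by (rule assoc_mult_mat[OF ac bc Tc(1)])
      then have "g = k1 * (a * (T * b')) * k2" unfolding gx bT by simp
      then show ?thesis using k1c(1) k2c(1) ac b'c Tc(1) by (smt (verit) assoc_mult_mat mult_carrier_mat)
    qed
    then show ?thesis using double_cosetI[OF kab, of T] by simp
  qed
  show ?thesis unfolding \<alpha>_def[symmetric] \<beta>_def[symmetric] T_def[symmetric]
    using le if_mem only_if by blast
qed

end
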